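(* Let $c(\theta),c_1(\theta)$ be bounded real functions on $\Theta$ satisfying the balance condition $$\Pi\, c(\theta)S(\theta)=0$$ and the non-symmetry condition $$\Pi\, c_1(\theta)S(\theta)=(d,\nabla)\neq 0,$$ where $S(\theta):=-(s(\theta),\nabla)$ and $\Pi$ denotes averaging over the sphere, $\Pi\varphi(\cdot\,;\theta)=\frac1N\int_{S_n}\varphi(\cdot\,;\theta)\mu(d\theta)$. For $\varepsilon>0$ let the Markov non-symmetry random evolution (MNRE) be $$\widetilde{\xi}_t^{\varepsilon}:=x+\int_0^t v(\theta_{\tau}^{\varepsilon})\,s(\theta_{\tau}^{\varepsilon})\,d\tau,\qquad v(\theta)=c(\theta)\varepsilon^{-1}+c_1(\theta),$$ where $x\in\mathbf{R}^n$ and $\theta^\varepsilon_t\in\Theta$ is the switching process of intensity $\varepsilon^{-2}$; the two-component Markov process $(\widetilde{\xi}_t^{\varepsilon},\theta_t^{\varepsilon})$ is described on test functions $\varphi(x_1,\dots,x_n;\theta)\in C_0^\infty(\mathbf{R}^n\times\Theta)$ by the generator $$L^{\varepsilon}\varphi=\varepsilon^{-2}Q\varphi+\varepsilon^{-1}c(\theta)S(\theta)\varphi+c_1(\theta)S(\theta)\varphi,\qquad Q=\Pi-I.$$ Then, as $\varepsilon\to0$ $(\varepsilon>0)$, $\widetilde{\xi}^{\varepsilon}_t$ converges weakly in $\mathbf{D}_{\mathbf{R}^n}[0,\infty)$ to the process $\widetilde{\xi}^{0}_t$: $$\widetilde{\xi}^{\varepsilon}_t\Rightarrow\widetilde{\xi}^{0}_t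 .$$ The limit process $\widetilde{\xi}^{0}_t\in\mathbf{R}^n$, with the same initial value $x$, is defined by the generator $$L^{0}\varphi(x_1,\dots,x_n)=(d,\nabla)\varphi(x_1,\dots,x_n)+(\sigma^2,\Delta)\varphi(x_1,\dots,x_n),$$ where $$(d,\nabla):=-\frac{1}{N}\int_{S_n}c_1(\theta)\,(s(\theta),\nabla)\,\mu(d\theta),\qquad (\sigma^2,\Delta):=\frac{1}{N}\int_{S_n}c^2(\theta)\,(s(\theta),\nabla)^2\,\mu(d\theta).$$
   Context: Directions: $\Theta$ is the set of angles $\theta=(\theta_1,\dots,\theta_{n-1})$ with $\theta_i\in[0,\pi)$ for $1\le i\le n-2$ and $\theta_{n-1}\in[0,2\pi)$, parametrizing the unit sphere $S_n$ of $\mathbf{R}^n$ through $$s(\theta)=(\cos\theta_1,\ \sin\theta_1\cos\theta_2,\ \dots,\ \sin\theta_1\cdots\sin\theta_{n-2}\cos\theta_{n-1},\ \sin\theta_1\cdots\sin\theta_{n-2}\sin\theta_{n-1}).$$ The element of volume of the sphere is $\mu(d\theta)=\sin^{n-2}\theta_1\sin^{n-3}\theta_2\cdots\sin\theta_{n-2}\,d\theta_1\cdots d\theta_{n-1}$, and $N=\int_{S_n}\mu(d\theta)$ is its total mass. Switching process: $\theta^{\varepsilon}_t$ is the Markov process on $\Theta$ with generator $\varepsilon^{-2}Q$, $Q\varphi(\theta)=\frac1N\int_{S_n}\varphi(\theta')\mu(d\theta')-\varphi(\theta)$; that is, at the jump times of a Poisson process of intensity $\varepsilon^{-2}$ a new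 direction is chosen at random with law $\frac1N\mu(d\theta)$. Notation: $\nabla=(\partial/\partial x_1,\dots,\partial/\partial x_n)$; $(s(\theta),\nabla)=\sum_i s_i(\theta)\,\partial/\partial x_i$, and $(s(\theta),\nabla)^2=\sum_{i,j}s_i(\theta)s_j(\theta)\,\partial^2/\partial x_i\partial x_j$. $\Delta\varphi=\left(\partial^2/\partial x_1^2+\dots+\partial^2/\partial x_n^2\right)\varphi$; the symbol $(\sigma^2,\Delta)$ is the name given to the constant-coefficient second-order operator defined by the integral in the claim. $\mathbf{D}_{\mathbf{R}^n}[0,\infty)$ is the Skorokhod space of right-continuous functions with left limits from $[0,\infty)$ to $\mathbf{R}^n$.
   Formalization: The displayed process x+∫v s dτ and the generators L^ε, L^0 have conflicting signs; proved instead: x−∫v s dτ (generator L^ε) converges to the process with L^0 as given, and x+∫v s dτ converges to the process with generator −(d,∇)+(σ²,Δ). *)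

theory Defs
  imports "HOL-Probability.Probability"
begin

section \<open>Directions\<close>

text \<open>Angles are functions on the index set \<open>{1..n-1}\<close>, as elements of the product space.\<close>

definition angle_set :: "nat \<Rightarrow> (nat \<Rightarrow> real) set" where
  "angle_set n = (\<Pi>\<^sub>E i\<in>{1..n-1}. if i = n - 1 then {0..<2 * pi} else {0..<pi})"

definition sphere_measure :: "nat \<Rightarrow> (nat \<Rightarrow> real) measure" where
  "sphere_measure n =
     density (restrict_space (\<Pi>\<^sub>M i\<in>{1..n-1}. lborel) (angle_set n))
       (\<lambda>\<theta>. ennreal (\<Prod>i=1..n-2. sin (\<theta> i) ^ (n - 1 - i)))"

definition sphere_mass :: "nat \<Rightarrow> real" where
  "sphere_mass n = measure (sphere_measure n) (space (sphere_measure n))"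

definition average :: "nat \<Rightarrow> ((nat \<Rightarrow> real) \<Rightarrow> real) \<Rightarrow> real" where
  "average n g = (1 / sphere_mass n) * (\<integral>\<theta>. g \<theta> \<partial>sphere_measure n)"

definition direction_law :: "nat \<Rightarrow> (nat \<Rightarrow> real) measure" where
  "direction_law n = scale_measure (ennreal (1 / sphere_mass n)) (sphere_measure n)"

text \<open>
  The coordinates of \<open>real ^ 'n\<close> are enumerated along the linear order of the index type:
  \<open>i\<close> is coordinate number \<open>card {j. j < i} + 1\<close>.  The last coordinate carries no cosine.
\<close>

definition direction :: "(nat \<Rightarrow> real) \<Rightarrow> real ^ ('n::{finite,linorder})" where
  "direction \<theta> = (\<chi> i. let k = card {j. j < i} in
     (\<Prod>j=1..k. sin (\<theta> j)) * (if Suc k < CARD('n) then cos (\<theta> (Suc k)) else 1))"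

section \<open>Test functions and differential operators\<close>

definition partial_deriv :: "'n::finite \<Rightarrow> (real ^ 'n \<Rightarrow> real) \<Rightarrow> real ^ 'n \<Rightarrow> real" where
  "partial_deriv i \<phi> x = deriv (\<lambda>h. \<phi> (x + h *\<^sub>R axis i 1)) 0"

text \<open>Smoothness: every iterated partial derivative exists and is (Frechet) differentiable.\<close>

definition test_functions :: "(real ^ ('n::finite) \<Rightarrow> real) set" where
  "test_functions = {\<phi>. (\<forall>is. foldr partial_deriv is \<phi> differentiable_on UNIV)
                        \<and> compact (closure {x. \<phi> x \<noteq> 0})}"

definition grad_along :: "real ^ ('n::finite) \<Rightarrow> (real ^ 'n \<Rightarrow> real) \<Rightarrow> real ^ 'n \<Rightarrow> real" where
  "grad_along v \<phi> x = (\<Sum>i\<in>UNIV. v $ i * partial_deriv i \<phi> x)"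

definition grad_along_sq :: "real ^ ('n::finite) \<Rightarrow> (real ^ 'n \<Rightarrow> real) \<Rightarrow> real ^ 'n \<Rightarrow> real" where
  "grad_along_sq v \<phi> x =
     (\<Sum>i\<in>UNIV. \<Sum>j\<in>UNIV. v $ i * v $ j * partial_deriv i (partial_deriv j \<phi>) x)"

definition transport_op ::
    "(nat \<Rightarrow> real) \<Rightarrow> (real ^ ('n::{finite,linorder}) \<Rightarrow> real) \<Rightarrow> (real, 'n) vec \<Rightarrow> real" where
  "transport_op \<theta> \<phi> x = - grad_along (direction \<theta>) \<phi> x"

definition diffusion_op ::
    "((nat \<Rightarrow> real) \<Rightarrow> real) \<Rightarrow> (real ^ ('n::{finite,linorder}) \<Rightarrow> real) \<Rightarrow> (real, 'n) vec \<Rightarrow> real" where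
  "diffusion_op c \<phi> x =
     average CARD('n) (\<lambda>\<theta>. (c \<theta>)\<^sup>2 * grad_along_sq (direction \<theta>) \<phi> x)"

section \<open>Switching process and random evolution\<close>

text \<open>
  \<open>\<tau> k\<close> are the waiting times of a Poisson process of intensity \<open>l\<close>, so that the cardinality
  below is the number of its jumps up to time \<open>t\<close>; \<open>D k\<close> is the direction chosen at
  the \<open>k\<close>-th jump.  The law of the initial direction \<open>D 0\<close> is arbitrary.
\<close>

definition switching_process ::
    "nat \<Rightarrow> real \<Rightarrow> 'w measure \<Rightarrow> (real \<Rightarrow> 'w \<Rightarrow> nat \<Rightarrow> real) \<Rightarrow> bool" where
  "switching_process n l M \<theta> \<longleftrightarrow> prob_space M \<and>
     (\<exists>\<tau> D.
        (\<forall>k. distributed M lborel (\<tau> k) (exponential_density l)) \<and>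
        (\<forall>k. D k \<in> measurable M (sphere_measure n)) \<and>
        (\<forall>k\<ge>1. distr M (sphere_measure n) (D k) = direction_law n) \<and>
        prob_space.indep_vars M (\<lambda>_. borel) \<tau> (UNIV :: nat set) \<and>
        prob_space.indep_vars M (\<lambda>_. sphere_measure n) D (UNIV :: nat set) \<and>
        prob_space.indep_set M
          (sets (vimage_algebra (space M) (\<lambda>\<omega> k. \<tau> k \<omega>) (\<Pi>\<^sub>M k\<in>UNIV. borel)))
          (sets (vimage_algebra (space M) (\<lambda>\<omega> k. D k \<omega>) (\<Pi>\<^sub>M k\<in>UNIV. sphere_measure n))) \<and>
        (\<forall>t\<ge>0. \<forall>\<omega>\<in>space M. \<theta> t \<omega> = D (card {k. (\<Sum>j\<le>k. \<tau> j \<omega>) \<le> t}) \<omega>))"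

text \<open>
  If \<open>\<theta>\<close> is a switching process with generator \<open>q\<close>, then the pair of the
  evolution below and \<open>\<theta>\<close> has generator \<open>q \<phi> + grad_along (w \<theta>) \<phi>\<close>.
  By the lemma below, the term \<open>v \<theta> * transport_op \<theta> \<phi>\<close> in a generator thus
  belongs to the velocity \<open>w \<theta> = - (v \<theta> *\<^sub>R direction \<theta>)\<close>, with a minus sign.
\<close>

definition random_evolution ::
    "((nat \<Rightarrow> real) \<Rightarrow> real ^ ('n::finite)) \<Rightarrow> real ^ 'n \<Rightarrow> (real \<Rightarrow> 'w \<Rightarrow> nat \<Rightarrow> real)
      \<Rightarrow> real \<Rightarrow> 'w \<Rightarrow> real ^ 'n" where
  "random_evolution w x \<theta> t \<omega> = x + (LINT u:{0..t}|lborel. w (\<theta> u \<omega>))"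

lemma grad_along_velocity:
  "grad_along (- (v *\<^sub>R direction \<theta>)) \<phi> x = v * transport_op \<theta> \<phi> x"
  by (simp add: grad_along_def transport_op_def sum_distrib_left sum_negf mult.assoc)

section \<open>Markov processes and their generators\<close>

definition transition_semigroup :: "(real \<Rightarrow> 'a::euclidean_space \<Rightarrow> 'a measure) \<Rightarrow> bool" where
  "transition_semigroup P \<longleftrightarrow>
     (\<forall>t\<ge>0. P t \<in> measurable borel (prob_algebra borel)) \<and>
     (\<forall>x. P 0 x = return borel x) \<and>
     (\<forall>s\<ge>0. \<forall>t\<ge>0. \<forall>x. P (s + t) x = P s x \<bind> P t)"

definition natural_filtration ::
    "'w measure \<Rightarrow> (real \<Rightarrow> 'w \<Rightarrow> 'a::topological_space) \<Rightarrow> real \<Rightarrow> 'w measure" where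
  "natural_filtration M X s =
     sigma (space M) {X u -` A \<inter> space M | u A. 0 \<le> u \<and> u \<le> s \<and> A \<in> sets borel}"

definition markov_process ::
    "'w measure \<Rightarrow> (real \<Rightarrow> 'w \<Rightarrow> 'a::euclidean_space) \<Rightarrow> (real \<Rightarrow> 'a \<Rightarrow> 'a measure) \<Rightarrow> bool" where
  "markov_process M X P \<longleftrightarrow> prob_space M \<and> transition_semigroup P \<and>
     (\<forall>t\<ge>0. X t \<in> borel_measurable M) \<and>
     (\<forall>s\<ge>0. \<forall>t\<ge>0. \<forall>A\<in>sets borel.
        AE \<omega> in M. real_cond_exp M (natural_filtration M X s)
                       (\<lambda>\<omega>. indicator A (X (s + t) \<omega>)) \<omega>
                     = measure (P t (X s \<omega>)) A)"

text \<open>The generator is taken in the supremum norm.\<close>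

definition has_generator_on ::
    "(real \<Rightarrow> 'a::euclidean_space \<Rightarrow> 'a measure) \<Rightarrow> (('a \<Rightarrow> real) \<Rightarrow> 'a \<Rightarrow> real)
      \<Rightarrow> ('a \<Rightarrow> real) set \<Rightarrow> bool" where
  "has_generator_on P L A \<longleftrightarrow>
     (\<forall>\<phi>\<in>A. uniform_limit UNIV (\<lambda>h x. ((\<integral>y. \<phi> y \<partial>P h x) - \<phi> x) / h) (L \<phi>) (at_right 0))"

section \<open>Weak convergence in the Skorokhod space\<close>

text \<open>
  Paths on \<open>[0,\<infinity>)\<close> are functions on the reals whose values at negative times are ignored:
  no condition below, and hence no continuous functional, depends on these values.
\<close>

definition skorokhod_space :: "(real \<Rightarrow> 'a::metric_space) set" where
  "skorokhod_space =
     {x. (\<forall>t\<ge>0. continuous (at_right t) x) \<and> (\<forall>t>0. \<exists>l. (x \<longlongrightarrow> l) (at_left t))}"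

definition time_change :: "(real \<Rightarrow> real) \<Rightarrow> bool" where
  "time_change \<rho> \<longleftrightarrow> strict_mono_on {0..} \<rho> \<and> \<rho> ` {0..} = {0..}"

definition skorokhod_nbhd ::
    "(real \<Rightarrow> 'a::metric_space) \<Rightarrow> real \<Rightarrow> real \<Rightarrow> (real \<Rightarrow> 'a) set" where
  "skorokhod_nbhd x T e =
     {y\<in>skorokhod_space. \<exists>\<rho>. time_change \<rho> \<and> (\<forall>t\<ge>0. \<bar>\<rho> t - t\<bar> < e) \<and>
        (\<forall>t\<in>{0..T}. dist (y (\<rho> t)) (x t) < e)}"

text \<open>
  The J1 topology: a sequence \<open>y m\<close> converges to \<open>x\<close> iff for all \<open>T\<close> and \<open>e > 0\<close>
  it is eventually in \<open>skorokhod_nbhd x T e\<close>.  As the J1 topology is metrizable, its open sets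
  are the sequentially open ones, which gives the following description.
\<close>

definition skorokhod_topology :: "(real \<Rightarrow> 'a::metric_space) topology" where
  "skorokhod_topology = topology (\<lambda>U. U \<subseteq> skorokhod_space \<and>
     (\<forall>x\<in>U. \<exists>T e. e > 0 \<and> skorokhod_nbhd x T e \<subseteq> U))"

lemma skorokhod_nbhd_mono:
  assumes "T' \<le> T" "e \<le> e'"
  shows "skorokhod_nbhd x T e \<subseteq> skorokhod_nbhd x T' e'"
proof
  fix y assume "y \<in> skorokhod_nbhd x T e"
  then obtain \<rho> where y: "y \<in> skorokhod_space" and l: "time_change \<rho>"
      "\<forall>t\<ge>0. \<bar>\<rho> t - t\<bar> < e" "\<forall>t\<in>{0..T}. dist (y (\<rho> t)) (x t) < e"
    unfolding skorokhod_nbhd_def by blast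
  have "\<forall>t\<ge>0. \<bar>\<rho> t - t\<bar> < e'" "\<forall>t\<in>{0..T'}. dist (y (\<rho> t)) (x t) < e'"
    using l assms by (force, force)
  with y l(1) show "y \<in> skorokhod_nbhd x T' e'"
    unfolding skorokhod_nbhd_def by blast
qed

lemma skorokhod_nbhd_self:
  assumes "x \<in> skorokhod_space" "e > 0"
  shows "x \<in> skorokhod_nbhd x T e"
proof -
  have "time_change (\<lambda>t. t)"
    by (auto simp: time_change_def strict_mono_on_def)
  with assms show ?thesis
    unfolding skorokhod_nbhd_def by (auto intro!: exI[of _ "\<lambda>t. t"])
qed

lemma openin_skorokhod_topology:
  "openin skorokhod_topology U \<longleftrightarrow>
     U \<subseteq> skorokhod_space \<and> (\<forall>x\<in>U. \<exists>T e. e > 0 \<and> skorokhod_nbhd x T e \<subseteq> U)"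
proof -
  let ?P = "\<lambda>U :: (real \<Rightarrow> 'a) set. U \<subseteq> skorokhod_space \<and>
     (\<forall>x\<in>U. \<exists>T e. e > 0 \<and> skorokhod_nbhd x T e \<subseteq> U)"
  have "?P (U \<inter> V)" if U: "?P U" and V: "?P V" for U V
  proof (intro conjI ballI)
    show "U \<inter> V \<subseteq> skorokhod_space" using U by blast
    fix x assume x: "x \<in> U \<inter> V"
    obtain T e where 1: "e > 0" "skorokhod_nbhd x T e \<subseteq> U" using U x by blast
    obtain T' e' where 2: "e' > 0" "skorokhod_nbhd x T' e' \<subseteq> V" using V x by blast
    have "skorokhod_nbhd x (max T T') (min e e') \<subseteq> U \<inter> V"
      using skorokhod_nbhd_mono[of T "max T T'" "min e e'" e x]
        skorokhod_nbhd_mono[of T' "max T T'" "min e e'" e' x] 1 2 by auto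
    moreover have "min e e' > 0" using 1 2 by simp
    ultimately show "\<exists>T e. e > 0 \<and> skorokhod_nbhd x T e \<subseteq> U \<inter> V" by blast
  qed
  moreover have "?P (\<Union>K)" if "\<forall>U\<in>K. ?P U" for K
    using that by (meson Sup_least UnionE Union_upper subset_trans)
  ultimately have "istopology ?P" unfolding istopology_def by blast
  then show ?thesis unfolding skorokhod_topology_def by (simp add: topology_inverse')
qed

lemma topspace_skorokhod_topology: "topspace skorokhod_topology = skorokhod_space"
proof -
  have "openin skorokhod_topology (skorokhod_space :: (real \<Rightarrow> 'a) set)"
    unfolding openin_skorokhod_topology
    by (auto intro!: exI[of _ "1::real"] simp: skorokhod_nbhd_def)
  then show ?thesis
    by (metis openin_skorokhod_topology openin_subset openin_topspace subset_antisym)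
qed

text \<open>
  Being a random element of the Skorokhod space is part of the definition: measurability of all
  compositions with bounded continuous functionals is contained in their integrability, and on
  a metrizable space this is the same as Borel measurability.
\<close>

definition weak_conv_skorokhod ::
    "('i \<Rightarrow> 'w measure) \<Rightarrow> ('i \<Rightarrow> real \<Rightarrow> 'w \<Rightarrow> 'a::metric_space) \<Rightarrow>
      'v measure \<Rightarrow> (real \<Rightarrow> 'v \<Rightarrow> 'a) \<Rightarrow> 'i filter \<Rightarrow> bool" where
  "weak_conv_skorokhod M X M0 X0 F \<longleftrightarrow>
     (\<forall>\<^sub>F i in F. \<forall>\<omega>\<in>space (M i). (\<lambda>t. X i t \<omega>) \<in> skorokhod_space) \<and>
     (\<forall>\<omega>\<in>space M0. (\<lambda>t. X0 t \<omega>) \<in> skorokhod_space) \<and>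
     (\<forall>f. continuous_map skorokhod_topology euclideanreal f \<and> bounded (f ` skorokhod_space) \<longrightarrow>
        (\<forall>\<^sub>F i in F. integrable (M i) (\<lambda>\<omega>. f (\<lambda>t. X i t \<omega>))) \<and>
        integrable M0 (\<lambda>\<omega>. f (\<lambda>t. X0 t \<omega>)) \<and>
        ((\<lambda>i. \<integral>\<omega>. f (\<lambda>t. X i t \<omega>) \<partial>M i) \<longlongrightarrow> (\<integral>\<omega>. f (\<lambda>t. X0 t \<omega>) \<partial>M0)) F)"

definition is_diffusion_from ::
    "real ^ ('n::finite) \<Rightarrow> ((real ^ 'n \<Rightarrow> real) \<Rightarrow> real ^ 'n \<Rightarrow> real)
      \<Rightarrow> 'v measure \<Rightarrow> (real \<Rightarrow> 'v \<Rightarrow> real ^ 'n) \<Rightarrow> bool" where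
  "is_diffusion_from x L M X \<longleftrightarrow>
     (\<forall>\<omega>\<in>space M. (\<lambda>t. X t \<omega>) \<in> skorokhod_space) \<and>
     (AE \<omega> in M. X 0 \<omega> = x) \<and>
     (\<exists>P. markov_process M X P \<and> has_generator_on P L test_functions)"

end

theory Submission
  imports Defs
begin

text \<open>
  At its renewal times the evolution is a random walk whose steps, a waiting time times the
  velocity of the direction then in force, are independent and identically distributed.  By the
  balance condition the characteristic function of a step is \<open>1 + \<epsilon>\<^sup>2 \<psi> + O(\<epsilon>\<^sup>3)\<close>, where
  \<open>\<psi>\<close> is the symbol of the limit operator, so the \<open>h / \<epsilon>\<^sup>2\<close> steps made in a time \<open>h\<close> have a
  characteristic function tending to \<open>exp (h \<psi>)\<close>.  The limit process has increments with the same
  characteristic functions: the generator is only known on test functions, but cosines are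
  bounded pointwise limits of test functions, together with their images under the operator, so
  that Dynkin's formula makes \<open>t \<mapsto> P\<^sub>t cos\<close> solve a linear differential equation.
  
  The increments over the grid of mesh \<open>1 / r\<^sup>2\<close> up to time \<open>r\<close> therefore converge weakly.
  Fourth moments and Ottaviani's inequality bound the oscillation between grid points by
  \<open>\<eta>\<close> with probability \<open>1 - O(1 / (r \<eta>\<^sup>4))\<close>, uniformly in small \<open>\<epsilon>\<close>.  Hence the evolution is locally
  uniformly close to the step path through its grid values; and the limit process has continuous
  paths, so it is locally uniformly close to its own step paths.  Functionals that are
  continuous for the J1 topology are continuous for the local uniform distance, and bounded ones
  are increasing limits of Lipschitz functions (infimal convolutions with multiples of the
  distance), so that the lower limit of the expectations is at least the expectation of the limit;
  applied to a functional and its negative this is the theorem.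
\<close>

section \<open>Continuous functionals on the Skorokhod space\<close>

text \<open>Three obstacles shape the argument. An infimum over all paths need not be measurable
  along a process, so the Lipschitz envelopes are integrated on step paths only, where they are
  continuous in finitely many values. Measurability of the given functional is a separate matter
  that needs the J1 topology in earnest: sampled paths approach a path with jumps only after a
  change of time. And the law of the initial direction is arbitrary, so the walk omits the first
  step, which is shown to be negligible. Random renewal counts are avoided: blocks end at
  deterministic step numbers, and only the renewal times at those ends are compared with the grid.
  The mesh \<open>1 / r^2\<close> is fine enough because a block errs with probability of order
  \<open>r^-4\<close> and there are about \<open>r^3\<close> blocks up to time \<open>r\<close>.
  Continuity of the limit paths is not assumed; it is inherited from the same bound, which survives
  weak convergence. The symbol contains no factor 1/2: an exponential waiting time of mean
  \<open>\<mu>\<close> has second moment \<open>2 * \<mu>^2\<close>, and this 2 cancels the 1/2 of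
  the Taylor expansion.\<close>

text \<open>
  The last grid point is at time \<open>r\<close>, and the path is constant from there on.
\<close>

definition grid_path :: "nat \<Rightarrow> (nat \<Rightarrow> 'a) \<Rightarrow> real \<Rightarrow> 'a" where
  "grid_path r z t = z (min (nat \<lfloor>(real r)\<^sup>2 * t\<rfloor>) (r ^ 3))"

text \<open>Truncation at 1 keeps the supremum finite, and the weight discounts late times, so that
  a small distance means uniform closeness on bounded time intervals.\<close>

definition udist :: "(real \<Rightarrow> 'a::metric_space) \<Rightarrow> (real \<Rightarrow> 'a) \<Rightarrow> real" where
  "udist x y = (SUP t\<in>{0..}. exp (- t) * min 1 (dist (x t) (y t)))"

definition udist_continuous :: "((real \<Rightarrow> 'a::metric_space) \<Rightarrow> real) \<Rightarrow> bool" where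
  "udist_continuous f \<longleftrightarrow> (\<forall>x\<in>skorokhod_space. \<forall>e>0. \<exists>\<delta>>0.
     \<forall>y\<in>skorokhod_space. udist y x < \<delta> \<longrightarrow> \<bar>f y - f x\<bar> < e)"

text \<open>For bounded \<open>f\<close> and \<open>k \<ge> 0\<close> this is the Pasch-Hausdorff
  envelope, the largest minorant of \<open>f\<close> on the Skorokhod space that is
  \<open>k\<close>-Lipschitz for \<open>udist\<close>.\<close>

definition lower_envelope :: "((real \<Rightarrow> 'a::metric_space) \<Rightarrow> real) \<Rightarrow> real \<Rightarrow> (real \<Rightarrow> 'a) \<Rightarrow> real" where
  "lower_envelope f k x = (INF y\<in>skorokhod_space. f y + k * udist x y)"

lemma grid_path_skorokhod: "grid_path r z \<in> skorokhod_space"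
proof -
  let ?a = "(real r)\<^sup>2"
  have "continuous (at_right t) (grid_path r z)" for t
  proof -
    have "eventually (\<lambda>u. grid_path r z u = grid_path r z t) (at_right t)"
    proof (cases "r = 0")
      case False
      then have a: "?a > 0" by simp
      show ?thesis
      proof (rule eventually_at_rightI[of t "(of_int \<lfloor>?a * t\<rfloor> + 1) / ?a"])
        show "t < (of_int \<lfloor>?a * t\<rfloor> + 1) / ?a"
          using a by (simp add: pos_less_divide_eq mult.commute)
        fix u assume u: "u \<in> {t<..<(of_int \<lfloor>?a * t\<rfloor> + 1) / ?a}"
        then have "?a * u < of_int \<lfloor>?a * t\<rfloor> + 1" "?a * t \<le> ?a * u"
          using a by (auto simp: pos_less_divide_eq mult.commute)
        then have "\<lfloor>?a * u\<rfloor> = \<lfloor>?a * t\<rfloor>" by linarith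
        then show "grid_path r z u = grid_path r z t" by (simp add: grid_path_def)
      qed
    qed (simp add: grid_path_def)
    then show ?thesis unfolding continuous_within by (rule tendsto_eventually)
  qed
  moreover have "\<exists>l. (grid_path r z \<longlongrightarrow> l) (at_left t)" for t
  proof -
    \<comment> \<open>Just left of \<open>t\<close> the index is the ceiling minus one; this also
      covers a grid point \<open>t\<close>, where the floor at \<open>t\<close> itself is already
      one larger.\<close>
    have "eventually (\<lambda>u. grid_path r z u = z (min (nat (\<lceil>?a * t\<rceil> - 1)) (r ^ 3))) (at_left t)"
      if "r \<noteq> 0"
    proof (rule eventually_at_leftI[of "(of_int \<lceil>?a * t\<rceil> - 1) / ?a"])
      have a: "?a > 0" using that by simp
      show "(of_int \<lceil>?a * t\<rceil> - 1) / ?a < t"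
        using a by (simp add: pos_divide_less_eq mult.commute) linarith
      fix u assume u: "u \<in> {(of_int \<lceil>?a * t\<rceil> - 1) / ?a<..<t}"
      then have "of_int \<lceil>?a * t\<rceil> - 1 < ?a * u" "?a * u < ?a * t"
        using a by (auto simp: pos_divide_less_eq mult.commute)
      then have "\<lfloor>?a * u\<rfloor> = \<lceil>?a * t\<rceil> - 1" by linarith
      then show "grid_path r z u = z (min (nat (\<lceil>?a * t\<rceil> - 1)) (r ^ 3))" by (simp add: grid_path_def)
    qed
    then show ?thesis
    proof (cases "r = 0")
      case True
      then have "grid_path r z = (\<lambda>_. z 0)" by (auto simp: grid_path_def)
      then show ?thesis by auto
    qed (blast intro: tendsto_eventually)
  qed
  ultimately show ?thesis unfolding skorokhod_space_def by blast
qed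

section \<open>The local uniform distance and Lipschitz envelopes\<close>

lemma skorokhod_space_nonempty: "skorokhod_space \<noteq> {}"
  using grid_path_skorokhod by blast

lemma bdd_above_udist: "bdd_above ((\<lambda>t. exp (- t) * min 1 (dist (x t) (y t))) ` {0::real..})"
proof (rule bdd_aboveI[of _ 1])
  fix a assume "a \<in> (\<lambda>t. exp (- t) * min 1 (dist (x t) (y t))) ` {0::real..}"
  then obtain t where "t \<ge> 0" "a = exp (- t) * min 1 (dist (x t) (y t))" by auto
  then show "a \<le> 1" using mult_mono[of "exp (- t)" 1 "min 1 (dist (x t) (y t))" 1] by simp
qed

lemma udist_ge: "t \<ge> 0 \<Longrightarrow> exp (- t) * min 1 (dist (x t) (y t)) \<le> udist x y"
  unfolding udist_def by (rule cSUP_upper[OF _ bdd_above_udist]) simp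

lemma udist_le:
  "(\<And>t. t \<ge> 0 \<Longrightarrow> exp (- t) * min 1 (dist (x t) (y t)) \<le> e) \<Longrightarrow> udist x y \<le> e"
  unfolding udist_def by (rule cSUP_least) auto

lemma udist_nonneg: "0 \<le> udist x y"
  using udist_ge[of 0 x y] by (smt (verit) exp_ge_zero mult_nonneg_nonneg zero_le_dist)

lemma udist_refl: "udist x x = 0"
  using udist_le[of x x 0] udist_nonneg[of x x] by simp

lemma udist_commute: "udist x y = udist y x"
  by (simp add: udist_def dist_commute)

lemma udist_triangle: "udist x z \<le> udist x y + udist y z"
proof (rule udist_le)
  fix t :: real assume t: "t \<ge> 0"
  have "min 1 (dist (x t) (z t)) \<le> min 1 (dist (x t) (y t)) + min 1 (dist (y t) (z t))"
    using dist_triangle[of "x t" "z t" "y t"] zero_le_dist[of "x t" "y t"] zero_le_dist[of "y t" "z t"]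
    by linarith
  then have "exp (- t) * min 1 (dist (x t) (z t)) \<le>
      exp (- t) * min 1 (dist (x t) (y t)) + exp (- t) * min 1 (dist (y t) (z t))"
    by (metis distrib_left exp_ge_zero mult_left_mono)
  also have "\<dots> \<le> udist x y + udist y z" by (intro add_mono udist_ge t)
  finally show "exp (- t) * min 1 (dist (x t) (z t)) \<le> udist x y + udist y z" .
qed

lemma udist_le_horizon:
  assumes "\<And>t. 0 \<le> t \<Longrightarrow> t < T \<Longrightarrow> dist (x t) (y t) \<le> e" "e \<ge> 0"
  shows "udist x y \<le> max e (exp (- T))"
proof (rule udist_le)
  fix t :: real assume t: "t \<ge> 0"
  show "exp (- t) * min 1 (dist (x t) (y t)) \<le> max e (exp (- T))"
  proof (cases "t < T")
    case True
    have "exp (- t) * min 1 (dist (x t) (y t)) \<le> 1 * e"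
      using assms(1)[OF t True] t assms(2) by (intro mult_mono) auto
    then show ?thesis by simp
  next
    case False
    have "exp (- t) * min 1 (dist (x t) (y t)) \<le> exp (- T) * 1"
      using False by (intro mult_mono) auto
    then show ?thesis by simp
  qed
qed

lemma skorokhod_continuous_nbhd:
  assumes f: "continuous_map skorokhod_topology euclideanreal f" and x: "x \<in> skorokhod_space" and e: "e > 0"
  shows "\<exists>T \<delta>. \<delta> > 0 \<and> (\<forall>y\<in>skorokhod_nbhd x T \<delta>. \<bar>f y - f x\<bar> < e)"
proof -
  have "openin skorokhod_topology {y \<in> topspace skorokhod_topology. f y \<in> ball (f x) e}"
    by (rule openin_continuous_map_preimage[OF f]) simp
  moreover have "x \<in> {y \<in> topspace skorokhod_topology. f y \<in> ball (f x) e}"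
    using x e by (simp add: topspace_skorokhod_topology)
  ultimately obtain T \<delta> where "\<delta> > 0"
      "skorokhod_nbhd x T \<delta> \<subseteq> {y \<in> topspace skorokhod_topology. f y \<in> ball (f x) e}"
    unfolding openin_skorokhod_topology by blast
  then show ?thesis
    by (intro exI[of _ T] exI[of _ \<delta>]) (auto simp: dist_real_def abs_minus_commute subset_iff)
qed

text \<open>The identity is an admissible time change, so a locally uniform neighbourhood lies
  inside the J1 neighbourhood.\<close>

lemma skorokhod_continuous_imp_udist_continuous:
  assumes f: "continuous_map skorokhod_topology euclideanreal f"
  shows "udist_continuous f"
  unfolding udist_continuous_def
proof (intro ballI allI impI)
  fix x :: "real \<Rightarrow> 'a" and e :: real assume x: "x \<in> skorokhod_space" and e: "e > 0"
  obtain T \<delta> where \<delta>: "\<delta> > 0" and fx: "\<And>y. y \<in> skorokhod_nbhd x T \<delta> \<Longrightarrow> \<bar>f y - f x\<bar> < e"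
    using skorokhod_continuous_nbhd[OF f x e] by blast
  show "\<exists>\<delta>>0. \<forall>y\<in>skorokhod_space. udist y x < \<delta> \<longrightarrow> \<bar>f y - f x\<bar> < e"
  \<comment> \<open>\<open>exp (- \<bar>T\<bar>)\<close> is a lower bound of the weights on
    \<open>{0..T}\<close>, and \<open>min 1 \<delta>\<close> takes care of the truncation in
    \<open>udist\<close>.\<close>
  proof (intro exI[of _ "exp (- \<bar>T\<bar>) * min 1 \<delta>"] conjI ballI impI)
    show "exp (- \<bar>T\<bar>) * min 1 \<delta> > 0" using \<delta> by simp
    fix y :: "real \<Rightarrow> 'a" assume y: "y \<in> skorokhod_space" and d: "udist y x < exp (- \<bar>T\<bar>) * min 1 \<delta>"
    have "dist (y t) (x t) < \<delta>" if t: "t \<in> {0..T}" for t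
    proof -
      have "exp (- \<bar>T\<bar>) * min 1 (dist (y t) (x t)) \<le> exp (- t) * min 1 (dist (y t) (x t))"
        using t by (intro mult_right_mono) auto
      also have "\<dots> < exp (- \<bar>T\<bar>) * min 1 \<delta>" using udist_ge[of t y x] t d by simp
      finally show ?thesis by (simp add: min_def split: if_splits)
    qed
    moreover have "time_change (\<lambda>t. t)" by (auto simp: time_change_def strict_mono_on_def)
    ultimately have "y \<in> skorokhod_nbhd x T \<delta>"
      using y \<delta> unfolding skorokhod_nbhd_def by (auto intro!: exI[of _ "\<lambda>t. t"])
    then show "\<bar>f y - f x\<bar> < e" by (rule fx)
  qed
qed

context
  fixes f :: "(real \<Rightarrow> 'a::metric_space) \<Rightarrow> real" and B :: real
  assumes B: "\<And>x. x \<in> skorokhod_space \<Longrightarrow> \<bar>f x\<bar> \<le> B"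
begin

lemma bdd_below_lower_envelope:
  "k \<ge> 0 \<Longrightarrow> bdd_below ((\<lambda>y. f y + k * udist x y) ` skorokhod_space)"
proof (rule bdd_belowI2[of _ "- B"])
  fix y :: "real \<Rightarrow> 'a" assume "k \<ge> 0" "y \<in> skorokhod_space"
  then show "- B \<le> f y + k * udist x y"
    using B[of y] mult_nonneg_nonneg[of k "udist x y"] udist_nonneg[of x y] by linarith
qed

lemma lower_envelope_le: "k \<ge> 0 \<Longrightarrow> x \<in> skorokhod_space \<Longrightarrow> lower_envelope f k x \<le> f x"
  unfolding lower_envelope_def
  using cINF_lower[OF bdd_below_lower_envelope, of k x x] by (simp add: udist_refl)

lemma lower_envelope_ge: "k \<ge> 0 \<Longrightarrow> - B \<le> lower_envelope f k x"
  unfolding lower_envelope_def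
proof (rule cINF_greatest[OF skorokhod_space_nonempty])
  fix y :: "real \<Rightarrow> 'a" assume "k \<ge> 0" "y \<in> skorokhod_space"
  then show "- B \<le> f y + k * udist x y"
    using B[of y] mult_nonneg_nonneg[of k "udist x y"] udist_nonneg[of x y] by linarith
qed

lemma lower_envelope_abs_le:
  assumes "k \<ge> 0" "x \<in> skorokhod_space" shows "\<bar>lower_envelope f k x\<bar> \<le> B"
  using lower_envelope_ge[OF assms(1), of x] lower_envelope_le[OF assms] B[OF assms(2)] by linarith

lemma lower_envelope_lipschitz:
  assumes k: "k \<ge> 0"
  shows "lower_envelope f k x \<le> lower_envelope f k x' + k * udist x x'"
proof -
  have "lower_envelope f k x - k * udist x x' \<le> lower_envelope f k x'"
    unfolding lower_envelope_def[of f k x']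
  proof (rule cINF_greatest[OF skorokhod_space_nonempty])
    fix y :: "real \<Rightarrow> 'a" assume y: "y \<in> skorokhod_space"
    have "lower_envelope f k x \<le> f y + k * udist x y"
      unfolding lower_envelope_def by (rule cINF_lower[OF bdd_below_lower_envelope[OF k] y])
    moreover have "k * udist x y \<le> k * udist x x' + k * udist x' y"
      using mult_left_mono[OF udist_triangle k] by (simp add: distrib_left)
    ultimately show "lower_envelope f k x - k * udist x x' \<le> f y + k * udist x' y" by linarith
  qed
  then show ?thesis by simp
qed

lemma udist_continuous_lower_envelope:
  assumes k: "k \<ge> 0" shows "udist_continuous (lower_envelope f k)"
  unfolding udist_continuous_def
proof (intro ballI allI impI)
  fix x :: "real \<Rightarrow> 'a" and e :: real assume e: "e > 0"
  \<comment> \<open>Dividing by \<open>k + 1\<close> and not by \<open>k\<close> includes the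
    constant envelope \<open>k = 0\<close>.\<close>
  have *: "k * (e / (k + 1)) < e" using k e by (simp add: field_simps)
  show "\<exists>\<delta>>0. \<forall>y\<in>skorokhod_space. udist y x < \<delta> \<longrightarrow> \<bar>lower_envelope f k y - lower_envelope f k x\<bar> < e"
  proof (intro exI[of _ "e / (k + 1)"] conjI ballI impI)
    show "e / (k + 1) > 0" using k e by simp
    fix y :: "real \<Rightarrow> 'a" assume "udist y x < e / (k + 1)"
    then have "k * udist y x \<le> k * (e / (k + 1))" using k by (intro mult_left_mono) auto
    then show "\<bar>lower_envelope f k y - lower_envelope f k x\<bar> < e"
      using lower_envelope_lipschitz[OF k, of x y] lower_envelope_lipschitz[OF k, of y x] *
      by (simp add: udist_commute)
  qed
qed

text \<open>Competitors within \<open>\<delta>\<close> of \<open>x\<close> cannot go below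
  \<open>f x - e / 2\<close> by continuity, and all others pay a penalty of at least
  \<open>k * \<delta>\<close>, which exceeds the largest possible gain \<open>2 * B\<close> once
  \<open>k\<close> is large.\<close>

lemma lower_envelope_tendsto:
  assumes f: "udist_continuous f" and x: "x \<in> skorokhod_space"
  shows "(\<lambda>k. lower_envelope f (real k) x) \<longlonglongrightarrow> f x"
proof (rule LIMSEQ_I)
  fix e :: real assume e: "e > 0"
  obtain \<delta> where \<delta>: "\<delta> > 0" and c: "\<And>y. y \<in> skorokhod_space \<Longrightarrow> udist y x < \<delta> \<Longrightarrow> \<bar>f y - f x\<bar> < e / 2"
    using f x e unfolding udist_continuous_def by (meson half_gt_zero)
  obtain K :: nat where K: "2 * B / \<delta> \<le> real K" using real_arch_simple by blast
  have "norm (lower_envelope f (real k) x - f x) < e" if k: "k \<ge> K" for k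
  proof -
    have "f x - e / 2 \<le> lower_envelope f (real k) x"
      unfolding lower_envelope_def
    proof (rule cINF_greatest[OF skorokhod_space_nonempty])
      fix y :: "real \<Rightarrow> 'a" assume y: "y \<in> skorokhod_space"
      show "f x - e / 2 \<le> f y + real k * udist x y"
      proof (cases "udist y x < \<delta>")
        case True
        then show ?thesis using c[OF y] udist_nonneg[of x y] by (smt (verit) mult_nonneg_nonneg of_nat_0_le_iff)
      next
        case False
        have "2 * B \<le> real K * \<delta>" using K \<delta> by (simp add: field_simps)
        also have "\<dots> \<le> real k * udist x y"
          using False k \<delta> by (intro mult_mono) (auto simp: udist_commute)
        finally show ?thesis using B[OF x] B[OF y] e by linarith
      qed
    qed
    then show ?thesis using lower_envelope_le[of "real k" x] x e by simp
  qed
  then show "\<exists>K. \<forall>k\<ge>K. norm (lower_envelope f (real k) x - f x) < e" by blast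
qed

end

text \<open>The sum is a crude majorant of the maximum over the grid values; it is chosen because a
  finite sum of distances is visibly continuous in the product topology.\<close>

lemma udist_grid_path_le:
  "udist (grid_path r z) (grid_path r z') \<le> (\<Sum>k\<le>r ^ 3. dist (z k) (z' k))"
proof (rule udist_le)
  fix t :: real assume t: "t \<ge> 0"
  let ?k = "min (nat \<lfloor>(real r)\<^sup>2 * t\<rfloor>) (r ^ 3)"
  have "exp (- t) * min 1 (dist (z ?k) (z' ?k)) \<le> 1 * dist (z ?k) (z' ?k)"
    using t by (intro mult_mono) auto
  also have "\<dots> \<le> (\<Sum>k\<le>r ^ 3. dist (z k) (z' k))"
    using member_le_sum[of ?k "{..r^3}" "\<lambda>k. dist (z k) (z' k)"] by simp
  finally show "exp (- t) * min 1 (dist (grid_path r z t) (grid_path r z' t)) \<le> (\<Sum>k\<le>r ^ 3. dist (z k) (z' k))"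
    by (simp add: grid_path_def)
qed

lemma continuous_on_grid_path:
  fixes f :: "(real \<Rightarrow> 'a::metric_space) \<Rightarrow> real"
  assumes f: "udist_continuous f"
  shows "continuous_on UNIV (\<lambda>z. f (grid_path r z))"
  unfolding continuous_on_eq_continuous_at[OF open_UNIV]
proof (intro ballI)
  fix z :: "nat \<Rightarrow> 'a"
  have coord: "((\<lambda>z'. z' k) \<longlongrightarrow> z k) (at z)" for k
  proof -
    have "continuous_on UNIV (\<lambda>z :: nat \<Rightarrow> 'a. z k)" by (rule continuous_on_product_coordinates)
    then show ?thesis unfolding continuous_on_def by auto
  qed
  have lim: "((\<lambda>z'. \<Sum>k\<le>r ^ 3. dist (z' k) (z k)) \<longlongrightarrow> (\<Sum>k\<le>r ^ 3. dist (z k) (z k))) (at z)"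
    by (intro tendsto_sum tendsto_dist coord tendsto_const)
  show "isCont (\<lambda>z. f (grid_path r z)) z"
    unfolding isCont_def
  proof (rule tendstoI)
    fix e :: real assume "e > 0"
    then obtain \<delta> where \<delta>: "\<delta> > 0"
      "\<And>y. y \<in> skorokhod_space \<Longrightarrow> udist y (grid_path r z) < \<delta> \<Longrightarrow> \<bar>f y - f (grid_path r z)\<bar> < e"
      using f grid_path_skorokhod[of r z] unfolding udist_continuous_def by blast
    have "eventually (\<lambda>z'. (\<Sum>k\<le>r ^ 3. dist (z' k) (z k)) < \<delta>) (at z)"
      using order_tendstoD(2)[OF lim, of \<delta>] \<delta>(1) by simp
    then show "eventually (\<lambda>z'. dist (f (grid_path r z')) (f (grid_path r z)) < e) (at z)"
    proof eventually_elim
      case (elim z')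
      then have "udist (grid_path r z') (grid_path r z) < \<delta>"
        using udist_grid_path_le[of r z' z] by linarith
      then show ?case using \<delta>(2)[OF grid_path_skorokhod] by (simp add: dist_real_def)
    qed
  qed
qed

text \<open>Bisection: the property passes from two adjacent intervals to their union, and it holds
  on small intervals around each point by the one-sided limits there. \<open>A\<close> contains the
  times of the large jumps. The interval \<open>{s<..t}\<close> is half-open because a jump at
  \<open>t\<close> separates \<open>s\<close> from \<open>t\<close>, whereas a jump at
  \<open>s\<close> is already part of the value \<open>x s\<close>.\<close>

lemma cadlag_partition:
  fixes x :: "real \<Rightarrow> 'a::metric_space"
  assumes x: "x \<in> skorokhod_space" and e: "e > 0" and T: "T \<ge> 0"
  obtains A where "finite A" "A \<subseteq> {0<..}"
    "\<And>s t. 0 \<le> s \<Longrightarrow> s \<le> t \<Longrightarrow> t \<le> T \<Longrightarrow> {s<..t} \<inter> A = {} \<Longrightarrow> dist (x s) (x t) < e"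
proof -
  define P where "P a b \<longleftrightarrow> (0 \<le> a \<longrightarrow> (\<exists>A. finite A \<and> A \<subseteq> {0<..} \<and>
     (\<forall>s t. a \<le> s \<and> s \<le> t \<and> t \<le> b \<and> {s<..t} \<inter> A = {} \<longrightarrow> dist (x s) (x t) < e)))" for a b :: real
  have "P 0 T"
  proof (rule Bolzano[OF T])
    fix a b c assume ab: "P a b" and bc: "P b c" and le: "a \<le> b" "b \<le> c"
    show "P a c"
      unfolding P_def
    proof
      assume a: "0 \<le> a"
      obtain A where A: "finite A" "A \<subseteq> {0<..}"
        "\<And>s t. a \<le> s \<and> s \<le> t \<and> t \<le> b \<and> {s<..t} \<inter> A = {} \<Longrightarrow> dist (x s) (x t) < e"
        using ab a unfolding P_def by blast
      obtain A' where A': "finite A'" "A' \<subseteq> {0<..}"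
        "\<And>s t. b \<le> s \<and> s \<le> t \<and> t \<le> c \<and> {s<..t} \<inter> A' = {} \<Longrightarrow> dist (x s) (x t) < e"
        using bc a le unfolding P_def by force
      show "\<exists>A. finite A \<and> A \<subseteq> {0<..} \<and>
         (\<forall>s t. a \<le> s \<and> s \<le> t \<and> t \<le> c \<and> {s<..t} \<inter> A = {} \<longrightarrow> dist (x s) (x t) < e)"
      \<comment> \<open>With the common endpoint \<open>b\<close> added, an interval that misses the
        set lies on one side of \<open>b\<close>, so that one of the two partitions applies to
        it.\<close>
      proof (intro exI[of _ "A \<union> A' \<union> ({b} \<inter> {0<..})"] conjI allI impI)
        fix s t assume st: "a \<le> s \<and> s \<le> t \<and> t \<le> c \<and> {s<..t} \<inter> (A \<union> A' \<union> ({b} \<inter> {0<..})) = {}"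
        have "t < b \<or> b \<le> s" using st a by force
        then show "dist (x s) (x t) < e"
        proof
          assume "t < b" then show ?thesis using A(3)[of s t] st by auto
        next
          assume "b \<le> s" then show ?thesis using A'(3)[of s t] st by auto
        qed
      qed (use A A' in auto)
    qed
  next
    fix u :: real assume u: "0 \<le> u" "u \<le> T"
    have "(x \<longlongrightarrow> x u) (at_right u)"
      using x u unfolding skorokhod_space_def continuous_within by blast
    then have "eventually (\<lambda>v. dist (x v) (x u) < e / 2) (at_right u)"
      using e by (intro tendstoD) auto
    then obtain b1 where b1: "b1 > u" "\<And>v. u < v \<Longrightarrow> v < b1 \<Longrightarrow> dist (x v) (x u) < e / 2"
      unfolding eventually_at_right_field by blast
    obtain b2 l where b2: "b2 < u" "\<And>v. 0 \<le> b2 \<Longrightarrow> b2 < v \<Longrightarrow> v < u \<Longrightarrow> dist (x v) l < e / 2" "u > 0 \<Longrightarrow> b2 \<ge> 0"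
    proof (cases "u > 0")
      case True
      then obtain l where "(x \<longlongrightarrow> l) (at_left u)"
        using x unfolding skorokhod_space_def by blast
      then have "eventually (\<lambda>v. dist (x v) l < e / 2) (at_left u)"
        using e by (intro tendstoD) auto
      then obtain b where b: "b < u" "\<And>v. b < v \<Longrightarrow> v < u \<Longrightarrow> dist (x v) l < e / 2"
        unfolding eventually_at_left_field by blast
      then show ?thesis using that[of "max b 0" l] True by auto
    next
      case False
      then show ?thesis using that[of "u - 1" undefined] u by auto
    qed
    show "\<exists>d>0. \<forall>a b. a \<le> u \<and> u \<le> b \<and> b - a < d \<longrightarrow> P a b"
    proof (intro exI[of _ "min (b1 - u) (u - b2)"] conjI allI impI)
      show "min (b1 - u) (u - b2) > 0" using b1 b2 by simp
      fix a b assume ab: "a \<le> u \<and> u \<le> b \<and> b - a < min (b1 - u) (u - b2)"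
      show "P a b" unfolding P_def
      proof (intro impI exI[of _ "{u} \<inter> {0<..}"] conjI allI)
        fix s t assume a: "0 \<le> a" and st: "a \<le> s \<and> s \<le> t \<and> t \<le> b \<and> {s<..t} \<inter> ({u} \<inter> {0<..}) = {}"
        have right: "dist (x v) (x u) < e / 2" if "u \<le> v" "v \<le> b" for v
          using that b1(2)[of v] ab e by (cases "v = u") auto
        have left: "dist (x v) l < e / 2" if "a \<le> v" "v < u" for v
          using that b2 ab a by auto
        have "t < u \<or> u \<le> s" using st a by force
        then show "dist (x s) (x t) < e"
        proof
          assume "t < u"
          then show ?thesis using left[of s] left[of t] st dist_triangle2[of "x s" "x t" l] by auto
        next
          assume "u \<le> s"
          then show ?thesis using right[of s] right[of t] st dist_triangle2[of "x s" "x t" "x u"] by auto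
        qed
      qed auto
    qed
  qed
  then obtain A where "finite A" "A \<subseteq> {0<..}"
     "\<forall>s t. 0 \<le> s \<and> s \<le> t \<and> t \<le> T \<and> {s<..t} \<inter> A = {} \<longrightarrow> dist (x s) (x t) < e"
    unfolding P_def by blast
  then show ?thesis using that[of A] by blast
qed

text \<open>
  The time change is the identity plus tents of height \<open>c a\<close> at the points \<open>a\<close>; it moves the
  finitely many large jumps of a path to grid points, from the right.
\<close>

lemma tent_time_change:
  fixes A :: "real set" and c :: "real \<Rightarrow> real"
  assumes A: "finite A" "A \<subseteq> {0<..}"
  obtains g where "g > 0"
    "\<And>c \<eta>. (\<And>a. a \<in> A \<Longrightarrow> 0 \<le> c a \<and> c a \<le> \<eta>) \<Longrightarrow> \<eta> \<ge> 0 \<Longrightarrow> real (card A) * \<eta> < g \<Longrightarrow>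
      \<exists>\<rho>. time_change \<rho> \<and> (\<forall>t. t \<le> \<rho> t \<and> \<rho> t \<le> t + real (card A) * \<eta>) \<and> (\<forall>a\<in>A. \<rho> a = a + c a)"
proof -
  \<comment> \<open>The point 0 is included among the points to be separated, so that no tent
    reaches it and the time change fixes 0.\<close>
  define D where "D = {\<bar>a - b\<bar> | a b. a \<in> insert 0 A \<and> b \<in> insert 0 A \<and> a \<noteq> b}"
  have "D \<subseteq> (\<lambda>(a, b). \<bar>a - b\<bar>) ` (insert 0 A \<times> insert 0 A)" by (auto simp: D_def)
  then have fin: "finite D" using A(1) finite_subset by blast
  \<comment> \<open>The inserted 1 makes the minimum meaningful when \<open>A\<close> is
    empty.\<close>
  define g where "g = Min (insert 1 D)"
  have g: "g > 0" unfolding g_def using fin by (auto simp: D_def)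
  have gap: "\<bar>a - b\<bar> \<ge> g" if "a \<in> insert 0 A" "b \<in> insert 0 A" "a \<noteq> b" for a b
  proof -
    have "\<bar>a - b\<bar> \<in> D" unfolding D_def using that by blast
    then show ?thesis unfolding g_def using fin by simp
  qed
  \<comment> \<open>The half-width is the smallest gap, so each tent vanishes at 0 and at all other
    points of \<open>A\<close>.\<close>
  define tent where "tent a t = max 0 (1 - \<bar>t - a\<bar> / g)" for a t
  have tent0: "0 \<le> tent a t" "tent a t \<le> 1" "tent a a = 1" for a t using g by (auto simp: tent_def)
  have tent_lip: "tent a s - tent a t \<le> (t - s) / g" if "s \<le> t" for a s t
  proof -
    have "\<bar>t - a\<bar> / g - \<bar>s - a\<bar> / g \<le> (t - s) / g"
      using g that by (simp add: diff_divide_distrib[symmetric] divide_right_mono)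
    moreover have "0 \<le> (t - s) / g" using g that by simp
    moreover have "max 0 p - max 0 q \<le> c" if "p - q \<le> c" "0 \<le> c" for p q c :: real using that by auto
    ultimately show ?thesis unfolding tent_def by simp
  qed
  have tent_zero: "tent a b = 0" if "a \<in> A" "b \<in> insert 0 A" "a \<noteq> b" for a b
    using gap[of a b] that g unfolding tent_def by (simp add: field_simps abs_minus_commute)
  have "\<exists>\<rho>. time_change \<rho> \<and> (\<forall>t. t \<le> \<rho> t \<and> \<rho> t \<le> t + real (card A) * \<eta>) \<and> (\<forall>a\<in>A. \<rho> a = a + c a)"
    if c: "\<And>a. a \<in> A \<Longrightarrow> 0 \<le> c a \<and> c a \<le> \<eta>" and \<eta>: "\<eta> \<ge> 0" "real (card A) * \<eta> < g" for c \<eta>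
  proof -
    define \<rho> where "\<rho> t = t + (\<Sum>a\<in>A. c a * tent a t)" for t
    have le: "t \<le> \<rho> t" for t unfolding \<rho>_def using c tent0(1) by (auto intro!: sum_nonneg mult_nonneg_nonneg)
    have ge: "\<rho> t \<le> t + real (card A) * \<eta>" for t
    proof -
      have "(\<Sum>a\<in>A. c a * tent a t) \<le> (\<Sum>a\<in>A. \<eta> * 1)" using c tent0(1,2) \<eta> by (intro sum_mono mult_mono) auto
      then show ?thesis by (simp add: \<rho>_def)
    qed
    have at: "\<rho> a = a + c a" if "a \<in> A" for a
    proof -
      have "(\<Sum>b\<in>A. c b * tent b a) = (\<Sum>b\<in>A. if b = a then c a else 0)"
        using that tent0(3) tent_zero[of _ a] by (intro sum.cong) auto
      then show ?thesis using that A(1) by (simp add: \<rho>_def)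
    qed
    have zero: "\<rho> 0 = 0"
    proof -
      have "(\<Sum>b\<in>A. c b * tent b 0) = 0"
        using A(2) tent_zero[of _ 0] by (intro sum.neutral) force
      then show ?thesis by (simp add: \<rho>_def)
    qed
    have mono: "\<rho> s < \<rho> t" if st: "s < t" for s t
    proof -
      \<comment> \<open>A tent descends with slope at most \<open>1 / g\<close>, so the sum of all
        tents descends with slope at most \<open>card A * \<eta> / g < 1\<close> and cannot outweigh
        the identity.\<close>
      have "(\<Sum>a\<in>A. c a * tent a s) - (\<Sum>a\<in>A. c a * tent a t) = (\<Sum>a\<in>A. c a * (tent a s - tent a t))"
        by (simp add: sum_subtractf right_diff_distrib)
      also have "\<dots> \<le> (\<Sum>a\<in>A. c a * ((t - s) / g))"
        using c tent_lip[of s t] st by (intro sum_mono mult_left_mono) auto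
      also have "\<dots> \<le> (\<Sum>a\<in>A. \<eta> * ((t - s) / g))"
        using c st g by (intro sum_mono mult_right_mono) auto
      also have "\<dots> = real (card A) * \<eta> / g * (t - s)" by simp
      also have "\<dots> < 1 * (t - s)" using st \<eta> g by (intro mult_strict_right_mono) auto
      finally show ?thesis by (simp add: \<rho>_def)
    qed
    have cont: "continuous_on S \<rho>" for S unfolding \<rho>_def tent_def using g by (intro continuous_intros) auto
    have "time_change \<rho>" unfolding time_change_def
    proof
      show "strict_mono_on {0..} \<rho>" using mono by (auto simp: strict_mono_on_def)
      show "\<rho> ` {0..} = {0..}"
      proof (intro equalityI subsetI)
        fix y assume "y \<in> \<rho> ` {0..}"
        then obtain t where "t \<ge> 0" "y = \<rho> t" by auto
        then show "y \<in> {0..}" using le[of t] by simp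
      next
        fix y :: real assume y: "y \<in> {0..}"
        \<comment> \<open>The time change never decreases a time, so \<open>y\<close> itself serves
          as the upper endpoint for the intermediate value theorem.\<close>
        obtain t where "0 \<le> t" "t \<le> y" "\<rho> t = y"
          using IVT'[of \<rho> 0 y y] zero y le[of y] cont by auto
        then show "y \<in> \<rho> ` {0..}" by force
      qed
    qed
    then show ?thesis using le ge at by blast
  qed
  then show ?thesis using that g by blast
qed

text \<open>A jump at \<open>b\<close> shows in the sampled path only at the first grid point
  \<open>\<lceil>b * a\<rceil> / a\<close> not before \<open>b\<close>. The time change sends
  \<open>b\<close> to that very point, so both paths cross each large jump together, and between the
  jumps the oscillation is below \<open>e\<close>.\<close>

lemma grid_path_in_skorokhod_nbhd:
  fixes x :: "real \<Rightarrow> 'a::metric_space"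
  assumes x: "x \<in> skorokhod_space" and e: "e > 0"
  shows "\<forall>\<^sub>F r in sequentially. grid_path r (\<lambda>k. x (real k / (real r)\<^sup>2)) \<in> skorokhod_nbhd x T e"
proof -
  \<comment> \<open>The extra unit leaves room for the displacement of times by the time
    change.\<close>
  define T' where "T' = \<bar>T\<bar> + 1"
  obtain A where A: "finite A" "A \<subseteq> {0<..}" and
    part: "\<And>s t. 0 \<le> s \<Longrightarrow> s \<le> t \<Longrightarrow> t \<le> T' \<Longrightarrow> {s<..t} \<inter> A = {} \<Longrightarrow> dist (x s) (x t) < e"
    using cadlag_partition[OF x e, of T'] unfolding T'_def by (metis abs_ge_zero add_nonneg_nonneg zero_le_one)
  obtain g where g: "g > 0" and tc:
    "\<And>c \<eta>. (\<And>a. a \<in> A \<Longrightarrow> 0 \<le> c a \<and> c a \<le> \<eta>) \<Longrightarrow> \<eta> \<ge> 0 \<Longrightarrow> real (card A) * \<eta> < g \<Longrightarrow>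
      \<exists>\<rho>. time_change \<rho> \<and> (\<forall>t. t \<le> \<rho> t \<and> \<rho> t \<le> t + real (card A) * \<eta>) \<and> (\<forall>a\<in>A. \<rho> a = a + c a)"
    using tent_time_change[OF A] by blast
  \<comment> \<open>Displacements below \<open>g\<close> allow the time change to exist, below
    \<open>e\<close> make it close to the identity, and below 1 keep it inside
    \<open>{0..T'}\<close>.\<close>
  define h where "h = min (min g e) 1"
  have h: "h > 0" using g e by (simp add: h_def)
  obtain R0 :: nat where R0: "real R0 > max 1 (max (T' + 1) (real (card A) / h))"
    using reals_Archimedean2 by blast
  have "grid_path r (\<lambda>k. x (real k / (real r)\<^sup>2)) \<in> skorokhod_nbhd x T e" if r: "r \<ge> R0" for r
  proof -
    define a where "a = (real r)\<^sup>2"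
    have r1: "real r > 1" "real r > T' + 1" "real r > real (card A) / h" using R0 r by auto
    have ar: "a \<ge> real r" unfolding a_def using r1 by (simp add: power2_eq_square)
    have a0: "a > 0" using ar r1 by linarith
    have small: "real (card A) * (1 / a) < h"
    proof -
      have "real (card A) / h < a" using r1 ar by linarith
      then show ?thesis using h a0 by (simp add: field_simps)
    qed
    have c: "0 \<le> of_int \<lceil>b * a\<rceil> / a - b \<and> of_int \<lceil>b * a\<rceil> / a - b \<le> 1 / a" for b
    proof -
      have "b \<le> of_int \<lceil>b * a\<rceil> / a" using a0 by (simp add: pos_le_divide_eq)
      moreover have "of_int \<lceil>b * a\<rceil> \<le> b * a + 1" by linarith
      then have "of_int \<lceil>b * a\<rceil> / a \<le> (b * a + 1) / a" using a0 by (intro divide_right_mono) auto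
      then have "of_int \<lceil>b * a\<rceil> / a \<le> b + 1 / a" using a0 by (simp add: add_divide_distrib)
      ultimately show ?thesis by linarith
    qed
    obtain \<rho> where \<rho>: "time_change \<rho>" "\<And>t. t \<le> \<rho> t \<and> \<rho> t \<le> t + real (card A) * (1 / a)"
      and \<rho>A: "\<And>b. b \<in> A \<Longrightarrow> \<rho> b = of_int \<lceil>b * a\<rceil> / a"
      using tc[of "\<lambda>b. of_int \<lceil>b * a\<rceil> / a - b" "1 / a"] c small a0 unfolding h_def by auto
    have "dist (grid_path r (\<lambda>k. x (real k / (real r)\<^sup>2)) (\<rho> t)) (x t) < e" if t: "t \<in> {0..T}" for t
    proof -
      define u where "u = of_int \<lfloor>a * \<rho> t\<rfloor> / a"
      have \<rho>0: "0 \<le> \<rho> t" "\<rho> t \<le> T'" using \<rho>(2)[of t] t small by (auto simp: T'_def h_def)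
      have "a * \<rho> t \<le> a * real r" using \<rho>0 r1 a0 by (intro mult_left_mono) auto
      also have "\<dots> = real (r ^ 3)" by (simp add: a_def power2_eq_square power3_eq_cube)
      finally have "nat \<lfloor>a * \<rho> t\<rfloor> \<le> r ^ 3" by linarith
      moreover have fl: "\<lfloor>a * \<rho> t\<rfloor> \<ge> 0" using \<rho>0 a0 by simp
      ultimately have eq: "grid_path r (\<lambda>k. x (real k / (real r)\<^sup>2)) (\<rho> t) = x u"
        by (simp add: grid_path_def u_def a_def)
      have u0: "0 \<le> u" "u \<le> \<rho> t" using fl a0 by (auto simp: u_def pos_divide_le_eq mult.commute)
      have mono: "\<rho> s < \<rho> s'" if "0 \<le> s" "s < s'" for s s'
        using \<rho>(1) that unfolding time_change_def by (auto simp: strict_mono_on_def)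
      \<comment> \<open>The sampling time \<open>u\<close> of the deformed time and the original
        time \<open>t\<close> lie on the same side of every point of \<open>A\<close>, which is what
        the partition asks for.\<close>
      have sep: "(b \<le> t \<longrightarrow> b \<le> u) \<and> (t < b \<longrightarrow> u < b)" if b: "b \<in> A" for b
      proof (intro conjI impI)
        assume "b \<le> t"
        then have "\<rho> b \<le> \<rho> t" using mono[of b t] A(2) b by (cases "b = t") auto
        then have "of_int \<lceil>b * a\<rceil> \<le> a * \<rho> t" using \<rho>A[OF b] a0 by (simp add: field_simps)
        then have "\<lceil>b * a\<rceil> \<le> \<lfloor>a * \<rho> t\<rfloor>" by linarith
        then have "b * a \<le> of_int \<lfloor>a * \<rho> t\<rfloor>" by linarith
        then show "b \<le> u" using a0 by (simp add: u_def field_simps)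
      next
        assume "t < b"
        then have "\<rho> t < \<rho> b" using mono[of t b] t by auto
        then have "a * \<rho> t < of_int \<lceil>b * a\<rceil>" using \<rho>A[OF b] a0 by (simp add: field_simps)
        then have "\<lfloor>a * \<rho> t\<rfloor> < \<lceil>b * a\<rceil>" by (simp add: floor_less_iff)
        then have "of_int \<lfloor>a * \<rho> t\<rfloor> < b * a" by linarith
        then show "u < b" using a0 by (simp add: u_def field_simps)
      qed
      show ?thesis
      proof (cases "u \<le> t")
        case True
        have "{u<..t} \<inter> A = {}" using sep by force
        then show ?thesis unfolding eq using part[of u t] u0 True t by (simp add: T'_def)
      next
        case False
        have "{t<..u} \<inter> A = {}" using sep by force
        then show ?thesis unfolding eq using part[of t u] u0 False t \<rho>0 by (simp add: dist_commute)
      qed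
    qed
    moreover have "\<bar>\<rho> t - t\<bar> < e" for t using \<rho>(2)[of t] small by (auto simp: h_def)
    ultimately show ?thesis using \<rho>(1) grid_path_skorokhod unfolding skorokhod_nbhd_def by blast
  qed
  then show ?thesis unfolding eventually_sequentially by blast
qed

text \<open>
  The step paths through grid values converge in the J1 topology, and on them the functional is a
  continuous function of finitely many values of the process.
\<close>

lemma measurable_skorokhod_functional:
  fixes X :: "real \<Rightarrow> 'w \<Rightarrow> 'a::{metric_space, second_countable_topology}"
  assumes f: "continuous_map skorokhod_topology euclideanreal f"
    and X: "\<And>t. t \<ge> 0 \<Longrightarrow> X t \<in> borel_measurable M"
    and path: "\<And>\<omega>. \<omega> \<in> space M \<Longrightarrow> (\<lambda>t. X t \<omega>) \<in> skorokhod_space"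
  shows "(\<lambda>\<omega>. f (\<lambda>t. X t \<omega>)) \<in> borel_measurable M"
proof (rule borel_measurable_LIMSEQ_real)
  fix \<omega> assume "\<omega> \<in> space M"
  then have x: "(\<lambda>t. X t \<omega>) \<in> skorokhod_space" by (rule path)
  show "(\<lambda>r. f (grid_path r (\<lambda>k. X (real k / (real r)\<^sup>2) \<omega>))) \<longlonglongrightarrow> f (\<lambda>t. X t \<omega>)"
  proof (rule tendstoI)
    fix e :: real assume "e > 0"
    then obtain T \<delta> where \<delta>: "\<delta> > 0"
      "\<And>y. y \<in> skorokhod_nbhd (\<lambda>t. X t \<omega>) T \<delta> \<Longrightarrow> \<bar>f y - f (\<lambda>t. X t \<omega>)\<bar> < e"
      using skorokhod_continuous_nbhd[OF f x] by blast
    show "\<forall>\<^sub>F r in sequentially. dist (f (grid_path r (\<lambda>k. X (real k / (real r)\<^sup>2) \<omega>))) (f (\<lambda>t. X t \<omega>)) < e"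
      using grid_path_in_skorokhod_nbhd[OF x \<delta>(1), of T]
      by eventually_elim (simp add: \<delta>(2) dist_real_def)
  qed
next
  fix r :: nat
  have "(\<lambda>\<omega>. \<lambda>k. X (real k / (real r)\<^sup>2) \<omega>) \<in> borel_measurable M"
    by (rule measurable_coordinatewise_then_product) (simp add: X)
  moreover have "(\<lambda>z. f (grid_path r z)) \<in> borel_measurable borel"
    by (intro borel_measurable_continuous_onI continuous_on_grid_path skorokhod_continuous_imp_udist_continuous f)
  ultimately show "(\<lambda>\<omega>. f (grid_path r (\<lambda>k. X (real k / (real r)\<^sup>2) \<omega>))) \<in> borel_measurable M"
    by (rule measurable_compose)
qed

section \<open>Smooth functions with compact support\<close>

text \<open>The grading by the number of derivatives is there for inductions on that number: the
  derivative of a product or a composition is again of the same kind, with one order less to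
  check.\<close>

definition smooth_upto :: "nat \<Rightarrow> (real ^ ('n::finite) \<Rightarrow> real) \<Rightarrow> bool" where
  "smooth_upto n \<phi> \<longleftrightarrow> (\<forall>is. length is \<le> n \<longrightarrow> foldr partial_deriv is \<phi> differentiable_on UNIV)"

definition smooth :: "(real ^ ('n::finite) \<Rightarrow> real) \<Rightarrow> bool" where
  "smooth \<phi> \<longleftrightarrow> (\<forall>n. smooth_upto n \<phi>)"

definition const_coeff_op ::
    "real ^ 'n \<Rightarrow> ('n \<Rightarrow> 'n \<Rightarrow> real) \<Rightarrow> (real ^ 'n \<Rightarrow> real) \<Rightarrow> real ^ ('n::finite) \<Rightarrow> real" where
  "const_coeff_op m A \<phi> y = (\<Sum>i\<in>UNIV. m $ i * partial_deriv i \<phi> y) +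
     (\<Sum>i\<in>UNIV. \<Sum>j\<in>UNIV. A i j * partial_deriv i (partial_deriv j \<phi>) y)"

lemma smooth_alt: "smooth \<phi> \<longleftrightarrow> (\<forall>is. foldr partial_deriv is \<phi> differentiable_on UNIV)"
  unfolding smooth_def smooth_upto_def by blast

lemma smooth_upto_0: "smooth_upto 0 \<phi> \<longleftrightarrow> \<phi> differentiable_on UNIV"
  by (simp add: smooth_upto_def)

lemma smooth_upto_Suc:
  "smooth_upto (Suc n) \<phi> \<longleftrightarrow> \<phi> differentiable_on UNIV \<and> (\<forall>i. smooth_upto n (partial_deriv i \<phi>))"
proof
  assume L: "smooth_upto (Suc n) \<phi>"
  \<comment> \<open>\<open>foldr\<close> applies the last entry of the list first, so the innermost
    derivative is split off at the end of the list.\<close>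
  have "foldr partial_deriv is (partial_deriv i \<phi>) differentiable_on UNIV" if "length is \<le> n" for "is" i
    using L[unfolded smooth_upto_def, rule_format, of "is @ [i]"] that by simp
  moreover have "\<phi> differentiable_on UNIV"
    using L[unfolded smooth_upto_def, rule_format, of "[]"] by simp
  ultimately show "\<phi> differentiable_on UNIV \<and> (\<forall>i. smooth_upto n (partial_deriv i \<phi>))"
    by (auto simp: smooth_upto_def)
next
  assume R: "\<phi> differentiable_on UNIV \<and> (\<forall>i. smooth_upto n (partial_deriv i \<phi>))"
  show "smooth_upto (Suc n) \<phi>" unfolding smooth_upto_def
  proof (intro allI impI)
    fix "is" :: "'a list" assume "length is \<le> Suc n"
    then show "foldr partial_deriv is \<phi> differentiable_on UNIV"
      using R by (cases "is" rule: rev_cases) (auto simp: smooth_upto_def)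
  qed
qed

lemma smooth_upto_differentiable: "smooth_upto n \<phi> \<Longrightarrow> \<phi> differentiable_on UNIV"
  by (cases n) (simp_all add: smooth_upto_0 smooth_upto_Suc)

lemma smooth_upto_mono: "smooth_upto n \<phi> \<Longrightarrow> m \<le> n \<Longrightarrow> smooth_upto m \<phi>"
  by (auto simp: smooth_upto_def)

lemma smooth_differentiable: "smooth \<phi> \<Longrightarrow> \<phi> differentiable (at x)"
  using smooth_upto_differentiable[of 0 \<phi>] by (simp add: smooth_def differentiable_on_def)

lemma smooth_partial_deriv: "smooth \<phi> \<Longrightarrow> smooth (partial_deriv i \<phi>)"
  unfolding smooth_def using smooth_upto_Suc by blast

lemma smooth_continuous_on: "smooth \<phi> \<Longrightarrow> continuous_on S \<phi>"
  by (meson smooth_differentiable differentiable_imp_continuous_within continuous_at_imp_continuous_on)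

lemma partial_deriv_eq:
  assumes "(\<phi> has_derivative D) (at x)"
  shows "partial_deriv i \<phi> x = D (axis i 1)"
proof -
  have "((\<lambda>h. x + h *\<^sub>R axis i 1) has_derivative (\<lambda>h. h *\<^sub>R axis i 1)) (at 0)"
    by (auto intro!: derivative_eq_intros)
  moreover have "(\<phi> has_derivative D) (at (x + 0 *\<^sub>R axis i 1))" using assms by simp
  ultimately have "((\<lambda>h. \<phi> (x + h *\<^sub>R axis i 1)) has_derivative (\<lambda>h. D (h *\<^sub>R axis i 1))) (at 0)"
    by (rule has_derivative_compose)
  moreover have "D (h *\<^sub>R axis i 1) = h * D (axis i 1)" for h
    using linear_cmul[OF has_derivative_linear[OF assms]] by simp
  ultimately have "((\<lambda>h. \<phi> (x + h *\<^sub>R axis i 1)) has_field_derivative D (axis i 1)) (at 0)"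
    unfolding has_field_derivative_def by (simp add: mult_commute_abs)
  then show ?thesis unfolding partial_deriv_def by (rule DERIV_imp_deriv)
qed

lemma partial_deriv_add:
  assumes "f differentiable (at x)" "g differentiable (at x)"
  shows "partial_deriv i (\<lambda>y. f y + g y) x = partial_deriv i f x + partial_deriv i g x"
proof -
  obtain F G where F: "(f has_derivative F) (at x)" and G: "(g has_derivative G) (at x)"
    using assms unfolding differentiable_def by blast
  show ?thesis
    using partial_deriv_eq[OF has_derivative_add[OF F G], of i] partial_deriv_eq[OF F, of i]
      partial_deriv_eq[OF G, of i] by simp
qed

lemma partial_deriv_mult:
  assumes "f differentiable (at x)" "g differentiable (at x)"
  shows "partial_deriv i (\<lambda>y. f y * g y) x = partial_deriv i f x * g x + f x * partial_deriv i g x"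
proof -
  obtain F G where F: "(f has_derivative F) (at x)" and G: "(g has_derivative G) (at x)"
    using assms unfolding differentiable_def by blast
  show ?thesis
    using partial_deriv_eq[OF has_derivative_mult[OF F G], of i] partial_deriv_eq[OF F, of i]
      partial_deriv_eq[OF G, of i] by simp
qed

lemma partial_deriv_const: "partial_deriv i (\<lambda>y. c) x = 0"
  by (simp add: partial_deriv_def)

lemma partial_deriv_cmult:
  assumes "f differentiable (at x)"
  shows "partial_deriv i (\<lambda>y. c * f y) x = c * partial_deriv i f x"
  using partial_deriv_mult[of "\<lambda>_. c" x f i] assms by (simp add: partial_deriv_const)

lemma partial_deriv_scale:
  assumes "f differentiable (at (r *\<^sub>R x))"
  shows "partial_deriv i (\<lambda>y. f (r *\<^sub>R y)) x = r * partial_deriv i f (r *\<^sub>R x)"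
proof -
  obtain F where F: "(f has_derivative F) (at (r *\<^sub>R x))"
    using assms unfolding differentiable_def by blast
  have "((\<lambda>y. r *\<^sub>R y) has_derivative (\<lambda>y. r *\<^sub>R y)) (at x)" by (auto intro!: derivative_eq_intros)
  from has_derivative_compose[OF this F] have "((\<lambda>y. f (r *\<^sub>R y)) has_derivative (\<lambda>y. F (r *\<^sub>R y))) (at x)" .
  from partial_deriv_eq[OF this, of i] partial_deriv_eq[OF F, of i] show ?thesis
    using linear_cmul[OF has_derivative_linear[OF F]] by simp
qed

lemma differentiable_on_UNIV_scale:
  assumes "f differentiable_on UNIV"
  shows "(\<lambda>y. f (r *\<^sub>R y)) differentiable_on UNIV"
proof -
  have "(\<lambda>y. r *\<^sub>R y) differentiable (at x)" for x by simp
  moreover have "f differentiable (at (r *\<^sub>R x))" for x using assms by (simp add: differentiable_on_def)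
  ultimately show ?thesis
    unfolding differentiable_on_def using differentiable_chain_at[of "\<lambda>y. r *\<^sub>R y" _ f] by (auto simp: o_def)
qed

lemma smooth_upto_add: "smooth_upto n f \<Longrightarrow> smooth_upto n g \<Longrightarrow> smooth_upto n (\<lambda>y. f y + g y)"
proof (induction n arbitrary: f g)
  case 0 then show ?case by (simp add: smooth_upto_0 differentiable_on_add)
next
  case (Suc n)
  then have "partial_deriv i (\<lambda>y. f y + g y) = (\<lambda>y. partial_deriv i f y + partial_deriv i g y)" for i
    by (auto simp: smooth_upto_Suc differentiable_on_def partial_deriv_add)
  then show ?case using Suc by (simp add: smooth_upto_Suc differentiable_on_add)
qed

lemma smooth_upto_mult: "smooth_upto n f \<Longrightarrow> smooth_upto n g \<Longrightarrow> smooth_upto n (\<lambda>y. f y * g y)"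
proof (induction n arbitrary: f g)
  case 0 then show ?case by (simp add: smooth_upto_0 differentiable_on_mult)
next
  case (Suc n)
  then have "partial_deriv i (\<lambda>y. f y * g y) = (\<lambda>y. partial_deriv i f y * g y + f y * partial_deriv i g y)" for i
    by (auto simp: smooth_upto_Suc differentiable_on_def partial_deriv_mult)
  then show ?case
    using Suc smooth_upto_mono[OF Suc.prems(1), of n] smooth_upto_mono[OF Suc.prems(2), of n]
    by (simp add: smooth_upto_Suc[of n] differentiable_on_mult smooth_upto_add)
qed

lemma smooth_upto_const: "smooth_upto n (\<lambda>y. c)"
proof (induction n arbitrary: c)
  case (Suc n)
  have "partial_deriv i (\<lambda>y. c) = (\<lambda>y. 0)" for i :: 'a by (auto simp: partial_deriv_const)
  then show ?case using Suc by (simp add: smooth_upto_Suc)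
qed (simp add: smooth_upto_0)

lemma smooth_upto_scale: "smooth_upto n f \<Longrightarrow> smooth_upto n (\<lambda>y. f (r *\<^sub>R y))"
proof (induction n arbitrary: f)
  case 0 then show ?case by (simp add: smooth_upto_0 differentiable_on_UNIV_scale)
next
  case (Suc n)
  then have "partial_deriv i (\<lambda>y. f (r *\<^sub>R y)) = (\<lambda>y. r * partial_deriv i f (r *\<^sub>R y))" for i
    by (auto simp: smooth_upto_Suc differentiable_on_def partial_deriv_scale)
  then show ?case
    using Suc by (simp add: smooth_upto_Suc differentiable_on_UNIV_scale smooth_upto_mult smooth_upto_const)
qed

lemma smooth_mult: "smooth f \<Longrightarrow> smooth g \<Longrightarrow> smooth (\<lambda>y. f y * g y)"
  by (simp add: smooth_def smooth_upto_mult)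

lemma smooth_const: "smooth (\<lambda>y. c)"
  by (simp add: smooth_def smooth_upto_const)

lemma smooth_scale: "smooth f \<Longrightarrow> smooth (\<lambda>y. f (r *\<^sub>R y))"
  by (simp add: smooth_def smooth_upto_scale)

lemma smooth_prod: "(\<And>i. i \<in> I \<Longrightarrow> smooth (f i)) \<Longrightarrow> smooth (\<lambda>y. \<Prod>i\<in>I. f i y)"
  by (induction I rule: infinite_finite_induct) (simp_all add: smooth_const smooth_mult)

lemma inner_axis_1: "v \<bullet> axis i (1::real) = v $ i"
  by (simp add: inner_axis)

lemma has_derivative_affine_compose:
  assumes "(g has_field_derivative g') (at (v \<bullet> x + a))"
  shows "((\<lambda>y :: real ^ 'n. g (v \<bullet> y + a)) has_derivative (\<lambda>y. (v \<bullet> y) * g')) (at x)"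
proof -
  have "((\<lambda>y. v \<bullet> y + a) has_derivative (\<lambda>y. v \<bullet> y)) (at x)" by (auto intro!: derivative_eq_intros)
  from has_derivative_compose[OF this assms[unfolded has_field_derivative_def]]
  show ?thesis by (simp add: mult.commute)
qed

lemma partial_deriv_affine_compose:
  assumes "(g has_field_derivative g') (at (v \<bullet> x + a))"
  shows "partial_deriv i (\<lambda>y. g (v \<bullet> y + a)) x = v $ i * g'"
  using partial_deriv_eq[OF has_derivative_affine_compose[OF assms]] by (simp add: inner_axis_1)

text \<open>\<open>G\<close> is the tower of successive derivatives of one function of a real
  variable. Giving it explicitly reduces smoothness in several variables to one-variable
  derivatives; it serves for cosines, for the flat functions and for coordinates.\<close>

lemma smooth_affine_compose:
  assumes G: "\<And>n x. (G n has_field_derivative G (Suc n) x) (at x)"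
  shows "smooth (\<lambda>y :: real ^ 'n::finite. G m (v \<bullet> y + a))"
proof -
  have diff: "(\<lambda>y. G m (v \<bullet> y + a)) differentiable_on UNIV" for m
      proof -
    have "(\<lambda>y. G m (v \<bullet> y + a)) differentiable at x" for x
      using has_derivative_affine_compose[OF G[of m "v \<bullet> x + a"]] by (rule differentiableI)
    then show ?thesis by (simp add: differentiable_on_def)
  qed
  have "smooth_upto n (\<lambda>y. G m (v \<bullet> y + a))" for n
  proof (induction n arbitrary: m)
    case 0 show ?case using diff by (simp add: smooth_upto_0)
  next
    case (Suc n)
    have "partial_deriv i (\<lambda>y. G m (v \<bullet> y + a)) = (\<lambda>y. v $ i * G (Suc m) (v \<bullet> y + a))" for i
      using partial_deriv_affine_compose[OF G] by blast
    then show ?case using Suc diff by (simp add: smooth_upto_Suc smooth_upto_mult smooth_upto_const)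
  qed
  then show ?thesis by (simp add: smooth_def)
qed

text \<open>The flat functions \<open>p(1/t) exp(-1/t)\<close>, extended by zero, are closed under differentiation.\<close>

definition flat_fun :: "real poly \<Rightarrow> real \<Rightarrow> real" where
  "flat_fun p t = (if t > 0 then poly p (1 / t) * exp (- (1 / t)) else 0)"

lemma poly_exp_tendsto_0: "((\<lambda>x::real. poly p x * exp (- x)) \<longlongrightarrow> 0) at_top"
proof -
  have "((\<lambda>x. \<Sum>i\<le>degree p. coeff p i * (x ^ i / exp x)) \<longlongrightarrow> (\<Sum>i\<le>degree p. coeff p i * 0)) at_top"
    by (intro tendsto_sum tendsto_mult tendsto_const tendsto_power_div_exp_0)
  moreover have "poly p x * exp (- x) = (\<Sum>i\<le>degree p. coeff p i * (x ^ i / exp x))" for x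
    by (simp add: poly_altdef sum_distrib_right exp_minus divide_inverse mult.assoc)
  ultimately show ?thesis by simp
qed

text \<open>For \<open>t > 0\<close> the derivative is
  \<open>(p - p')(1/t) * (1/t)^2 * exp (- 1/t)\<close>, and \<open>[:0, 0, 1:]\<close> is the square
  factor. At 0 the exponential beats every power of \<open>1/t\<close>.\<close>

lemma flat_has_derivative:
  "(flat_fun p has_field_derivative flat_fun ((p - pderiv p) * [:0, 0, 1:]) t) (at t)"
proof -
  consider "t > 0" | "t < 0" | "t = 0" by linarith
  then show ?thesis
  proof cases
    case 1
    have "((\<lambda>t. poly p (1 / t) * exp (- (1 / t))) has_field_derivative
        flat_fun ((p - pderiv p) * [:0, 0, 1:]) t) (at t)"
      using 1 by (auto intro!: derivative_eq_intros simp: flat_fun_def power2_eq_square field_simps)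
    moreover have "eventually (\<lambda>s. s > 0) (nhds t)" using 1 eventually_nhds_in_open[of "{0<..}" t] by simp
    then have "eventually (\<lambda>s. flat_fun p s = poly p (1 / s) * exp (- (1 / s))) (nhds t)"
      by eventually_elim (simp add: flat_fun_def)
    ultimately show ?thesis by (subst DERIV_cong_ev[OF refl _ refl])
  next
    case 2
    have "eventually (\<lambda>s. s < 0) (nhds t)" using 2 eventually_nhds_in_open[of "{..<0}" t] by simp
    then have "eventually (\<lambda>s. flat_fun p s = 0) (nhds t)"
      by eventually_elim (simp add: flat_fun_def)
    then have "(flat_fun p has_field_derivative 0) (at t)" by (subst DERIV_cong_ev[OF refl _ refl]) auto
    then show ?thesis using 2 by (simp add: flat_fun_def)
  next
    case 3
    have "((\<lambda>h. flat_fun p h / h) \<longlongrightarrow> 0) (at 0)"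
    proof (rule filterlim_split_at_real)
      have "eventually (\<lambda>h. flat_fun p h / h = 0) (at_left 0)"
        by (rule eventually_at_leftI[of "-1"]) (auto simp: flat_fun_def)
      then show "((\<lambda>h. flat_fun p h / h) \<longlongrightarrow> 0) (at_left 0)" by (rule tendsto_eventually)
      \<comment> \<open>The factor \<open>[:0, 1:]\<close> absorbs the division by \<open>h\<close>
        in the difference quotient after the substitution \<open>x = 1 / h\<close>.\<close>
      have "((\<lambda>x. poly (p * [:0, 1:]) x * exp (- x)) \<longlongrightarrow> 0) at_top" by (rule poly_exp_tendsto_0)
      then have "((\<lambda>h. poly (p * [:0, 1:]) (inverse h) * exp (- inverse h)) \<longlongrightarrow> 0) (at_right 0)"
        by (rule filterlim_compose[OF _ filterlim_inverse_at_top_right])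
      moreover have "eventually (\<lambda>h. poly (p * [:0, 1:]) (inverse h) * exp (- inverse h)
        = flat_fun p h / h) (at_right 0)"
        by (rule eventually_at_rightI[of _ 1]) (auto simp: flat_fun_def field_simps)
      ultimately show "((\<lambda>h. flat_fun p h / h) \<longlongrightarrow> 0) (at_right 0)"
        by (simp cong: filterlim_cong)
    qed
    then show ?thesis using 3 by (simp add: DERIV_def flat_fun_def)
  qed
qed

text \<open>A product over the coordinates of one-dimensional bumps, each a flat function of
  \<open>1 + y $ i\<close> times one of \<open>1 - y $ i\<close>, vanishes outside a cube.\<close>

lemma bump_exists:
  obtains \<kappa> :: "real ^ ('n::finite) \<Rightarrow> real" where
    "smooth \<kappa>" "\<kappa> 0 = 1" "bounded {y. \<kappa> y \<noteq> 0}"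
proof -
  define q :: "nat \<Rightarrow> real poly" where "q n = ((\<lambda>p. (p - pderiv p) * [:0, 0, 1:]) ^^ n) 1" for n
  have der: "(flat_fun (q n) has_field_derivative flat_fun (q (Suc n)) x) (at x)" for n x
    unfolding q_def using flat_has_derivative by simp
  have sm: "smooth (\<lambda>y :: real ^ 'n. flat_fun 1 (v \<bullet> y + a))" for v a
    using smooth_affine_compose[where G = "\<lambda>n. flat_fun (q n)", OF der, of 0 v a] by (simp add: q_def)
  \<comment> \<open>At the origin both flat factors equal \<open>exp (- 1)\<close>, hence the
    normalisation by \<open>exp 2\<close>.\<close>
  define F :: "'n \<Rightarrow> real ^ 'n \<Rightarrow> real" where
    "F i y = exp 2 * (flat_fun 1 (axis i 1 \<bullet> y + 1) * flat_fun 1 ((- axis i 1) \<bullet> y + 1))" for i y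
  have F: "smooth (F i)" for i
    unfolding F_def by (intro smooth_mult smooth_const sm)
  have F0: "F i 0 = 1" for i by (simp add: F_def flat_fun_def flip: exp_add)
  have Fz: "\<bar>y $ i\<bar> \<le> 1" if "F i y \<noteq> 0" for i y
    using that by (auto simp: F_def flat_fun_def inner_commute[of _ y] inner_axis split: if_splits)
  have "norm y \<le> real CARD('n)" if "(\<Prod>i\<in>UNIV. F i y) \<noteq> 0" for y
  proof -
    have "norm y \<le> (\<Sum>i\<in>UNIV. \<bar>y $ i\<bar>)" by (rule norm_le_l1_cart)
    also have "\<dots> \<le> (\<Sum>i\<in>(UNIV::'n set). 1)" using that Fz by (intro sum_mono) auto
    finally show ?thesis by simp
  qed
  then have "bounded {y. (\<Prod>i\<in>UNIV. F i y) \<noteq> 0}" unfolding bounded_iff by blast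
  then show ?thesis using that[of "\<lambda>y. \<Prod>i\<in>UNIV. F i y"] F F0 by (auto intro: smooth_prod)
qed

lemma partial_deriv_zero_outside:
  assumes "\<And>y. y \<notin> K \<Longrightarrow> \<phi> y = 0" "closed K" "x \<notin> K"
  shows "partial_deriv i \<phi> x = 0"
proof -
  have "open (- K)" "x \<in> - K" using assms by auto
  have "(\<phi> has_derivative (\<lambda>_. 0)) (at x)"
    by (rule has_derivative_transform_within_open[OF has_derivative_const[of 0] \<open>open (- K)\<close> \<open>x \<in> - K\<close>])
      (use assms in auto)
  from partial_deriv_eq[OF this] show ?thesis .
qed

lemma test_functions_iff: "\<phi> \<in> test_functions \<longleftrightarrow> smooth \<phi> \<and> bounded {y. \<phi> y \<noteq> 0}"
  by (simp add: test_functions_def smooth_alt compact_closure)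

lemma smooth_compact_support_bounded:
  assumes s: "smooth \<phi>" and K: "compact K" "\<And>y. y \<notin> K \<Longrightarrow> \<phi> y = 0"
  obtains B where "B \<ge> 0" "\<And>y. \<bar>\<phi> y\<bar> \<le> B"
proof -
  have "bounded (\<phi> ` K)"
    by (intro compact_imp_bounded compact_continuous_image smooth_continuous_on s K)
  then obtain B where "\<And>y. y \<in> K \<Longrightarrow> \<bar>\<phi> y\<bar> \<le> B" unfolding bounded_iff by auto
  then have "\<bar>\<phi> y\<bar> \<le> max B 0" for y using K(2)[of y] by (cases "y \<in> K") force+
  then show ?thesis using that[of "max B 0"] by auto
qed

section \<open>The semigroup acts on cosines by multiplication\<close>

lemma transition_semigroupD:
  fixes P :: "real \<Rightarrow> 'a::euclidean_space \<Rightarrow> 'a measure"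
  assumes "transition_semigroup P" "t \<ge> 0"
  shows "P t \<in> measurable borel (subprob_algebra borel)" "prob_space (P t x)" "sets (P t x) = sets borel"
    "space (P t x) = UNIV"
proof -
  have m: "P t \<in> measurable borel (prob_algebra borel)" using assms by (simp add: transition_semigroup_def)
  show "P t \<in> measurable borel (subprob_algebra borel)" by (rule measurable_prob_algebraD[OF m])
  have "P t x \<in> space (prob_algebra borel)" using measurable_space[OF m, of x] by simp
  then show 1: "prob_space (P t x)" and 2: "sets (P t x) = sets borel" by (auto simp: space_prob_algebra)
  show "space (P t x) = UNIV" using sets_eq_imp_space_eq[OF 2] by simp
qed

lemma transition_semigroup_measurable:
  assumes "transition_semigroup P" "t \<ge> 0" "f \<in> borel_measurable borel"
  shows "f \<in> borel_measurable (P t x)"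
  using assms(3) measurable_cong_sets[OF transition_semigroupD(3)[OF assms(1,2)] refl] by blast

lemma integrable_prob_bounded:
  fixes f :: "'a \<Rightarrow> 'b::{banach, second_countable_topology}"
  assumes "prob_space M" "f \<in> borel_measurable M" "\<And>x. x \<in> space M \<Longrightarrow> norm (f x) \<le> B"
  shows "integrable M f"
proof -
  interpret prob_space M by fact
  show ?thesis using assms by (intro integrable_const_bound[of _ B]) auto
qed

lemma abs_integral_prob_le:
  fixes f :: "'a \<Rightarrow> real"
  assumes M: "prob_space M" and f: "f \<in> borel_measurable M" and b: "\<And>x. x \<in> space M \<Longrightarrow> \<bar>f x\<bar> \<le> B"
  shows "\<bar>\<integral>x. f x \<partial>M\<bar> \<le> B"
proof -
  interpret prob_space M by fact
  have i: "integrable M f" using integrable_prob_bounded[OF M f, of B] b by simp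
  have "AE x in M. f x \<le> B" "AE x in M. - B \<le> f x" using b by (force intro!: AE_I2)+
  then show ?thesis using integral_le_const[OF i, of B] integral_ge_const[OF i, of "- B"] by linarith
qed

lemma semigroup_integral_add:
  fixes P :: "real \<Rightarrow> 'a::euclidean_space \<Rightarrow> 'a measure" and f :: "'a \<Rightarrow> real"
  assumes P: "transition_semigroup P" and st: "s \<ge> 0" "t \<ge> 0"
    and f: "f \<in> borel_measurable borel" "\<And>x. \<bar>f x\<bar> \<le> B"
  shows "(\<integral>z. f z \<partial>P (s + t) x) = (\<integral>y. (\<integral>z. f z \<partial>P t y) \<partial>P s x)"
proof -
  have "P (s + t) x = P s x \<bind> P t" using P st by (simp add: transition_semigroup_def)
  moreover have "integral\<^sup>L (P s x \<bind> P t) f = (\<integral>y. integral\<^sup>L (P t y) f \<partial>P s x)"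
  proof (rule integral_bind[where B = B and B' = 1 and K = borel])
    show "finite_measure (P s x)"
      using transition_semigroupD(2)[OF P st(1)] by (simp add: prob_space.finite_measure)
    show "P t \<in> P s x \<rightarrow>\<^sub>M subprob_algebra borel"
      using transition_semigroupD(1)[OF P st(2)]
        measurable_cong_sets[OF transition_semigroupD(3)[OF P st(1)] refl] by blast
    show "AE y in P s x. emeasure (P t y) (space (P t y)) \<le> ennreal 1"
      using transition_semigroupD(2)[OF P st(2)] by (simp add: prob_space.emeasure_space_1)
  qed (use f in auto)
  ultimately show ?thesis by simp
qed

lemma semigroup_integral_measurable:
  fixes P :: "real \<Rightarrow> 'a::euclidean_space \<Rightarrow> 'a measure" and f :: "'a \<Rightarrow> 'b::{banach, second_countable_topology}"
  assumes P: "transition_semigroup P" and t: "t \<ge> 0" and f: "f \<in> borel_measurable borel"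
  shows "(\<lambda>y. \<integral>z. f z \<partial>P t y) \<in> borel_measurable borel"
  using transition_semigroupD(1)[OF P t] f
  by (intro measurable_compose[OF _ integral_measurable_subprob_algebra]) auto

text \<open>Dynkin's formula. The generator limit is uniform in the state, and \<open>P s\<close>
  averages over states, so the right difference quotients of \<open>u\<close> converge uniformly in
  time. This makes \<open>u\<close> and \<open>v\<close> continuous, gives the left derivatives as
  well, and the fundamental theorem of calculus finishes.\<close>

lemma semigroup_dynkin:
  fixes P :: "real \<Rightarrow> 'a::euclidean_space \<Rightarrow> 'a measure" and f g :: "'a \<Rightarrow> real"
  assumes P: "transition_semigroup P"
    and f: "f \<in> borel_measurable borel" "\<And>x. \<bar>f x\<bar> \<le> B"
    and g: "g \<in> borel_measurable borel" "\<And>x. \<bar>g x\<bar> \<le> B"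
    and gen: "uniform_limit UNIV (\<lambda>h x. ((\<integral>y. f y \<partial>P h x) - f x) / h) g (at_right 0)"
    and t: "t \<ge> 0"
  shows "((\<lambda>s. \<integral>y. g y \<partial>P s x) has_integral ((\<integral>y. f y \<partial>P t x) - f x)) {0..t}"
proof -
  define u where "u s = (\<integral>y. f y \<partial>P s x)" for s
  define v where "v s = (\<integral>y. g y \<partial>P s x)" for s
  have B: "B \<ge> 0" using f(2)[of undefined] by linarith
  \<comment> \<open>One \<open>\<delta>\<close> serves all times \<open>s\<close>: by the semigroup
    property the error at time \<open>s\<close> is the mean under \<open>P s x\<close> of the error
    at time 0.\<close>
  have diff: "\<exists>\<delta>>0. \<forall>h s. 0 < h \<longrightarrow> h < \<delta> \<longrightarrow> 0 \<le> s \<longrightarrow> \<bar>(u (s + h) - u s) / h - v s\<bar> \<le> e" if e: "e > 0" for e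
  proof -
    have "eventually (\<lambda>h. \<forall>x. dist (((\<integral>y. f y \<partial>P h x) - f x) / h) (g x) < e) (at_right 0)"
      using uniform_limitD[OF gen e] by simp
    then obtain \<delta> where \<delta>: "\<delta> > 0" "\<And>h x. 0 < h \<Longrightarrow> h < \<delta> \<Longrightarrow> \<bar>((\<integral>y. f y \<partial>P h x) - f x) / h - g x\<bar> < e"
      unfolding eventually_at_right_field dist_real_def by blast
    have "\<bar>(u (s + h) - u s) / h - v s\<bar> \<le> e" if h: "0 < h" "h < \<delta>" and s: "0 \<le> s" for h s
    proof -
      note Ps = transition_semigroupD[OF P s]
      have meas: "F \<in> borel_measurable (P s x)" if "F \<in> borel_measurable borel" for F :: "'a \<Rightarrow> real"
        by (rule transition_semigroup_measurable[OF P s that])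
      have h0: "h \<ge> 0" using h by simp
      have mf: "(\<lambda>z. \<integral>y. f y \<partial>P h z) \<in> borel_measurable borel"
        by (rule semigroup_integral_measurable[OF P h0 f(1)])
      have bf: "\<bar>\<integral>y. f y \<partial>P h z\<bar> \<le> B" for z
        by (intro abs_integral_prob_le transition_semigroupD(2)[OF P h0]
            transition_semigroup_measurable[OF P h0] f)
      have i1: "integrable (P s x) (\<lambda>z. \<integral>y. f y \<partial>P h z)"
        using bf by (intro integrable_prob_bounded[OF Ps(2) meas[OF mf], of B]) auto
      have i2: "integrable (P s x) f"
        using f by (intro integrable_prob_bounded[OF Ps(2) meas, of _ B]) auto
      have i3: "integrable (P s x) g"
        using g by (intro integrable_prob_bounded[OF Ps(2) meas, of _ B]) auto
      have "u (s + h) = (\<integral>z. (\<integral>y. f y \<partial>P h z) \<partial>P s x)"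
        unfolding u_def by (rule semigroup_integral_add[OF P s h0 f])
      then have "(u (s + h) - u s) / h - v s = (\<integral>z. ((\<integral>y. f y \<partial>P h z) - f z) / h - g z \<partial>P s x)"
        using i1 i2 i3 by (simp add: u_def v_def)
      also have "\<bar>\<dots>\<bar> \<le> e"
        using \<delta>(2)[OF h] mf f g by (intro abs_integral_prob_le[OF Ps(2) meas]) (auto intro: less_imp_le)
      finally show ?thesis .
    qed
    then show ?thesis using \<delta> by blast
  qed
  have vb: "\<bar>v s\<bar> \<le> B" if "s \<ge> 0" for s
    unfolding v_def
    by (intro abs_integral_prob_le transition_semigroupD(2)[OF P that]
        transition_semigroup_measurable[OF P that] g)
  obtain \<delta>1 where \<delta>1: "\<delta>1 > 0" "\<And>h s. 0 < h \<Longrightarrow> h < \<delta>1 \<Longrightarrow> 0 \<le> s \<Longrightarrow> \<bar>(u (s + h) - u s) / h - v s\<bar> \<le> 1"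
    using diff[of 1] by auto
  have lip: "\<bar>u (s + h) - u s\<bar> \<le> h * (B + 1)" if "0 < h" "h < \<delta>1" "0 \<le> s" for h s
  proof -
    have "\<bar>(u (s + h) - u s) / h\<bar> \<le> B + 1" using \<delta>1(2)[OF that] vb[OF that(3)] by linarith
    then show ?thesis using that by (simp add: field_simps)
  qed
  have ucont: "continuous_on {0..} u"
    unfolding continuous_on_iff
  proof (intro ballI allI impI)
    fix s e :: real assume s: "s \<in> {0..}" and e: "e > 0"
    show "\<exists>d>0. \<forall>s'\<in>{0..}. dist s' s < d \<longrightarrow> dist (u s') (u s) < e"
    proof (intro exI[of _ "min \<delta>1 (e / (B + 2))"] conjI ballI impI)
      show "min \<delta>1 (e / (B + 2)) > 0" using \<delta>1 e B by simp
      fix s' assume s': "s' \<in> {0..}" "dist s' s < min \<delta>1 (e / (B + 2))"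
      have "\<bar>u s' - u s\<bar> \<le> \<bar>s' - s\<bar> * (B + 1)"
        using lip[of "s' - s" s] lip[of "s - s'" s'] s s'
          by (cases s' s rule: linorder_cases) (auto simp: dist_real_def abs_minus_commute)
      also have "\<dots> \<le> \<bar>s' - s\<bar> * (B + 2)" by (intro mult_left_mono) auto
      also have "\<dots> < e" using s' B by (simp add: dist_real_def pos_less_divide_eq)
      finally show "dist (u s') (u s) < e" by (simp add: dist_real_def)
    qed
  qed
  \<comment> \<open>\<open>v\<close> is a uniform limit of quotients that are continuous in
    time.\<close>
  have vcont: "continuous_on {0..} v"
  proof (rule uniform_limit_theorem[of _ "\<lambda>h s. (u (s + h) - u s) / h" "at_right 0"])
    show "\<forall>\<^sub>F h in at_right 0. continuous_on {0..} (\<lambda>s. (u (s + h) - u s) / h)"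
    proof (rule eventually_at_rightI[of 0 1])
      fix h :: real assume h: "h \<in> {0<..<1}"
      have "continuous_on {0..} (\<lambda>s. u (s + h))"
        by (rule continuous_on_compose2[OF ucont]) (use h in \<open>auto intro!: continuous_intros\<close>)
      then show "continuous_on {0..} (\<lambda>s. (u (s + h) - u s) / h)"
        using h by (intro continuous_intros ucont) auto
    qed simp
    show "uniform_limit {0..} (\<lambda>h s. (u (s + h) - u s) / h) v (at_right 0)"
    proof (rule uniform_limitI)
      fix e :: real assume "e > 0"
      then obtain \<delta> where "\<delta> > 0" "\<forall>h s. 0 < h \<longrightarrow> h < \<delta> \<longrightarrow> 0 \<le> s \<longrightarrow> \<bar>(u (s + h) - u s) / h - v s\<bar> \<le> e / 2"
        using diff[of "e / 2"] by auto
      then have "\<forall>s\<in>{0..}. dist ((u (s + h) - u s) / h) (v s) < e" if "h \<in> {0<..<\<delta>}" for h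
        using that \<open>e > 0\<close> unfolding dist_real_def
          by (smt (verit) field_sum_of_halves greaterThanLessThan_iff atLeast_iff)
      then show "\<forall>\<^sub>F h in at_right 0. \<forall>s\<in>{0..}. dist ((u (s + h) - u s) / h) (v s) < e"
        by (rule eventually_at_rightI[of 0 \<delta>, OF _ \<open>\<delta> > 0\<close>])
    qed
  qed simp
  have der: "(u has_vector_derivative v s) (at s)" if s: "s > 0" for s
  proof -
    have right: "((\<lambda>h. (u (s + h) - u s) / h) \<longlongrightarrow> v s) (at_right 0)"
    proof (rule tendstoI)
      fix e :: real assume "e > 0"
      then obtain \<delta> where "\<delta> > 0" "\<forall>h s. 0 < h \<longrightarrow> h < \<delta> \<longrightarrow> 0 \<le> s \<longrightarrow> \<bar>(u (s + h) - u s) / h - v s\<bar> \<le> e / 2"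
        using diff[of "e / 2"] by auto
      then have "dist ((u (s + h) - u s) / h) (v s) < e" if "h \<in> {0<..<\<delta>}" for h
        using that s \<open>e > 0\<close> unfolding dist_real_def by (smt (verit) field_sum_of_halves greaterThanLessThan_iff)
      then show "\<forall>\<^sub>F h in at_right 0. dist ((u (s + h) - u s) / h) (v s) < e"
        by (rule eventually_at_rightI[of 0 \<delta>, OF _ \<open>\<delta> > 0\<close>])
    qed
    \<comment> \<open>The left quotient at \<open>s\<close> is the right quotient at
      \<open>s - h\<close>; it is near \<open>v (s - h)\<close> uniformly, and \<open>v\<close> is
      continuous.\<close>
    have "((\<lambda>h. (u (s - h) - u s) / (- h)) \<longlongrightarrow> v s) (at_right 0)"
    proof (rule tendstoI)
      fix e :: real assume e: "e > 0"
      then obtain \<delta> where \<delta>: "\<delta> > 0" "\<forall>h s. 0 < h \<longrightarrow> h < \<delta> \<longrightarrow> 0 \<le> s \<longrightarrow> \<bar>(u (s + h) - u s) / h - v s\<bar> \<le> e / 2"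
        using diff[of "e / 2"] by auto
      obtain d where d: "d > 0" "\<And>s'. s' \<ge> 0 \<Longrightarrow> dist s' s < d \<Longrightarrow> dist (v s') (v s) < e / 2"
        using vcont s e unfolding continuous_on_iff by (metis atLeast_iff half_gt_zero less_imp_le)
      show "\<forall>\<^sub>F h in at_right 0. dist ((u (s - h) - u s) / (- h)) (v s) < e"
      proof (rule eventually_at_rightI[of 0 "min s (min \<delta> d)"])
        show "0 < min s (min \<delta> d)" using s \<delta> d by simp
        fix h assume h: "h \<in> {0<..<min s (min \<delta> d)}"
        have 1: "\<bar>(u (s - h + h) - u (s - h)) / h - v (s - h)\<bar> \<le> e / 2"
          using \<delta>(2)[rule_format, of h "s - h"] h by auto
        have 2: "\<bar>v (s - h) - v s\<bar> < e / 2" using d(2)[of "s - h"] h by (auto simp: dist_real_def)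
        have "(u (s - h) - u s) / (- h) = (u (s - h + h) - u (s - h)) / h" using h by (simp add: field_simps)
        show "dist ((u (s - h) - u s) / (- h)) (v s) < e"
          unfolding dist_real_def \<open>(u (s - h) - u s) / (- h) = _\<close> using 1 2 by linarith
      qed
    qed
    then have left: "((\<lambda>h. (u (s + h) - u s) / h) \<longlongrightarrow> v s) (at_left 0)"
      by (subst filterlim_at_left_to_right) simp
    have "((\<lambda>h. (u (s + h) - u s) / h) \<longlongrightarrow> v s) (at 0)"
      by (rule filterlim_split_at_real[OF left right])
    then have "(u has_field_derivative v s) (at s)" by (simp add: DERIV_def)
    then show ?thesis by (simp add: has_real_derivative_iff_has_vector_derivative)
  qed
  have "(v has_integral (u t - u 0)) {0..t}"
    by (rule fundamental_theorem_of_calculus_interior[OF t])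
      (use der continuous_on_subset[OF ucont] in auto)
  moreover have "u 0 = f x"
    using P f(1) by (simp add: u_def transition_semigroup_def integral_return)
  moreover have "v = (\<lambda>s. \<integral>y. g y \<partial>P s x)" by (auto simp: v_def)
  ultimately show ?thesis by (simp add: u_def)
qed

lemma smooth_cos: "smooth (\<lambda>y :: real ^ 'n::finite. cos (v \<bullet> y + a))"
  and smooth_minus_sin: "smooth (\<lambda>y :: real ^ 'n::finite. - sin (v \<bullet> y + a))"
proof -
  \<comment> \<open>Differentiating a cosine advances its phase by a quarter period, so the whole
    tower has one formula and contains \<open>- sin\<close> as its second member.\<close>
  define G where "G n x = cos (x + real n * (pi / 2))" for n x
  have "(G n has_field_derivative G (Suc n) x) (at x)" for n x
  proof -
    have "G (Suc n) x = - sin (x + real n * (pi / 2))"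
    proof -
      have "x + real (Suc n) * (pi / 2) = (x + real n * (pi / 2)) + pi / 2" by (simp add: algebra_simps)
      then show ?thesis unfolding G_def by (simp only: cos_add) simp
    qed
    then show ?thesis unfolding G_def by (auto intro!: derivative_eq_intros)
  qed
  note * = smooth_affine_compose[where G = G, OF this]
  show "smooth (\<lambda>y :: real ^ 'n::finite. cos (v \<bullet> y + a))" using *[of 0 v a] by (simp add: G_def)
  show "smooth (\<lambda>y :: real ^ 'n::finite. - sin (v \<bullet> y + a))" using *[of 1 v a] by (simp add: G_def cos_add)
qed

lemma partial_deriv_cos: "partial_deriv i (\<lambda>y. cos (v \<bullet> y + a)) = (\<lambda>y. v $ i * (- sin (v \<bullet> y + a)))"
  by (rule ext) (rule partial_deriv_affine_compose, auto intro!: derivative_eq_intros)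

lemma partial_deriv_minus_sin:
  "partial_deriv i (\<lambda>y. - sin (v \<bullet> y + a)) = (\<lambda>y. v $ i * (- cos (v \<bullet> y + a)))"
  by (rule ext) (rule partial_deriv_affine_compose[where g = "\<lambda>t. - sin t"], auto intro!: derivative_eq_intros)

text \<open>Cosines lack compact support, so they are multiplied by the slowly varying cutoffs
  \<open>\<kappa> (r k *\<^sub>R y)\<close>. Each derivative that falls on the cutoff brings a
  factor \<open>r k \<le> 1\<close>: the images under the operator stay bounded uniformly in
  \<open>k\<close> and \<open>y\<close>, and in the limit only the derivatives of the cosine
  remain.\<close>

lemma cosine_cutoff:
  fixes v m :: "real ^ 'n::finite" and A :: "'n \<Rightarrow> 'n \<Rightarrow> real" and a :: real
  obtains \<phi> B where "\<And>k::nat. \<phi> k \<in> test_functions" "\<And>k y. \<bar>\<phi> k y\<bar> \<le> B"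
    "\<And>k y. \<bar>const_coeff_op m A (\<phi> k) y\<bar> \<le> B" "\<And>k. const_coeff_op m A (\<phi> k) \<in> borel_measurable borel"
    "\<And>k. \<phi> k \<in> borel_measurable borel"
    "\<And>y. (\<lambda>k. \<phi> k y) \<longlonglongrightarrow> cos (v \<bullet> y + a)"
    "\<And>y. (\<lambda>k. const_coeff_op m A (\<phi> k) y) \<longlonglongrightarrow> (m \<bullet> v) * (- sin (v \<bullet> y + a))
       + (\<Sum>i\<in>UNIV. \<Sum>j\<in>UNIV. A i j * (v $ i * v $ j)) * (- cos (v \<bullet> y + a))"
proof -
  obtain \<kappa> :: "real ^ 'n \<Rightarrow> real" where \<kappa>: "smooth \<kappa>" "\<kappa> 0 = 1" "bounded {y. \<kappa> y \<noteq> 0}"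
    using bump_exists by blast
  define K where "K = closure {y. \<kappa> y \<noteq> 0}"
  have K: "compact K" "closed K" using \<kappa>(3) by (simp_all add: K_def compact_closure)
  have K0: "\<kappa> y = 0" if "y \<notin> K" for y using that closure_subset[of "{y. \<kappa> y \<noteq> 0}"] by (auto simp: K_def)
  have K1: "partial_deriv i \<kappa> y = 0" if "y \<notin> K" for i y
    by (rule partial_deriv_zero_outside[OF _ K(2) that]) (rule K0)
  have K2: "partial_deriv i (partial_deriv j \<kappa>) y = 0" if "y \<notin> K" for i j y
    by (rule partial_deriv_zero_outside[OF _ K(2) that]) (rule K1)
  note s1 = smooth_partial_deriv[OF \<kappa>(1)]
  note s2 = smooth_partial_deriv[OF s1]
  obtain b0 where b0: "b0 \<ge> 0" "\<And>y. \<bar>\<kappa> y\<bar> \<le> b0"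
    using smooth_compact_support_bounded[OF \<kappa>(1) K(1) K0] by blast
  have "\<forall>i. \<exists>b\<ge>0. \<forall>y. \<bar>partial_deriv i \<kappa> y\<bar> \<le> b"
    using smooth_compact_support_bounded[OF s1 K(1) K1] by metis
  then obtain b1 where b1: "\<And>i. b1 i \<ge> 0" "\<And>i y. \<bar>partial_deriv i \<kappa> y\<bar> \<le> b1 i" by metis
  have "\<forall>i j. \<exists>b\<ge>0. \<forall>y. \<bar>partial_deriv i (partial_deriv j \<kappa>) y\<bar> \<le> b"
    using smooth_compact_support_bounded[OF s2 K(1) K2] by metis
  then obtain b2 where b2: "\<And>i j. b2 i j \<ge> 0" "\<And>i j y. \<bar>partial_deriv i (partial_deriv j \<kappa>) y\<bar> \<le> b2 i j" by metis
  define C where "C y = cos (v \<bullet> y + a)" for y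
  define S where "S y = - sin (v \<bullet> y + a)" for y
  have CS: "smooth C" "smooth S" unfolding C_def S_def by (rule smooth_cos smooth_minus_sin)+
  have Cb: "\<bar>C y\<bar> \<le> 1" "\<bar>S y\<bar> \<le> 1" for y by (simp_all add: C_def S_def)
  have dC: "partial_deriv i C = (\<lambda>y. v $ i * S y)" for i unfolding C_def S_def by (rule partial_deriv_cos)
  have dS: "partial_deriv i S = (\<lambda>y. v $ i * (- C y))" for i unfolding C_def S_def by (rule partial_deriv_minus_sin)
  define r where "r k = 1 / real (Suc k)" for k
  have r: "r k > 0" "r k \<le> 1" for k by (simp_all add: r_def)
  have r0: "r \<longlonglongrightarrow> 0" unfolding r_def by (rule LIMSEQ_Suc[OF lim_1_over_n])
  define \<phi> where "\<phi> k y = \<kappa> (r k *\<^sub>R y) * C y" for k y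
  note diffs = smooth_differentiable[OF \<kappa>(1)] smooth_differentiable[OF s1] smooth_differentiable[OF CS(1)]
    smooth_differentiable[OF CS(2)] smooth_differentiable[OF smooth_scale[OF \<kappa>(1)]]
    smooth_differentiable[OF smooth_scale[OF s1]]
  have d1: "partial_deriv j (\<phi> k)
    = (\<lambda>y. r k * (partial_deriv j \<kappa> (r k *\<^sub>R y) * C y) + v $ j * (\<kappa> (r k *\<^sub>R y) * S y))" for j k
    unfolding \<phi>_def by (rule ext) (simp add: partial_deriv_mult diffs partial_deriv_scale dC)
  have d2: "partial_deriv i (partial_deriv j (\<phi> k)) = (\<lambda>y.
      r k * (r k * (partial_deriv i (partial_deriv j \<kappa>) (r k *\<^sub>R y) * C y) + partial_deriv j \<kappa> (r k *\<^sub>R y) * (v $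
        i * S y))
      + v $ j * (r k * (partial_deriv i \<kappa> (r k *\<^sub>R y) * S y) + \<kappa> (r k *\<^sub>R y) * (v $ i * (- C y))))" for i j k
    unfolding d1
    by (rule ext) (simp add: partial_deriv_mult partial_deriv_add partial_deriv_cmult diffs partial_deriv_scale dC dS
        differentiable_add differentiable_mult partial_deriv_const algebra_simps)
  have sm: "smooth (\<phi> k)" for k unfolding \<phi>_def by (intro smooth_mult smooth_scale \<kappa> CS)
  have test: "\<phi> k \<in> test_functions" for k
  proof -
    obtain b where b: "\<And>y. \<kappa> y \<noteq> 0 \<Longrightarrow> norm y \<le> b" using \<kappa>(3) unfolding bounded_iff by auto
    have "norm y \<le> b / r k" if "\<phi> k y \<noteq> 0" for y
      using b[of "r k *\<^sub>R y"] that r(1)[of k] by (simp add: \<phi>_def pos_le_divide_eq mult.commute)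
    then have "bounded {y. \<phi> k y \<noteq> 0}" unfolding bounded_iff by blast
    then show ?thesis using sm by (simp add: test_functions_iff)
  qed
  \<comment> \<open>The bound copies the shape of the second derivative term by term, trivial
    factors 1 included, so that it follows by monotonicity alone.\<close>
  define B2
    where "B2 i j = 1 * (1 * (b2 i j * 1) + b1 j * (\<bar>v $ i\<bar> * 1)) + \<bar>v $ j\<bar>
    * (1 * (b1 i * 1) + b0 * (\<bar>v $ i\<bar> * 1))" for i j
  define B
    where "B = b0 + (\<Sum>i\<in>UNIV. \<bar>m $ i\<bar> * (1 * (b1 i * 1) + \<bar>v $ i\<bar> * (b0 * 1))) + (\<Sum>i\<in>UNIV. \<Sum>j\<in>UNIV. \<bar>A i j\<bar> * B2 i j)"
  have mb: "\<bar>x * y\<bar> \<le> c * d" if "\<bar>x\<bar> \<le> c" "\<bar>y\<bar> \<le> d" for x y c d :: real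
    unfolding abs_mult using that by (intro mult_mono) auto
  have ab: "\<bar>x + y\<bar> \<le> c + d" if "\<bar>x\<bar> \<le> c" "\<bar>y\<bar> \<le> d" for x y c d :: real
    using that by linarith
  have rb: "\<bar>r k\<bar> \<le> 1" "\<bar>- C y\<bar> \<le> 1" for k y using r[of k] Cb by auto
  have p1: "\<bar>partial_deriv j (\<phi> k) y\<bar> \<le> 1 * (b1 j * 1) + \<bar>v $ j\<bar> * (b0 * 1)" for j k y
    unfolding d1 by (intro ab mb b0 b1 Cb rb order.refl)
  have p2: "\<bar>partial_deriv i (partial_deriv j (\<phi> k)) y\<bar> \<le> B2 i j" for i j k y
    unfolding d2 B2_def by (intro ab mb b0 b1 b2 Cb rb order.refl)
  have B2: "B2 i j \<ge> 0" for i j using b0 b1 b2 by (auto simp: B2_def)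
  have bd1: "\<bar>\<phi> k y\<bar> \<le> B" for k y
  proof -
    have "\<bar>\<phi> k y\<bar> \<le> b0 * 1" unfolding \<phi>_def abs_mult using b0 Cb by (intro mult_mono) auto
    moreover have "0 \<le> (\<Sum>i\<in>UNIV. \<bar>m $ i\<bar> * (1 * (b1 i * 1) + \<bar>v $ i\<bar> * (b0 * 1)))"
      using b0 b1 by (intro sum_nonneg) auto
    moreover have "0 \<le> (\<Sum>i\<in>UNIV. \<Sum>j\<in>UNIV. \<bar>A i j\<bar> * B2 i j)" using B2 by (intro sum_nonneg) auto
    ultimately show ?thesis by (simp add: B_def)
  qed
  have bd2: "\<bar>const_coeff_op m A (\<phi> k) y\<bar> \<le> B" for k y
  proof -
    have "\<bar>\<Sum>i\<in>UNIV. m $ i * partial_deriv i (\<phi> k) y\<bar> \<le> (\<Sum>i\<in>UNIV. \<bar>m $ i\<bar> * (1 * (b1 i * 1) + \<bar>v $ i\<bar> * (b0 * 1)))"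
      by (rule order.trans[OF sum_abs], rule sum_mono, unfold abs_mult, rule mult_left_mono[OF p1]) simp
    moreover have "\<bar>\<Sum>i\<in>UNIV. \<Sum>j\<in>UNIV. A i j * partial_deriv i (partial_deriv j (\<phi> k)) y\<bar>
      \<le> (\<Sum>i\<in>UNIV. \<Sum>j\<in>UNIV. \<bar>A i j\<bar> * B2 i j)"
      by (rule order.trans[OF sum_abs], rule sum_mono, rule order.trans[OF sum_abs], rule sum_mono, unfold
        abs_mult, rule mult_left_mono[OF p2]) simp
    ultimately show ?thesis using b0(1) unfolding const_coeff_op_def B_def by linarith
  qed
  have meas: "const_coeff_op m A (\<phi> k) \<in> borel_measurable borel" "\<phi> k \<in> borel_measurable borel" for k
  proof -
    have "\<psi> \<in> borel_measurable borel" if "smooth \<psi>" for \<psi> :: "real ^ 'n \<Rightarrow> real"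
      using that by (intro borel_measurable_continuous_onI smooth_continuous_on)
    note [measurable] = this[OF sm] this[OF smooth_partial_deriv[OF sm]]
      this[OF smooth_partial_deriv[OF smooth_partial_deriv[OF sm]]]
    show "const_coeff_op m A (\<phi> k) \<in> borel_measurable borel" "\<phi> k \<in> borel_measurable borel"
      unfolding const_coeff_op_def[abs_def] by measurable
  qed
  have lim: "(\<lambda>k. \<psi> (r k *\<^sub>R y)) \<longlonglongrightarrow> \<psi> 0" if "smooth \<psi>" for \<psi> :: "real ^ 'n \<Rightarrow> real" and y
  proof (rule isCont_tendsto_compose[of 0])
    show "isCont \<psi> 0" using smooth_continuous_on[OF that, of UNIV] by (simp add: continuous_on_eq_continuous_at)
    show "(\<lambda>k. r k *\<^sub>R y) \<longlonglongrightarrow> 0" using tendsto_scaleR[OF r0 tendsto_const[of y]] by simp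
  qed
  note lims = lim[OF \<kappa>(1)] lim[OF s1] lim[OF s2]
  have l1: "(\<lambda>k. partial_deriv j (\<phi> k) y) \<longlonglongrightarrow> v $ j * S y" for j y
  proof -
    have "(\<lambda>k. partial_deriv j (\<phi> k) y) \<longlonglongrightarrow> 0 * (partial_deriv j \<kappa> 0 * C y) + v $ j * (\<kappa> 0 * S y)"
      unfolding d1 by (intro tendsto_intros r0 lims)
    then show ?thesis by (simp add: \<kappa>)
  qed
  have l2: "(\<lambda>k. partial_deriv i (partial_deriv j (\<phi> k)) y) \<longlonglongrightarrow> v $ i * v $ j * (- C y)" for i j y
  proof -
    have "(\<lambda>k. partial_deriv i (partial_deriv j (\<phi> k)) y) \<longlonglongrightarrow>
      0 * (0 * (partial_deriv i (partial_deriv j \<kappa>) 0 * C y) + partial_deriv j \<kappa> 0 * (v $ i * S y))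
      + v $ j * (0 * (partial_deriv i \<kappa> 0 * S y) + \<kappa> 0 * (v $ i * (- C y)))"
      unfolding d2 by (intro tendsto_intros r0 lims)
    then show ?thesis by (simp add: \<kappa> mult_ac)
  qed
  have l3: "(\<lambda>k. const_coeff_op m A (\<phi> k) y) \<longlonglongrightarrow> (m \<bullet> v) * (- sin (v \<bullet> y + a))
       + (\<Sum>i\<in>UNIV. \<Sum>j\<in>UNIV. A i j * (v $ i * v $ j)) * (- cos (v \<bullet> y + a))" for y
  proof -
    have "(\<lambda>k. const_coeff_op m A (\<phi> k) y) \<longlonglongrightarrow> (\<Sum>i\<in>UNIV. m $ i * (v $ i * S y))
      + (\<Sum>i\<in>UNIV. \<Sum>j\<in>UNIV. A i j * (v $ i * v $ j * (- C y)))"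
      unfolding const_coeff_op_def by (intro tendsto_intros l1 l2)
    moreover have "(\<Sum>i\<in>UNIV. m $ i * (v $ i * S y)) = (m \<bullet> v) * S y"
      by (simp add: inner_vec_def sum_distrib_right mult.assoc)
    moreover have "(\<Sum>i\<in>UNIV. \<Sum>j\<in>UNIV. A i j * (v $ i * v $ j * (- C y)))
      = (\<Sum>i\<in>UNIV. \<Sum>j\<in>UNIV. A i j * (v $ i * v $ j)) * (- C y)"
      by (simp only: sum_distrib_right mult.assoc)
    ultimately show ?thesis unfolding C_def S_def by metis
  qed
  have l0: "(\<lambda>k. \<phi> k y) \<longlonglongrightarrow> cos (v \<bullet> y + a)" for y
  proof -
    have "(\<lambda>k. \<phi> k y) \<longlonglongrightarrow> \<kappa> 0 * C y" unfolding \<phi>_def by (intro tendsto_intros lims)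
    then show ?thesis by (simp add: \<kappa> C_def)
  qed
  show ?thesis by (rule that[OF test bd1 bd2 meas l0 l3])
qed

text \<open>Dynkin's formula for the cutoffs passes to the limit by dominated convergence twice,
  once under each \<open>P s x\<close> and once in the time integral. The phase \<open>a\<close>
  lets one equation serve for cosines and sines.\<close>

lemma semigroup_cosine_equation:
  fixes P :: "real \<Rightarrow> real ^ 'n::finite \<Rightarrow> (real ^ 'n) measure"
  assumes P: "transition_semigroup P" and gen: "has_generator_on P (const_coeff_op m A) test_functions"
    and t: "t \<ge> 0"
  shows "((\<lambda>s. (m \<bullet> v) * (- (\<integral>y. sin (v \<bullet> y + a) \<partial>P s x))
       + (\<Sum>i\<in>UNIV. \<Sum>j\<in>UNIV. A i j * (v $ i * v $ j)) * (- (\<integral>y. cos (v \<bullet> y + a) \<partial>P s x)))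
     has_integral ((\<integral>y. cos (v \<bullet> y + a) \<partial>P t x) - cos (v \<bullet> x + a))) {0..t}"
proof -
  obtain \<phi> B where \<phi>: "\<And>k::nat. \<phi> k \<in> test_functions" "\<And>k y. \<bar>\<phi> k y\<bar> \<le> B"
    "\<And>k y. \<bar>const_coeff_op m A (\<phi> k) y\<bar> \<le> B" "\<And>k. const_coeff_op m A (\<phi> k) \<in> borel_measurable borel"
    "\<And>k. \<phi> k \<in> borel_measurable borel"
    "\<And>y. (\<lambda>k. \<phi> k y) \<longlonglongrightarrow> cos (v \<bullet> y + a)"
    "\<And>y. (\<lambda>k. const_coeff_op m A (\<phi> k) y) \<longlonglongrightarrow> (m \<bullet> v) * (- sin (v \<bullet> y + a))
       + (\<Sum>i\<in>UNIV. \<Sum>j\<in>UNIV. A i j * (v $ i * v $ j)) * (- cos (v \<bullet> y + a))"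
    using cosine_cutoff[of m A v a] by blast
  let ?q = "(\<Sum>i\<in>UNIV. \<Sum>j\<in>UNIV. A i j * (v $ i * v $ j))"
  have int: "((\<lambda>s. \<integral>y. const_coeff_op m A (\<phi> k) y \<partial>P s x) has_integral ((\<integral>y. \<phi> k y \<partial>P t x) - \<phi> k x)) {0..t}" for k
    by (rule semigroup_dynkin[OF P \<phi>(5,2,4,3) _ t]) (use gen \<phi>(1) in \<open>simp add: has_generator_on_def\<close>)
  have conv: "(\<lambda>k. \<integral>y. F k y \<partial>P s x) \<longlonglongrightarrow> (\<integral>y. G y \<partial>P s x)"
    if s: "s \<ge> 0"
      and F: "\<And>k. F k \<in> borel_measurable borel" "G \<in> borel_measurable borel" "\<And>k y. \<bar>F k y\<bar> \<le> B" "\<And>y. (\<lambda>k. F k y)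
      \<longlonglongrightarrow> G y" for F :: "nat \<Rightarrow> real ^ 'n \<Rightarrow> real" and G s
  proof (rule integral_dominated_convergence[where w = "\<lambda>_. B"])
    interpret prob_space "P s x" by (rule transition_semigroupD(2)[OF P s])
    show "integrable (P s x) (\<lambda>_. B)" by simp
  qed (use F in \<open>auto intro: transition_semigroup_measurable[OF P s]\<close>)
  have lim1: "(\<lambda>k. (\<integral>y. \<phi> k y \<partial>P t x) - \<phi> k x) \<longlonglongrightarrow> (\<integral>y. cos (v \<bullet> y + a) \<partial>P t x) - cos (v \<bullet> x + a)"
    by (intro tendsto_diff conv[OF t] \<phi>) simp
  have lim2: "(\<lambda>k. \<integral>y. const_coeff_op m A (\<phi> k) y \<partial>P s x) \<longlonglongrightarrow>
      (m \<bullet> v) * (- (\<integral>y. sin (v \<bullet> y + a) \<partial>P s x)) + ?q * (- (\<integral>y. cos (v \<bullet> y + a) \<partial>P s x))" if s: "s \<in> {0..t}" for s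
  proof -
    have s0: "s \<ge> 0" using s by simp
    note m = transition_semigroup_measurable[OF P s0]
    note i = integrable_prob_bounded[OF transition_semigroupD(2)[OF P s0] m, where B = 1]
    have "integrable (P s x) (\<lambda>y. sin (v \<bullet> y + a))" "integrable (P s x) (\<lambda>y. cos (v \<bullet> y + a))"
      by (auto intro!: i)
    then have "(m \<bullet> v) * (- (\<integral>y. sin (v \<bullet> y + a) \<partial>P s x)) + ?q * (- (\<integral>y. cos (v \<bullet> y + a) \<partial>P s x))
      = (\<integral>y. (m \<bullet> v) * (- sin (v \<bullet> y + a)) + ?q * (- cos (v \<bullet> y + a)) \<partial>P s x)"
      by simp
    then show ?thesis using conv[OF s0 \<phi>(4) _ \<phi>(3,7)] by simp
  qed
  have b: "norm (\<integral>y. const_coeff_op m A (\<phi> k) y \<partial>P s x) \<le> B" if s: "s \<in> {0..t}" for k s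
    using s \<phi>(3)
      by (auto intro!: abs_integral_prob_le transition_semigroupD(2)[OF P] transition_semigroup_measurable[OF P] \<phi>(4))
  have ii: "(\<lambda>s. B) integrable_on {0..t}" by (rule integrable_const_ivl)
  note dc = dominated_convergence[of "\<lambda>k s. \<integral>y. const_coeff_op m A (\<phi> k) y \<partial>P s x" "{0..t}"
    "\<lambda>s. B", OF has_integral_integrable[OF int] ii b lim2]
  have "integral {0..t} (\<lambda>s. \<integral>y. const_coeff_op m A (\<phi> k) y \<partial>P s x) = (\<integral>y. \<phi> k y \<partial>P t x) - \<phi> k x" for k
    using int by (rule integral_unique)
  then have "integral {0..t} (\<lambda>s. (m \<bullet> v) * (- (\<integral>y. sin (v \<bullet> y + a) \<partial>P s x)) + ?q * (- (\<integral>y. cos (v \<bullet> y + a) \<partial>P s x)))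
     = (\<integral>y. cos (v \<bullet> y + a) \<partial>P t x) - cos (v \<bullet> x + a)"
    using LIMSEQ_unique[OF dc(2)] lim1 by simp
  then show ?thesis using integrable_integral[OF dc(1)] by simp
qed

text \<open>The cosine and sine equations combine to the complex linear equation
  \<open>E' = \<psi> * E\<close> with initial value \<open>cis (v \<bullet> x)\<close>.\<close>

lemma semigroup_char:
  fixes P :: "real \<Rightarrow> real ^ 'n::finite \<Rightarrow> (real ^ 'n) measure"
  assumes P: "transition_semigroup P" and gen: "has_generator_on P (const_coeff_op m A) test_functions"
    and t: "t \<ge> 0"
  shows "(\<integral>y. cis (v \<bullet> y) \<partial>P t x)
    = exp (of_real t * Complex (- (\<Sum>i\<in>UNIV. \<Sum>j\<in>UNIV. A i j * (v $ i * v $ j))) (m \<bullet> v)) * cis (v \<bullet> x)"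
proof -
  define p where "p = m \<bullet> v"
  define q where "q = (\<Sum>i\<in>UNIV. \<Sum>j\<in>UNIV. A i j * (v $ i * v $ j))"
  define \<psi> where "\<psi> = Complex (- q) p"
  define U where "U s = (\<integral>y. cos (v \<bullet> y) \<partial>P s x)" for s
  define V where "V s = (\<integral>y. sin (v \<bullet> y) \<partial>P s x)" for s
  define E where "E s = Complex (U s) (V s)" for s
  have E: "(\<integral>y. cis (v \<bullet> y) \<partial>P s x) = E s" if s: "s \<ge> 0" for s
  proof -
    have "integrable (P s x) (\<lambda>y. cis (v \<bullet> y))"
    proof (rule integrable_prob_bounded[OF transition_semigroupD(2)[OF P s], of _ _ 1])
      show "(\<lambda>y. cis (v \<bullet> y)) \<in> borel_measurable (P s x)"
        unfolding cis_conv_exp by (rule transition_semigroup_measurable[OF P s]) simp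
    qed simp
    from integral_Re[OF this] integral_Im[OF this] show ?thesis
      by (simp add: complex_eq_iff E_def U_def V_def)
  qed
  have U: "((\<lambda>s. - p * V s - q * U s) has_integral (U u - cos (v \<bullet> x))) {0..u}" if "u \<ge> 0" for u
    using semigroup_cosine_equation[OF P gen that, where v = v and a = 0 and x = x]
      by (simp add: U_def V_def p_def q_def)
  have V: "((\<lambda>s. p * U s - q * V s) has_integral (V u - sin (v \<bullet> x))) {0..u}" if "u \<ge> 0" for u
  proof -
    \<comment> \<open>The phase \<open>- pi / 2\<close> turns the cosine equation into the one for
      the sine.\<close>
    have "sin (w - pi / 2) = - cos w" "cos (w - pi / 2) = sin w" for w :: real
      by (simp_all add: sin_diff cos_diff)
    then show ?thesis
      using semigroup_cosine_equation[OF P gen that, where v = v and a = "- (pi / 2)"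
        and x = x] by (simp add: U_def V_def p_def q_def)
  qed
  have EI: "((\<lambda>s. \<psi> * E s) has_integral (E u - cis (v \<bullet> x))) {0..u}" if "u \<ge> 0" for u
  proof -
    have "((\<lambda>s. of_real (- p * V s - q * U s) + \<i> * of_real (p * U s - q * V s)) has_integral
      (of_real (U u - cos (v \<bullet> x)) + \<i> * of_real (V u - sin (v \<bullet> x)))) {0..u}"
      using has_integral_linear[OF U[OF that] bounded_linear_of_real]
        has_integral_linear[OF V[OF that] bounded_linear_of_real]
      by (intro has_integral_add has_integral_mult_right) (simp_all add: o_def)
    moreover have "of_real (- p * V s - q * U s) + \<i> * of_real (p * U s - q * V s) = \<psi> * E s" for s
      by (simp add: complex_eq_iff \<psi>_def E_def)
    moreover have "of_real (U u - cos (v \<bullet> x)) + \<i> * of_real (V u - sin (v \<bullet> x)) = E u - cis (v \<bullet> x)"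
      by (simp add: complex_eq_iff E_def)
    ultimately show ?thesis by simp
  qed
  have Eeq: "E u = cis (v \<bullet> x) + integral {0..u} (\<lambda>s. \<psi> * E s)" if "u \<ge> 0" for u
    using integral_unique[OF EI[OF that]] by simp
  \<comment> \<open>The integral equation bootstraps: \<open>E\<close> is an indefinite integral,
    hence continuous, hence the integrand is continuous and \<open>E\<close> is
    differentiable.\<close>
  have cont: "continuous_on {0..t} E"
  proof -
    have "continuous_on {0..t} (\<lambda>u. cis (v \<bullet> x) + integral {0..u} (\<lambda>s. \<psi> * E s))"
      by (intro continuous_intros indefinite_integral_continuous_1 has_integral_integrable[OF EI[OF t]])
    then show ?thesis by (rule continuous_on_eq) (use Eeq in auto)
  qed
  have der: "(E has_vector_derivative \<psi> * E s) (at s within {0..t})" if s: "s \<in> {0..t}" for s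
  proof -
    have "((\<lambda>u. cis (v \<bullet> x) + integral {0..u} (\<lambda>s. \<psi> * E s)) has_vector_derivative 0 + \<psi> * E s) (at s within {0..t})"
      using cont s
        by (intro has_vector_derivative_add has_vector_derivative_const integral_has_vector_derivative
        continuous_intros)
    then have *: "((\<lambda>u. cis (v \<bullet> x) + integral {0..u} (\<lambda>s. \<psi> * E s)) has_vector_derivative \<psi>
      * E s) (at s within {0..t})"
      by simp
    show ?thesis by (rule has_vector_derivative_transform[OF s _ *]) (use Eeq in auto)
  qed
  \<comment> \<open>With the integrating factor the solution becomes constant.\<close>
  have "((\<lambda>s. exp (- (of_real s * \<psi>)) * E s) has_vector_derivative 0) (at s within {0..t})" if s: "s \<in> {0..t}" for s
  proof -
    have "((\<lambda>s. exp (- (of_real s * \<psi>))) has_vector_derivative (- \<psi> * exp (- (of_real s * \<psi>)))) (at s within {0..t})"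
    proof -
      have "((\<lambda>z. exp (- (z * \<psi>))) has_field_derivative (- \<psi> * exp (- (of_real s * \<psi>)))) (at (of_real s))"
        by (auto intro!: derivative_eq_intros)
      from has_vector_derivative_real_field[OF this] show ?thesis by (simp add: has_vector_derivative_at_within)
    qed
    from has_vector_derivative_mult[OF this der[OF s]] show ?thesis by (simp add: algebra_simps)
  qed
  then obtain c where c: "\<And>s. s \<in> {0..t} \<Longrightarrow> exp (- (of_real s * \<psi>)) * E s = c"
    by (rule has_vector_derivative_zero_constant[of "{0..t}", rotated]) auto
  have "exp (- (of_real t * \<psi>)) * E t = cis (v \<bullet> x)"
    using c[of t] c[of 0] t Eeq[of 0] by simp
  then have "E t = exp (of_real t * \<psi>) * cis (v \<bullet> x)"
    by (metis exp_minus_inverse mult.assoc mult.left_commute mult_1)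
  then show ?thesis using E[OF t] by (simp add: \<psi>_def p_def q_def)
qed

text \<open>The Levy exponent of a Brownian motion with drift \<open>m\<close> and covariance
  \<open>2 * A\<close>; the doubling reflects that the operator carries \<open>A\<close> without a
  factor 1/2.\<close>

definition char_exponent :: "real ^ 'n::finite \<Rightarrow> ('n \<Rightarrow> 'n \<Rightarrow> real) \<Rightarrow> real ^ 'n \<Rightarrow> complex" where
  "char_exponent m A v = Complex (- (\<Sum>i\<in>UNIV. \<Sum>j\<in>UNIV. A i j * (v $ i * v $ j))) (m \<bullet> v)"

section \<open>The Markov property as an identity of expectations\<close>

context
  fixes M :: "'w measure" and X :: "real \<Rightarrow> 'w \<Rightarrow> 'a::euclidean_space" and P
  assumes markov: "markov_process M X P"
begin

lemma markov_prob_space: "prob_space M" and markov_semigroup: "transition_semigroup P"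
  and markov_measurable: "t \<ge> 0 \<Longrightarrow> X t \<in> borel_measurable M"
  using markov by (auto simp: markov_process_def)

lemma subalgebra_natural_filtration: "subalgebra M (natural_filtration M X s)"
proof -
  have *: "{X u -` A \<inter> space M | u A. 0 \<le> u \<and> u \<le> s \<and> A \<in> sets borel} \<subseteq> sets M"
    using markov_measurable by (auto intro: measurable_sets)
  have "sigma_sets (space M) {X u -` A \<inter> space M | u A. 0 \<le> u \<and> u \<le> s \<and> A \<in> sets borel} \<subseteq> sets M"
    by (rule sets.sigma_sets_subset[OF *])
  then show ?thesis
    unfolding subalgebra_def natural_filtration_def
    by (subst sets_measure_of) (use * sets.space_closed in \<open>auto simp: space_measure_of_conv\<close>)
qed

lemma measurable_natural_filtration:
  assumes "0 \<le> u" "u \<le> s" shows "X u \<in> borel_measurable (natural_filtration M X s)"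
proof (rule measurableI)
  fix A :: "'a set" assume A: "A \<in> sets borel"
  have "{X u -` A \<inter> space M | u A. 0 \<le> u \<and> u \<le> s \<and> A \<in> sets borel} \<subseteq> Pow (space M)" by auto
  then show "X u -` A \<inter> space (natural_filtration M X s) \<in> sets (natural_filtration M X s)"
    unfolding natural_filtration_def using A assms
    by (subst sets_measure_of) (auto simp: space_measure_of_conv intro!: sigma_sets.Basic)
qed simp

text \<open>The Markov property is given for indicators as a conditional probability; monotone
  approximation by simple functions extends it to bounded functions, tested against a bounded factor
  \<open>G\<close> from the past.\<close>

lemma markov_expectation_nonneg:
  assumes s: "s \<ge> 0" and t: "t \<ge> 0"
    and G: "G \<in> borel_measurable (natural_filtration M X s)" "\<And>\<omega>. \<bar>G \<omega> :: real\<bar> \<le> C"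
    and g: "g \<in> borel_measurable borel" "\<And>x. 0 \<le> g x" "\<And>x. g x \<le> B"
  shows "(\<integral>\<omega>. G \<omega> * g (X (s + t) \<omega>) \<partial>M) = (\<integral>\<omega>. G \<omega> * (\<integral>y. g y \<partial>P t (X s \<omega>)) \<partial>M)"
proof -
  interpret prob_space M by (rule markov_prob_space)
  let ?F = "natural_filtration M X s"
  interpret finite_measure_subalgebra M ?F
    by unfold_locales (rule subalgebra_natural_filtration)
  have GM [measurable]: "G \<in> borel_measurable M"
    by (rule measurable_from_subalg[OF subalgebra_natural_filtration G(1)])
  have X [measurable]: "X (s + t) \<in> borel_measurable M" "X s \<in> borel_measurable M"
    using markov_measurable s t by auto
  have C: "C \<ge> 0" using G(2)[of undefined] by linarith
  have intg: "integrable M (\<lambda>\<omega>. G \<omega> * h \<omega>)" if "h \<in> borel_measurable M" "\<And>\<omega>. \<bar>h \<omega>\<bar> \<le> b" for h b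
    using that G(2) C by (intro integrable_prob_bounded[OF markov_prob_space, of _ "C * b"])
      (auto simp: abs_mult intro!: mult_mono)
  have Pm [measurable]: "(\<lambda>\<omega>. \<integral>y. u y \<partial>P t (X s \<omega>)) \<in> borel_measurable M"
    if "u \<in> borel_measurable borel" for u :: "'a \<Rightarrow> real"
    using semigroup_integral_measurable[OF markov_semigroup t that] by simp
  note Pmeas = transition_semigroup_measurable[OF markov_semigroup t]
  have Pb: "\<bar>\<integral>y. u y \<partial>P t x\<bar> \<le> b" if "u \<in> borel_measurable borel" "\<And>y. \<bar>u y\<bar> \<le> b" for u :: "'a \<Rightarrow> real" and b x
    by (intro abs_integral_prob_le transition_semigroupD(2)[OF markov_semigroup t] Pmeas that)
  \<comment> \<open>Boundedness is put into the induction formula as a premise. It descends to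
    summands and approximants, since all of them are nonnegative and lie below the function in
    question.\<close>
  have "(\<exists>b. \<forall>x. g x \<le> b) \<longrightarrow> (\<integral>\<omega>. G \<omega> * g (X (s + t) \<omega>) \<partial>M) = (\<integral>\<omega>. G \<omega> * (\<integral>y. g y \<partial>P t (X s \<omega>)) \<partial>M)"
    using g(1,2)
  proof (induction g rule: borel_measurable_induct_real)
    case (set A)
    have A [measurable]: "A \<in> sets borel" using set by simp
    have "AE \<omega> in M. real_cond_exp M ?F (\<lambda>\<omega>. indicator A (X (s + t) \<omega>)) \<omega> = measure (P t (X s \<omega>)) A"
      using markov s t A unfolding markov_process_def by blast
    then have "(\<integral>\<omega>. G \<omega> * real_cond_exp M ?F (\<lambda>\<omega>. indicator A (X (s + t) \<omega>)) \<omega> \<partial>M)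
        = (\<integral>\<omega>. G \<omega> * (\<integral>y. indicator A y \<partial>P t (X s \<omega>)) \<partial>M)"
    proof (intro integral_cong_AE)
      show "(\<lambda>\<omega>. G \<omega> * real_cond_exp M ?F (\<lambda>\<omega>. indicator A (X (s + t) \<omega>)) \<omega>) \<in> borel_measurable M"
        by measurable
      show "(\<lambda>\<omega>. G \<omega> * (\<integral>y. indicator A y \<partial>P t (X s \<omega>))) \<in> borel_measurable M"
        by (intro borel_measurable_times GM Pm) simp
    qed (auto elim!: eventually_mono simp: transition_semigroupD[OF markov_semigroup t])
    moreover have "(\<integral>\<omega>. G \<omega> * real_cond_exp M ?F (\<lambda>\<omega>. indicator A (X (s + t) \<omega>)) \<omega> \<partial>M)
        = (\<integral>\<omega>. G \<omega> * indicator A (X (s + t) \<omega>) \<partial>M)"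
      by (rule real_cond_exp_intg(2)[OF intg[of _ 1] G(1)]) (auto simp: indicator_def)
    ultimately show ?case by simp
  next
    case (mult u c)
    show ?case
    proof (cases "c = 0")
      case False
      show ?thesis
      proof
        assume "\<exists>b. \<forall>x. c * u x \<le> b"
        then obtain b where "\<And>x. c * u x \<le> b" by blast
        then have "\<forall>x. u x \<le> b / c" using mult.hyps(1) False by (simp add: pos_le_divide_eq mult.commute)
        then have *: "(\<integral>\<omega>. G \<omega> * u (X (s + t) \<omega>) \<partial>M) = (\<integral>\<omega>. G \<omega> * (\<integral>y. u y \<partial>P t (X s \<omega>)) \<partial>M)"
          using mult.IH by blast
        have "(\<integral>\<omega>. G \<omega> * (c * u (X (s + t) \<omega>)) \<partial>M) = c * (\<integral>\<omega>. G \<omega> * u (X (s + t) \<omega>) \<partial>M)"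
          by (subst integral_mult_right_zero[symmetric]) (simp add: mult_ac)
        also have "\<dots> = (\<integral>\<omega>. G \<omega> * (\<integral>y. c * u y \<partial>P t (X s \<omega>)) \<partial>M)"
          unfolding * by (subst integral_mult_right_zero[symmetric]) (simp add: mult_ac)
        finally show "(\<integral>\<omega>. G \<omega> * (c * u (X (s + t) \<omega>)) \<partial>M) = (\<integral>\<omega>. G \<omega> * (\<integral>y. c * u y \<partial>P t (X s \<omega>)) \<partial>M)" .
      qed
    qed simp
  next
    case (add u v)
    show ?case
    proof
      assume "\<exists>b. \<forall>x. v x + u x \<le> b"
      then obtain b where b: "\<And>x. v x + u x \<le> b" by blast
      have ub: "u x \<le> b" and vb: "v x \<le> b" for x
        using b[of x] add.hyps(2)[of x] add.hyps(4)[of x] by auto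
      have ua: "\<bar>u x\<bar> \<le> b" and va: "\<bar>v x\<bar> \<le> b" for x using ub vb add.hyps(2)[of x] add.hyps(4)[of x] by auto
      have [measurable]: "u \<in> borel_measurable borel" "v \<in> borel_measurable borel" using add by auto
      have e: "(\<integral>\<omega>. G \<omega> * u (X (s + t) \<omega>) \<partial>M) = (\<integral>\<omega>. G \<omega> * (\<integral>y. u y \<partial>P t (X s \<omega>)) \<partial>M)"
        "(\<integral>\<omega>. G \<omega> * v (X (s + t) \<omega>) \<partial>M) = (\<integral>\<omega>. G \<omega> * (\<integral>y. v y \<partial>P t (X s \<omega>)) \<partial>M)"
        using add.IH ub vb by blast+
      have i: "integrable M (\<lambda>\<omega>. G \<omega> * u (X (s + t) \<omega>))" "integrable M (\<lambda>\<omega>. G \<omega> * v (X (s + t) \<omega>))"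
        "integrable M (\<lambda>\<omega>. G \<omega> * (\<integral>y. u y \<partial>P t (X s \<omega>)))" "integrable M (\<lambda>\<omega>. G \<omega> * (\<integral>y. v y \<partial>P t (X s \<omega>)))"
        by (rule intg[of _ b]; use ua va Pb in simp)+
      have j: "integrable (P t x) u" "integrable (P t x) v" for x
        by (rule integrable_prob_bounded[OF transition_semigroupD(2)[OF markov_semigroup t] Pmeas,
          where B = b]; use ua va in simp)+
      show "(\<integral>\<omega>. G \<omega> * (v (X (s + t) \<omega>) + u (X (s + t) \<omega>)) \<partial>M) = (\<integral>\<omega>. G \<omega> * (\<integral>y. v y + u y \<partial>P t (X s \<omega>)) \<partial>M)"
        using i j e by (simp add: distrib_left)
    qed
  next
    case (seq U)
    show ?case
    proof
      assume "\<exists>b. \<forall>x. g x \<le> b"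
      then obtain b where b: "\<And>x. g x \<le> b" by blast
      have Ub: "U i x \<le> b" for i x
      proof -
        have "incseq (\<lambda>i. U i x)" using seq.hyps(3) by (auto simp: incseq_def le_fun_def)
        from incseq_le[OF this seq.hyps(4)[of x], of i] b[of x] show ?thesis by (auto intro: order.trans)
      qed
      have Ua: "\<bar>U i x\<bar> \<le> b" for i x using Ub seq.hyps(2)[of i x] by simp
      have [measurable]: "U i \<in> borel_measurable borel" for i using seq by auto
      have [measurable]: "g \<in> borel_measurable borel"
        by (rule borel_measurable_LIMSEQ_real[OF seq.hyps(4)]) simp_all
      have e: "(\<integral>\<omega>. G \<omega> * U i (X (s + t) \<omega>) \<partial>M) = (\<integral>\<omega>. G \<omega> * (\<integral>y. U i y \<partial>P t (X s \<omega>)) \<partial>M)" for i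
        using seq.IH Ub by blast
      have lim: "(\<lambda>i. \<integral>y. U i y \<partial>P t x) \<longlonglongrightarrow> (\<integral>y. g y \<partial>P t x)" for x
      proof (rule integral_dominated_convergence[where w = "\<lambda>_. b"])
        interpret Px: prob_space "P t x" by (rule transition_semigroupD(2)[OF markov_semigroup t])
        show "integrable (P t x) (\<lambda>_. b)" by simp
      qed (use Ua seq.hyps(4) in \<open>auto intro: Pmeas\<close>)
      have "(\<lambda>i. \<integral>\<omega>. G \<omega> * U i (X (s + t) \<omega>) \<partial>M) \<longlonglongrightarrow> (\<integral>\<omega>. G \<omega> * g (X (s + t) \<omega>) \<partial>M)"
        by (rule integral_dominated_convergence[where w = "\<lambda>_. C * b"])
          (use Ua seq.hyps(4) G(2) C in \<open>auto intro!: tendsto_intros mult_mono simp: abs_mult\<close>)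
      moreover have "(\<lambda>i. \<integral>\<omega>. G \<omega> * (\<integral>y. U i y \<partial>P t (X s \<omega>)) \<partial>M) \<longlonglongrightarrow> (\<integral>\<omega>. G \<omega> * (\<integral>y. g y \<partial>P t (X s \<omega>)) \<partial>M)"
        by (rule integral_dominated_convergence[where w = "\<lambda>_. C * b"])
          (use Pb[OF _ Ua] lim G(2) C in \<open>auto intro!: tendsto_intros mult_mono simp: abs_mult\<close>)
      ultimately show "(\<integral>\<omega>. G \<omega> * g (X (s + t) \<omega>) \<partial>M) = (\<integral>\<omega>. G \<omega> * (\<integral>y. g y \<partial>P t (X s \<omega>)) \<partial>M)"
        unfolding e by (rule LIMSEQ_unique)
    qed
  qed
  then show ?thesis using g(3) by blast
qed

text \<open>Adding the bound \<open>B\<close> makes \<open>g\<close> nonnegative, and the constant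
  integrates to \<open>B\<close> under each probability measure \<open>P t x\<close>.\<close>

lemma markov_expectation:
  assumes s: "s \<ge> 0" and t: "t \<ge> 0"
    and G: "G \<in> borel_measurable (natural_filtration M X s)" "\<And>\<omega>. \<bar>G \<omega> :: real\<bar> \<le> C"
    and g: "g \<in> borel_measurable borel" "\<And>x. \<bar>g x\<bar> \<le> B"
  shows "(\<integral>\<omega>. G \<omega> * g (X (s + t) \<omega>) \<partial>M) = (\<integral>\<omega>. G \<omega> * (\<integral>y. g y \<partial>P t (X s \<omega>)) \<partial>M)"
proof -
  interpret prob_space M by (rule markov_prob_space)
  have C: "C \<ge> 0" using G(2)[of undefined] by linarith
  have GM [measurable]: "G \<in> borel_measurable M"
    by (rule measurable_from_subalg[OF subalgebra_natural_filtration G(1)])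
  have X [measurable]: "X (s + t) \<in> borel_measurable M" "X s \<in> borel_measurable M"
    using markov_measurable s t by auto
  have intg: "integrable M (\<lambda>\<omega>. G \<omega> * h \<omega>)" if "h \<in> borel_measurable M" "\<And>\<omega>. \<bar>h \<omega>\<bar> \<le> b" for h b
    using that G(2) C by (intro integrable_prob_bounded[OF markov_prob_space, of _ "C * b"])
      (auto simp: abs_mult intro!: mult_mono)
  have Pm [measurable]: "(\<lambda>\<omega>. \<integral>y. g y \<partial>P t (X s \<omega>)) \<in> borel_measurable M"
    using semigroup_integral_measurable[OF markov_semigroup t g(1)] by simp
  have Pb: "\<bar>\<integral>y. g y \<partial>P t x\<bar> \<le> B" for x
    by (intro abs_integral_prob_le transition_semigroupD(2)[OF markov_semigroup t]
        transition_semigroup_measurable[OF markov_semigroup t] g)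
  have Pi: "(\<integral>y. g y + B \<partial>P t x) = (\<integral>y. g y \<partial>P t x) + B" for x
  proof -
    interpret Px: prob_space "P t x" by (rule transition_semigroupD(2)[OF markov_semigroup t])
    have "integrable (P t x) g"
      by (rule integrable_prob_bounded[OF _ transition_semigroup_measurable[OF markov_semigroup t g(1)], where B = B])
        (use g Px.prob_space_axioms in auto)
    then show ?thesis by (simp add: Px.prob_space)
  qed
  have "(\<integral>\<omega>. G \<omega> * (g (X (s + t) \<omega>) + B) \<partial>M) = (\<integral>\<omega>. G \<omega> * (\<integral>y. g y + B \<partial>P t (X s \<omega>)) \<partial>M)"
  proof (rule markov_expectation_nonneg[OF s t G])
    fix x show "0 \<le> g x + B" "g x + B \<le> 2 * B" using g(2)[of x] by auto
  qed (use g in simp)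
  moreover have "integrable M (\<lambda>\<omega>. G \<omega> * g (X (s + t) \<omega>))" "integrable M (\<lambda>\<omega>. G \<omega> * (\<integral>y. g y \<partial>P t (X s \<omega>)))"
    using g Pb by (intro intg[of _ B]; simp)+
  moreover have "integrable M (\<lambda>\<omega>. G \<omega> * B)"
    by (rule intg[of _ "\<bar>B\<bar>"]) simp_all
  ultimately show ?thesis by (simp add: distrib_left Pi)
qed

end

text \<open>Real and imaginary parts of the product give four real instances. The past factor is
  complex because it carries the characters of the earlier increments.\<close>

lemma markov_expectation_cis:
  fixes X :: "real \<Rightarrow> 'w \<Rightarrow> real ^ 'n::finite"
  assumes markov: "markov_process M X P" and s: "s \<ge> 0" and t: "t \<ge> 0"
    and G: "G \<in> borel_measurable (natural_filtration M X s)" "\<And>\<omega>. norm (G \<omega> :: complex) \<le> C"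
  shows "(\<integral>\<omega>. G \<omega> * cis (v \<bullet> X (s + t) \<omega>) \<partial>M) = (\<integral>\<omega>. G \<omega> * (\<integral>y. cis (v \<bullet> y) \<partial>P t (X s \<omega>)) \<partial>M)"
proof -
  note P = markov_semigroup[OF markov]
  have cism: "(\<lambda>y. cis (v \<bullet> y)) \<in> borel_measurable borel"
    unfolding cis_conv_exp by simp
  interpret prob_space M by (rule markov_prob_space[OF markov])
  have C: "C \<ge> 0" using G(2)[of undefined] norm_ge_zero[of "G undefined"] by linarith
  have GM [measurable]: "G \<in> borel_measurable M"
    by (rule measurable_from_subalg[OF subalgebra_natural_filtration[OF markov] G(1)])
  have X [measurable]: "X (s + t) \<in> borel_measurable M" "X s \<in> borel_measurable M"
    using markov_measurable[OF markov] s t by auto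
  define I where "I x = (\<integral>y. cis (v \<bullet> y) \<partial>P t x)" for x
  have ci: "integrable (P t x) (\<lambda>y. cis (v \<bullet> y))" for x
    by (rule integrable_prob_bounded[OF transition_semigroupD(2)[OF P t] transition_semigroup_measurable[OF P t
      cism], where B = 1]) simp
  have Ire: "Re (I x) = (\<integral>y. cos (v \<bullet> y) \<partial>P t x)" and Iim: "Im (I x) = (\<integral>y. sin (v \<bullet> y) \<partial>P t x)" for x
    using integral_Re[OF ci[of x]] integral_Im[OF ci[of x]] by (simp_all add: I_def)
  have Ib: "norm (I x) \<le> 1" for x
  proof -
    interpret Px: prob_space "P t x" by (rule transition_semigroupD(2)[OF P t])
    have "norm (I x) \<le> (\<integral>y. norm (cis (v \<bullet> y)) \<partial>P t x)" unfolding I_def by (rule integral_norm_bound)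
    then show ?thesis by (simp add: Px.prob_space)
  qed
  have Im [measurable]: "I \<in> borel_measurable borel"
    unfolding I_def[abs_def] by (rule semigroup_integral_measurable[OF P t cism])
  have Gre: "(\<lambda>\<omega>. Re (G \<omega>)) \<in> borel_measurable (natural_filtration M X s)" "(\<lambda>\<omega>. Im (G \<omega>))
    \<in> borel_measurable (natural_filtration M X s)"
    using G(1) by simp_all
  have Gb: "\<bar>Re (G \<omega>)\<bar> \<le> C" "\<bar>Im (G \<omega>)\<bar> \<le> C" for \<omega>
    using G(2)[of \<omega>] abs_Re_le_cmod[of "G \<omega>"] abs_Im_le_cmod[of "G \<omega>"] by linarith+
  have mc: "(\<lambda>y. cos (v \<bullet> y)) \<in> borel_measurable borel" "(\<lambda>y. sin (v \<bullet> y)) \<in> borel_measurable borel" by simp_all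
  note M1 = markov_expectation[OF markov s t Gre(1) Gb(1) mc(1) abs_cos_le_one]
    markov_expectation[OF markov s t Gre(1) Gb(1) mc(2) abs_sin_le_one]
    markov_expectation[OF markov s t Gre(2) Gb(2) mc(1) abs_cos_le_one]
    markov_expectation[OF markov s t Gre(2) Gb(2) mc(2) abs_sin_le_one]
  have i1: "integrable M (\<lambda>\<omega>. a \<omega> * b \<omega>)"
    if "a \<in> borel_measurable M" "b \<in> borel_measurable M" "\<And>\<omega>. norm (a \<omega>) \<le> C" "\<And>\<omega>. norm (b \<omega>) \<le> 1"
    for a b :: "'w \<Rightarrow> 'b::{real_normed_algebra, banach, second_countable_topology}"
  proof (rule integrable_prob_bounded[OF markov_prob_space[OF markov], of _ C])
    fix \<omega>
    have "norm (a \<omega> * b \<omega>) \<le> norm (a \<omega>) * norm (b \<omega>)" by (rule norm_mult_ineq)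
    also have "\<dots> \<le> C * 1" using that C by (intro mult_mono) auto
    finally show "norm (a \<omega> * b \<omega>) \<le> C" by simp
  qed (use that in simp)
  have IRb: "\<bar>Re (I x)\<bar> \<le> 1" "\<bar>Im (I x)\<bar> \<le> 1" for x
    using Ib[of x] abs_Re_le_cmod[of "I x"] abs_Im_le_cmod[of "I x"] by linarith+
  have cX: "(\<lambda>\<omega>. cis (v \<bullet> X (s + t) \<omega>)) \<in> borel_measurable M"
    using measurable_compose[OF X(1) cism] .
  have L: "integrable M (\<lambda>\<omega>. G \<omega> * cis (v \<bullet> X (s + t) \<omega>))" by (rule i1) (use G(2) cX in auto)
  have R: "integrable M (\<lambda>\<omega>. G \<omega> * I (X s \<omega>))" by (rule i1) (use G(2) Ib in auto)
  have r1: "integrable M (\<lambda>\<omega>. Re (G \<omega>) * cos (v \<bullet> X (s + t) \<omega>))" "integrable M (\<lambda>\<omega>. Re (G \<omega>) * sin (v \<bullet> X (s + t) \<omega>))"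
    "integrable M (\<lambda>\<omega>. Im (G \<omega>) * cos (v \<bullet> X (s + t) \<omega>))" "integrable M (\<lambda>\<omega>. Im (G \<omega>) * sin (v \<bullet> X (s + t) \<omega>))"
    by (rule i1; use Gb in simp)+
  have r2: "integrable M (\<lambda>\<omega>. Re (G \<omega>) * Re (I (X s \<omega>)))" "integrable M (\<lambda>\<omega>. Re (G \<omega>) * Im (I (X s \<omega>)))"
    "integrable M (\<lambda>\<omega>. Im (G \<omega>) * Re (I (X s \<omega>)))" "integrable M (\<lambda>\<omega>. Im (G \<omega>) * Im (I (X s \<omega>)))"
    by (rule i1; use Gb IRb in simp)+
  have "Re (\<integral>\<omega>. G \<omega> * cis (v \<bullet> X (s + t) \<omega>) \<partial>M) = Re (\<integral>\<omega>. G \<omega> * I (X s \<omega>) \<partial>M)"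
    using integral_Re[OF L, symmetric] integral_Re[OF R, symmetric] M1 r1 r2 by (simp add: Ire Iim)
  moreover have "Im (\<integral>\<omega>. G \<omega> * cis (v \<bullet> X (s + t) \<omega>) \<partial>M) = Im (\<integral>\<omega>. G \<omega> * I (X s \<omega>) \<partial>M)"
    using integral_Im[OF L, symmetric] integral_Im[OF R, symmetric] M1 r1 r2 by (simp add: Ire Iim)
  ultimately show ?thesis by (simp add: complex_eq_iff I_def)
qed

text \<open>Conditioning on the past replaces the last factor by \<open>exp (h * \<psi>)\<close>
  times a character of the earlier position, which cancels against the one split off from the
  increment. The increments thus behave as independent ones, although only the Markov property is
  given.\<close>

lemma diffusion_increments_char:
  fixes X :: "real \<Rightarrow> 'w \<Rightarrow> real ^ 'n::finite"
  assumes markov: "markov_process M X P" and gen: "has_generator_on P (const_coeff_op m A) test_functions"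
    and h: "h \<ge> 0"
  shows "(\<integral>\<omega>. (\<Prod>i<K. cis (v i \<bullet> (X (real (Suc i) * h) \<omega> - X (real i * h) \<omega>))) \<partial>M)
    = (\<Prod>i<K. exp (of_real h * char_exponent m A (v i)))"
proof (induction K)
  case 0
  interpret prob_space M by (rule markov_prob_space[OF markov])
  show ?case by (simp add: prob_space)
next
  case (Suc K)
  define Q where "Q \<omega> = (\<Prod>i<K. cis (v i \<bullet> (X (real (Suc i) * h) \<omega> - X (real i * h) \<omega>)))" for \<omega>
  let ?s = "real K * h"
  have s: "?s \<ge> 0" using h by simp
  have mx: "X (real i * h) \<in> borel_measurable (natural_filtration M X ?s)" if "i \<le> K" for i
    by (rule measurable_natural_filtration[OF markov]) (use h that in \<open>auto intro: mult_right_mono\<close>)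
  \<comment> \<open>The character of the position at time \<open>?s\<close> is counted to the past,
    so that only the position at time \<open>?s + h\<close> remains to be averaged.\<close>
  have G: "(\<lambda>\<omega>. Q \<omega> * cis (- (v K \<bullet> X ?s \<omega>))) \<in> borel_measurable (natural_filtration M X ?s)"
  proof -
    have ie: "(\<lambda>\<omega>. exp (\<i> * complex_of_real (f \<omega>))) \<in> borel_measurable N" if "f \<in> borel_measurable N" for f N
      using that by simp
    show ?thesis
      unfolding Q_def cis_conv_exp
      by (intro borel_measurable_times borel_measurable_prod ie
          borel_measurable_inner borel_measurable_diff borel_measurable_uminus borel_measurable_const mx) auto
  qed
  have Qn: "norm (Q \<omega>) = 1" for \<omega> by (simp add: Q_def flip: prod_norm)
  have "(\<Prod>i<Suc K. cis (v i \<bullet> (X (real (Suc i) * h) \<omega> - X (real i * h) \<omega>)))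
      = (Q \<omega> * cis (- (v K \<bullet> X ?s \<omega>))) * cis (v K \<bullet> X (?s + h) \<omega>)" for \<omega>
  proof -
    have "real (Suc K) * h = ?s + h" by (simp add: algebra_simps)
    then show ?thesis by (simp add: Q_def inner_diff_right cis_mult mult.assoc)
  qed
  then have "(\<integral>\<omega>. (\<Prod>i<Suc K. cis (v i \<bullet> (X (real (Suc i) * h) \<omega> - X (real i * h) \<omega>))) \<partial>M)
      = (\<integral>\<omega>. (Q \<omega> * cis (- (v K \<bullet> X ?s \<omega>))) * cis (v K \<bullet> X (?s + h) \<omega>) \<partial>M)" by simp
  also have "\<dots> = (\<integral>\<omega>. (Q \<omega> * cis (- (v K \<bullet> X ?s \<omega>))) * (\<integral>y. cis (v K \<bullet> y) \<partial>P h (X ?s \<omega>)) \<partial>M)"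
    by (rule markov_expectation_cis[OF markov s h G, of 1]) (simp add: norm_mult Qn)
  also have "\<dots> = (\<integral>\<omega>. exp (of_real h * char_exponent m A (v K)) * Q \<omega> \<partial>M)"
    by (rule Bochner_Integration.integral_cong[OF refl])
      (simp add: semigroup_char[OF markov_semigroup[OF markov] gen h] char_exponent_def cis_mult mult_ac flip:
        cis_divide)
  also have "\<dots> = exp (of_real h * char_exponent m A (v K)) * (\<integral>\<omega>. Q \<omega> \<partial>M)"
    by (rule integral_mult_right_zero)
  finally show ?case using Suc by (simp add: Q_def mult.commute)
qed

section \<open>Weak convergence from characteristic functions\<close>

text \<open>The phase \<open>a\<close> includes the sines, and the product formula for cosines makes
  the class an algebra, as Stone-Weierstrass requires.\<close>

inductive trig_poly :: "nat \<Rightarrow> ((nat \<Rightarrow> 'a::euclidean_space) \<Rightarrow> real) \<Rightarrow> bool" for K where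
  cos: "trig_poly K (\<lambda>z. c * cos ((\<Sum>k<K. v k \<bullet> z k) + a))"
| add: "trig_poly K g \<Longrightarrow> trig_poly K h \<Longrightarrow> trig_poly K (\<lambda>z. g z + h z)"

lemma trig_poly_cos_mult:
  "trig_poly K h \<Longrightarrow> trig_poly K (\<lambda>z. (c * cos ((\<Sum>k<K. v k \<bullet> z k) + a)) * h z)"
proof (induction rule: trig_poly.induct)
  case (cos c' v' a')
  have "(c * cos ((\<Sum>k<K. v k \<bullet> z k) + a)) * (c' * cos ((\<Sum>k<K. v' k \<bullet> z k) + a')) =
     (c * c' / 2) * cos ((\<Sum>k<K. (v k - v' k) \<bullet> z k) + (a - a'))
     + (c * c' / 2) * cos ((\<Sum>k<K. (v k + v' k) \<bullet> z k) + (a + a'))" for z :: "nat \<Rightarrow> 'a"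
  proof -
    define x where "x = (\<Sum>k<K. v k \<bullet> z k) + a"
    define y where "y = (\<Sum>k<K. v' k \<bullet> z k) + a'"
    have eqs: "(\<Sum>k<K. (v k - v' k) \<bullet> z k) + (a - a') = x - y" "(\<Sum>k<K. (v k + v' k) \<bullet> z k) + (a + a') = x + y"
      by (simp_all add: x_def y_def inner_diff_left inner_add_left sum.distrib sum_subtractf)
    show ?thesis
      unfolding eqs x_def[symmetric] y_def[symmetric] by (simp add: cos_diff cos_add field_simps)
  qed
  then show ?case
    by (simp only:) (intro trig_poly.add trig_poly.cos)
next
  case (add g h)
  then show ?case by (simp only: distrib_left) (intro trig_poly.add)
qed

lemma trig_poly_mult: "trig_poly K g \<Longrightarrow> trig_poly K h \<Longrightarrow> trig_poly K (\<lambda>z. g z * h z)"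
proof (induction rule: trig_poly.induct)
  case (cos c v a) then show ?case by (rule trig_poly_cos_mult)
next
  case (add g g')
  show ?case unfolding distrib_right by (rule trig_poly.add[OF add.IH(1)[OF add.prems] add.IH(2)[OF add.prems]])
qed

lemma trig_poly_const: "trig_poly K (\<lambda>z. c)"
  using trig_poly.cos[of K c "\<lambda>_. 0" 0] by simp

lemma trig_poly_continuous: "trig_poly K h \<Longrightarrow> continuous_on UNIV h"
  by (induction rule: trig_poly.induct) (intro continuous_intros continuous_on_product_coordinates; simp)+

lemma trig_poly_bounded: "trig_poly K h \<Longrightarrow> \<exists>B. \<forall>z. \<bar>h z\<bar> \<le> B"
proof (induction rule: trig_poly.induct)
  case (cos c v a)
  have "\<bar>c * cos ((\<Sum>k<K. v k \<bullet> z k) + a)\<bar> \<le> \<bar>c\<bar> * 1" for z :: "nat \<Rightarrow> 'a"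
    unfolding abs_mult by (intro mult_left_mono) auto
  then show ?case by blast
next
  case (add g h)
  then obtain B C where "\<And>z. \<bar>g z\<bar> \<le> B" "\<And>z. \<bar>h z\<bar> \<le> C" by blast
  then have "\<bar>g z + h z\<bar> \<le> B + C" for z using abs_triangle_ineq[of "g z" "h z"] by (meson add_mono order.trans)
  then show ?case by blast
qed

text \<open>
  Replacing coordinates by their rescaled sines turns the polynomials in the coordinates of the
  cube into trigonometric polynomials, and Stone-Weierstrass on the cube applies.  A function \<open>G\<close> is
  carried to the cube through \<open>arcsin\<close>, which changes it outside of a large cube only.
\<close>

definition sine_map :: "nat \<Rightarrow> real \<Rightarrow> (nat \<Rightarrow> 'a::euclidean_space) \<Rightarrow> nat \<Rightarrow> 'a" where
  "sine_map K L z k = (if k < K then \<Sum>b\<in>Basis. sin ((z k \<bullet> b) / L) *\<^sub>R b else 0)"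

text \<open>Coordinates from \<open>K\<close> on are pinned to 0: the set becomes compact in the
  product topology, and its points are separated by the first \<open>K\<close> coordinates.\<close>

definition sine_cube :: "nat \<Rightarrow> (nat \<Rightarrow> 'a::euclidean_space) set" where
  "sine_cube K = {z. \<forall>k. if k < K then z k \<in> cbox (- One) One else z k = 0}"

lemma sine_map_in_cube: "sine_map K L z \<in> sine_cube K"
  by (auto simp: sine_cube_def sine_map_def mem_box inner_sum_left_Basis)

lemma compact_sine_cube: "compact (sine_cube K :: (nat \<Rightarrow> 'a::euclidean_space) set)"
proof -
  have "sine_cube K = (\<Pi>\<^sub>E k\<in>UNIV. if k < K then cbox (- One) One else {0::'a})"
    by (auto simp: sine_cube_def PiE_def Pi_def split: if_splits)
  moreover have "compactin (product_topology (\<lambda>_. euclidean) UNIV) (\<Pi>\<^sub>E k\<in>UNIV. if k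
    < K then cbox (- One) One else {0::'a})"
    unfolding compactin_PiE by auto
  ultimately show ?thesis by (simp add: euclidean_product_topology)
qed

text \<open>The bound \<open>B + e\<close> on \<open>h\<close> holds everywhere and not only on the
  large cube, because the sine map takes all arguments into the compact cube where the approximation
  is uniform. This global bound controls the error on the event that the process leaves the large
  cube.\<close>

lemma trig_poly_approximation:
  fixes G :: "(nat \<Rightarrow> 'a::euclidean_space) \<Rightarrow> real"
  assumes G: "continuous_on UNIV G" "\<And>z. \<bar>G z\<bar> \<le> B" "\<And>z z'. (\<And>k. k < K \<Longrightarrow> z k = z' k) \<Longrightarrow> G z = G z'"
    and L: "L > 0" and e: "e > 0"
  obtains h where "trig_poly K h" "\<And>z. \<bar>h z\<bar> \<le> B + e"
    "\<And>z. (\<And>k b. k < K \<Longrightarrow> b \<in> Basis \<Longrightarrow> \<bar>z k \<bullet> b\<bar> \<le> L) \<Longrightarrow> \<bar>h z - G z\<bar> \<le> e"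
proof -
  define R where "R = {p. continuous_on UNIV p \<and> trig_poly K (\<lambda>z :: nat \<Rightarrow> 'a. p (sine_map K L z))}"
  interpret function_ring_on R "sine_cube K"
  proof
    show "compact (sine_cube K :: (nat \<Rightarrow> 'a) set)" by (rule compact_sine_cube)
    show "continuous_on (sine_cube K) f" if "f \<in> R" for f
      using that continuous_on_subset by (auto simp: R_def)
    show "(\<lambda>x. f x + g x) \<in> R" "(\<lambda>x. f x * g x) \<in> R" if "f \<in> R" "g \<in> R" for f g
      using that by (auto simp: R_def intro: continuous_intros trig_poly.add trig_poly_mult)
    show "(\<lambda>_. c) \<in> R" for c by (simp add: R_def trig_poly_const)
    fix x y :: "nat \<Rightarrow> 'a" assume xy: "x \<in> sine_cube K" "y \<in> sine_cube K" "x \<noteq> y"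
    then obtain k where k: "x k \<noteq> y k" by blast
    have kK: "k < K" using xy(1,2) k unfolding sine_cube_def mem_Collect_eq by metis
    obtain b where b: "b \<in> Basis" "x k \<bullet> b \<noteq> y k \<bullet> b" using k euclidean_eqI by blast
    \<comment> \<open>A sine is a cosine with phase \<open>- pi / 2\<close>, so a single coordinate
      of the sine map is itself a generator of the algebra.\<close>
    have "sine_map K L z k \<bullet> b = 1 * cos ((\<Sum>j<K. (if j = k then (1 / L) *\<^sub>R b else 0) \<bullet> z j) + - (pi / 2))"
      for z :: "nat \<Rightarrow> 'a"
    proof -
      have "(\<Sum>j<K. (if j = k then (1 / L) *\<^sub>R b else 0) \<bullet> z j) = (\<Sum>j<K. if j = k then (z k \<bullet> b) / L else 0)"
        by (intro sum.cong) (auto simp: inner_commute)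
      also have "\<dots> = (z k \<bullet> b) / L" using kK by simp
      finally show ?thesis using kK b by (simp add: sine_map_def cos_diff)
    qed
    then have "(\<lambda>z. z k \<bullet> b) \<in> R"
      unfolding R_def
        by (simp only: mem_Collect_eq) (intro conjI trig_poly.cos continuous_intros continuous_on_product_coordinates)
    then show "\<exists>f\<in>R. f x \<noteq> f y" by (rule rev_bexI) (rule b(2))
  qed
  \<comment> \<open>A right inverse of the sine map on the cube, which is the exact inverse for
    arguments whose coordinates are at most \<open>L\<close>.\<close>
  define unfold where "unfold w k = (\<Sum>b\<in>Basis. (L * arcsin (w k \<bullet> b)) *\<^sub>R b)" for w :: "nat \<Rightarrow> 'a" and k :: nat
  have inner: "-1 \<le> w k \<bullet> b \<and> w k \<bullet> b \<le> 1" if "w \<in> sine_cube K" "b \<in> Basis" for w :: "nat \<Rightarrow> 'a" and k b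
    using that by (cases "k < K") (auto simp: sine_cube_def mem_box dest: spec[of _ k])
  have "continuous_on (sine_cube K) unfold"
    unfolding unfold_def
    by (intro continuous_on_coordinatewise_then_product continuous_on_sum continuous_on_scaleR continuous_on_mult
        continuous_on_const continuous_on_arcsin continuous_on_inner
          continuous_on_subset[OF continuous_on_product_coordinates])
      (use inner in auto)
  then have "continuous_on (sine_cube K) (\<lambda>w. G (unfold w))"
    using continuous_on_compose2[OF G(1)] by blast
  from Stone_Weierstrass_basic[OF this e] obtain g where g: "g \<in> R" "\<And>w. w \<in> sine_cube K \<Longrightarrow> \<bar>G (unfold w) - g w\<bar> < e"
    by blast
  show ?thesis
  proof (rule that[of "\<lambda>z. g (sine_map K L z)"])
    show "trig_poly K (\<lambda>z. g (sine_map K L z))" using g by (simp add: R_def)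
    show "\<bar>g (sine_map K L z)\<bar> \<le> B + e" for z
      using g(2)[OF sine_map_in_cube[of K L z]] G(2)[of "unfold (sine_map K L z)"] by linarith
    fix z :: "nat \<Rightarrow> 'a" assume z: "\<And>k b. k < K \<Longrightarrow> b \<in> Basis \<Longrightarrow> \<bar>z k \<bullet> b\<bar> \<le> L"
    have "unfold (sine_map K L z) k = z k" if k: "k < K" for k
    proof -
      have "L * arcsin (sin ((z k \<bullet> b) / L)) = z k \<bullet> b" if b: "b \<in> Basis" for b
      proof -
        \<comment> \<open>The quotient stays within \<open>1 < pi / 2\<close>, where
          \<open>arcsin\<close> inverts \<open>sin\<close>.\<close>
        have "\<bar>(z k \<bullet> b) / L\<bar> \<le> 1" using z[OF k b] L by simp
        then have "arcsin (sin ((z k \<bullet> b) / L)) = (z k \<bullet> b) / L"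
          using pi_gt3 by (intro arcsin_sin) linarith+
        then show ?thesis using L by simp
      qed
      then show ?thesis using k by (simp add: unfold_def sine_map_def inner_sum_left_Basis euclidean_representation)
    qed
    then have "G (unfold (sine_map K L z)) = G z" by (rule G(3))
    then show "\<bar>g (sine_map K L z) - G z\<bar> \<le> e"
      using g(2)[OF sine_map_in_cube[of K L z]] by linarith
  qed
qed

section \<open>From trigonometric polynomials to bounded continuous functions\<close>

lemma integral_approximation:
  fixes g h :: "'w \<Rightarrow> real"
  assumes M: "prob_space M" and m: "g \<in> borel_measurable M" "h \<in> borel_measurable M"
    and A: "A \<in> sets M" "measure M A \<le> \<eta>"
    and b: "\<And>\<omega>. \<bar>g \<omega>\<bar> \<le> B" "\<And>\<omega>. \<bar>h \<omega>\<bar> \<le> B" and e: "\<And>\<omega>. \<omega> \<in> space M - A \<Longrightarrow> \<bar>g \<omega> - h \<omega>\<bar> \<le> e" "e \<ge> 0"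
  shows "\<bar>(\<integral>\<omega>. g \<omega> \<partial>M) - (\<integral>\<omega>. h \<omega> \<partial>M)\<bar> \<le> e + 2 * B * \<eta>"
proof -
  interpret prob_space M by fact
  have B: "B \<ge> 0" using b(1)[of undefined] by linarith
  have i: "integrable M g" "integrable M h" using m b by (auto intro!: integrable_const_bound[of _ B])
  have iA: "integrable M (\<lambda>\<omega>. 2 * B * indicator A \<omega>)"
    using A(1) by (intro integrable_mult_right) (simp add: emeasure_eq_measure)
  have "\<bar>(\<integral>\<omega>. g \<omega> \<partial>M) - (\<integral>\<omega>. h \<omega> \<partial>M)\<bar> = \<bar>\<integral>\<omega>. g \<omega> - h \<omega> \<partial>M\<bar>" using i by simp
  also have "\<dots> \<le> (\<integral>\<omega>. \<bar>g \<omega> - h \<omega>\<bar> \<partial>M)" by (rule integral_abs_bound)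
  also have "\<dots> \<le> (\<integral>\<omega>. e + 2 * B * indicator A \<omega> \<partial>M)"
  proof (rule integral_mono)
    fix \<omega> assume "\<omega> \<in> space M"
    then show "\<bar>g \<omega> - h \<omega>\<bar> \<le> e + 2 * B * indicator A \<omega>"
      using e b[of \<omega>] by (cases "\<omega> \<in> A") (auto simp: indicator_def)
  qed (use i iA in auto)
  also have "\<dots> = e + 2 * B * measure M A"
    using iA A(1) by (simp add: prob_space)
  also have "\<dots> \<le> e + 2 * B * \<eta>" using A(2) B by (intro add_left_mono mult_left_mono) auto
  finally show ?thesis .
qed

lemma measurable_sequence_functional:
  fixes h :: "(nat \<Rightarrow> 'a::{metric_space, second_countable_topology}) \<Rightarrow> real"
  assumes "continuous_on UNIV h" "\<And>k. Y k \<in> borel_measurable N"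
  shows "(\<lambda>\<omega>. h (\<lambda>k. Y k \<omega>)) \<in> borel_measurable N"
proof -
  have "(\<lambda>\<omega>. \<lambda>k. Y k \<omega>) \<in> borel_measurable N"
    by (rule measurable_coordinatewise_then_product) (rule assms)
  from measurable_compose[OF this borel_measurable_continuous_onI[OF assms(1)]] show ?thesis .
qed

lemma prod_cis: "(\<Prod>k\<in>I. cis (f k)) = cis (\<Sum>k\<in>I. f k)"
  by (induction I rule: infinite_finite_induct) (simp_all add: cis_mult)

lemma integrable_prod_cis:
  fixes Y :: "nat \<Rightarrow> 'w \<Rightarrow> 'a::euclidean_space"
  assumes N: "prob_space N" "\<And>k. Y k \<in> borel_measurable N"
  shows "integrable N (\<lambda>\<omega>. \<Prod>k<K::nat. cis (v k \<bullet> Y k \<omega>))"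
proof (rule integrable_prob_bounded[OF N(1), where B = 1])
  have [measurable]: "\<And>k. Y k \<in> borel_measurable N" by (rule N)
  show "(\<lambda>\<omega>. \<Prod>k<K. cis (v k \<bullet> Y k \<omega>)) \<in> borel_measurable N"
    unfolding cis_conv_exp by measurable
qed (simp flip: prod_norm)

lemma integral_cos_prod_cis:
  fixes Y :: "nat \<Rightarrow> 'w \<Rightarrow> 'a::euclidean_space"
  assumes N: "prob_space N" "\<And>k. Y k \<in> borel_measurable N"
  shows "(\<integral>\<omega>. c * cos ((\<Sum>k<K::nat. v k \<bullet> Y k \<omega>) + a) \<partial>N) = c * Re (cis a * (\<integral>\<omega>. (\<Prod>k<K. cis (v k \<bullet> Y k \<omega>)) \<partial>N))"
proof -
  note i = integrable_prod_cis[OF N, where v = v and K = K]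
  have "Re (cis a * (\<Prod>k<K. cis (v k \<bullet> Y k \<omega>))) = cos ((\<Sum>k<K. v k \<bullet> Y k \<omega>) + a)" for \<omega>
    by (simp only: prod_cis cis_mult) (simp add: add.commute)
  then have "(\<integral>\<omega>. c * cos ((\<Sum>k<K. v k \<bullet> Y k \<omega>) + a) \<partial>N) = c * (\<integral>\<omega>. Re (cis a * (\<Prod>k<K. cis (v k \<bullet> Y k \<omega>))) \<partial>N)"
    by simp
  also have "\<dots> = c * Re (\<integral>\<omega>. cis a * (\<Prod>k<K. cis (v k \<bullet> Y k \<omega>)) \<partial>N)"
    using integral_Re[OF integrable_mult_right[OF i, of "cis a"]] by simp
  finally show ?thesis by simp
qed

lemma integral_trig_poly_add:
  fixes Y :: "nat \<Rightarrow> 'w \<Rightarrow> 'a::euclidean_space"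
  assumes N: "prob_space N" "\<And>k. Y k \<in> borel_measurable N" and gh: "trig_poly K g" "trig_poly K h"
  shows "(\<integral>\<omega>. g (\<lambda>k. Y k \<omega>) + h (\<lambda>k. Y k \<omega>) \<partial>N) = (\<integral>\<omega>. g (\<lambda>k. Y k \<omega>) \<partial>N) + (\<integral>\<omega>. h (\<lambda>k. Y k \<omega>) \<partial>N)"
proof -
  have "integrable N (\<lambda>\<omega>. f (\<lambda>k. Y k \<omega>))" if f: "trig_poly K f" for f :: "(nat \<Rightarrow> 'a) \<Rightarrow> real"
  proof -
    obtain b where "\<And>z. \<bar>f z\<bar> \<le> b" using trig_poly_bounded[OF f] by blast
    then show ?thesis
      by (intro integrable_prob_bounded[OF N(1) measurable_sequence_functional[OF trig_poly_continuous[OF f]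
        N(2)], where B = b]) simp
  qed
  then show ?thesis using gh by simp
qed

text \<open>The exceedance events decrease to the empty set as the level grows, since every outcome
  involves finitely many finite coordinates; continuity of the measure from above gives the
  level.\<close>

lemma single_law_tight:
  fixes Y :: "nat \<Rightarrow> 'w \<Rightarrow> 'a::euclidean_space"
  assumes N: "prob_space N" "\<And>k. Y k \<in> borel_measurable N" and \<eta>: "\<eta> > 0"
  obtains L0 where "\<And>L. L \<ge> L0 \<Longrightarrow> measure N {\<omega> \<in> space N. \<exists>k<K::nat. \<exists>b\<in>Basis. L < \<bar>Y k \<omega> \<bullet> b\<bar>} \<le> \<eta>"
proof -
  interpret prob_space N by fact
  define A where "A L = {\<omega> \<in> space N. \<exists>k<K. \<exists>b\<in>Basis. L < \<bar>Y k \<omega> \<bullet> b\<bar>}" for L :: real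
  have [measurable]: "\<And>k. Y k \<in> borel_measurable N" by (rule N)
  have m: "A L \<in> sets N" for L unfolding A_def by measurable
  have mono: "A L' \<subseteq> A L" if "L \<le> L'" for L L'
  proof
    fix \<omega> assume "\<omega> \<in> A L'"
    then obtain k b where "\<omega> \<in> space N" "k < K" "b \<in> Basis" "L' < \<bar>Y k \<omega> \<bullet> b\<bar>" by (auto simp: A_def)
    moreover from this that have "L < \<bar>Y k \<omega> \<bullet> b\<bar>" by linarith
    ultimately show "\<omega> \<in> A L" by (auto simp: A_def)
  qed
  have "(\<Inter>n. A (real n)) = {}"
  proof (rule ccontr)
    assume "(\<Inter>n. A (real n)) \<noteq> {}"
    then obtain \<omega> where \<omega>: "\<And>n. \<omega> \<in> A (real n)" by blast
    define s where "s = (\<Sum>k<K. \<Sum>b\<in>Basis. \<bar>Y k \<omega> \<bullet> b\<bar>)"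
    obtain n :: nat where n: "s \<le> real n" using real_arch_simple by blast
    obtain k b where kb: "k < K" "b \<in> Basis" "real n < \<bar>Y k \<omega> \<bullet> b\<bar>" using \<omega>[of n] by (auto simp: A_def)
    have "\<bar>Y k \<omega> \<bullet> b\<bar> \<le> (\<Sum>b\<in>Basis. \<bar>Y k \<omega> \<bullet> b\<bar>)" using kb by (intro member_le_sum) auto
    also have "\<dots> \<le> s"
      unfolding s_def using kb
      by (intro member_le_sum[of k "{..<K}" "\<lambda>k. \<Sum>b\<in>Basis. \<bar>Y k \<omega> \<bullet> b\<bar>"]) (auto intro: sum_nonneg)
    finally show False using n kb by linarith
  qed
  moreover have "(\<lambda>n. measure N (A (real n))) \<longlonglongrightarrow> measure N (\<Inter>n. A (real n))"
    by (rule finite_Lim_measure_decseq) (use m mono in \<open>auto simp: decseq_def\<close>)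
  ultimately have "(\<lambda>n. measure N (A (real n))) \<longlonglongrightarrow> 0" by simp
  then have "eventually (\<lambda>n. measure N (A (real n)) < \<eta>) sequentially" using \<eta> by (rule order_tendstoD)
  then obtain n where n: "measure N (A (real n)) < \<eta>" by (auto simp: eventually_sequentially)
  have "measure N (A L) \<le> \<eta>" if "L \<ge> real n" for L
  proof -
    have "measure N (A L) \<le> measure N (A (real n))"
      using that by (intro finite_measure_mono m mono)
    then show ?thesis using n by linarith
  qed
  then show ?thesis using that unfolding A_def by blast
qed

text \<open>A form of the Levy continuity theorem with tightness as a hypothesis: for the walks it
  comes directly from the moment bounds. Trigonometric polynomials converge by assumption, and each
  bounded continuous \<open>G\<close> is close to one of them outside an event of small
  probability.\<close>

lemma weak_convergence_of_char:
  fixes M :: "'i \<Rightarrow> 'w measure" and Z :: "'i \<Rightarrow> nat \<Rightarrow> 'w \<Rightarrow> 'a::euclidean_space"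
    and M0 :: "'v measure" and Z0 :: "nat \<Rightarrow> 'v \<Rightarrow> 'a" and G :: "(nat \<Rightarrow> 'a) \<Rightarrow> real"
  assumes M: "\<forall>\<^sub>F i in F. prob_space (M i) \<and> (\<forall>k. Z i k \<in> borel_measurable (M i))"
    and M0: "prob_space M0" and Z0: "\<And>k. Z0 k \<in> borel_measurable M0"
    and char: "\<And>v. ((\<lambda>i. \<integral>\<omega>. (\<Prod>k<K. cis (v k \<bullet> Z i k \<omega>)) \<partial>M i) \<longlongrightarrow> (\<integral>\<omega>. (\<Prod>k<K. cis (v k \<bullet> Z0 k \<omega>)) \<partial>M0)) F"
    and tight: "\<And>\<eta>. \<eta> > 0 \<Longrightarrow> \<exists>L0. \<forall>L\<ge>L0. \<forall>\<^sub>F i in F.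
       measure (M i) {\<omega> \<in> space (M i). \<exists>k<K. \<exists>b\<in>Basis. L < \<bar>Z i k \<omega> \<bullet> b\<bar>} \<le> \<eta>"
    and G: "continuous_on UNIV G" "\<And>z. \<bar>G z\<bar> \<le> B" "\<And>z z'. (\<And>k. k < K \<Longrightarrow> z k = z' k) \<Longrightarrow> G z = G z'"
  shows "((\<lambda>i. \<integral>\<omega>. G (\<lambda>k. Z i k \<omega>) \<partial>M i) \<longlongrightarrow> (\<integral>\<omega>. G (\<lambda>k. Z0 k \<omega>) \<partial>M0)) F"
proof -
  have B: "B \<ge> 0" using G(2)[of undefined] by linarith
  have conv: "((\<lambda>i. \<integral>\<omega>. h (\<lambda>k. Z i k \<omega>) \<partial>M i) \<longlongrightarrow> (\<integral>\<omega>. h (\<lambda>k. Z0 k \<omega>) \<partial>M0)) F" if "trig_poly K h" for h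
    using that
  proof (induction rule: trig_poly.induct)
    case (cos c v a)
    have "((\<lambda>i. c * Re (cis a * (\<integral>\<omega>. (\<Prod>k<K. cis (v k \<bullet> Z i k \<omega>)) \<partial>M i))) \<longlongrightarrow>
      c * Re (cis a * (\<integral>\<omega>. (\<Prod>k<K. cis (v k \<bullet> Z0 k \<omega>)) \<partial>M0))) F"
      by (intro tendsto_intros char)
    moreover have "\<forall>\<^sub>F i in F. c * Re (cis a * (\<integral>\<omega>. (\<Prod>k<K. cis (v k \<bullet> Z i k \<omega>)) \<partial>M i))
        = (\<integral>\<omega>. c * cos ((\<Sum>k<K. v k \<bullet> Z i k \<omega>) + a) \<partial>M i)"
      using M by eventually_elim (simp only: integral_cos_prod_cis)
    ultimately show ?case
      by (subst integral_cos_prod_cis[OF M0 Z0]) (rule Lim_transform_eventually)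
  next
    case (add g h)
    have "\<forall>\<^sub>F i in F. (\<integral>\<omega>. g (\<lambda>k. Z i k \<omega>) \<partial>M i) + (\<integral>\<omega>. h (\<lambda>k. Z i k \<omega>) \<partial>M i)
        = (\<integral>\<omega>. g (\<lambda>k. Z i k \<omega>) + h (\<lambda>k. Z i k \<omega>) \<partial>M i)"
      using M
    proof eventually_elim
      case (elim i)
      then show ?case using integral_trig_poly_add[OF _ _ add.hyps, of "M i" "Z i"] by simp
    qed
    then show ?case
      unfolding integral_trig_poly_add[OF M0 Z0 add.hyps]
      by (rule Lim_transform_eventually[OF tendsto_add[OF add.IH]])
  qed
  show ?thesis
  proof (rule tendstoI)
    fix \<delta> :: real assume \<delta>: "\<delta> > 0"
    \<comment> \<open>Each passage between \<open>G\<close> and \<open>h\<close> costs at most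
      \<open>e + 2 * (B + 1) * \<eta> \<le> \<delta> / 8\<close>; two passages and the convergence
      for \<open>h\<close> stay below \<open>\<delta>\<close>. The cap at 1 bounds \<open>h\<close>
      by \<open>B + 1\<close>.\<close>
    define e where "e = min 1 (\<delta> / 16)"
    define \<eta> where "\<eta> = \<delta> / (32 * (B + 1))"
    have e: "e > 0" "e \<le> 1" "e \<le> \<delta> / 16" using \<delta> by (auto simp: e_def)
    have \<eta>: "\<eta> > 0" "2 * (B + 1) * \<eta> = \<delta> / 16" using \<delta> B by (auto simp: \<eta>_def field_simps)
    obtain L1
      where L1: "\<And>L. L \<ge> L1 \<Longrightarrow> \<forall>\<^sub>F i in F. measure (M i) {\<omega> \<in> space (M i). \<exists>k<K. \<exists>b\<in>Basis. L < \<bar>Z i k \<omega> \<bullet> b\<bar>} \<le> \<eta>"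
      using tight[OF \<eta>(1)] by blast
    obtain L2 where L2: "\<And>L. L \<ge> L2 \<Longrightarrow> measure M0 {\<omega> \<in> space M0. \<exists>k<K. \<exists>b\<in>Basis. L < \<bar>Z0 k \<omega> \<bullet> b\<bar>} \<le> \<eta>"
      using single_law_tight[of M0 Z0, OF M0 Z0 \<eta>(1)] by blast
    define L where "L = max 1 (max L1 L2)"
    have L: "L > 0" "L \<ge> L1" "L \<ge> L2" by (auto simp: L_def)
    obtain h where h: "trig_poly K h" "\<And>z. \<bar>h z\<bar> \<le> B + e"
      "\<And>z. (\<And>k b. k < K \<Longrightarrow> b \<in> Basis \<Longrightarrow> \<bar>z k \<bullet> b\<bar> \<le> L) \<Longrightarrow> \<bar>h z - G z\<bar> \<le> e"
      using trig_poly_approximation[OF G L(1) e(1)] by blast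
    have hb: "\<bar>h z\<bar> \<le> B + 1" "\<bar>G z\<bar> \<le> B + 1" for z using h(2)[of z] G(2)[of z] e by auto
    note hc = trig_poly_continuous[OF h(1)]
    have near: "\<forall>\<^sub>F i in F. \<bar>(\<integral>\<omega>. h (\<lambda>k. Z i k \<omega>) \<partial>M i) - (\<integral>\<omega>. G (\<lambda>k. Z i k \<omega>) \<partial>M i)\<bar> \<le> \<delta> / 8"
      using M L1[OF L(2)]
    proof eventually_elim
      case (elim i)
      then have [measurable]: "\<And>k. Z i k \<in> borel_measurable (M i)" by blast
      let ?A = "{\<omega> \<in> space (M i). \<exists>k<K. \<exists>b\<in>Basis. L < \<bar>Z i k \<omega> \<bullet> b\<bar>}"
      have A: "?A \<in> sets (M i)" by measurable
      have "\<bar>(\<integral>\<omega>. h (\<lambda>k. Z i k \<omega>) \<partial>M i) - (\<integral>\<omega>. G (\<lambda>k. Z i k \<omega>) \<partial>M i)\<bar> \<le> e + 2 * (B + 1) * \<eta>"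
      proof (rule integral_approximation[OF _ _ _ A])
        from elim have prob: "prob_space (M i)" and small: "measure (M i) ?A \<le> \<eta>" by blast+
        have mm: "(\<lambda>\<omega>. h (\<lambda>k. Z i k \<omega>)) \<in> borel_measurable (M i)" "(\<lambda>\<omega>. G (\<lambda>k. Z i k \<omega>)) \<in> borel_measurable (M i)"
          by (rule measurable_sequence_functional[OF hc] measurable_sequence_functional[OF G(1)]; simp)+
        show "prob_space (M i)" by (rule prob)
        show "(\<lambda>\<omega>. h (\<lambda>k. Z i k \<omega>)) \<in> borel_measurable (M i)" "(\<lambda>\<omega>. G (\<lambda>k. Z i k \<omega>)) \<in> borel_measurable (M i)"
          by (rule mm)+
        show "measure (M i) ?A \<le> \<eta>" by (rule small)
        show "0 \<le> e" using e by simp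
        fix \<omega>
        show "\<bar>h (\<lambda>k. Z i k \<omega>)\<bar> \<le> B + 1" "\<bar>G (\<lambda>k. Z i k \<omega>)\<bar> \<le> B + 1" by (rule hb)+
        assume "\<omega> \<in> space (M i) - ?A"
        then show "\<bar>h (\<lambda>k. Z i k \<omega>) - G (\<lambda>k. Z i k \<omega>)\<bar> \<le> e" by (intro h(3)) force
      qed
      then show ?case using \<eta> e by linarith
    qed
    have near0: "\<bar>(\<integral>\<omega>. h (\<lambda>k. Z0 k \<omega>) \<partial>M0) - (\<integral>\<omega>. G (\<lambda>k. Z0 k \<omega>) \<partial>M0)\<bar> \<le> \<delta> / 8"
    proof -
      have [measurable]: "\<And>k. Z0 k \<in> borel_measurable M0" by (rule Z0)
      let ?A = "{\<omega> \<in> space M0. \<exists>k<K. \<exists>b\<in>Basis. L < \<bar>Z0 k \<omega> \<bullet> b\<bar>}"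
      have A: "?A \<in> sets M0" by measurable
      have "\<bar>(\<integral>\<omega>. h (\<lambda>k. Z0 k \<omega>) \<partial>M0) - (\<integral>\<omega>. G (\<lambda>k. Z0 k \<omega>) \<partial>M0)\<bar> \<le> e + 2 * (B + 1) * \<eta>"
      proof (rule integral_approximation[OF M0 measurable_sequence_functional[OF hc Z0]
        measurable_sequence_functional[OF G(1) Z0] A])
        fix \<omega> assume "\<omega> \<in> space M0 - ?A"
        then show "\<bar>h (\<lambda>k. Z0 k \<omega>) - G (\<lambda>k. Z0 k \<omega>)\<bar> \<le> e" by (intro h(3)) force
      qed (use e hb L2[OF L(3)] in auto)
      then show ?thesis using \<eta> e by linarith
    qed
    have "\<forall>\<^sub>F i in F. dist (\<integral>\<omega>. h (\<lambda>k. Z i k \<omega>) \<partial>M i) (\<integral>\<omega>. h (\<lambda>k. Z0 k \<omega>) \<partial>M0) < \<delta> / 8"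
      using tendstoD[OF conv[OF h(1)], of "\<delta> / 8"] \<delta> by simp
    with near show "\<forall>\<^sub>F i in F. dist (\<integral>\<omega>. G (\<lambda>k. Z i k \<omega>) \<partial>M i) (\<integral>\<omega>. G (\<lambda>k. Z0 k \<omega>) \<partial>M0) < \<delta>"
    proof eventually_elim
      case (elim i)
      then show ?case using near0 \<delta> unfolding dist_real_def by linarith
    qed
  qed
qed

section \<open>Independence and maximal inequalities\<close>

context prob_space
begin

text \<open>Events on which both components lie in given sets form an intersection-stable generator
  of the algebra of a pair. On these the product rule follows from independence inside each sequence
  together with independence of the two sequences.\<close>

lemma indep_vars_pair_sequences:
  assumes \<tau>: "indep_vars (\<lambda>_. borel) \<tau> (UNIV :: nat set)" and D: "indep_vars (\<lambda>_. N) D (UNIV :: nat set)"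
    and ind: "indep_set
          (sets (vimage_algebra (space M) (\<lambda>\<omega> k. \<tau> k \<omega>) (\<Pi>\<^sub>M k\<in>UNIV. borel)))
          (sets (vimage_algebra (space M) (\<lambda>\<omega> k. D k \<omega>) (\<Pi>\<^sub>M k\<in>UNIV. N)))"
  shows "indep_vars (\<lambda>_. borel \<Otimes>\<^sub>M N) (\<lambda>k \<omega>. (\<tau> k \<omega> :: real, D k \<omega>)) (UNIV :: nat set)"
    and "S \<in> sets borel \<Longrightarrow> T \<in> sets N \<Longrightarrow>
      prob ((\<tau> k -` S \<inter> space M) \<inter> (D k -` T \<inter> space M)) = prob (\<tau> k -` S \<inter> space M) * prob (D k -` T \<inter> space M)"
proof -
  have \<tau>m [measurable]: "\<tau> k \<in> borel_measurable M" for k using \<tau> unfolding indep_vars_def by auto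
  have Dm [measurable]: "D k \<in> measurable M N" for k using D unfolding indep_vars_def by auto
  \<comment> \<open>Preimages of rectangles, the generator to which the extension theorem for
    independence is applied.\<close>
  define G where "G k = {(\<tau> k -` A \<inter> space M) \<inter> (D k -` B \<inter> space M) | A B. A \<in> sets borel \<and> B \<in> sets N}" for k
  have Gsub: "G k \<subseteq> events" for k unfolding G_def using measurable_sets[OF \<tau>m] measurable_sets[OF Dm]
    by (blast intro: sets.Int)
  have split: "prob (\<Inter>j\<in>J. (\<tau> j -` a j \<inter> space M) \<inter> (D j -` b j \<inter> space M))
     = (\<Prod>j\<in>J. prob (\<tau> j -` a j \<inter> space M)) * (\<Prod>j\<in>J. prob (D j -` b j \<inter> space M))"
    if J: "J \<noteq> {}" "finite J" and ab: "\<And>j. j \<in> J \<Longrightarrow> a j \<in> sets borel" "\<And>j. j \<in> J \<Longrightarrow> b j \<in> sets N" for J :: "nat set"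
      and a b
  proof -
    let ?T = "\<Inter>j\<in>J. \<tau> j -` a j \<inter> space M" and ?U = "\<Inter>j\<in>J. D j -` b j \<inter> space M"
    have D_sp: "D k \<omega> \<in> space N" if "\<omega> \<in> space M" for k \<omega> using measurable_space[OF Dm that] .
    \<comment> \<open>An event about finitely many waiting times is the preimage of a cylinder of
      the whole sequence, which places it in the algebra that occurs in the hypothesis.\<close>
    have "?T = (\<lambda>\<omega> k. \<tau> k \<omega>) -` {x \<in> space (\<Pi>\<^sub>M k\<in>UNIV. borel). \<forall>j\<in>J. x j \<in> a j} \<inter> space M"
      using J by (auto simp: space_PiM PiE_def)
    note eqT = this
    have "{x \<in> space (\<Pi>\<^sub>M k\<in>UNIV. borel). \<forall>j\<in>J. x j \<in> a j} \<in> sets (\<Pi>\<^sub>M k\<in>(UNIV :: nat set). borel)"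
      using J ab by (intro sets.sets_Collect_finite_All) (auto intro!: measurable_sets_Collect)
    then have T: "?T \<in> sets (vimage_algebra (space M) (\<lambda>\<omega> k. \<tau> k \<omega>) (\<Pi>\<^sub>M k\<in>UNIV. borel))"
      unfolding eqT by (rule in_vimage_algebra)
    have "?U = (\<lambda>\<omega> k. D k \<omega>) -` {x \<in> space (\<Pi>\<^sub>M k\<in>UNIV. N). \<forall>j\<in>J. x j \<in> b j} \<inter> space M"
      using J D_sp by (auto simp: space_PiM PiE_def)
    note eqU = this
    have "{x \<in> space (\<Pi>\<^sub>M k\<in>UNIV. N). \<forall>j\<in>J. x j \<in> b j} \<in> sets (\<Pi>\<^sub>M k\<in>(UNIV :: nat set). N)"
      using J ab by (intro sets.sets_Collect_finite_All) (auto intro!: measurable_sets_Collect)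
    then have U: "?U \<in> sets (vimage_algebra (space M) (\<lambda>\<omega> k. D k \<omega>) (\<Pi>\<^sub>M k\<in>UNIV. N))"
      unfolding eqU by (rule in_vimage_algebra)
    have "(\<Inter>j\<in>J. (\<tau> j -` a j \<inter> space M) \<inter> (D j -` b j \<inter> space M)) = ?T \<inter> ?U" by auto
    moreover have "prob (?T \<inter> ?U) = prob ?T * prob ?U" by (rule indep_setD[OF ind T U])
    moreover have "prob ?T = (\<Prod>j\<in>J. prob (\<tau> j -` a j \<inter> space M))"
      by (rule indep_varsD[OF \<tau>]) (use J ab in auto)
    moreover have "prob ?U = (\<Prod>j\<in>J. prob (D j -` b j \<inter> space M))"
      by (rule indep_varsD[OF D]) (use J ab in auto)
    ultimately show ?thesis by simp
  qed
  have "indep_sets G UNIV"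
    unfolding indep_sets_def
  proof (intro conjI ballI allI impI)
    fix J A assume J: "J \<noteq> {}" "finite J" and A: "A \<in> Pi J G"
    have "\<forall>j\<in>J. \<exists>a b. A j = (\<tau> j -` a \<inter> space M) \<inter> (D j -` b \<inter> space M) \<and> a \<in> sets borel \<and> b \<in> sets N"
      using A unfolding G_def Pi_def by blast
    then obtain a b where ab: "\<And>j. j \<in> J \<Longrightarrow> A j = (\<tau> j -` a j \<inter> space M) \<inter> (D j -` b j \<inter> space M)"
      "\<And>j. j \<in> J \<Longrightarrow> a j \<in> sets borel" "\<And>j. j \<in> J \<Longrightarrow> b j \<in> sets N" by metis
    have "prob (\<Inter>j\<in>J. A j) = prob (\<Inter>j\<in>J. (\<tau> j -` a j \<inter> space M) \<inter> (D j -` b j \<inter> space M))"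
      using ab(1) by simp
    also have "\<dots> = (\<Prod>j\<in>J. prob (\<tau> j -` a j \<inter> space M) * prob (D j -` b j \<inter> space M))"
      by (subst split[OF J ab(2,3)]) (simp_all add: prod.distrib)
    also have "\<dots> = (\<Prod>j\<in>J. prob (A j))"
    proof (rule prod.cong[OF refl])
      fix j assume j: "j \<in> J"
      show "prob (\<tau> j -` a j \<inter> space M) * prob (D j -` b j \<inter> space M) = prob (A j)"
        using split[of "{j}" a b] ab j by simp
    qed
    finally show "prob (\<Inter>j\<in>J. A j) = (\<Prod>j\<in>J. prob (A j))" .
  qed (use Gsub in auto)
  moreover have "Int_stable (G k)" for k
    unfolding Int_stable_def
  proof (intro ballI)
    fix X Y assume "X \<in> G k" "Y \<in> G k"
    then obtain A B A' B' where "X = (\<tau> k -` A \<inter> space M) \<inter> (D k -` B \<inter> space M)" "A \<in> sets borel" "B \<in> sets N"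
      "Y = (\<tau> k -` A' \<inter> space M) \<inter> (D k -` B' \<inter> space M)" "A' \<in> sets borel" "B' \<in> sets N" unfolding G_def by blast
    then show "X \<inter> Y \<in> G k" unfolding G_def
      by (intro CollectI exI[of _ "A \<inter> A'"] exI[of _ "B \<inter> B'"]) auto
  qed
  ultimately have ind2: "indep_sets (\<lambda>k. sigma_sets (space M) (G k)) UNIV" by (rule indep_sets_sigma)
  have "{(\<lambda>\<omega>. (\<tau> k \<omega>, D k \<omega>)) -` C \<inter> space M | C. C \<in> sets (borel \<Otimes>\<^sub>M N)} \<subseteq> sigma_sets (space M) (G k)" for k
  proof -
    let ?S = "sigma (space M) (G k)"
    have GP: "G k \<subseteq> Pow (space M)" by (auto simp: G_def)
    have "\<tau> k \<in> measurable ?S borel"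
    proof (rule measurableI)
      fix A :: "real set" assume "A \<in> sets borel"
      then have "(\<tau> k -` A \<inter> space M) \<inter> (D k -` space N \<inter> space M) \<in> G k" unfolding G_def by blast
      moreover have "(\<tau> k -` A \<inter> space M) \<inter> (D k -` space N \<inter> space M) = \<tau> k -` A \<inter> space M"
        using measurable_space[OF Dm] by auto
      ultimately show "\<tau> k -` A \<inter> space ?S \<in> sets ?S" using GP by (auto simp: space_measure_of_conv)
    qed simp
    moreover have "D k \<in> measurable ?S N"
    proof (rule measurableI)
      fix B assume "B \<in> sets N"
      then have "(\<tau> k -` UNIV \<inter> space M) \<inter> (D k -` B \<inter> space M) \<in> G k" unfolding G_def
        by (intro CollectI exI[of _ UNIV] exI[of _ B]) simp
      moreover have "(\<tau> k -` UNIV \<inter> space M) \<inter> (D k -` B \<inter> space M) = D k -` B \<inter> space M" by auto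
      ultimately show "D k -` B \<inter> space ?S \<in> sets ?S" using GP by (auto simp: space_measure_of_conv)
    qed (use measurable_space[OF Dm] in \<open>auto simp: space_measure_of_conv\<close>)
    ultimately have "(\<lambda>\<omega>. (\<tau> k \<omega>, D k \<omega>)) \<in> measurable ?S (borel \<Otimes>\<^sub>M N)" by (rule measurable_Pair)
    from measurable_sets[OF this] show ?thesis using GP by (force simp: space_measure_of_conv)
  qed
  then have "indep_sets (\<lambda>k. {(\<lambda>\<omega>. (\<tau> k \<omega>, D k \<omega>)) -` C \<inter> space M | C. C \<in> sets (borel \<Otimes>\<^sub>M N)}) UNIV"
    by (rule indep_sets_mono_sets[OF ind2])
  then show "indep_vars (\<lambda>_. borel \<Otimes>\<^sub>M N) (\<lambda>k \<omega>. (\<tau> k \<omega>, D k \<omega>)) UNIV" unfolding indep_vars_def2 by auto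
  show "S \<in> sets borel \<Longrightarrow> T \<in> sets N \<Longrightarrow>
      prob ((\<tau> k -` S \<inter> space M) \<inter> (D k -` T \<inter> space M)) = prob (\<tau> k -` S \<inter> space M) * prob (D k -` T \<inter> space M)"
    using split[of "{k}" "\<lambda>_. S" "\<lambda>_. T"] by simp
qed

lemma integrable_power_le_4:
  fixes X :: "'a \<Rightarrow> real"
  assumes X: "X \<in> borel_measurable M" "integrable M (\<lambda>\<omega>. X \<omega> ^ 4)" and k: "k \<le> 4"
  shows "integrable M (\<lambda>\<omega>. X \<omega> ^ k)"
proof (rule Bochner_Integration.integrable_bound[of _ "\<lambda>\<omega>. 1 + X \<omega> ^ 4"])
  show "AE \<omega> in M. norm (X \<omega> ^ k) \<le> norm (1 + X \<omega> ^ 4)"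
  proof (rule AE_I2)
    fix \<omega>
    have "\<bar>X \<omega>\<bar> ^ k \<le> 1 + \<bar>X \<omega>\<bar> ^ 4"
    proof (cases "\<bar>X \<omega>\<bar> \<le> 1")
      case True
      then have "\<bar>X \<omega>\<bar> ^ k \<le> 1" by (simp add: power_le_one)
      then show ?thesis by (smt (verit) zero_le_power abs_ge_zero)
    next
      case False
      then show ?thesis using power_increasing[OF k, of "\<bar>X \<omega>\<bar>"] by simp
    qed
    then show "norm (X \<omega> ^ k) \<le> norm (1 + X \<omega> ^ 4)" by (simp add: power_abs)
  qed
qed (use X in auto)

text \<open>In the expansion of the fourth power the terms with a first power vanish by independence
  and zero mean, so only \<open>6 * E (U^2) * E (S^2)\<close> is added to the two fourth moments.
  The mean and the second moment are carried along for this purpose.\<close>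

lemma fourth_moment_sum:
  fixes U :: "nat \<Rightarrow> 'a \<Rightarrow> real" and s q :: real
  assumes U: "indep_vars (\<lambda>_. borel) U UNIV"
    and i4: "\<And>j. integrable M (\<lambda>\<omega>. U j \<omega> ^ 4)" and m1: "\<And>j. expectation (U j) = 0"
    and m2: "\<And>j. expectation (\<lambda>\<omega>. U j \<omega> ^ 2) \<le> s" and m4: "\<And>j. expectation (\<lambda>\<omega>. U j \<omega> ^ 4) \<le> q"
    and J: "finite J"
  shows "integrable M (\<lambda>\<omega>. (\<Sum>j\<in>J. U j \<omega>) ^ 4) \<and> expectation (\<lambda>\<omega>. \<Sum>j\<in>J. U j \<omega>) = 0 \<and>
     expectation (\<lambda>\<omega>. (\<Sum>j\<in>J. U j \<omega>) ^ 2) \<le> card J * s \<and>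
     expectation (\<lambda>\<omega>. (\<Sum>j\<in>J. U j \<omega>) ^ 4) \<le> card J * q + 3 * (card J)\<^sup>2 * s\<^sup>2"
  using J
proof (induction J rule: finite_induct)
  case empty then show ?case by simp
next
  case (insert j J)
  have Um [measurable]: "U k \<in> borel_measurable M" for k using U unfolding indep_vars_def by auto
  define S where "S \<omega> = (\<Sum>j\<in>J. U j \<omega>)" for \<omega>
  have Sm [measurable]: "S \<in> borel_measurable M" unfolding S_def by measurable
  have s: "s \<ge> 0" by (rule order.trans[OF _ m2[of 0]]) (rule Bochner_Integration.integral_nonneg, simp)
  have IH: "integrable M (\<lambda>\<omega>. S \<omega> ^ 4)" "expectation S = 0" "expectation (\<lambda>\<omega>. S \<omega> ^ 2) \<le> card J * s"
    "expectation (\<lambda>\<omega>. S \<omega> ^ 4) \<le> card J * q + 3 * (card J)\<^sup>2 * s\<^sup>2"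
    using insert.IH unfolding S_def[abs_def] by auto
  have ind: "indep_var borel (U j) borel S"
    unfolding S_def by (rule indep_vars_sum[OF insert.hyps(1,2) indep_vars_subset[OF U]]) simp
  have indp: "indep_var borel (\<lambda>\<omega>. U j \<omega> ^ a) borel (\<lambda>\<omega>. S \<omega> ^ b)" for a b
    using indep_var_compose[OF ind, of "\<lambda>x. x ^ a" borel "\<lambda>x. x ^ b" borel] by (simp add: comp_def)
  have iU: "integrable M (\<lambda>\<omega>. U j \<omega> ^ a)" if "a \<le> 4" for a by (rule integrable_power_le_4[OF Um i4 that])
  have iS: "integrable M (\<lambda>\<omega>. S \<omega> ^ a)" if "a \<le> 4" for a by (rule integrable_power_le_4[OF Sm IH(1) that])
  have prod: "expectation (\<lambda>\<omega>. U j \<omega> ^ a * S \<omega> ^ b) = expectation (\<lambda>\<omega>. U j \<omega> ^ a) * expectation (\<lambda>\<omega>. S \<omega> ^ b)"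
    and iprod: "integrable M (\<lambda>\<omega>. U j \<omega> ^ a * S \<omega> ^ b)" if "a \<le> 4" "b \<le> 4" for a b
    using indep_var_lebesgue_integral[OF indp iU[OF that(1)] iS[OF that(2)]]
      indep_var_integrable[OF indp iU[OF that(1)] iS[OF that(2)]] by auto
  have eq: "(\<Sum>i\<in>insert j J. U i \<omega>) = U j \<omega> + S \<omega>" for \<omega> using insert.hyps by (simp add: S_def)
  have e4: "(U j \<omega> + S \<omega>) ^ 4 = U j \<omega> ^ 4 + 4 * (U j \<omega> ^ 3 * S \<omega> ^ 1) + 6 * (U j \<omega> ^ 2 * S \<omega> ^ 2) + 4
    * (U j \<omega> ^ 1 * S \<omega> ^ 3) + S \<omega> ^ 4" for \<omega>
    by (simp add: power4_eq_xxxx power3_eq_cube power2_eq_square algebra_simps)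
  have e2: "(U j \<omega> + S \<omega>) ^ 2 = U j \<omega> ^ 2 + 2 * (U j \<omega> ^ 1 * S \<omega> ^ 1) + S \<omega> ^ 2" for \<omega>
    by (simp add: power2_eq_square algebra_simps)
  have "integrable M (\<lambda>\<omega>. (U j \<omega> + S \<omega>) ^ 4)"
    unfolding e4 by (intro Bochner_Integration.integrable_add integrable_mult_right iprod iU iS) auto
  moreover have "expectation (\<lambda>\<omega>. U j \<omega> + S \<omega>) = 0"
    using iU[of 1] iS[of 1] IH(2) m1[of j] by simp
  moreover have "expectation (\<lambda>\<omega>. (U j \<omega> + S \<omega>) ^ 2) \<le> card (insert j J) * s"
  proof -
    have "expectation (\<lambda>\<omega>. (U j \<omega> + S \<omega>) ^ 2) = expectation (\<lambda>\<omega>. U j \<omega> ^ 2) + 2 * expectation (\<lambda>\<omega>. U j \<omega> ^ 1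
      * S \<omega> ^ 1) + expectation (\<lambda>\<omega>. S \<omega> ^ 2)"
      unfolding e2 using iU[of 2] iS[of 2] iprod[of 1 1] by simp
    also have "expectation (\<lambda>\<omega>. U j \<omega> ^ 1 * S \<omega> ^ 1) = 0" using prod[of 1 1] m1[of j] by simp
    finally show ?thesis using m2[of j] IH(3) insert.hyps by (simp add: algebra_simps)
  qed
  moreover have "expectation (\<lambda>\<omega>. (U j \<omega> + S \<omega>) ^ 4) \<le> card (insert j J) * q + 3 * (card (insert j J))\<^sup>2 * s\<^sup>2"
  proof -
    let ?k = "real (card J)"
    have "expectation (\<lambda>\<omega>. (U j \<omega> + S \<omega>) ^ 4) = expectation (\<lambda>\<omega>. U j \<omega> ^ 4) + 4 * expectation (\<lambda>\<omega>. U j \<omega> ^ 3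
      * S \<omega> ^ 1)
       + 6 * expectation (\<lambda>\<omega>. U j \<omega> ^ 2 * S \<omega> ^ 2) + 4 * expectation (\<lambda>\<omega>. U j \<omega> ^ 1 * S \<omega> ^ 3) + expectation
         (\<lambda>\<omega>. S \<omega> ^ 4)"
      unfolding e4 using iU[of 4] iS[of 4] iprod[of 3 1] iprod[of 2 2] iprod[of 1 3] by simp
    also have "\<dots> = expectation (\<lambda>\<omega>. U j \<omega> ^ 4) + 6 * (expectation (\<lambda>\<omega>. U j \<omega> ^ 2) * expectation (\<lambda>\<omega>. S \<omega> ^ 2))
      + expectation (\<lambda>\<omega>. S \<omega> ^ 4)"
      using prod[of 3 1] prod[of 2 2] prod[of 1 3] m1[of j] IH(2) by simp
    also have "\<dots> \<le> q + 6 * (s * (?k * s)) + (?k * q + 3 * ?k\<^sup>2 * s\<^sup>2)"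
      using m4[of j] m2[of j] IH(3,4) s
      by (intro add_mono mult_left_mono mult_mono) (auto intro!: integral_nonneg)
    \<comment> \<open>The induction closes because
      \<open>3 * k^2 + 6 * k \<le> 3 * (k + 1)^2\<close>.\<close>
    also have "\<dots> \<le> real (card (insert j J)) * q + 3 * (real (card (insert j J)))\<^sup>2 * s\<^sup>2"
      using insert.hyps by (simp add: power2_eq_square algebra_simps)
    finally show ?thesis by simp
  qed
  ultimately show ?case unfolding eq by blast
qed

text \<open>Split by the first index at which the partial sum exceeds \<open>2 * \<eta>\<close>. The
  remaining sum is independent of the past and with probability at least 1/2 not larger than
  \<open>\<eta>\<close>; then the full sum still exceeds \<open>\<eta>\<close>.\<close>

lemma ottaviani:
  fixes U :: "nat \<Rightarrow> 'a \<Rightarrow> real"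
  assumes U: "indep_vars (\<lambda>_. borel) U UNIV" and \<eta>: "\<eta> > 0"
    and half: "\<And>k. a \<le> k \<Longrightarrow> k \<le> b \<Longrightarrow> prob {\<omega> \<in> space M. \<eta> < \<bar>\<Sum>j=k..<b. U j \<omega>\<bar>} \<le> 1 / 2"
  shows "prob {\<omega> \<in> space M. \<exists>k\<in>{a..b}. 2 * \<eta> < \<bar>\<Sum>j=a..<k. U j \<omega>\<bar>} \<le> 2 * prob {\<omega> \<in> space M. \<eta> < \<bar>\<Sum>j=a..<b. U j \<omega>\<bar>}"
proof -
  have Um [measurable]: "U k \<in> borel_measurable M" for k using U unfolding indep_vars_def by auto
  define A where "A k = {\<omega> \<in> space M. 2 * \<eta> < \<bar>\<Sum>j=a..<k. U j \<omega>\<bar> \<and> (\<forall>i\<in>{a..<k}. \<bar>\<Sum>j=a..<i. U j \<omega>\<bar> \<le> 2 * \<eta>)}" for k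
  define B where "B k = {\<omega> \<in> space M. \<bar>\<Sum>j=k..<b. U j \<omega>\<bar> \<le> \<eta>}" for k
  have Am [measurable]: "A k \<in> events" and Bm [measurable]: "B k \<in> events" for k unfolding A_def B_def by measurable
  have disj: "disjoint_family_on A {a..b}"
    unfolding disjoint_family_on_def
  proof (intro ballI impI)
    fix m n assume mn: "m \<in> {a..b}" "n \<in> {a..b}" "m \<noteq> n"
    have "A m \<inter> A n = {}" if "m < n" "m \<in> {a..b}" for m n using that by (force simp: A_def)
    then show "A m \<inter> A n = {}" using mn by (metis inf_commute linorder_neqE_nat)
  qed
  have union: "{\<omega> \<in> space M. \<exists>k\<in>{a..b}. 2 * \<eta> < \<bar>\<Sum>j=a..<k. U j \<omega>\<bar>} \<subseteq> (\<Union>k\<in>{a..b}. A k)"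
  proof
    fix \<omega> assume \<omega>: "\<omega> \<in> {\<omega> \<in> space M. \<exists>k\<in>{a..b}. 2 * \<eta> < \<bar>\<Sum>j=a..<k. U j \<omega>\<bar>}"
    define k where "k = (LEAST k. k \<in> {a..b} \<and> 2 * \<eta> < \<bar>\<Sum>j=a..<k. U j \<omega>\<bar>)"
    have k: "k \<in> {a..b} \<and> 2 * \<eta> < \<bar>\<Sum>j=a..<k. U j \<omega>\<bar>"
      unfolding k_def by (rule LeastI_ex) (use \<omega> in blast)
    have "\<bar>\<Sum>j=a..<i. U j \<omega>\<bar> \<le> 2 * \<eta>" if i: "i \<in> {a..<k}" for i
    proof (rule ccontr)
      assume "\<not> \<bar>\<Sum>j=a..<i. U j \<omega>\<bar> \<le> 2 * \<eta>"
      then have "k \<le> i" unfolding k_def by (intro Least_le) (use i k in auto)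
      then show False using i by auto
    qed
    then show "\<omega> \<in> (\<Union>k\<in>{a..b}. A k)" using k \<omega> by (auto simp: A_def)
  qed
  have step: "prob (A k) / 2 \<le> prob (A k \<inter> B k)" if k: "k \<in> {a..b}" for k
  proof -
    \<comment> \<open>\<open>A k\<close> is decided by the variables before \<open>k\<close> and
      \<open>B k\<close> by those from \<open>k\<close> on; both are written as preimages under the
      two restricted families.\<close>
    have iv: "indep_var (PiM {a..<k} (\<lambda>_. borel)) (\<lambda>\<omega>. restrict (\<lambda>i. U i \<omega>) {a..<k})
        (PiM {k..<b} (\<lambda>_. borel)) (\<lambda>\<omega>. restrict (\<lambda>i. U i \<omega>) {k..<b})"
      by (rule indep_var_restrict[OF U]) auto
    let ?XA = "{x \<in> space (PiM {a..<k} (\<lambda>_. borel)). 2 * \<eta> < \<bar>\<Sum>j=a..<k. x j\<bar> \<and> (\<forall>i\<in>{a..<k}. \<bar>\<Sum>j=a..<i. x j\<bar> \<le> 2 * \<eta>)}"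
    let ?XB = "{x \<in> space (PiM {k..<b} (\<lambda>_. borel)). \<bar>\<Sum>j=k..<b. x j\<bar> \<le> \<eta>}"
    have sm: "(\<lambda>x :: nat \<Rightarrow> real. \<Sum>j=l..<i. x j) \<in> borel_measurable (PiM {l..<m} (\<lambda>_. borel))" if "i \<le> m"
      for l i m :: nat
      using that by (intro borel_measurable_sum measurable_component_singleton) auto
    have [measurable]: "(\<lambda>x :: nat \<Rightarrow> real. \<Sum>j=a..<i. x j) \<in> borel_measurable (PiM {a..<k} (\<lambda>_. borel))"
      if "i \<in> {a..<k}" for i
      using that by (intro sm) auto
    have [measurable]: "(\<lambda>x :: nat \<Rightarrow> real. \<Sum>j=a..<k. x j) \<in> borel_measurable (PiM {a..<k} (\<lambda>_. borel))"
      by (intro sm) auto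
    have [measurable]: "(\<lambda>x :: nat \<Rightarrow> real. \<Sum>j=k..<b. x j) \<in> borel_measurable (PiM {k..<b} (\<lambda>_. borel))"
      by (intro sm) auto
    have XA: "?XA \<in> sets (PiM {a..<k} (\<lambda>_. borel))" by measurable
    have XB: "?XB \<in> sets (PiM {k..<b} (\<lambda>_. borel))" by measurable
    have eA: "(\<lambda>\<omega>. restrict (\<lambda>i. U i \<omega>) {a..<k}) -` ?XA \<inter> space M = A k"
    proof -
      have "(\<Sum>j=a..<i. restrict (\<lambda>i. U i \<omega>) {a..<k} j) = (\<Sum>j=a..<i. U j \<omega>)" if "i \<le> k" for i \<omega>
        using that by (intro sum.cong) auto
      then show ?thesis by (auto simp: A_def space_PiM)
    qed
    have eB: "(\<lambda>\<omega>. restrict (\<lambda>i. U i \<omega>) {k..<b}) -` ?XB \<inter> space M = B k"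
      by (auto simp: B_def space_PiM)
    have "prob ((\<lambda>\<omega>. (restrict (\<lambda>i. U i \<omega>) {a..<k}, restrict (\<lambda>i. U i \<omega>) {k..<b})) -` (?XA \<times> ?XB) \<inter> space M)
       = prob (A k) * prob (B k)"
      using indep_varD[OF iv XA XB] unfolding eA eB .
    moreover have "(\<lambda>\<omega>. (restrict (\<lambda>i. U i \<omega>) {a..<k}, restrict (\<lambda>i. U i \<omega>) {k..<b})) -` (?XA \<times> ?XB) \<inter> space M
      = A k \<inter> B k"
      using eA eB by blast
    ultimately have "prob (A k \<inter> B k) = prob (A k) * prob (B k)" by simp
    moreover have "prob (B k) \<ge> 1 / 2"
    proof -
      have "B k = space M - {\<omega> \<in> space M. \<eta> < \<bar>\<Sum>j=k..<b. U j \<omega>\<bar>}" by (auto simp: B_def)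
      then have "prob (B k) = 1 - prob {\<omega> \<in> space M. \<eta> < \<bar>\<Sum>j=k..<b. U j \<omega>\<bar>}" by (simp add: prob_compl)
      then show ?thesis using half[of k] k by simp
    qed
    ultimately show ?thesis using mult_left_mono[of "1 / 2" "prob (B k)" "prob (A k)"] by simp
  qed
  have sub: "(\<Union>k\<in>{a..b}. A k \<inter> B k) \<subseteq> {\<omega> \<in> space M. \<eta> < \<bar>\<Sum>j=a..<b. U j \<omega>\<bar>}"
  proof
    fix \<omega> assume "\<omega> \<in> (\<Union>k\<in>{a..b}. A k \<inter> B k)"
    then obtain k where k: "a \<le> k" "k \<le> b" "\<omega> \<in> A k" "\<omega> \<in> B k" by auto
    have "(\<Sum>j=a..<b. U j \<omega>) = (\<Sum>j=a..<k. U j \<omega>) + (\<Sum>j=k..<b. U j \<omega>)"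
      using k by (simp add: sum.atLeastLessThan_concat)
    then show "\<omega> \<in> {\<omega> \<in> space M. \<eta> < \<bar>\<Sum>j=a..<b. U j \<omega>\<bar>}" using k(3,4) by (auto simp: A_def B_def)
  qed
  have "prob {\<omega> \<in> space M. \<exists>k\<in>{a..b}. 2 * \<eta> < \<bar>\<Sum>j=a..<k. U j \<omega>\<bar>} \<le> prob (\<Union>k\<in>{a..b}. A k)"
    by (rule finite_measure_mono[OF union]) auto
  also have "\<dots> = (\<Sum>k\<in>{a..b}. prob (A k))"
    by (rule finite_measure_finite_Union) (use disj in auto)
  also have "\<dots> \<le> (\<Sum>k\<in>{a..b}. 2 * prob (A k \<inter> B k))" using step by (intro sum_mono) force
  also have "\<dots> = 2 * prob (\<Union>k\<in>{a..b}. A k \<inter> B k)"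
    unfolding sum_distrib_left[symmetric]
    by (subst finite_measure_finite_Union) (use disj in \<open>auto simp: disjoint_family_on_def\<close>)
  also have "\<dots> \<le> 2 * prob {\<omega> \<in> space M. \<eta> < \<bar>\<Sum>j=a..<b. U j \<omega>\<bar>}"
    by (intro mult_left_mono finite_measure_mono[OF sub]) auto
  finally show ?thesis .
qed

lemma fourth_moment_tail:
  fixes X :: "'a \<Rightarrow> real"
  assumes X: "X \<in> borel_measurable M" "integrable M (\<lambda>\<omega>. X \<omega> ^ 4)" and \<eta>: "\<eta> > 0"
  shows "prob {\<omega> \<in> space M. \<eta> < \<bar>X \<omega>\<bar>} \<le> expectation (\<lambda>\<omega>. X \<omega> ^ 4) / \<eta> ^ 4"
proof -
  have [measurable]: "X \<in> borel_measurable M" by fact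
  have "\<eta> ^ 4 \<le> X \<omega> ^ 4" if "\<eta> < \<bar>X \<omega>\<bar>" for \<omega>
    using power_mono[of \<eta> "\<bar>X \<omega>\<bar>" 4] that \<eta> by (simp add: power_abs)
  then have "prob {\<omega> \<in> space M. \<eta> < \<bar>X \<omega>\<bar>} \<le> prob {\<omega> \<in> space M. \<eta> ^ 4 \<le> X \<omega> ^ 4}"
    by (intro finite_measure_mono) auto
  also have "\<dots> \<le> expectation (\<lambda>\<omega>. X \<omega> ^ 4) / \<eta> ^ 4"
    by (rule integral_Markov_inequality_measure[OF X(2)]) (use \<eta> in auto)
  finally show ?thesis .
qed

lemma maximal_fourth_moment:
  fixes U :: "nat \<Rightarrow> 'a \<Rightarrow> real"
  assumes U: "indep_vars (\<lambda>_. borel) U UNIV" and \<eta>: "\<eta> > 0"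
    and i4: "\<And>j. integrable M (\<lambda>\<omega>. U j \<omega> ^ 4)" and m1: "\<And>j. expectation (U j) = 0"
    and m2: "\<And>j. expectation (\<lambda>\<omega>. U j \<omega> ^ 2) \<le> s" and m4: "\<And>j. expectation (\<lambda>\<omega>. U j \<omega> ^ 4) \<le> q"
    and K: "real (b - a) \<le> K"
  shows "prob {\<omega> \<in> space M. \<exists>k\<in>{a..b}. 2 * \<eta> < \<bar>\<Sum>j=a..<k. U j \<omega>\<bar>} \<le> 2 * ((K * q + 3 * K\<^sup>2 * s\<^sup>2) / \<eta> ^ 4)"
proof -
  have Um [measurable]: "U k \<in> borel_measurable M" for k using U unfolding indep_vars_def by auto
  have q: "q \<ge> 0" by (rule order.trans[OF _ m4[of 0]]) (rule Bochner_Integration.integral_nonneg, simp)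
  have s0: "s \<ge> 0" by (rule order.trans[OF _ m2[of 0]]) (rule Bochner_Integration.integral_nonneg, simp)
  let ?Q = "K * q + 3 * K\<^sup>2 * s\<^sup>2"
  have tail: "prob {\<omega> \<in> space M. \<eta> < \<bar>\<Sum>j=k..<b. U j \<omega>\<bar>} \<le> ?Q / \<eta> ^ 4" if "a \<le> k" for k
  proof -
    have k: "real (b - k) \<le> K" "0 \<le> K" using K that by linarith+
    note m = fourth_moment_sum[OF U i4 m1 m2 m4, of "{k..<b}", simplified]
    have "prob {\<omega> \<in> space M. \<eta> < \<bar>\<Sum>j=k..<b. U j \<omega>\<bar>} \<le> expectation (\<lambda>\<omega>. (\<Sum>j=k..<b. U j \<omega>) ^ 4) / \<eta> ^ 4"
      by (rule fourth_moment_tail[OF _ _ \<eta>]) (use m in auto)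
    also have "\<dots> \<le> (real (b - k) * q + 3 * (real (b - k))\<^sup>2 * s\<^sup>2) / \<eta> ^ 4"
      using m \<eta> by (intro divide_right_mono) auto
    also have "\<dots> \<le> ?Q / \<eta> ^ 4"
      using k q s0 \<eta> by (intro divide_right_mono add_mono mult_mono power_mono) auto
    finally show ?thesis .
  qed
  show ?thesis
  \<comment> \<open>If the tail bound is at most 1/2 it supplies the hypothesis of Ottaviani's
    inequality; otherwise the asserted bound exceeds 1.\<close>
  proof (cases "?Q / \<eta> ^ 4 \<le> 1 / 2")
    case True
    have "prob {\<omega> \<in> space M. \<exists>k\<in>{a..b}. 2 * \<eta> < \<bar>\<Sum>j=a..<k. U j \<omega>\<bar>} \<le> 2 * prob {\<omega> \<in> space M. \<eta> < \<bar>\<Sum>j=a..<b. U j \<omega>\<bar>}"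
      by (rule ottaviani[OF U \<eta>]) (rule order.trans[OF tail True])
    also have "\<dots> \<le> 2 * (?Q / \<eta> ^ 4)" by (intro mult_left_mono tail) auto
    finally show ?thesis .
  next
    case False
    then show ?thesis using prob_le_1[of "{\<omega> \<in> space M. \<exists>k\<in>{a..b}. 2 * \<eta> < \<bar>\<Sum>j=a..<k. U j \<omega>\<bar>}"] by linarith
  qed
qed

end

section \<open>Integrals along renewal paths\<close>

definition renewal_time :: "(nat \<Rightarrow> real) \<Rightarrow> nat \<Rightarrow> real" where
  "renewal_time \<tau> k = (\<Sum>j<k. \<tau> j)"

definition renewal_count :: "(nat \<Rightarrow> real) \<Rightarrow> real \<Rightarrow> nat" where
  "renewal_count \<tau> t = card {k. (\<Sum>j\<le>k. \<tau> j) \<le> t}"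

context
  fixes \<tau> :: "nat \<Rightarrow> real"
  assumes pos: "\<And>j. \<tau> j > 0"
begin

lemma renewal_time_less: "i < j \<Longrightarrow> renewal_time \<tau> i < renewal_time \<tau> j"
  using pos by (auto simp: renewal_time_def less_imp_le intro!: sum_strict_mono2)

lemma renewal_time_le: "i \<le> j \<Longrightarrow> renewal_time \<tau> i \<le> renewal_time \<tau> j"
  using renewal_time_less[of i j] by (cases "i = j") auto

lemma renewal_time_less_iff: "renewal_time \<tau> i < renewal_time \<tau> j \<longleftrightarrow> i < j"
  using renewal_time_less renewal_time_le by (meson linorder_not_less)

lemma renewal_time_le_iff: "renewal_time \<tau> i \<le> renewal_time \<tau> j \<longleftrightarrow> i \<le> j"
  using renewal_time_less renewal_time_le by (meson linorder_not_less)

lemma renewal_count_eq: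
  assumes "renewal_time \<tau> k \<le> t" "t < renewal_time \<tau> (Suc k)"
  shows "renewal_count \<tau> t = k"
proof -
  have "(\<Sum>j\<le>i. \<tau> j) \<le> t \<longleftrightarrow> i < k" for i
  proof -
    have eq: "(\<Sum>j\<le>i. \<tau> j) = renewal_time \<tau> (Suc i)" by (simp add: renewal_time_def lessThan_Suc_atMost)
    show ?thesis
    proof
      assume "(\<Sum>j\<le>i. \<tau> j) \<le> t"
      then have "renewal_time \<tau> (Suc i) < renewal_time \<tau> (Suc k)" using assms eq by linarith
      then show "i < k" by (simp add: renewal_time_less_iff)
    next
      assume "i < k"
      then have "renewal_time \<tau> (Suc i) \<le> renewal_time \<tau> k" by (simp add: renewal_time_le_iff)
      then show "(\<Sum>j\<le>i. \<tau> j) \<le> t" using assms eq by linarith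
    qed
  qed
  then show ?thesis by (simp add: renewal_count_def)
qed

lemma has_integral_renewal_path:
  fixes v :: "nat \<Rightarrow> 'a::euclidean_space"
  assumes "renewal_time \<tau> k \<le> t" "t \<le> renewal_time \<tau> (Suc k)"
  shows "((\<lambda>u. v (renewal_count \<tau> u)) has_integral
     ((\<Sum>j<k. \<tau> j *\<^sub>R v j) + (t - renewal_time \<tau> k) *\<^sub>R v k)) {0..t}"
  using assms
proof (induction k arbitrary: t)
  case 0
  have "((\<lambda>u. v 0) has_integral ((t - 0) *\<^sub>R v 0)) {0..t}"
    using has_integral_const_real[of "v 0" 0 t] 0 by (simp add: renewal_time_def)
  \<comment> \<open>The endpoint \<open>t\<close> may be the next renewal time, where the count has
    already jumped; one point does not affect the integral.\<close>
  moreover have "v (renewal_count \<tau> u) = v 0" if "u \<in> {0..t} - {t}" for u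
    using renewal_count_eq[of 0 u] that 0 by (simp add: renewal_time_def)
  ultimately show ?case
    using has_integral_spike_finite[of "{t}" "{0..t}" "\<lambda>u. v (renewal_count \<tau> u)" "\<lambda>u. v 0"]
    by (simp add: renewal_time_def)
next
  case (Suc k)
  let ?T = "renewal_time \<tau> (Suc k)"
  have T0: "0 \<le> ?T" using renewal_time_le[of 0 "Suc k"] by (simp add: renewal_time_def)
  have Tk: "?T - renewal_time \<tau> k = \<tau> k" by (simp add: renewal_time_def)
  have 1: "((\<lambda>u. v (renewal_count \<tau> u)) has_integral (\<Sum>j<Suc k. \<tau> j *\<^sub>R v j)) {0..?T}"
    using Suc.IH[of ?T] renewal_time_le[of k "Suc k"] Tk by simp
  have "((\<lambda>u. v (Suc k)) has_integral ((t - ?T) *\<^sub>R v (Suc k))) {?T..t}"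
    using has_integral_const_real[of "v (Suc k)" ?T t] Suc.prems by simp
  moreover have "v (renewal_count \<tau> u) = v (Suc k)" if "u \<in> {?T..t} - {t}" for u
    using renewal_count_eq[of "Suc k" u] that Suc.prems by simp
  ultimately have 2: "((\<lambda>u. v (renewal_count \<tau> u)) has_integral ((t - ?T) *\<^sub>R v (Suc k))) {?T..t}"
    using has_integral_spike_finite[of "{t}" "{?T..t}" "\<lambda>u. v (renewal_count \<tau> u)" "\<lambda>u. v (Suc k)"] by simp
  show ?case using has_integral_combine[OF T0 Suc.prems(1) 1 2] .
qed

end

lemma measurable_renewal_count:
  assumes "\<And>j. (\<lambda>z. \<tau> z j) \<in> borel_measurable N" "f \<in> borel_measurable N"
  shows "(\<lambda>z. renewal_count (\<tau> z) (f z)) \<in> measurable N (count_space UNIV)"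
  unfolding renewal_count_def
proof (rule measurable_card)
  fix i show "{z \<in> space N. i \<in> {k. (\<Sum>j\<le>k. \<tau> z j) \<le> f z}} \<in> sets N"
    using assms by simp
qed

lemma set_integrable_renewal_path:
  fixes v :: "nat \<Rightarrow> 'a::euclidean_space"
  assumes "\<And>j. norm (v j) \<le> C"
  shows "set_integrable lborel {a..b} (\<lambda>u. v (renewal_count \<tau> u))"
proof -
  have m: "(\<lambda>u. v (renewal_count \<tau> u)) \<in> borel_measurable borel"
    by (rule measurable_compose[OF measurable_renewal_count]) simp_all
  have "integrable lborel (\<lambda>u. indicator {a..b} u *\<^sub>R v (renewal_count \<tau> u))"
  proof (rule Bochner_Integration.integrable_bound[of _ "\<lambda>u. indicator {a..b} u *\<^sub>R C"])
    have "integrable lborel (indicator {a..b} :: real \<Rightarrow> real)"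
      by (rule integrable_real_indicator) (auto simp: emeasure_lborel_Icc_eq)
    then show "integrable lborel (\<lambda>u. indicator {a..b} u *\<^sub>R C)" by simp
    show "(\<lambda>u. indicator {a..b} u *\<^sub>R v (renewal_count \<tau> u)) \<in> borel_measurable lborel" using m by measurable
    show "AE u in lborel. norm (indicator {a..b} u *\<^sub>R v (renewal_count \<tau> u)) \<le> norm (indicator {a..b} u *\<^sub>R C)"
      by (auto simp: indicator_def intro!: AE_I2 order.trans[OF assms abs_ge_self])
  qed
  then show ?thesis by (simp add: set_integrable_def)
qed

text \<open>The waiting times are arbitrary reals here, so the estimate is available at every
  outcome and not only where they are positive; weak convergence as defined demands good paths
  everywhere.\<close>

lemma renewal_path_lipschitz:
  fixes v :: "nat \<Rightarrow> 'a::euclidean_space"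
  assumes v: "\<And>j. norm (v j) \<le> C" and st: "0 \<le> s" "s \<le> t"
  shows "norm ((LINT u:{0..t}|lborel. v (renewal_count \<tau> u)) - (LINT u:{0..s}|lborel. v (renewal_count \<tau> u)))
    \<le> C * (t - s)"
proof -
  let ?g = "\<lambda>u. v (renewal_count \<tau> u)"
  note i = set_integrable_renewal_path[OF v]
  have e: "(LINT u:{a..b}|lborel. ?g u) = integral {a..b} ?g" for a b :: real
    by (rule set_borel_integral_eq_integral(2)[OF i])
  have ii: "?g integrable_on {a..b}" for a b :: real by (rule set_borel_integral_eq_integral(1)[OF i])
  have "integral {0..t} ?g - integral {0..s} ?g = integral {s..t} ?g"
    using Henstock_Kurzweil_Integration.integral_combine[OF st ii] by (simp add: algebra_simps)
  moreover have "norm (integral {s..t} ?g) \<le> C * (t - s)"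
  proof -
    have "C \<ge> 0" using v norm_ge_zero order.trans by blast
    then have "norm (integral {s..t} ?g) \<le> C * measure lborel {s..t}"
      by (rule has_integral_bound_real[OF _ finite.emptyI integrable_integral[OF ii]]) (rule v)
    then show ?thesis using st by simp
  qed
  ultimately show ?thesis unfolding e by simp
qed

text \<open>
  The evolution at time \<open>t\<close> and the walk at the grid index of \<open>t\<close> lie in the same or in adjacent
  blocks, since the renewal times at block ends deviate from the grid by at most half a mesh.
\<close>

lemma renewal_path_approximation:
  fixes \<tau> :: "nat \<Rightarrow> real" and v :: "nat \<Rightarrow> 'a::euclidean_space" and x :: 'a
  defines "W \<equiv> \<lambda>i. \<Sum>j<i. \<tau> (Suc j) *\<^sub>R v (Suc j)"
  assumes pos: "\<And>j. \<tau> j > 0" and v: "\<And>j. norm (v j) \<le> C" and a: "a > 0" and n: "n 0 = 0" "mono n"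
    and first: "norm (\<tau> 0 *\<^sub>R v 0) \<le> \<eta>"
    and times: "\<And>k. k \<le> N + 2 \<Longrightarrow> \<bar>renewal_time \<tau> (Suc (n k)) - real k / a\<bar> \<le> 1 / (2 * a)"
    and blocks: "\<And>k i. k \<le> N + 1 \<Longrightarrow> n k \<le> i \<Longrightarrow> i \<le> n (Suc k) \<Longrightarrow> norm (W i - W (n k)) \<le> \<eta>"
    and t: "0 \<le> t" "nat \<lfloor>a * t\<rfloor> \<le> N"
  shows "norm ((x + (LINT u:{0..t}|lborel. v (renewal_count \<tau> u))) - (x + W (n (nat \<lfloor>a * t\<rfloor>)))) \<le> 7 * \<eta>"
proof -
  define k where "k = nat \<lfloor>a * t\<rfloor>"
  let ?T = "renewal_time \<tau>"
  have \<eta>: "\<eta> \<ge> 0" using first norm_ge_zero order.trans by blast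
  have "real k \<le> a * t" "a * t < real k + 1" unfolding k_def using t a by (auto simp: of_nat_floor)
  then have kt: "real k / a \<le> t" "t < (real k + 1) / a" using a by (simp_all add: field_simps)
  have kN: "k \<le> N" using t by (simp add: k_def)
  have up: "t < ?T (Suc (n (k + 2)))"
  proof -
    \<comment> \<open>Even if late by half a mesh, the knot two grid points ahead is reached after
      \<open>t\<close>; this bounds the index of the holding interval that contains
      \<open>t\<close>.\<close>
    have "(real k + 1) / a \<le> real (k + 2) / a - 1 / (2 * a)" using a by (simp add: field_simps)
    then show ?thesis using times[of "k + 2"] kN kt by auto
  qed
  define i where "i = (LEAST i. t < ?T (Suc i))"
  have i1: "t < ?T (Suc i)" unfolding i_def by (rule LeastI[of _ "n (k + 2)"]) (rule up)
  have i2: "?T i \<le> t"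
  proof (cases i)
    case 0 then show ?thesis using t by (simp add: renewal_time_def)
  next
    case (Suc j)
    then have "\<not> t < ?T (Suc j)" unfolding i_def using not_less_Least by (metis lessI)
    then show ?thesis using Suc by simp
  qed
  have X: "(LINT u:{0..t}|lborel. v (renewal_count \<tau> u)) = (\<Sum>j<i. \<tau> j *\<^sub>R v j) + (t - ?T i) *\<^sub>R v i"
  proof -
    have "(LINT u:{0..t}|lborel. v (renewal_count \<tau> u)) = integral {0..t} (\<lambda>u. v (renewal_count \<tau> u))"
      by (rule set_borel_integral_eq_integral(2)[OF set_integrable_renewal_path]) (rule v)
    also have "\<dots> = (\<Sum>j<i. \<tau> j *\<^sub>R v j) + (t - ?T i) *\<^sub>R v i"
      by (rule integral_unique[OF has_integral_renewal_path[OF pos i2]]) (use i1 in simp)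
    finally show ?thesis .
  qed
  have rest: "norm ((t - ?T i) *\<^sub>R v i) \<le> norm (\<tau> i *\<^sub>R v i)"
  proof -
    have "t - ?T i \<le> \<tau> i" using i1 by (simp add: renewal_time_def)
    then show ?thesis using i2 pos[of i] by (auto intro!: mult_right_mono)
  qed
  show ?thesis
  proof (cases i)
    case 0
    \<comment> \<open>Before the first renewal less than half a mesh has passed, so the grid index
      is still 0 and the walk has not started.\<close>
    have "?T (Suc (n 0)) \<le> 1 / (2 * a)" using times[of 0] by auto
    moreover have "t < ?T (Suc (n 0))" using i1 0 n by simp
    moreover have "k = 0"
    proof (rule ccontr)
      assume "k \<noteq> 0"
      then have "1 / a \<le> real k / a" using a by (intro divide_right_mono) auto
      moreover have "1 / (2 * a) < 1 / a" using a by (simp add: field_simps)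
      ultimately show False using kt \<open>t < ?T (Suc (n 0))\<close> \<open>?T (Suc (n 0)) \<le> 1 / (2 * a)\<close> by linarith
    qed
    ultimately have "W (n k) = 0" using n by (simp add: W_def)
    then have "norm ((x + (LINT u:{0..t}|lborel. v (renewal_count \<tau> u))) - (x + W (n k))) \<le> \<eta>"
      using X 0 rest first by (simp add: renewal_time_def)
    then show ?thesis using \<eta> by (simp add: k_def)
  next
    case (Suc i')
    have hi: "i \<le> n (k + 2)" using i2 up renewal_time_less_iff[of \<tau> i "Suc (n (k + 2))", OF pos] by linarith
    have near: "norm (W j - W (n k)) \<le> 2 * \<eta>" if j: "j \<in> {i', i}" for j
    proof -
      \<comment> \<open>The index lies in the preceding block, in the block of \<open>k\<close>, or
        in the following one; two block oscillations bound the distance in each case.\<close>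
      consider "j \<le> n k" "k \<ge> 1" | "n k \<le> j" "j \<le> n (k + 1)" | "n (k + 1) \<le> j"
        using n linear[of j "n k"] linear[of j "n (k + 1)"] by (cases "k = 0") auto
      then show ?thesis
      proof cases
        case 1
        then obtain k' where k': "k = Suc k'" by (cases k) auto
        have "?T (Suc (n k')) \<le> real k' / a + 1 / (2 * a)" using times[of k'] kN k' by auto
        also have "\<dots> < real k / a" using a k' by (simp add: field_simps)
        also have "\<dots> \<le> t" by (rule kt)
        finally have "?T (Suc (n k')) < ?T (Suc i)" using i1 by linarith
        then have "n k' < i" using renewal_time_less_iff[of \<tau> "Suc (n k')" "Suc i", OF pos] by simp
        then have lo: "n k' \<le> j" using j Suc by auto
        have "norm (W j - W (n k')) \<le> \<eta>" using blocks[of k' j] lo 1 k' kN by auto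
        moreover have "norm (W (n k) - W (n k')) \<le> \<eta>"
          using blocks[of k' "n k"] k' kN monoD[OF n(2), of k' k] by auto
        ultimately show ?thesis using norm_triangle_ineq4[of "W j - W (n k')" "W (n k) - W (n k')"] by simp
      next
        case 2
        then show ?thesis using blocks[of k j] kN \<eta> by auto
      next
        case 3
        have "norm (W j - W (n (k + 1))) \<le> \<eta>" using blocks[of "k + 1" j] 3 kN hi j Suc by auto
        moreover have "norm (W (n (k + 1)) - W (n k)) \<le> \<eta>"
          using blocks[of k "n (k + 1)"] kN monoD[OF n(2), of k "k + 1"] by auto
        ultimately show ?thesis using norm_triangle_ineq[of "W j - W (n (k + 1))" "W (n (k + 1)) - W (n k)"] by simp
      qed
    qed
    \<comment> \<open>The initial step is separated, since \<open>W\<close> begins with step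
      1.\<close>
    have Y: "(\<Sum>j<i. \<tau> j *\<^sub>R v j) = \<tau> 0 *\<^sub>R v 0 + W i'"
      unfolding Suc W_def by (rule sum.lessThan_Suc_shift)
    have d: "\<tau> i *\<^sub>R v i = W i - W i'" by (simp add: W_def Suc)
    \<comment> \<open>A single step is the difference of two walk positions, each within
      \<open>2 * \<eta>\<close> of the knot. With the initial step and the position itself the total
      is \<open>\<eta> + 2 * \<eta> + 4 * \<eta> = 7 * \<eta>\<close>.\<close>
    have "norm (\<tau> i *\<^sub>R v i) \<le> 4 * \<eta>"
      unfolding d using near[of i] near[of i'] norm_triangle_ineq4[of "W i - W (n k)" "W i' - W (n k)"] by simp
    then have "norm (\<tau> 0 *\<^sub>R v 0 + (W i' - W (n k)) + (t - ?T i) *\<^sub>R v i) \<le> \<eta> + 2 * \<eta> + 4 * \<eta>"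
      using rest near[of i'] first by (intro norm_triangle_le add_mono) auto
    then show ?thesis unfolding X Y k_def[symmetric] by (simp add: algebra_simps)
  qed
qed

text \<open>Applied with \<open>Suc\<close>, which drops the initial pair of waiting time and
  direction.\<close>

lemma (in prob_space) indep_vars_reindex_inj:
  fixes h :: "'i \<Rightarrow> 'j"
  assumes X: "indep_vars M' X UNIV" and h: "inj h"
  shows "indep_vars (\<lambda>i. M' (h i)) (\<lambda>i. X (h i)) UNIV"
  unfolding indep_vars_def2
proof (intro conjI ballI)
  show "random_variable (M' (h i)) (X (h i))" for i using X unfolding indep_vars_def2 by blast
  have ind: "indep_sets (\<lambda>i. {X i -` A \<inter> space M | A. A \<in> sets (M' i)}) UNIV"
    using X unfolding indep_vars_def2 by blast
  show "indep_sets (\<lambda>i. {X (h i) -` A \<inter> space M | A. A \<in> sets (M' (h i))}) UNIV"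
  proof (rule indep_setsI)
    show "{X (h i) -` A \<inter> space M | A. A \<in> sets (M' (h i))} \<subseteq> events" for i
      using ind unfolding indep_sets_def by blast
    fix A J assume J: "J \<noteq> {}" "finite J" and A: "\<forall>j\<in>J. A j \<in> {X (h j) -` A \<inter> space M | A. A \<in> sets (M' (h j))}"
    have "prob (\<Inter>k\<in>h ` J. A (inv h k)) = (\<Prod>k\<in>h ` J. prob (A (inv h k)))"
      by (rule indep_setsD[OF ind]) (use J A h in auto)
    then show "prob (\<Inter>j\<in>J. A j) = (\<Prod>j\<in>J. prob (A j))"
      using h by (simp add: prod.reindex inj_on_subset[OF h] image_image)
  qed
qed

section \<open>The walk at the renewal times\<close>

text \<open>Here the sphere is forgotten. \<open>f\<close> is the part of the velocity of order
  \<open>1 / \<epsilon>\<close>, whose mean vanishes by the balance condition, and \<open>g\<close>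
  is the part of order one, whose mean is the drift. The direction law is prescribed from index 1 on
  only.\<close>

locale scaled_walk = prob_space M for M :: "'w measure" +
  fixes N :: "'b measure" and law :: "'b measure" and \<epsilon> :: real and \<tau> :: "nat \<Rightarrow> 'w \<Rightarrow> real" and D :: "nat \<Rightarrow> 'w \<Rightarrow> 'b"
    and f g :: "'b \<Rightarrow> real ^ 'n::finite" and b :: real and m :: "real ^ 'n" and A :: "'n \<Rightarrow> 'n \<Rightarrow> real" and dim :: real
  assumes dim_def: "dim = real CARD('n)"
    and eps: "0 < \<epsilon>" "\<epsilon> \<le> 1"
    and exp_dist: "\<And>k. distributed M lborel (\<tau> k) (exponential_density (1 / \<epsilon>\<^sup>2))"
    and D_meas [measurable]: "\<And>k. D k \<in> measurable M N"
    and law: "\<And>k. 1 \<le> k \<Longrightarrow> distr M N (D k) = law"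
    and ind: "indep_vars (\<lambda>_. borel \<Otimes>\<^sub>M N) (\<lambda>k \<omega>. (\<tau> k \<omega>, D k \<omega>)) (UNIV :: nat set)"
    and ind_pair: "\<And>k S T. S \<in> sets borel \<Longrightarrow> T \<in> sets N \<Longrightarrow>
      prob ((\<tau> k -` S \<inter> space M) \<inter> (D k -` T \<inter> space M)) = prob (\<tau> k -` S \<inter> space M) * prob (D k -` T \<inter> space M)"
    and fg_meas [measurable]: "f \<in> borel_measurable N" "g \<in> borel_measurable N"
    and fg_bound: "\<And>\<alpha>. \<alpha> \<in> space N \<Longrightarrow> norm (f \<alpha>) \<le> b" "\<And>\<alpha>. \<alpha> \<in> space N \<Longrightarrow> norm (g \<alpha>) \<le> b"
    and b: "0 \<le> b"
    and f_mean: "\<And>i. (\<integral>\<alpha>. f \<alpha> $ i \<partial>law) = 0"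
    and g_mean: "\<And>i. (\<integral>\<alpha>. g \<alpha> $ i \<partial>law) = m $ i"
    and f_cov: "\<And>i j. (\<integral>\<alpha>. f \<alpha> $ i * f \<alpha> $ j \<partial>law) = A i j"
begin

definition w :: "'b \<Rightarrow> real ^ 'n" where "w \<alpha> = (1 / \<epsilon>) *\<^sub>R f \<alpha> + g \<alpha>"

text \<open>The shift by \<open>Suc\<close> leaves out the initial direction, so that the steps are
  identically distributed.\<close>

definition Y :: "nat \<Rightarrow> 'w \<Rightarrow> real ^ 'n" where "Y j \<omega> = \<tau> (Suc j) \<omega> *\<^sub>R w (D (Suc j) \<omega>)"

lemma tau_meas [measurable]: "\<tau> k \<in> borel_measurable M"
  using distributed_measurable[OF exp_dist] by simp

lemma indep_tau_D:
  assumes [measurable]: "p \<in> borel_measurable borel" "F \<in> borel_measurable N"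
  shows "indep_var borel (\<lambda>\<omega>. p (\<tau> k \<omega>) :: real) borel (\<lambda>\<omega>. F (D k \<omega>) :: real)"
  unfolding indep_var_eq
proof (intro conjI indep_set_sigma_sets)
  show "indep_set {(\<lambda>\<omega>. p (\<tau> k \<omega>)) -` S \<inter> space M | S. S \<in> sets borel} {(\<lambda>\<omega>. F (D k \<omega>)) -` S \<inter> space M | S. S
    \<in> sets borel}"
  proof (rule indep_setI)
    fix a c assume "a \<in> {(\<lambda>\<omega>. p (\<tau> k \<omega>)) -` S \<inter> space M | S. S \<in> sets borel}"
      "c \<in> {(\<lambda>\<omega>. F (D k \<omega>)) -` S \<inter> space M | S. S \<in> sets borel}"
    then obtain S T where S: "S \<in> sets borel" "a = (\<lambda>\<omega>. p (\<tau> k \<omega>)) -` S \<inter> space M"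
      and T: "T \<in> sets borel" "c = (\<lambda>\<omega>. F (D k \<omega>)) -` T \<inter> space M" by blast
    have "a = \<tau> k -` (p -` S \<inter> space borel) \<inter> space M" using S by auto
    moreover have "c = D k -` (F -` T \<inter> space N) \<inter> space M" using T measurable_space[OF D_meas] by auto
    moreover have "p -` S \<inter> space borel \<in> sets borel" "F -` T \<inter> space N \<in> sets N"
      using measurable_sets[OF assms(1) S(1)] measurable_sets[OF assms(2) T(1)] by auto
    ultimately show "prob (a \<inter> c) = prob a * prob c" using ind_pair by metis
  qed auto
qed (auto intro!: Int_stableI simp: vimage_Int[symmetric] intro: exI[of _ "_ \<inter> _"])

lemma w_meas [measurable]: "w \<in> borel_measurable N"
  unfolding w_def[abs_def] by measurable

lemma Y_meas [measurable]: "Y k \<in> borel_measurable M"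
  unfolding Y_def[abs_def] by measurable

lemma w_bound: "\<alpha> \<in> space N \<Longrightarrow> norm (w \<alpha>) \<le> 2 * b / \<epsilon>"
proof -
  assume a: "\<alpha> \<in> space N"
  have "norm (w \<alpha>) \<le> norm ((1 / \<epsilon>) *\<^sub>R f \<alpha>) + norm (g \<alpha>)" unfolding w_def by (rule norm_triangle_ineq)
  also have "\<dots> \<le> b / \<epsilon> + b"
    using fg_bound[OF a] eps by (intro add_mono) (auto simp: divide_right_mono)
  also have "\<dots> \<le> b / \<epsilon> + b / \<epsilon>"
    using eps b mult_left_le[of \<epsilon> b] by (intro add_left_mono, subst pos_le_divide_eq) auto
  finally show ?thesis by simp
qed

lemma D_space: "\<omega> \<in> space M \<Longrightarrow> D k \<omega> \<in> space N"
  by (rule measurable_space[OF D_meas])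

lemma tau_pos: "AE \<omega> in M. 0 < \<tau> k \<omega>"
proof -
  have e2: "0 < 1 / \<epsilon>\<^sup>2" using eps by simp
  have "\<P>(\<omega> in M. 0 < \<tau> k \<omega>) = exp (- 0 * (1 / \<epsilon>\<^sup>2))"
    by (rule exponential_distributedD_gt[OF exp_dist _ e2]) simp
  then have "prob {\<omega> \<in> space M. 0 < \<tau> k \<omega>} = 1" by simp
  then show ?thesis by (subst (asm) prob_eq_1) auto
qed

lemma integrable_tau: "integrable M (\<lambda>\<omega>. \<tau> k \<omega> ^ p)"
  and expectation_tau: "expectation (\<lambda>\<omega>. \<tau> k \<omega> ^ p) = fact p * \<epsilon> ^ (2 * p)"
proof -
  have e2: "0 < 1 / \<epsilon>\<^sup>2" using eps by simp
  show "integrable M (\<lambda>\<omega>. \<tau> k \<omega> ^ p)" by (rule erlang_ith_moment_integrable[OF e2 exp_dist])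
  show "expectation (\<lambda>\<omega>. \<tau> k \<omega> ^ p) = fact p * \<epsilon> ^ (2 * p)"
    using erlang_ith_moment[OF e2 exp_dist, of k p] by (simp add: power_one_over power_mult)
qed

lemma integrable_bounded_D:
  fixes F :: "'b \<Rightarrow> real"
  assumes F: "F \<in> borel_measurable N" "\<And>\<alpha>. \<alpha> \<in> space N \<Longrightarrow> \<bar>F \<alpha>\<bar> \<le> B"
  shows "integrable M (\<lambda>\<omega>. F (D k \<omega>))" "integrable law F" "\<bar>\<integral>\<alpha>. F \<alpha> \<partial>law\<bar> \<le> B"
    "1 \<le> k \<Longrightarrow> expectation (\<lambda>\<omega>. F (D k \<omega>)) = (\<integral>\<alpha>. F \<alpha> \<partial>law)"
proof -
  note [measurable] = F(1)
  show i: "integrable M (\<lambda>\<omega>. F (D k \<omega>))" for k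
    using F(2) D_space by (intro integrable_const_bound[of _ B]) auto
  have l1: "law = distr M N (D 1)" using law[of 1] by simp
  show "integrable law F" unfolding l1 by (subst integrable_distr_eq) (use i[of 1] in auto)
  show e: "1 \<le> k \<Longrightarrow> expectation (\<lambda>\<omega>. F (D k \<omega>)) = (\<integral>\<alpha>. F \<alpha> \<partial>law)" for k
    using integral_distr[OF D_meas F(1), of k] law[of k] by simp
  show "\<bar>\<integral>\<alpha>. F \<alpha> \<partial>law\<bar> \<le> B"
    unfolding e[of 1, symmetric, OF order.refl] using F(2) D_space
    by (intro abs_integral_prob_le prob_space_axioms) auto
qed

lemma moment_tau_D:
  fixes F :: "'b \<Rightarrow> real"
  assumes F: "F \<in> borel_measurable N" "\<And>\<alpha>. \<alpha> \<in> space N \<Longrightarrow> \<bar>F \<alpha>\<bar> \<le> B"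
  shows "integrable M (\<lambda>\<omega>. \<tau> (Suc j) \<omega> ^ p * F (D (Suc j) \<omega>))"
    "expectation (\<lambda>\<omega>. \<tau> (Suc j) \<omega> ^ p * F (D (Suc j) \<omega>)) = fact p * \<epsilon> ^ (2 * p) * (\<integral>\<alpha>. F \<alpha> \<partial>law)"
proof -
  have iv: "indep_var borel (\<lambda>\<omega>. \<tau> (Suc j) \<omega> ^ p) borel (\<lambda>\<omega>. F (D (Suc j) \<omega>))"
    by (rule indep_tau_D[OF _ F(1)]) simp
  note iD = integrable_bounded_D[OF F]
  show "integrable M (\<lambda>\<omega>. \<tau> (Suc j) \<omega> ^ p * F (D (Suc j) \<omega>))"
    by (rule indep_var_integrable[OF iv integrable_tau iD(1)])
  show "expectation (\<lambda>\<omega>. \<tau> (Suc j) \<omega> ^ p * F (D (Suc j) \<omega>)) = fact p * \<epsilon> ^ (2 * p) * (\<integral>\<alpha>. F \<alpha> \<partial>law)"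
    using indep_var_lebesgue_integral[OF iv integrable_tau iD(1)] iD(4)[of "Suc j"] by (simp add: expectation_tau)
qed

lemma inner_w_bound: "\<alpha> \<in> space N \<Longrightarrow> \<bar>v \<bullet> w \<alpha>\<bar> \<le> norm v * (2 * b / \<epsilon>)"
  using Cauchy_Schwarz_ineq2[of v "w \<alpha>"] mult_left_mono[OF w_bound, of \<alpha> "norm v"] by (meson norm_ge_zero order.trans)

text \<open>The waiting time contributes \<open>fact p * \<epsilon> ^ (2 * p)\<close> and the
  velocity at most order \<open>\<epsilon>\<close> to the power \<open>- p\<close>, so a step is of
  size \<open>\<epsilon>\<close> in every moment.\<close>

lemma moment_Y:
  shows "integrable M (\<lambda>\<omega>. (v \<bullet> Y j \<omega>) ^ p)"
    "expectation (\<lambda>\<omega>. (v \<bullet> Y j \<omega>) ^ p) = fact p * \<epsilon> ^ (2 * p) * (\<integral>\<alpha>. (v \<bullet> w \<alpha>) ^ p \<partial>law)"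
    "\<bar>expectation (\<lambda>\<omega>. (v \<bullet> Y j \<omega>) ^ p)\<bar> \<le> fact p * (2 * b * norm v * \<epsilon>) ^ p"
proof -
  have bd: "\<bar>(v \<bullet> w \<alpha>) ^ p\<bar> \<le> (norm v * (2 * b / \<epsilon>)) ^ p" if "\<alpha> \<in> space N" for \<alpha>
    unfolding power_abs by (intro power_mono inner_w_bound that) simp
  have ms: "(\<lambda>\<alpha>. (v \<bullet> w \<alpha>) ^ p) \<in> borel_measurable N" by measurable
  have eq: "(v \<bullet> Y j \<omega>) ^ p = \<tau> (Suc j) \<omega> ^ p * (v \<bullet> w (D (Suc j) \<omega>)) ^ p" for \<omega>
    by (simp add: Y_def power_mult_distrib)
  show "integrable M (\<lambda>\<omega>. (v \<bullet> Y j \<omega>) ^ p)" unfolding eq by (rule moment_tau_D(1)[OF ms bd])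
  show e: "expectation (\<lambda>\<omega>. (v \<bullet> Y j \<omega>) ^ p) = fact p * \<epsilon> ^ (2 * p) * (\<integral>\<alpha>. (v \<bullet> w \<alpha>) ^ p \<partial>law)"
    unfolding eq by (rule moment_tau_D(2)[OF ms bd])
  have "\<bar>\<integral>\<alpha>. (v \<bullet> w \<alpha>) ^ p \<partial>law\<bar> \<le> (norm v * (2 * b / \<epsilon>)) ^ p" by (rule integrable_bounded_D(3)[OF ms bd])
  then have "\<bar>expectation (\<lambda>\<omega>. (v \<bullet> Y j \<omega>) ^ p)\<bar> \<le> fact p * \<epsilon> ^ (2 * p) * (norm v * (2 * b / \<epsilon>)) ^ p"
    unfolding e abs_mult using eps by (intro mult_mono) auto
  also have "\<dots> = fact p * (2 * b * norm v * \<epsilon>) ^ p"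
  proof -
    have "\<epsilon> ^ (2 * p) * (norm v * (2 * b / \<epsilon>)) ^ p = (\<epsilon>\<^sup>2 * (norm v * (2 * b / \<epsilon>))) ^ p"
      by (simp only: power_mult power_mult_distrib)
    also have "\<epsilon>\<^sup>2 * (norm v * (2 * b / \<epsilon>)) = 2 * b * norm v * \<epsilon>" using eps by (simp add: power2_eq_square)
    finally show ?thesis by simp
  qed
  finally show "\<bar>expectation (\<lambda>\<omega>. (v \<bullet> Y j \<omega>) ^ p)\<bar> \<le> fact p * (2 * b * norm v * \<epsilon>) ^ p" .
qed

lemma comp_bound: "\<alpha> \<in> space N \<Longrightarrow> \<bar>f \<alpha> $ i\<bar> \<le> b" "\<alpha> \<in> space N \<Longrightarrow> \<bar>g \<alpha> $ i\<bar> \<le> b"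
  using fg_bound component_le_norm_cart order.trans by blast+

lemma integrable_law:
  "integrable law (\<lambda>\<alpha>. f \<alpha> $ i)" "integrable law (\<lambda>\<alpha>. g \<alpha> $ i)"
  "integrable law (\<lambda>\<alpha>. f \<alpha> $ i * f \<alpha> $ j)" "integrable law (\<lambda>\<alpha>. f \<alpha> $ i * g \<alpha> $ j)"
    "integrable law (\<lambda>\<alpha>. g \<alpha> $ i * g \<alpha> $ j)"
proof -
  have [measurable]: "(\<lambda>\<alpha>. f \<alpha> $ i) \<in> borel_measurable N" "(\<lambda>\<alpha>. g \<alpha> $ i) \<in> borel_measurable N" for i
    by (rule measurable_compose[OF fg_meas(1) borel_measurable_nth] measurable_compose[OF fg_meas(2)
      borel_measurable_nth])+
  have mb: "\<bar>x * y\<bar> \<le> b * b" if "\<bar>x\<bar> \<le> b" "\<bar>y\<bar> \<le> b" for x y :: real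
    unfolding abs_mult using that b by (intro mult_mono) auto
  show "integrable law (\<lambda>\<alpha>. f \<alpha> $ i)" "integrable law (\<lambda>\<alpha>. g \<alpha> $ i)"
    by (rule integrable_bounded_D(2)[where B = b]; use comp_bound in simp)+
  show "integrable law (\<lambda>\<alpha>. f \<alpha> $ i * f \<alpha> $ j)" "integrable law (\<lambda>\<alpha>. f \<alpha> $ i * g \<alpha> $ j)"
    "integrable law (\<lambda>\<alpha>. g \<alpha> $ i * g \<alpha> $ j)"
    by (rule integrable_bounded_D(2)[where B = "b * b"]; use comp_bound mb in simp)+
qed

lemma mean_w: "(\<integral>\<alpha>. v \<bullet> w \<alpha> \<partial>law) = v \<bullet> m"
proof -
  have "(\<integral>\<alpha>. v \<bullet> w \<alpha> \<partial>law) = (\<integral>\<alpha>. (\<Sum>i\<in>UNIV. v $ i * ((1 / \<epsilon>) * f \<alpha> $ i + g \<alpha> $ i)) \<partial>law)"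
    by (simp add: inner_vec_def w_def)
  also have "\<dots> = (\<Sum>i\<in>UNIV. v $ i * ((1 / \<epsilon>) * (\<integral>\<alpha>. f \<alpha> $ i \<partial>law) + (\<integral>\<alpha>. g \<alpha> $ i \<partial>law)))"
    using integrable_law by (simp add: Bochner_Integration.integral_sum)
  finally show ?thesis by (simp add: f_mean g_mean inner_vec_def)
qed

lemma second_moment_f: "(\<integral>\<alpha>. (v \<bullet> f \<alpha>)\<^sup>2 \<partial>law) = (\<Sum>i\<in>UNIV. \<Sum>j\<in>UNIV. A i j * (v $ i * v $ j))"
proof -
  have "(v \<bullet> f \<alpha>)\<^sup>2 = (\<Sum>i\<in>UNIV. \<Sum>j\<in>UNIV. (v $ i * v $ j) * (f \<alpha> $ i * f \<alpha> $ j))" for \<alpha>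
    by (simp add: power2_eq_square inner_vec_def sum_product mult_ac)
  then have "(\<integral>\<alpha>. (v \<bullet> f \<alpha>)\<^sup>2 \<partial>law) = (\<Sum>i\<in>UNIV. \<Sum>j\<in>UNIV. (v $ i * v $ j) * (\<integral>\<alpha>. f \<alpha> $ i * f \<alpha> $ j \<partial>law))"
    using integrable_law by (simp add: Bochner_Integration.integral_sum)
  then show ?thesis by (simp add: f_cov mult.commute)
qed

lemma inner_fg_bound: "\<alpha> \<in> space N \<Longrightarrow> \<bar>v \<bullet> f \<alpha>\<bar> \<le> norm v * b" "\<alpha> \<in> space N \<Longrightarrow> \<bar>v \<bullet> g \<alpha>\<bar> \<le> norm v * b"
  using Cauchy_Schwarz_ineq2[of v] mult_left_mono[OF fg_bound(1), of \<alpha> "norm v"]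
    mult_left_mono[OF fg_bound(2), of \<alpha> "norm v"]
  by (meson norm_ge_zero order.trans)+

text \<open>Since \<open>\<epsilon> * (v \<bullet> w \<alpha>) = v \<bullet> f \<alpha> + \<epsilon>
  * (v \<bullet> g \<alpha>)\<close>, the error consists of a cross term with factor
  \<open>2 * \<epsilon>\<close> and a square with factor at most \<open>\<epsilon>\<close>, together
  3.\<close>

lemma second_moment_w:
  "\<bar>\<epsilon>\<^sup>2 * (\<integral>\<alpha>. (v \<bullet> w \<alpha>)\<^sup>2 \<partial>law) - (\<Sum>i\<in>UNIV. \<Sum>j\<in>UNIV. A i j * (v $ i * v $ j))\<bar> \<le> 3 * (norm v * b)\<^sup>2 * \<epsilon>"
proof -
  let ?B = "norm v * b"
  have bd: "\<alpha> \<in> space N \<Longrightarrow> \<bar>(v \<bullet> f \<alpha>)\<^sup>2\<bar> \<le> ?B\<^sup>2" "\<alpha> \<in> space N \<Longrightarrow> \<bar>(v \<bullet> g \<alpha>)\<^sup>2\<bar> \<le> ?B\<^sup>2"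
    "\<alpha> \<in> space N \<Longrightarrow> \<bar>(v \<bullet> f \<alpha>) * (v \<bullet> g \<alpha>)\<bar> \<le> ?B\<^sup>2" for \<alpha>
  proof -
    have mb: "\<bar>x * y\<bar> \<le> ?B\<^sup>2" if "\<bar>x\<bar> \<le> ?B" "\<bar>y\<bar> \<le> ?B" for x y :: real
      unfolding abs_mult power2_eq_square[of ?B] using that b by (intro mult_mono) auto
    show "\<alpha> \<in> space N \<Longrightarrow> \<bar>(v \<bullet> f \<alpha>)\<^sup>2\<bar> \<le> ?B\<^sup>2" "\<alpha> \<in> space N \<Longrightarrow> \<bar>(v \<bullet> g \<alpha>)\<^sup>2\<bar> \<le> ?B\<^sup>2"
      "\<alpha> \<in> space N \<Longrightarrow> \<bar>(v \<bullet> f \<alpha>) * (v \<bullet> g \<alpha>)\<bar> \<le> ?B\<^sup>2"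
      unfolding power2_eq_square[of "v \<bullet> f \<alpha>"] power2_eq_square[of "v \<bullet> g \<alpha>"]
        by (intro mb inner_fg_bound; assumption)+
  qed
  have mf: "(\<lambda>\<alpha>. (v \<bullet> f \<alpha>)\<^sup>2) \<in> borel_measurable N" "(\<lambda>\<alpha>. (v \<bullet> g \<alpha>)\<^sup>2) \<in> borel_measurable N"
    "(\<lambda>\<alpha>. (v \<bullet> f \<alpha>) * (v \<bullet> g \<alpha>)) \<in> borel_measurable N" by measurable
  note i1 = integrable_bounded_D(2,3)[OF mf(1) bd(1)] integrable_bounded_D(2,3)[OF mf(2) bd(2)]
    integrable_bounded_D(2,3)[OF mf(3) bd(3)]
  have "\<epsilon>\<^sup>2 * (v \<bullet> w \<alpha>)\<^sup>2 = (v \<bullet> f \<alpha>)\<^sup>2 + (2 * \<epsilon>) * ((v \<bullet> f \<alpha>) * (v \<bullet> g \<alpha>)) + \<epsilon>\<^sup>2 * (v \<bullet> g \<alpha>)\<^sup>2" for \<alpha>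
  proof -
    have "\<epsilon> * (v \<bullet> w \<alpha>) = v \<bullet> f \<alpha> + \<epsilon> * (v \<bullet> g \<alpha>)" using eps by (simp add: w_def inner_add_right distrib_left)
    then have "(\<epsilon> * (v \<bullet> w \<alpha>))\<^sup>2 = (v \<bullet> f \<alpha> + \<epsilon> * (v \<bullet> g \<alpha>))\<^sup>2" by simp
    then show ?thesis by (simp add: power2_eq_square algebra_simps)
  qed
  then have "\<epsilon>\<^sup>2 * (\<integral>\<alpha>. (v \<bullet> w \<alpha>)\<^sup>2 \<partial>law) =
      (\<integral>\<alpha>. (v \<bullet> f \<alpha>)\<^sup>2 + (2 * \<epsilon>) * ((v \<bullet> f \<alpha>) * (v \<bullet> g \<alpha>)) + \<epsilon>\<^sup>2 * (v \<bullet> g \<alpha>)\<^sup>2 \<partial>law)"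
    by (subst integral_mult_right_zero[symmetric]) simp
  also have "\<dots> = (\<Sum>i\<in>UNIV. \<Sum>j\<in>UNIV. A i j * (v $ i * v $ j))
      + (2 * \<epsilon>) * (\<integral>\<alpha>. (v \<bullet> f \<alpha>) * (v \<bullet> g \<alpha>) \<partial>law) + \<epsilon>\<^sup>2 * (\<integral>\<alpha>. (v \<bullet> g \<alpha>)\<^sup>2 \<partial>law)"
    using i1 by (simp add: second_moment_f)
  finally have "\<bar>\<epsilon>\<^sup>2 * (\<integral>\<alpha>. (v \<bullet> w \<alpha>)\<^sup>2 \<partial>law) - (\<Sum>i\<in>UNIV. \<Sum>j\<in>UNIV. A i j * (v $ i * v $ j))\<bar>
     = \<bar>(2 * \<epsilon>) * (\<integral>\<alpha>. (v \<bullet> f \<alpha>) * (v \<bullet> g \<alpha>) \<partial>law) + \<epsilon>\<^sup>2 * (\<integral>\<alpha>. (v \<bullet> g \<alpha>)\<^sup>2 \<partial>law)\<bar>" by simp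
  also have "\<dots> \<le> (2 * \<epsilon>) * ?B\<^sup>2 + \<epsilon> * ?B\<^sup>2"
  proof (rule order.trans[OF abs_triangle_ineq], unfold abs_mult, intro add_mono mult_mono)
    show "\<bar>\<epsilon>\<^sup>2\<bar> \<le> \<epsilon>" using eps by (simp add: power2_eq_square mult_left_le_one_le)
  qed (use i1 eps in auto)
  finally show ?thesis by (simp add: mult_ac)
qed

definition char_Y :: "real ^ 'n \<Rightarrow> complex" where "char_Y v = (\<integral>\<omega>. cis (v \<bullet> Y 0 \<omega>) \<partial>M)"

lemma integrable_cis_Y: "integrable M (\<lambda>\<omega>. cis (v \<bullet> Y j \<omega>))"
  unfolding cis_conv_exp by (rule integrable_prob_bounded[OF prob_space_axioms, where B = 1]) simp_all

text \<open>Taylor expansion of the character to second order, with the absolute third moment as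
  remainder. The linear term yields the drift at order \<open>\<epsilon>^2\<close> because the mean
  of \<open>f\<close> vanishes, and the quadratic term yields \<open>A\<close> at the same
  order.\<close>

lemma char_expansion:
  "norm ((\<integral>\<omega>. cis (v \<bullet> Y j \<omega>) \<partial>M) - (1 + of_real (\<epsilon>\<^sup>2) * char_exponent m A v))
    \<le> (8 * (norm v * b) ^ 3 + 3 * (norm v * b)\<^sup>2) * \<epsilon> ^ 3"
proof -
  let ?q = "\<Sum>i\<in>UNIV. \<Sum>k\<in>UNIV. A i k * (v $ i * v $ k)"
  define u where "u \<omega> = v \<bullet> Y j \<omega>" for \<omega>
  have [measurable]: "u \<in> borel_measurable M" unfolding u_def[abs_def] by measurable
  have iu: "integrable M u" "integrable M (\<lambda>\<omega>. (u \<omega>)\<^sup>2)"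
    using moment_Y(1)[of v j 1] moment_Y(1)[of v j 2] by (simp_all add: u_def[abs_def])
  have e1: "expectation u = \<epsilon>\<^sup>2 * (v \<bullet> m)" using moment_Y(2)[of v j 1] by (simp add: u_def[abs_def] mean_w)
  define I2 where "I2 = (\<integral>\<alpha>. (v \<bullet> w \<alpha>)\<^sup>2 \<partial>law)"
  \<comment> \<open>The 2 is the second moment of the exponential law in units of the squared mean;
    it cancels the division by 2 in the Taylor polynomial \<open>?P\<close>.\<close>
  have e2: "expectation (\<lambda>\<omega>. (u \<omega>)\<^sup>2) = 2 * \<epsilon>\<^sup>2 * (\<epsilon>\<^sup>2 * I2)"
    using moment_Y(2)[of v j 2] by (simp add: u_def I2_def power2_eq_square power4_eq_xxxx)
  let ?P = "\<lambda>\<omega>. 1 + \<i> * of_real (u \<omega>) - of_real ((u \<omega>)\<^sup>2 / 2) :: complex"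
  have iP: "integrable M ?P"
    using iu
    by (intro Bochner_Integration.integrable_add Bochner_Integration.integrable_diff integrable_mult_right
    integrable_of_real) auto
  have "expectation (\<lambda>\<omega>. \<bar>u \<omega>\<bar> ^ 3) = fact 3 * \<epsilon> ^ 6 * (\<integral>\<alpha>. \<bar>v \<bullet> w \<alpha>\<bar> ^ 3 \<partial>law)
     \<and> integrable M (\<lambda>\<omega>. \<bar>u \<omega>\<bar> ^ 3) \<and> \<bar>\<integral>\<alpha>. \<bar>v \<bullet> w \<alpha>\<bar> ^ 3 \<partial>law\<bar> \<le> (norm v * (2 * b / \<epsilon>)) ^ 3"
  proof -
    have bd: "\<bar>\<bar>v \<bullet> w \<alpha>\<bar> ^ 3\<bar> \<le> (norm v * (2 * b / \<epsilon>)) ^ 3" if "\<alpha> \<in> space N" for \<alpha>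
      unfolding power_abs abs_abs by (intro power_mono inner_w_bound that) simp
    have ms: "(\<lambda>\<alpha>. \<bar>v \<bullet> w \<alpha>\<bar> ^ 3) \<in> borel_measurable N" by measurable
    \<comment> \<open>Pulling the waiting time out of the absolute value requires its positivity,
      which holds almost everywhere only.\<close>
    have ae: "AE \<omega> in M. \<bar>u \<omega>\<bar> ^ 3 = \<tau> (Suc j) \<omega> ^ 3 * \<bar>v \<bullet> w (D (Suc j) \<omega>)\<bar> ^ 3"
      using tau_pos[of "Suc j"] by eventually_elim (simp add: u_def Y_def abs_mult power_mult_distrib)
    have "expectation (\<lambda>\<omega>. \<bar>u \<omega>\<bar> ^ 3) = expectation (\<lambda>\<omega>. \<tau> (Suc j) \<omega> ^ 3 * \<bar>v \<bullet> w (D (Suc j) \<omega>)\<bar> ^ 3)"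
      by (rule integral_cong_AE) (use ae in auto)
    moreover have "integrable M (\<lambda>\<omega>. \<bar>u \<omega>\<bar> ^ 3) = integrable M (\<lambda>\<omega>. \<tau> (Suc j) \<omega> ^ 3 * \<bar>v \<bullet> w (D (Suc j) \<omega>)\<bar> ^ 3)"
      by (rule integrable_cong_AE) (use ae in auto)
    ultimately show ?thesis
      using moment_tau_D[OF ms bd, of j 3] integrable_bounded_D(3)[OF ms bd] by simp
  qed
  then have i3: "integrable M (\<lambda>\<omega>. \<bar>u \<omega>\<bar> ^ 3)"
    and e3: "expectation (\<lambda>\<omega>. \<bar>u \<omega>\<bar> ^ 3) \<le> 6 * \<epsilon> ^ 6 * (norm v * (2 * b / \<epsilon>)) ^ 3"
    using eps by (auto simp: fact_numeral)
  have eP: "(\<integral>\<omega>. ?P \<omega> \<partial>M) = 1 + \<i> * of_real (\<epsilon>\<^sup>2 * (v \<bullet> m)) - of_real (\<epsilon>\<^sup>2 * (\<epsilon>\<^sup>2 * I2))"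
    using iu e1 e2 by (simp add: prob_space del: of_real_power of_real_mult of_real_divide flip: of_real_divide)
  have "norm ((\<integral>\<omega>. cis (v \<bullet> Y j \<omega>) \<partial>M) - (\<integral>\<omega>. ?P \<omega> \<partial>M)) = norm (\<integral>\<omega>. cis (u \<omega>) - ?P \<omega> \<partial>M)"
    using integrable_cis_Y[of v j] iP by (simp add: u_def)
  also have "\<dots> \<le> (\<integral>\<omega>. norm (cis (u \<omega>) - ?P \<omega>) \<partial>M)" by (rule integral_norm_bound)
  also have "\<dots> \<le> (\<integral>\<omega>. \<bar>u \<omega>\<bar> ^ 3 / 6 \<partial>M)"
  proof (rule integral_mono)
    have "integrable M (\<lambda>\<omega>. cis (u \<omega>))" using integrable_cis_Y[of v j] by (simp add: u_def)
    from integrable_norm[OF Bochner_Integration.integrable_diff[OF this iP]]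
    show "integrable M (\<lambda>\<omega>. norm (cis (u \<omega>) - ?P \<omega>))" .
    show "integrable M (\<lambda>\<omega>. \<bar>u \<omega>\<bar> ^ 3 / 6)" using i3 by simp
    fix \<omega>
    have "(\<Sum>k\<le>2. (\<i> * of_real (u \<omega>)) ^ k / fact k) = ?P \<omega>"
      by (simp add: numeral_2_eq_2 power_mult_distrib power2_eq_square)
    then show "norm (cis (u \<omega>) - ?P \<omega>) \<le> \<bar>u \<omega>\<bar> ^ 3 / 6"
      using iexp_approx1[of "u \<omega>" 2] by (simp add: cis_conv_exp fact_numeral numeral_3_eq_3[symmetric])
  qed
  also have "\<dots> \<le> \<epsilon> ^ 6 * (norm v * (2 * b / \<epsilon>)) ^ 3" using e3 by simp
  also have "\<dots> = 8 * (norm v * b) ^ 3 * \<epsilon> ^ 3"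
    using eps by (simp add: power_mult_distrib power_divide field_simps power_numeral_reduce)
  finally have 1: "norm ((\<integral>\<omega>. cis (v \<bullet> Y j \<omega>) \<partial>M) - (\<integral>\<omega>. ?P \<omega> \<partial>M)) \<le> 8 * (norm v * b) ^ 3 * \<epsilon> ^ 3" .
  have "(\<integral>\<omega>. ?P \<omega> \<partial>M) - (1 + of_real (\<epsilon>\<^sup>2) * char_exponent m A v) = of_real (\<epsilon>\<^sup>2 * (?q - \<epsilon>\<^sup>2 * I2))"
    unfolding eP by (simp add: char_exponent_def complex_eq_iff algebra_simps inner_commute)
  then have "norm ((\<integral>\<omega>. ?P \<omega> \<partial>M) - (1 + of_real (\<epsilon>\<^sup>2) * char_exponent m A v)) = \<epsilon>\<^sup>2 * \<bar>\<epsilon>\<^sup>2 * I2 - ?q\<bar>"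
    by (simp only: norm_of_real abs_mult) (simp add: abs_minus_commute)
  also have "\<dots> \<le> \<epsilon>\<^sup>2 * (3 * (norm v * b)\<^sup>2 * \<epsilon>)"
    using second_moment_w[of v] by (intro mult_left_mono) (auto simp: I2_def)
  also have "\<dots> = 3 * (norm v * b)\<^sup>2 * \<epsilon> ^ 3" by (simp add: power2_eq_square power3_eq_cube)
  finally have 2: "norm ((\<integral>\<omega>. ?P \<omega> \<partial>M) - (1 + of_real (\<epsilon>\<^sup>2) * char_exponent m A v)) \<le> 3 * (norm v * b)\<^sup>2 * \<epsilon> ^ 3" .
  show ?thesis
    using norm_diff_triangle_le[OF 1 2] by (simp only: distrib_right)
qed

text \<open>Independence inside a pair identifies its joint law as a product of two marginals, and
  neither marginal depends on the index once it is at least 1.\<close>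

lemma law_pairs: "(\<integral>\<omega>. cis (v \<bullet> Y j \<omega>) \<partial>M) = char_Y v"
proof -
  have l0: "law = distr M N (D 1)" using law[of 1] by simp
  have eq: "distr M (borel \<Otimes>\<^sub>M N) (\<lambda>\<omega>. (\<tau> (Suc j) \<omega>, D (Suc j) \<omega>))
    = distr M (borel \<Otimes>\<^sub>M N) (\<lambda>\<omega>. (\<tau> (Suc 0) \<omega>, D (Suc 0) \<omega>))" for j
  proof -
    have pair: "distr M borel (\<tau> k) \<Otimes>\<^sub>M distr M N (D k) = distr M (borel \<Otimes>\<^sub>M N) (\<lambda>\<omega>. (\<tau> k \<omega>, D k \<omega>))" for k
    proof (rule pair_measure_eqI)
      show "sigma_finite_measure (distr M borel (\<tau> k))" "sigma_finite_measure (distr M N (D k))"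
        by (intro finite_measure.axioms(1) prob_space.finite_measure prob_space_distr; simp)+
      show "sets (distr M borel (\<tau> k) \<Otimes>\<^sub>M distr M N (D k)) = sets (distr M (borel \<Otimes>\<^sub>M N) (\<lambda>\<omega>. (\<tau> k \<omega>, D k \<omega>)))"
        by (simp cong: sets_pair_measure_cong)
      fix S T assume "S \<in> sets (distr M borel (\<tau> k))" "T \<in> sets (distr M N (D k))"
      then have S [measurable]: "S \<in> sets borel" and T [measurable]: "T \<in> sets N" by auto
      have "(\<lambda>\<omega>. (\<tau> k \<omega>, D k \<omega>)) -` (S \<times> T) \<inter> space M = (\<tau> k -` S \<inter> space M) \<inter> (D k -` T \<inter> space M)" by auto
      then show "emeasure (distr M borel (\<tau> k)) S * emeasure (distr M N (D k)) T
        = emeasure (distr M (borel \<Otimes>\<^sub>M N) (\<lambda>\<omega>. (\<tau> k \<omega>, D k \<omega>))) (S \<times> T)"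
        by (simp add: emeasure_distr emeasure_eq_measure ind_pair ennreal_mult)
    qed
    have "distr M borel (\<tau> k) = density lborel (exponential_density (1 / \<epsilon>\<^sup>2))" for k
      using distributed_distr_eq_density[OF exp_dist[of k]] distr_cong[of M M lborel borel "\<tau> k" "\<tau> k"] by simp
    then have "distr M borel (\<tau> (Suc j)) = distr M borel (\<tau> (Suc 0))" by simp
    moreover have "distr M N (D (Suc j)) = distr M N (D (Suc 0))" by (simp add: law)
    ultimately show ?thesis unfolding pair[symmetric] by simp
  qed
  define h where "h = (\<lambda>(t, \<alpha>). cis (v \<bullet> (t *\<^sub>R w \<alpha>)))"
  have h: "h \<in> borel_measurable (borel \<Otimes>\<^sub>M N)" unfolding h_def cis_conv_exp by measurable
  have "(\<integral>\<omega>. cis (v \<bullet> Y j \<omega>) \<partial>M) = (\<integral>z. h z \<partial>distr M (borel \<Otimes>\<^sub>M N) (\<lambda>\<omega>. (\<tau> (Suc j) \<omega>, D (Suc j) \<omega>)))" for j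
    by (subst integral_distr[OF _ h]) (simp_all add: h_def Y_def)
  from this[of j] this[of 0] show ?thesis by (simp add: char_Y_def eq[of j])
qed

lemma indep_Y: "indep_vars (\<lambda>_. borel) Y UNIV"
proof -
  have "indep_vars (\<lambda>_. borel \<Otimes>\<^sub>M N) (\<lambda>k \<omega>. (\<tau> (Suc k) \<omega>, D (Suc k) \<omega>)) UNIV"
    using indep_vars_reindex_inj[OF ind, of Suc] by simp
  from indep_vars_compose2[OF this, of "\<lambda>_ (t, \<alpha>). t *\<^sub>R w \<alpha>" "\<lambda>_. borel"]
  show ?thesis by (simp add: Y_def[abs_def] case_prod_beta)
qed

text \<open>Giving every step the frequency of its block turns a product over blocks into a product
  over single steps, to which independence applies.\<close>

lemma char_walk_increments:
  assumes n: "n 0 = 0" "mono n"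
  shows "(\<integral>\<omega>. (\<Prod>k<K. cis (v k \<bullet> (\<Sum>j=n k..<n (Suc k). Y j \<omega>))) \<partial>M) = (\<Prod>k<K. char_Y (v k) ^ (n (Suc k) - n k))"
proof -
  define V where "V j = v (LEAST k. j < n (Suc k))" for j
  have V: "V j = v k" if "n k \<le> j" "j < n (Suc k)" for j k
  proof -
    have "(LEAST k. j < n (Suc k)) = k"
    proof (rule Least_equality)
      fix k' assume "j < n (Suc k')"
      then have "n k < n (Suc k')" using that by linarith
      then have "k < Suc k'" using monoD[OF n(2), of "Suc k'" k] by (meson leD leI)
      then show "k \<le> k'" by simp
    qed (rule that)
    then show ?thesis by (simp add: V_def)
  qed
  have blocks: "(\<Prod>k<K. \<Prod>j=n k..<n (Suc k). F j) = (\<Prod>j<n K. F j)" for F :: "nat \<Rightarrow> complex" and K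
  proof (induction K)
    case (Suc K)
    then show ?case
      using prod.atLeastLessThan_concat[of 0 "n K" "n (Suc K)" F] monoD[OF n(2), of K "Suc K"]
      by (simp add: atLeast0LessThan)
  qed (simp add: n)
  have "cis (v k \<bullet> (\<Sum>j=n k..<n (Suc k). Y j \<omega>)) = (\<Prod>j=n k..<n (Suc k). cis (V j \<bullet> Y j \<omega>))" for k \<omega>
    by (auto simp: inner_sum_right prod_cis V intro!: arg_cong[where f = cis] sum.cong)
  then have "(\<integral>\<omega>. (\<Prod>k<K. cis (v k \<bullet> (\<Sum>j=n k..<n (Suc k). Y j \<omega>))) \<partial>M) = (\<integral>\<omega>. (\<Prod>j<n K. cis (V j \<bullet> Y j \<omega>)) \<partial>M)"
    by (simp add: blocks)
  also have "\<dots> = (\<Prod>j<n K. char_Y (V j))"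
  proof -
    have "indep_vars (\<lambda>_. borel) (\<lambda>j \<omega>. cis (V j \<bullet> Y j \<omega>)) {..<n K}"
      using indep_vars_compose2[OF indep_vars_subset[OF indep_Y, of "{..<n K}"], of "\<lambda>j y. cis (V j \<bullet> y)" "\<lambda>_. borel"]
      unfolding cis_conv_exp by simp
    from indep_vars_lebesgue_integral[OF _ this integrable_cis_Y] show ?thesis by (simp add: law_pairs)
  qed
  also have "\<dots> = (\<Prod>k<K. \<Prod>j=n k..<n (Suc k). char_Y (V j))" by (simp add: blocks)
  also have "\<dots> = (\<Prod>k<K. char_Y (v k) ^ (n (Suc k) - n k))" 
  proof (intro prod.cong refl)
    fix k
    have "(\<Prod>j=n k..<n (Suc k). char_Y (V j)) = (\<Prod>j=n k..<n (Suc k). char_Y (v k))"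
      by (intro prod.cong) (auto simp: V)
    then show "(\<Prod>j=n k..<n (Suc k). char_Y (V j)) = char_Y (v k) ^ (n (Suc k) - n k)" by simp
  qed
  finally show ?thesis .
qed

lemma norm_char_Y: "norm (char_Y v) \<le> 1"
proof -
  have "norm (char_Y v) \<le> (\<integral>\<omega>. norm (cis (v \<bullet> Y 0 \<omega>)) \<partial>M)" unfolding char_Y_def by (rule integral_norm_bound)
  then show ?thesis by (simp add: prob_space)
qed

end

section \<open>Deviation bounds for the walk and for the renewal times\<close>

lemma power4_diff_le: "((x::real) - y) ^ 4 \<le> 8 * (x ^ 4 + y ^ 4)"
proof -
  have s: "(p + q)\<^sup>2 \<le> 2 * (p\<^sup>2 + q\<^sup>2)" for p q :: real
    using zero_le_power2[of "p - q"] by (simp add: power2_eq_square algebra_simps)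
  have "(x - y)\<^sup>2 \<le> 2 * (x\<^sup>2 + y\<^sup>2)" using s[of x "- y"] by simp
  then have "((x - y)\<^sup>2)\<^sup>2 \<le> (2 * (x\<^sup>2 + y\<^sup>2))\<^sup>2" by (intro power_mono) auto
  also have "\<dots> = 4 * (x\<^sup>2 + y\<^sup>2)\<^sup>2" by (simp only: power_mult_distrib, simp)
  also have "\<dots> \<le> 4 * (2 * ((x\<^sup>2)\<^sup>2 + (y\<^sup>2)\<^sup>2))" using s[of "x\<^sup>2" "y\<^sup>2"] by simp
  finally show ?thesis by (simp flip: power_mult)
qed

lemma (in prob_space) centred_moments:
  fixes X :: "'a \<Rightarrow> real"
  assumes X: "X \<in> borel_measurable M" "integrable M (\<lambda>\<omega>. X \<omega> ^ 4)" and c: "expectation X = c"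
    and bounds: "expectation (\<lambda>\<omega>. X \<omega> ^ 2) \<le> s" "8 * (expectation (\<lambda>\<omega>. X \<omega> ^ 4) + c ^ 4) \<le> q"
  shows "integrable M (\<lambda>\<omega>. (X \<omega> - c) ^ 4)" "expectation (\<lambda>\<omega>. X \<omega> - c) = 0"
    "expectation (\<lambda>\<omega>. (X \<omega> - c) ^ 2) \<le> s" "expectation (\<lambda>\<omega>. (X \<omega> - c) ^ 4) \<le> q"
proof -
  note [measurable] = X(1)
  have i1: "integrable M X" using integrable_power_le_4[OF X, of 1] by simp
  have i2: "integrable M (\<lambda>\<omega>. X \<omega> ^ 2)" using integrable_power_le_4[OF X, of 2] by simp
  have iq: "integrable M (\<lambda>\<omega>. 8 * (X \<omega> ^ 4 + c ^ 4))" using X(2) by simp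
  show i4: "integrable M (\<lambda>\<omega>. (X \<omega> - c) ^ 4)"
    by (rule Bochner_Integration.integrable_bound[OF iq]) (use power4_diff_le in auto)
  show "expectation (\<lambda>\<omega>. X \<omega> - c) = 0" using i1 c by (simp add: prob_space)
  have "expectation (\<lambda>\<omega>. (X \<omega> - c) ^ 2) = expectation (\<lambda>\<omega>. X \<omega> ^ 2) - c\<^sup>2"
  proof -
    have "expectation (\<lambda>\<omega>. (X \<omega> - c) ^ 2) = expectation (\<lambda>\<omega>. X \<omega> ^ 2 - 2 * c * X \<omega> + c\<^sup>2)"
      by (simp add: power2_diff algebra_simps)
    also have "\<dots> = expectation (\<lambda>\<omega>. X \<omega> ^ 2) - 2 * c * c + c\<^sup>2" using i1 i2 c by (simp add: prob_space)
    finally show ?thesis by (simp add: power2_eq_square)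
  qed
  then show "expectation (\<lambda>\<omega>. (X \<omega> - c) ^ 2) \<le> s" using bounds(1) by (smt (verit) zero_le_power2)
  have "expectation (\<lambda>\<omega>. (X \<omega> - c) ^ 4) \<le> expectation (\<lambda>\<omega>. 8 * (X \<omega> ^ 4 + c ^ 4))"
    by (rule integral_mono[OF i4 iq]) (rule power4_diff_le)
  also have "\<dots> \<le> q" using X(2) bounds(2) by (simp add: prob_space)
  finally show "expectation (\<lambda>\<omega>. (X \<omega> - c) ^ 4) \<le> q" .
qed

context scaled_walk
begin

lemma dim_pos: "dim \<ge> 1"
  by (simp add: dim_def Suc_leI)

lemma m_bound: "\<bar>m $ i\<bar> \<le> b"
proof -
  have "(\<lambda>\<alpha>. g \<alpha> $ i) \<in> borel_measurable N" by (rule measurable_compose[OF fg_meas(2) borel_measurable_nth])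
  from integrable_bounded_D(3)[OF this comp_bound(2)] show ?thesis by (simp add: g_mean)
qed

text \<open>From \<open>moment_Y\<close>: \<open>8 = 2! * 2^2\<close> for the second moment and
  \<open>384 = 4! * 2^4\<close> for the fourth. Centring adds the fourth power of the mean, at most
  \<open>(\<epsilon> * b)^4\<close>, and \<open>3080 = 8 * (384 + 1)\<close>.\<close>

lemma coordinate_moments:
  defines "U \<equiv> \<lambda>i j \<omega>. Y j \<omega> $ i - \<epsilon>\<^sup>2 * m $ i"
  shows "indep_vars (\<lambda>_. borel) (U i) UNIV" "integrable M (\<lambda>\<omega>. U i j \<omega> ^ 4)" "expectation (U i j) = 0"
    "expectation (\<lambda>\<omega>. U i j \<omega> ^ 2) \<le> 8 * b\<^sup>2 * \<epsilon>\<^sup>2" "expectation (\<lambda>\<omega>. U i j \<omega> ^ 4) \<le> 3080 * b ^ 4 * \<epsilon> ^ 4"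
proof -
  have "indep_vars (\<lambda>_. borel) (\<lambda>j \<omega>. (\<lambda>y. y $ i - \<epsilon>\<^sup>2 * m $ i) (Y j \<omega>)) UNIV"
    by (rule indep_vars_compose2[OF indep_Y]) simp
  then show "indep_vars (\<lambda>_. borel) (U i) UNIV" by (simp add: U_def)
  have ax: "axis i 1 \<bullet> y = y $ i" for y :: "real ^ 'n" by (simp add: inner_axis inner_commute)
  have na: "norm (axis i 1 :: real ^ 'n) = 1" by simp
  note mY = moment_Y[of "axis i 1" j, unfolded ax na]
  have Ym: "(\<lambda>\<omega>. Y j \<omega> $ i) \<in> borel_measurable M" by (rule measurable_compose[OF Y_meas borel_measurable_nth])
  have e1: "expectation (\<lambda>\<omega>. Y j \<omega> $ i) = \<epsilon>\<^sup>2 * m $ i"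
    using mY(2)[of 1] mean_w[of "axis i 1", unfolded ax] by simp
  have e2: "expectation (\<lambda>\<omega>. (Y j \<omega> $ i) ^ 2) \<le> 8 * b\<^sup>2 * \<epsilon>\<^sup>2"
    using mY(3)[of 2] by (simp add: power_mult_distrib)
  have e4: "8 * (expectation (\<lambda>\<omega>. (Y j \<omega> $ i) ^ 4) + (\<epsilon>\<^sup>2 * m $ i) ^ 4) \<le> 3080 * b ^ 4 * \<epsilon> ^ 4"
  proof -
    have "expectation (\<lambda>\<omega>. (Y j \<omega> $ i) ^ 4) \<le> 384 * b ^ 4 * \<epsilon> ^ 4"
      using mY(3)[of 4] by (simp add: power_mult_distrib fact_numeral)
    moreover have "(\<epsilon>\<^sup>2 * m $ i) ^ 4 \<le> (\<epsilon> * b) ^ 4"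
    proof -
      have "\<epsilon>\<^sup>2 \<le> \<epsilon>" using eps by (simp add: power2_eq_square mult_left_le_one_le)
      then have "\<bar>\<epsilon>\<^sup>2 * m $ i\<bar> \<le> \<epsilon> * b" unfolding abs_mult using m_bound[of i] eps by (intro mult_mono) auto
      then have "\<bar>\<epsilon>\<^sup>2 * m $ i\<bar> ^ 4 \<le> (\<epsilon> * b) ^ 4" by (intro power_mono) auto
      then show ?thesis by (simp add: power_abs)
    qed
    ultimately show ?thesis by (simp add: power_mult_distrib mult.commute)
  qed
  note cm = centred_moments[OF Ym mY(1)[of 4] e1 e2 e4]
  show "integrable M (\<lambda>\<omega>. U i j \<omega> ^ 4)" "expectation (U i j) = 0"
    "expectation (\<lambda>\<omega>. U i j \<omega> ^ 2) \<le> 8 * b\<^sup>2 * \<epsilon>\<^sup>2" "expectation (\<lambda>\<omega>. U i j \<omega> ^ 4) \<le> 3080 * b ^ 4 * \<epsilon> ^ 4"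
    using cm by (simp_all add: U_def)
qed

text \<open>
  Each coordinate of the walk without its drift has at most \<open>2 h / \<epsilon>\<^sup>2\<close> steps with moments bounded in
  \<open>coordinate_moments\<close>, hence \<open>13856 = 2 * (2 * 3080 + 3 * 2\<^sup>2 * 8\<^sup>2)\<close>; the level \<open>\<eta> / (4 * dim)\<close> for
  a coordinate gives the factor \<open>256 * dim ^ 4\<close>.
\<close>

lemma block_tail:
  assumes h: "\<epsilon>\<^sup>2 \<le> h" and len: "real (n2 - n1) \<le> 2 * h / \<epsilon>\<^sup>2" and \<eta>: "\<eta> > 0" "4 * h * b * dim \<le> \<eta>"
  shows "prob {\<omega> \<in> space M. \<exists>i\<in>{n1..n2}. \<eta> < norm (\<Sum>j=n1..<i. Y j \<omega>)}
    \<le> dim * (13856 * 256 * h\<^sup>2 * b ^ 4 * dim ^ 4 / \<eta> ^ 4)"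
proof -
  define U where "U i j \<omega> = Y j \<omega> $ i - \<epsilon>\<^sup>2 * m $ i" for i j \<omega>
  note Um = coordinate_moments[folded U_def]
  have e2: "\<epsilon>\<^sup>2 > 0" using eps by simp
  have h0: "h > 0" using h e2 by linarith
  define \<eta>' where "\<eta>' = \<eta> / (4 * dim)"
  have \<eta>': "\<eta>' > 0" using \<eta> dim_pos by (simp add: \<eta>'_def)
  have [measurable]: "U i j \<in> borel_measurable M" for i j
    using Um(1)[of i] unfolding indep_vars_def by auto
  let ?E = "\<lambda>c. {\<omega> \<in> space M. \<exists>i\<in>{n1..n2}. 2 * \<eta>' < \<bar>\<Sum>j=n1..<i. U c j \<omega>\<bar>}"
  have sub: "{\<omega> \<in> space M. \<exists>i\<in>{n1..n2}. \<eta> < norm (\<Sum>j=n1..<i. Y j \<omega>)} \<subseteq> (\<Union>c\<in>UNIV. ?E c)"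
  proof
    fix \<omega> assume "\<omega> \<in> {\<omega> \<in> space M. \<exists>i\<in>{n1..n2}. \<eta> < norm (\<Sum>j=n1..<i. Y j \<omega>)}"
    then obtain i where i: "\<omega> \<in> space M" "n1 \<le> i" "i \<le> n2" "\<eta> < norm (\<Sum>j=n1..<i. Y j \<omega>)" by auto
    have "\<exists>c. \<eta> / dim < \<bar>(\<Sum>j=n1..<i. Y j \<omega>) $ c\<bar>"
    proof (rule ccontr)
      assume "\<nexists>c. \<eta> / dim < \<bar>(\<Sum>j=n1..<i. Y j \<omega>) $ c\<bar>"
      then have "(\<Sum>c\<in>UNIV. \<bar>(\<Sum>j=n1..<i. Y j \<omega>) $ c\<bar>) \<le> (\<Sum>c\<in>(UNIV :: 'n set). \<eta> / dim)"
        by (intro sum_mono) (simp add: not_less)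
      also have "\<dots> = \<eta>" using dim_pos by (simp add: dim_def)
      finally show False using i(4) norm_le_l1_cart[of "\<Sum>j=n1..<i. Y j \<omega>"] by linarith
    qed
    then obtain c where c: "\<eta> / dim < \<bar>(\<Sum>j=n1..<i. Y j \<omega>) $ c\<bar>" by blast
    have "(\<Sum>j=n1..<i. Y j \<omega>) $ c = (\<Sum>j=n1..<i. U c j \<omega>) + real (i - n1) * (\<epsilon>\<^sup>2 * m $ c)"
      by (simp add: U_def sum_subtractf)
    moreover have "\<bar>real (i - n1) * (\<epsilon>\<^sup>2 * m $ c)\<bar> \<le> 2 * h * b"
    proof -
      have "real (i - n1) \<le> 2 * h / \<epsilon>\<^sup>2" using i len by linarith
      then have "real (i - n1) * \<epsilon>\<^sup>2 \<le> 2 * h" using e2 by (simp add: pos_le_divide_eq)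
      then have "(real (i - n1) * \<epsilon>\<^sup>2) * \<bar>m $ c\<bar> \<le> 2 * h * b"
        using mult_mono[of "real (i - n1) * \<epsilon>\<^sup>2" "2 * h" "\<bar>m $ c\<bar>" b] m_bound[of c] h0 by simp
      then show ?thesis by (simp add: abs_mult mult.assoc)
    qed
    \<comment> \<open>Half of the level \<open>\<eta> / dim\<close> of a coordinate is spent on the
      drift over the block, the other half, \<open>2 * \<eta>'\<close>, on the centred sum.\<close>
    moreover have "2 * h * b \<le> \<eta> / dim - 2 * \<eta>'"
    proof -
      have "2 * h * b \<le> \<eta> / (2 * dim)" using \<eta>(2) dim_pos by (simp add: pos_le_divide_eq)
      also have "\<dots> = \<eta> / dim - 2 * \<eta>'" using dim_pos by (simp add: \<eta>'_def field_simps)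
      finally show ?thesis .
    qed
    ultimately have "2 * \<eta>' < \<bar>\<Sum>j=n1..<i. U c j \<omega>\<bar>" using c by linarith
    with i have "\<omega> \<in> ?E c" by (intro CollectI conjI bexI[of _ i]) auto
    then show "\<omega> \<in> (\<Union>c\<in>UNIV. ?E c)" by blast
  qed
  have E: "prob (?E c) \<le> 13856 * 256 * h\<^sup>2 * b ^ 4 * dim ^ 4 / \<eta> ^ 4" for c
  proof -
    have "prob (?E c) \<le> 2 * ((2 * h / \<epsilon>\<^sup>2 * (3080 * b ^ 4 * \<epsilon> ^ 4) + 3 * (2 * h / \<epsilon>\<^sup>2)\<^sup>2 * (8 * b\<^sup>2 * \<epsilon>\<^sup>2)\<^sup>2)
      / \<eta>' ^ 4)"
      by (rule maximal_fourth_moment[OF Um(1) \<eta>' Um(2,3,4,5) len])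
    also have "\<dots> \<le> 2 * ((6928 * h\<^sup>2 * b ^ 4) / \<eta>' ^ 4)"
    proof (intro mult_left_mono divide_right_mono)
      have "2 * h / \<epsilon>\<^sup>2 * (3080 * b ^ 4 * \<epsilon> ^ 4) = 6160 * (h * b ^ 4) * \<epsilon>\<^sup>2"
        using eps by (simp add: power4_eq_xxxx power2_eq_square)
      \<comment> \<open>The fourth moments of single steps contribute order
        \<open>h * \<epsilon>\<^sup>2\<close>, raised to \<open>h\<^sup>2\<close> by the assumption
        on \<open>h\<close>. With the 768 from the squared variances the constant is 6928.\<close>
      also have "\<dots> \<le> 6160 * (h * b ^ 4) * h" using h h0 by (intro mult_left_mono) auto
      finally have 1: "2 * h / \<epsilon>\<^sup>2 * (3080 * b ^ 4 * \<epsilon> ^ 4) \<le> 6160 * h\<^sup>2 * b ^ 4"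
        by (simp add: power2_eq_square mult_ac)
      have "3 * (2 * h / \<epsilon>\<^sup>2)\<^sup>2 * (8 * b\<^sup>2 * \<epsilon>\<^sup>2)\<^sup>2 = 768 * h\<^sup>2 * b ^ 4"
        using eps by (simp add: power_mult_distrib power_divide power4_eq_xxxx power2_eq_square)
      then show "2 * h / \<epsilon>\<^sup>2 * (3080 * b ^ 4 * \<epsilon> ^ 4) + 3 * (2 * h / \<epsilon>\<^sup>2)\<^sup>2 * (8 * b\<^sup>2 * \<epsilon>\<^sup>2)\<^sup>2 \<le> 6928 * h\<^sup>2 * b ^ 4"
        using 1 by linarith
    qed (use \<eta>' in auto)
    also have "\<dots> = 13856 * 256 * h\<^sup>2 * b ^ 4 * dim ^ 4 / \<eta> ^ 4"
      by (simp add: \<eta>'_def power_divide power_mult_distrib)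
    finally show ?thesis .
  qed
  have "prob {\<omega> \<in> space M. \<exists>i\<in>{n1..n2}. \<eta> < norm (\<Sum>j=n1..<i. Y j \<omega>)} \<le> prob (\<Union>c\<in>UNIV. ?E c)"
    by (rule finite_measure_mono[OF sub]) auto
  also have "\<dots> \<le> (\<Sum>c\<in>UNIV. prob (?E c))" by (rule finite_measure_subadditive_finite) auto
  also have "\<dots> \<le> (\<Sum>c\<in>(UNIV::'n set). 13856 * 256 * h\<^sup>2 * b ^ 4 * dim ^ 4 / \<eta> ^ 4)" by (intro sum_mono E)
  finally show ?thesis by (simp add: dim_def)
qed

text \<open>A waiting time has mean \<open>\<epsilon>\<^sup>2\<close>, so this deterministic number
  of steps takes the time \<open>k / a\<close> on average, up to rounding.\<close>

definition knot :: "real \<Rightarrow> nat \<Rightarrow> nat" where "knot a k = nat \<lfloor>real k / a / \<epsilon>\<^sup>2\<rfloor>"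

lemma knot_0: "knot a 0 = 0" by (simp add: knot_def)

lemma mono_knot: "a > 0 \<Longrightarrow> mono (knot a)"
  unfolding knot_def by (intro monoI nat_mono floor_mono divide_right_mono) auto

lemma knot_bounds:
  assumes "a > 0"
  shows "real (knot a k) \<le> real k / a / \<epsilon>\<^sup>2" "real k / a / \<epsilon>\<^sup>2 < real (knot a k) + 1"
proof -
  have "0 \<le> real k / a / \<epsilon>\<^sup>2" using assms by simp
  then show "real (knot a k) \<le> real k / a / \<epsilon>\<^sup>2" "real k / a / \<epsilon>\<^sup>2 < real (knot a k) + 1"
    unfolding knot_def by linarith+
qed

lemma blocks_tail:
  assumes a: "a > 0" "\<epsilon>\<^sup>2 \<le> 1 / a" and \<eta>: "\<eta> > 0" "4 * (1 / a) * b * dim \<le> \<eta>"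
  shows "prob {\<omega> \<in> space M. \<exists>k\<in>{..K}. \<exists>i\<in>{knot a k..knot a (Suc k)}. \<eta> < norm (\<Sum>j=knot a k..<i. Y j \<omega>)}
     \<le> (real K + 1) * (dim * (13856 * 256 * (1 / a)\<^sup>2 * b ^ 4 * dim ^ 4 / \<eta> ^ 4))"
proof -
  let ?E = "\<lambda>k. {\<omega> \<in> space M. \<exists>i\<in>{knot a k..knot a (Suc k)}. \<eta> < norm (\<Sum>j=knot a k..<i. Y j \<omega>)}"
  have e2: "\<epsilon>\<^sup>2 > 0" using eps by simp
  have len: "real (knot a (Suc k) - knot a k) \<le> 2 * (1 / a) / \<epsilon>\<^sup>2" for k
  proof -
    have "real (knot a (Suc k) - knot a k) = real (knot a (Suc k)) - real (knot a k)"
      using monoD[OF mono_knot[OF a(1)], of k "Suc k"] by simp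
    also have "\<dots> \<le> real (Suc k) / a / \<epsilon>\<^sup>2 - real k / a / \<epsilon>\<^sup>2 + 1"
      using knot_bounds[OF a(1), of k] knot_bounds[OF a(1), of "Suc k"] by linarith
    also have "\<dots> = 1 / a / \<epsilon>\<^sup>2 + 1" by (simp add: add_divide_distrib)
    \<comment> \<open>Rounding adds at most one step to a block, and
      \<open>\<epsilon>\<^sup>2 \<le> 1 / a\<close> says that one step is at most a full block
      length.\<close>
    also have "\<dots> \<le> 1 / a / \<epsilon>\<^sup>2 + 1 / a / \<epsilon>\<^sup>2"
      using a e2 by (intro add_left_mono) (simp add: pos_le_divide_eq mult.commute)
    finally show ?thesis by simp
  qed
  have "{\<omega> \<in> space M. \<exists>k\<in>{..K}. \<exists>i\<in>{knot a k..knot a (Suc k)}. \<eta> < norm (\<Sum>j=knot a k..<i. Y j \<omega>)} = (\<Union>k\<in>{..K}. ?E k)"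
    by auto
  moreover have "prob (\<Union>k\<in>{..K}. ?E k) \<le> (\<Sum>k\<in>{..K}. prob (?E k))" by (rule finite_measure_subadditive_finite) auto
  moreover have "(\<Sum>k\<in>{..K}. prob (?E k)) \<le> (\<Sum>k\<in>{..K}. dim * (13856 * 256 * (1 / a)\<^sup>2 * b ^ 4 * dim ^ 4 / \<eta> ^ 4))"
    by (intro sum_mono block_tail a len \<eta>)
  ultimately show ?thesis by (simp add: add.commute)
qed

text \<open>
  The factor \<open>256 * a ^ 4\<close> comes from the level \<open>1 / (4 * a)\<close>, half of the admissible deviation.
\<close>

lemma times_tail:
  assumes a: "a > 0" "\<epsilon>\<^sup>2 \<le> 1 / (4 * a)"
  shows "prob {\<omega> \<in> space M. \<exists>k\<in>{..K}. 1 / (2 * a) < \<bar>renewal_time (\<lambda>j. \<tau> j \<omega>) (Suc (knot a k)) - real k / a\<bar>}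
     \<le> (real K + 1) * (212 * (real K / a + 1)\<^sup>2 * \<epsilon> ^ 4 * (256 * a ^ 4))"
proof -
  define V where "V j \<omega> = \<tau> j \<omega> - \<epsilon>\<^sup>2" for j \<omega>
  have e2: "\<epsilon>\<^sup>2 > 0" "\<epsilon>\<^sup>2 \<le> 1" using eps by (simp_all add: power_le_one)
  have "indep_vars (\<lambda>_. borel) (\<lambda>j \<omega>. (\<lambda>z. fst z - \<epsilon>\<^sup>2) (\<tau> j \<omega>, D j \<omega>)) UNIV"
    by (rule indep_vars_compose2[OF ind]) simp
  then have Vi: "indep_vars (\<lambda>_. borel) V UNIV" by (simp add: V_def[abs_def])
  have "expectation (\<tau> j) = \<epsilon>\<^sup>2" for j using expectation_tau[of j 1] by (simp add: power2_eq_square)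
  moreover have "expectation (\<lambda>\<omega>. \<tau> j \<omega> ^ 2) \<le> 2 * \<epsilon> ^ 4" for j using expectation_tau[of j 2] by simp
  \<comment> \<open>\<open>200 = 8 * (4! + 1)\<close>.\<close>
  moreover have "8 * (expectation (\<lambda>\<omega>. \<tau> j \<omega> ^ 4) + (\<epsilon>\<^sup>2) ^ 4) \<le> 200 * \<epsilon> ^ 8" for j
    using expectation_tau[of j 4] by (simp add: fact_numeral flip: power_mult)
  ultimately have Vm: "integrable M (\<lambda>\<omega>. V j \<omega> ^ 4)" "expectation (V j) = 0"
    "expectation (\<lambda>\<omega>. V j \<omega> ^ 2) \<le> 2 * \<epsilon> ^ 4" "expectation (\<lambda>\<omega>. V j \<omega> ^ 4) \<le> 200 * \<epsilon> ^ 8" for j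
    using centred_moments[OF tau_meas integrable_tau, of j "\<epsilon>\<^sup>2" "2 * \<epsilon> ^ 4" "200 * \<epsilon> ^ 8"]
      by (simp_all add: V_def[abs_def])
  have [measurable]: "V j \<in> borel_measurable M" for j using Vi unfolding indep_vars_def by auto
  have [measurable]: "(\<lambda>\<omega>. renewal_time (\<lambda>j. \<tau> j \<omega>) k) \<in> borel_measurable M" for k
    unfolding renewal_time_def by measurable
  let ?E = "\<lambda>k. {\<omega> \<in> space M. 1 / (2 * a) < \<bar>renewal_time (\<lambda>j. \<tau> j \<omega>) (Suc (knot a k)) - real k / a\<bar>}"
  have E: "prob (?E k) \<le> 212 * (real K / a + 1)\<^sup>2 * \<epsilon> ^ 4 * (256 * a ^ 4)" if k: "k \<le> K" for k
  proof -
    let ?p = "Suc (knot a k)"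
    \<comment> \<open>The mean of the renewal time exceeds the grid time by at most
      \<open>\<epsilon>\<^sup>2 \<le> 1 / (4 * a)\<close>, which uses up half of the admissible
      deviation.\<close>
    have pb: "real ?p * \<epsilon>\<^sup>2 \<le> real k / a + \<epsilon>\<^sup>2" "real k / a \<le> real ?p * \<epsilon>\<^sup>2"
    proof -
      have "real (knot a k) * \<epsilon>\<^sup>2 \<le> real k / a"
        using iffD1[OF pos_le_divide_eq[OF e2(1)] knot_bounds(1)[OF a(1), of k]] .
      then show "real ?p * \<epsilon>\<^sup>2 \<le> real k / a + \<epsilon>\<^sup>2" by (simp add: distrib_right)
      have "real k / a < (real (knot a k) + 1) * \<epsilon>\<^sup>2"
        using iffD1[OF pos_divide_less_eq[OF e2(1)] knot_bounds(2)[OF a(1), of k]] .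
      then show "real k / a \<le> real ?p * \<epsilon>\<^sup>2" by (simp add: add.commute)
    qed
    have sub: "?E k \<subseteq> {\<omega> \<in> space M. 1 / (4 * a) < \<bar>\<Sum>j\<in>{..<?p}. V j \<omega>\<bar>}"
    proof
      fix \<omega> assume \<omega>: "\<omega> \<in> ?E k"
      have "renewal_time (\<lambda>j. \<tau> j \<omega>) ?p = (\<Sum>j\<in>{..<?p}. V j \<omega>) + real ?p * \<epsilon>\<^sup>2"
        by (simp add: renewal_time_def V_def sum_subtractf distrib_right)
      moreover have "1 / (2 * a) = 1 / (4 * a) + 1 / (4 * a)" using a by simp
      ultimately show "\<omega> \<in> {\<omega> \<in> space M. 1 / (4 * a) < \<bar>\<Sum>j\<in>{..<?p}. V j \<omega>\<bar>}"
        using \<omega> pb a(2) by auto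
    qed
    note fm = fourth_moment_sum[OF Vi Vm, of "{..<?p}", simplified]
    have "prob (?E k) \<le> prob {\<omega> \<in> space M. 1 / (4 * a) < \<bar>\<Sum>j\<in>{..<?p}. V j \<omega>\<bar>}"
      by (rule finite_measure_mono[OF sub]) simp
    also have "\<dots> \<le> expectation (\<lambda>\<omega>. (\<Sum>j\<in>{..<?p}. V j \<omega>) ^ 4) / (1 / (4 * a)) ^ 4"
      by (rule fourth_moment_tail) (use fm a in auto)
    also have "\<dots> \<le> (real ?p * (200 * \<epsilon> ^ 8) + 3 * (real ?p)\<^sup>2 * (2 * \<epsilon> ^ 4)\<^sup>2) / (1 / (4 * a)) ^ 4"
      using fourth_moment_sum[OF Vi Vm, of "{..<?p}"] by (intro divide_right_mono) auto
    also have "\<dots> \<le> (212 * (real K / a + 1)\<^sup>2 * \<epsilon> ^ 4) / (1 / (4 * a)) ^ 4"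
    proof (rule divide_right_mono)
      \<comment> \<open>\<open>212 = 200 + 3 * 4\<close>, after raising the linear term to the
        square of the number of steps.\<close>
      have "real ?p * (200 * \<epsilon> ^ 8) \<le> (real ?p)\<^sup>2 * (200 * \<epsilon> ^ 8)"
        by (intro mult_right_mono) (auto simp: power2_eq_square)
      moreover have "(2 * \<epsilon> ^ 4)\<^sup>2 = 4 * \<epsilon> ^ 8" by (simp add: power_mult_distrib flip: power_mult)
      ultimately have "real ?p * (200 * \<epsilon> ^ 8) + 3 * (real ?p)\<^sup>2 * (2 * \<epsilon> ^ 4)\<^sup>2 \<le> 212 * ((real ?p)\<^sup>2 * \<epsilon> ^ 8)"
        by (simp add: mult_ac)
      also have "(real ?p)\<^sup>2 * \<epsilon> ^ 8 = (real ?p * \<epsilon>\<^sup>2)\<^sup>2 * \<epsilon> ^ 4"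
        by (simp add: power_mult_distrib flip: power_mult power_add)
      also have "212 * ((real ?p * \<epsilon>\<^sup>2)\<^sup>2 * \<epsilon> ^ 4) \<le> 212 * ((real K / a + 1)\<^sup>2 * \<epsilon> ^ 4)"
      proof (intro mult_left_mono mult_right_mono power_mono)
        have "real k / a \<le> real K / a" using k a by (intro divide_right_mono) auto
        then show "real ?p * \<epsilon>\<^sup>2 \<le> real K / a + 1" using pb e2 by linarith
      qed auto
      finally show "real ?p * (200 * \<epsilon> ^ 8) + 3 * (real ?p)\<^sup>2 * (2 * \<epsilon> ^ 4)\<^sup>2 \<le> 212 * (real K / a + 1)\<^sup>2 * \<epsilon> ^ 4"
        by simp
    qed simp
    also have "\<dots> = 212 * (real K / a + 1)\<^sup>2 * \<epsilon> ^ 4 * (256 * a ^ 4)"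
      by (simp add: power_divide power_mult_distrib)
    finally show ?thesis .
  qed
  have "{\<omega> \<in> space M. \<exists>k\<in>{..K}. 1 / (2 * a) < \<bar>renewal_time (\<lambda>j. \<tau> j \<omega>) (Suc (knot a k)) - real k / a\<bar>}
    = (\<Union>k\<in>{..K}. ?E k)"
    by auto
  moreover have "prob (\<Union>k\<in>{..K}. ?E k) \<le> (\<Sum>k\<in>{..K}. prob (?E k))" by (rule finite_measure_subadditive_finite) auto
  moreover have "(\<Sum>k\<in>{..K}. prob (?E k)) \<le> (\<Sum>k\<in>{..K}. 212 * (real K / a + 1)\<^sup>2 * \<epsilon> ^ 4 * (256 * a ^ 4))"
    by (intro sum_mono E) simp
  ultimately show ?thesis by (simp add: add.commute)
qed

text \<open>The law of the initial direction is arbitrary, so only the bound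
  \<open>2 * b / \<epsilon>\<close> on the speed is available; multiplied by the mean waiting time
  \<open>\<epsilon>\<^sup>2\<close> it is still of order \<open>\<epsilon>\<close>.\<close>

lemma first_step_tail:
  assumes \<eta>: "\<eta> > 0"
  shows "prob {\<omega> \<in> space M. \<eta> < norm (\<tau> 0 \<omega> *\<^sub>R w (D 0 \<omega>))} \<le> 2 * b * \<epsilon> / \<eta>"
proof -
  have i: "integrable M (\<lambda>\<omega>. \<tau> 0 \<omega> * (2 * b / \<epsilon>))" using integrable_tau[of 0 1] by simp
  have ae: "AE \<omega> in M. \<eta> < norm (\<tau> 0 \<omega> *\<^sub>R w (D 0 \<omega>)) \<longrightarrow> \<eta> \<le> \<tau> 0 \<omega> * (2 * b / \<epsilon>)"
    using tau_pos[of 0] AE_space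
  proof eventually_elim
    case (elim \<omega>)
    have "norm (\<tau> 0 \<omega> *\<^sub>R w (D 0 \<omega>)) \<le> \<tau> 0 \<omega> * (2 * b / \<epsilon>)"
      using elim(1) mult_left_mono[OF w_bound[OF D_space[OF elim(2), of 0]], of "\<tau> 0 \<omega>"] by simp
    then show ?case by linarith
  qed
  have "prob {\<omega> \<in> space M. \<eta> < norm (\<tau> 0 \<omega> *\<^sub>R w (D 0 \<omega>))} \<le> prob {\<omega> \<in> space M. \<eta> \<le> \<tau> 0 \<omega> * (2 * b / \<epsilon>)}"
    by (rule finite_measure_mono_AE) (use ae in auto)
  also have "\<dots> \<le> expectation (\<lambda>\<omega>. \<tau> 0 \<omega> * (2 * b / \<epsilon>)) / \<eta>"
  proof (rule integral_Markov_inequality_measure[OF i sets.empty_sets _ \<eta>])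
    show "AE \<omega> in M. 0 \<le> \<tau> 0 \<omega> * (2 * b / \<epsilon>)" using tau_pos[of 0] by eventually_elim (use b eps in auto)
  qed
  also have "\<dots> = 2 * b * \<epsilon> / \<eta>" using expectation_tau[of 0 1] eps by (simp add: power2_eq_square)
  finally show ?thesis .
qed

text \<open>The exceptional event collects a nonpositive waiting time, a long initial step, a
  renewal time off the grid and a large oscillation in a block. The first has probability 0, the
  next two vanish with \<open>\<epsilon>\<close>; the last is of order \<open>K / a^2\<close>
  uniformly in \<open>\<epsilon>\<close> and becomes small through the mesh. Counts exceed
  \<open>K\<close> because the comparison looks two grid points ahead.\<close>

lemma walk_approximation:
  assumes a: "a > 0" "\<epsilon>\<^sup>2 \<le> 1 / (4 * a)" and \<eta>: "\<eta> > 0" "4 * (1 / a) * b * dim \<le> \<eta>"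
  obtains B where "B \<in> events"
    "prob B \<le> 2 * b * \<epsilon> / \<eta> + (real K + 3) * (212 * (real (K + 2) / a + 1)\<^sup>2 * \<epsilon> ^ 4 * (256 * a ^ 4))
       + (real K + 2) * (dim * (13856 * 256 * (1 / a)\<^sup>2 * b ^ 4 * dim ^ 4 / \<eta> ^ 4))"
    "\<And>\<omega> t x. \<omega> \<in> space M - B \<Longrightarrow> 0 \<le> t \<Longrightarrow> nat \<lfloor>a * t\<rfloor> \<le> K \<Longrightarrow>
       norm ((x + (LINT u:{0..t}|lborel. w (D (renewal_count (\<lambda>j. \<tau> j \<omega>) u) \<omega>)))
         - (x + (\<Sum>j<knot a (nat \<lfloor>a * t\<rfloor>). Y j \<omega>))) \<le> 7 * \<eta>"
proof -
  let ?B0 = "{\<omega> \<in> space M. \<exists>j. \<not> 0 < \<tau> j \<omega>}"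
  let ?B1 = "{\<omega> \<in> space M. \<eta> < norm (\<tau> 0 \<omega> *\<^sub>R w (D 0 \<omega>))}"
  let ?B2 = "{\<omega> \<in> space M. \<exists>k\<in>{..K + 2}. 1 / (2 * a) < \<bar>renewal_time (\<lambda>j. \<tau> j \<omega>) (Suc (knot a k)) - real k / a\<bar>}"
  let ?B3 = "{\<omega> \<in> space M. \<exists>k\<in>{..K + 1}. \<exists>i\<in>{knot a k..knot a (Suc k)}. \<eta> < norm (\<Sum>j=knot a k..<i. Y j \<omega>)}"
  have [measurable]: "(\<lambda>\<omega>. renewal_time (\<lambda>j. \<tau> j \<omega>) k) \<in> borel_measurable M" for k
    unfolding renewal_time_def by measurable
  have m: "?B0 \<in> events" "?B1 \<in> events" "?B2 \<in> events" "?B3 \<in> events" by measurable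
  have "1 / (4 * a) \<le> 1 / a" using a by (simp add: field_simps)
  then have a': "\<epsilon>\<^sup>2 \<le> 1 / a" using a by linarith
  have "AE \<omega> in M. \<forall>j. 0 < \<tau> j \<omega>" using tau_pos by (subst AE_all_countable) blast
  then have "AE \<omega> in M. \<not> (\<exists>j. \<not> 0 < \<tau> j \<omega>)" by simp
  then have p0: "prob ?B0 = 0" using m(1) by (subst prob_eq_0) auto
  have un: "prob (?B0 \<union> ?B1 \<union> ?B2 \<union> ?B3) \<le> prob ?B0 + prob ?B1 + prob ?B2 + prob ?B3"
  proof -
    have "prob (?B0 \<union> ?B1 \<union> ?B2 \<union> ?B3) \<le> prob (?B0 \<union> ?B1 \<union> ?B2) + prob ?B3"
      by (rule measure_Un_le) (use m in auto)
    moreover have "prob (?B0 \<union> ?B1 \<union> ?B2) \<le> prob (?B0 \<union> ?B1) + prob ?B2"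
      by (rule measure_Un_le) (use m in auto)
    moreover have "prob (?B0 \<union> ?B1) \<le> prob ?B0 + prob ?B1"
      by (rule measure_Un_le) (use m in auto)
    ultimately show ?thesis by linarith
  qed
  show ?thesis
  proof (rule that[of "?B0 \<union> ?B1 \<union> ?B2 \<union> ?B3"])
    show "?B0 \<union> ?B1 \<union> ?B2 \<union> ?B3 \<in> events" by (intro sets.Un m)
    have "prob ?B2 \<le> (real K + 3) * (212 * (real (K + 2) / a + 1)\<^sup>2 * \<epsilon> ^ 4 * (256 * a ^ 4))"
      using times_tail[OF a, of "K + 2"] by (simp add: add.commute)
    moreover have "prob ?B3 \<le> (real K + 2) * (dim * (13856 * 256 * (1 / a)\<^sup>2 * b ^ 4 * dim ^ 4 / \<eta> ^ 4))"
      using blocks_tail[OF a(1) a' \<eta>, of "K + 1"] by (simp add: add.commute)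
    ultimately show "prob (?B0 \<union> ?B1 \<union> ?B2 \<union> ?B3) \<le> 2 * b * \<epsilon> / \<eta> + (real K + 3) * (212 * (real (K + 2) / a + 1)\<^sup>2
      * \<epsilon> ^ 4 * (256 * a ^ 4))
       + (real K + 2) * (dim * (13856 * 256 * (1 / a)\<^sup>2 * b ^ 4 * dim ^ 4 / \<eta> ^ 4))"
      using un p0 first_step_tail[OF \<eta>(1)] by linarith
    fix \<omega> t x assume \<omega>: "\<omega> \<in> space M - (?B0 \<union> ?B1 \<union> ?B2 \<union> ?B3)" and t: "0 \<le> t" "nat \<lfloor>a * t\<rfloor> \<le> K"
    have blk: "norm ((\<Sum>j<i. Y j \<omega>) - (\<Sum>j<knot a k. Y j \<omega>)) \<le> \<eta>" if "k \<le> K + 1" "knot a k \<le> i" "i \<le> knot a (Suc k)"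
      for k i
    proof -
      have "(\<Sum>j<i. Y j \<omega>) = (\<Sum>j<knot a k. Y j \<omega>) + (\<Sum>j=knot a k..<i. Y j \<omega>)"
        using sum.atLeastLessThan_concat[of 0 "knot a k" i "\<lambda>j. Y j \<omega>"] that by (simp add: atLeast0LessThan)
      moreover have "norm (\<Sum>j=knot a k..<i. Y j \<omega>) \<le> \<eta>" using \<omega> that by force
      ultimately show ?thesis by simp
    qed
    show "norm ((x + (LINT u:{0..t}|lborel. w (D (renewal_count (\<lambda>j. \<tau> j \<omega>) u) \<omega>)))
         - (x + (\<Sum>j<knot a (nat \<lfloor>a * t\<rfloor>). Y j \<omega>))) \<le> 7 * \<eta>"
      unfolding Y_def
    proof (rule renewal_path_approximation[where C = "2 * b / \<epsilon>" and N = K and v = "\<lambda>j. w (D j \<omega>)" and n = "knot a"])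
      show "0 < \<tau> j \<omega>" for j using \<omega> by blast
      show "norm (w (D j \<omega>)) \<le> 2 * b / \<epsilon>" for j using \<omega> by (intro w_bound D_space) auto
      show "norm (\<tau> 0 \<omega> *\<^sub>R w (D 0 \<omega>)) \<le> \<eta>" using \<omega> by force
      show "\<bar>renewal_time (\<lambda>j. \<tau> j \<omega>) (Suc (knot a k)) - real k / a\<bar> \<le> 1 / (2 * a)" if "k \<le> K + 2" for k
        using \<omega> that by force
      show "norm ((\<Sum>j<i. \<tau> (Suc j) \<omega> *\<^sub>R w (D (Suc j) \<omega>)) - (\<Sum>j<knot a k. \<tau> (Suc j) \<omega> *\<^sub>R w (D (Suc j) \<omega>))) \<le> \<eta>"
        if "k \<le> K + 1" "knot a k \<le> i" "i \<le> knot a (Suc k)" for k i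
        using blk[OF that] by (simp add: Y_def)
    qed (use a t knot_0 mono_knot in auto)
  qed
qed

end

section \<open>Paths with small grid increments\<close>

lemma continuous_imp_skorokhod:
  fixes y :: "real \<Rightarrow> 'a::metric_space"
  assumes "continuous_on {0..} y" shows "y \<in> skorokhod_space"
proof -
  have c: "(y \<longlongrightarrow> y t) (at t within {0..})" if "t \<ge> 0" for t
    using assms that by (simp add: continuous_on_def)
  have "continuous (at_right t) y" if "t \<ge> 0" for t
    unfolding continuous_within by (rule tendsto_within_subset[OF c[OF that]]) (use that in auto)
  moreover have "(y \<longlongrightarrow> y t) (at_left t)" if t: "t > 0" for t
  proof -
    have "(y \<longlongrightarrow> y t) (at t within {0<..<t})" by (rule tendsto_within_subset[OF c]) (use t in auto)
    moreover have "at_left t = at t within {0<..<t}"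
      by (rule at_within_nhd[of t "{0<..}"]) (use t in auto)
    ultimately show ?thesis by simp
  qed
  ultimately show ?thesis unfolding skorokhod_space_def by blast
qed

text \<open>A jump at \<open>s\<close> falls between two consecutive points of every grid that
  reaches beyond \<open>s\<close>, and on a fine grid their increment nearly equals the jump. For
  each \<open>e\<close> one fine grid suffices, hence the weak quantifier over
  \<open>r\<close>.\<close>

lemma cadlag_continuous_of_small_increments:
  fixes x :: "real \<Rightarrow> 'a::real_normed_vector"
  assumes x: "x \<in> skorokhod_space"
    and small: "\<And>e. e > 0 \<Longrightarrow>
      \<exists>\<^sub>F r in sequentially. \<forall>k<r ^ 3. norm (x (real (Suc k) / (real r)\<^sup>2) - x (real k / (real r)\<^sup>2)) \<le> e"
  shows "continuous_on {0..} x"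
  unfolding continuous_on_def
proof
  fix s :: real assume s: "s \<in> {0..}"
  have right: "(x \<longlongrightarrow> x s) (at_right s)"
    using x s unfolding skorokhod_space_def continuous_within by auto
  show "(x \<longlongrightarrow> x s) (at s within {0..})"
  proof (cases "s = 0")
    case True
    have "at 0 within {0..} = (at_right (0::real))" by (rule at_within_Ici_at_right)
    then show ?thesis using right True by simp
  next
    case False
    then have s0: "s > 0" using s by simp
    obtain l where l: "(x \<longlongrightarrow> l) (at_left s)" using x s0 unfolding skorokhod_space_def by blast
    have "norm (x s - l) \<le> 3 * e" if e: "e > 0" for e
    proof -
      have "eventually (\<lambda>v. dist (x v) (x s) < e) (at_right s)" by (rule tendstoD[OF right e])
      then obtain b1 where b1: "b1 > s" "\<And>v. s < v \<Longrightarrow> v < b1 \<Longrightarrow> dist (x v) (x s) < e"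
        unfolding eventually_at_right_field by blast
      have "eventually (\<lambda>v. dist (x v) l < e) (at_left s)" by (rule tendstoD[OF l e])
      then obtain b2 where b2: "b2 < s" "\<And>v. b2 < v \<Longrightarrow> v < s \<Longrightarrow> dist (x v) l < e"
        unfolding eventually_at_left_field by blast
      define d where "d = min (min (b1 - s) (s - b2)) 1"
      have d: "d > 0" using b1 b2 by (simp add: d_def)
      obtain R0 :: nat where R0: "real R0 > max (s + 1) (1 / d)" using reals_Archimedean2 by blast
      obtain r where r: "r \<ge> R0" "\<And>k. k < r ^ 3 \<Longrightarrow> norm (x (real (Suc k) / (real r)\<^sup>2) - x (real k / (real r)\<^sup>2)) \<le> e"
        using small[OF e] unfolding frequently_sequentially by blast
      let ?a = "(real r)\<^sup>2"
      have rr: "real r > s + 1" "real r > 1 / d" "real r \<ge> 1" using R0 r s0 by linarith+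
      have ar: "?a \<ge> real r" using rr by (simp add: power2_eq_square)
      have a0: "?a > 0" using ar rr by linarith
      have ad: "1 / ?a < d"
      proof -
        have "1 / d < ?a" using ar rr by linarith
        then show ?thesis using d a0 by (simp add: field_simps)
      qed
      \<comment> \<open>The last grid point strictly before \<open>s\<close>: its value is near the
        left limit even if \<open>s\<close> is a grid point.\<close>
      define k where "k = nat (\<lceil>?a * s\<rceil> - 1)"
      have pos: "?a * s > 0" using a0 s0 by simp
      then have kk: "real k < ?a * s" "?a * s \<le> real k + 1" unfolding k_def by linarith+
      have "?a * s \<le> ?a * real r" using a0 rr by (intro mult_left_mono) auto
      also have "\<dots> = real (r ^ 3)" by (simp add: power2_eq_square power3_eq_cube)
      finally have "k < r ^ 3" using kk by linarith
      then have inc: "norm (x (real (Suc k) / ?a) - x (real k / ?a)) \<le> e" by (rule r)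
      have b: "real k / ?a < s" "s - 1 / ?a \<le> real k / ?a" "s \<le> real (Suc k) / ?a" "real (Suc k) / ?a < s + 1 / ?a"
      proof -
        have "p / c < u \<and> u - 1 / c \<le> p / c \<and> u \<le> (1 + p) / c \<and> (1 + p) / c < u + 1 / c"
          if "c > 0" "p < c * u" "c * u \<le> p + 1" for p c u :: real
        proof -
          have "p / c < u" "u \<le> (1 + p) / c" using that by (simp_all add: field_simps)
          moreover have "(1 + p) / c = 1 / c + p / c" by (rule add_divide_distrib)
          ultimately show ?thesis by linarith
        qed
        from this[OF a0 kk] show "real k / ?a < s" "s - 1 / ?a \<le> real k / ?a" "s \<le> real (Suc k) / ?a"
          "real (Suc k) / ?a < s + 1 / ?a"
          by simp_all
      qed
      have 1: "norm (x (real k / ?a) - l) \<le> e" using b2(2)[of "real k / ?a"] b ad by (simp add: d_def dist_norm)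
      have 2: "norm (x (real (Suc k) / ?a) - x s) \<le> e"
      proof (cases "real (Suc k) / ?a = s")
        case False
        then show ?thesis using b1(2)[of "real (Suc k) / ?a"] b ad by (simp add: d_def dist_norm)
      qed (use e in simp)
      have "x s - l = (x (real k / ?a) - l) + (x (real (Suc k) / ?a) - x (real k / ?a)) - (x (real (Suc k) / ?a)
        - x s)"
        by simp
      also have "norm \<dots> \<le> e + e + e" by (intro norm_triangle_le_diff norm_triangle_le add_mono 1 2 inc)
      finally show ?thesis by simp
    qed
    from this[of "e / 3" for e] have "norm (x s - l) \<le> 0 + e" if "e > 0" for e using that by simp
    then have "norm (x s - l) \<le> 0" by (rule field_le_epsilon)
    then have "(x \<longlongrightarrow> x s) (at_left s)" using l by simp
    then have "(x \<longlongrightarrow> x s) (at s)" using right by (rule filterlim_split_at)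
    then show ?thesis by (rule tendsto_within_subset) auto
  qed
qed

lemma udist_grid_path_tendsto:
  fixes x :: "real \<Rightarrow> 'a::metric_space"
  assumes x: "continuous_on {0..} x"
  shows "(\<lambda>r. udist x (grid_path r (\<lambda>k. x (real k / (real r)\<^sup>2)))) \<longlonglongrightarrow> 0"
proof (rule tendstoI)
  fix e :: real assume e: "e > 0"
  obtain T :: nat where T: "exp (- real T) < e"
  proof -
    obtain T :: nat where "- ln e < real T" using reals_Archimedean2 by blast
    then have "- real T < ln e" by linarith
    then have "exp (- real T) < exp (ln e)" by (simp only: exp_less_cancel_iff)
    then show ?thesis using that e by simp
  qed
  have "uniformly_continuous_on {0..real T} x"
    by (rule compact_uniformly_continuous[OF continuous_on_subset[OF x]]) auto
  then obtain d where d: "d > 0" "\<And>s t. s \<in> {0..real T} \<Longrightarrow> t \<in> {0..real T} \<Longrightarrow> dist s t < d \<Longrightarrow> dist (x s) (x t) < e / 2"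
    unfolding uniformly_continuous_on_def using e by (meson half_gt_zero)
  obtain R0 :: nat where R0: "real R0 > max (real T + 1) (1 / d)" using reals_Archimedean2 by blast
  have "dist (udist x (grid_path r (\<lambda>k. x (real k / (real r)\<^sup>2)))) 0 < e" if r: "r \<ge> R0" for r
  proof -
    let ?a = "(real r)\<^sup>2"
    have rr: "real r > real T + 1" "real r > 1 / d" "real r \<ge> 1" using R0 r by linarith+
    have ar: "?a \<ge> real r" using rr by (simp add: power2_eq_square)
    have a0: "?a > 0" using ar rr by linarith
    have ad: "1 / ?a < d"
    proof -
      have "1 / d < ?a" using ar rr by linarith
      then show ?thesis using d(1) a0 by (simp add: field_simps)
    qed
    have "udist x (grid_path r (\<lambda>k. x (real k / ?a))) \<le> max (e / 2) (exp (- real T))"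
    proof (rule udist_le_horizon)
      fix t :: real assume t: "0 \<le> t" "t < real T"
      let ?k = "nat \<lfloor>?a * t\<rfloor>"
      have at: "0 \<le> ?a * t" using t a0 by simp
      have k: "real ?k \<le> ?a * t" "?a * t < real ?k + 1" using at by linarith+
      have "?a * t \<le> ?a * real r" using t rr a0 by (intro mult_left_mono) auto
      also have "\<dots> = real (r ^ 3)" by (simp add: power2_eq_square power3_eq_cube)
      finally have "?k \<le> r ^ 3" using k by linarith
      then have eq: "grid_path r (\<lambda>k. x (real k / ?a)) t = x (real ?k / ?a)" by (simp add: grid_path_def min_def)
      have "real ?k / ?a \<le> t" "t < real ?k / ?a + 1 / ?a" using k a0 by (simp_all add: field_simps)
      then have "dist t (real ?k / ?a) < d" "real ?k / ?a \<in> {0..real T}" using ad t by (auto simp: dist_real_def)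
      then show "dist (x t) (grid_path r (\<lambda>k. x (real k / ?a)) t) \<le> e / 2"
        unfolding eq using d(2)[of t "real ?k / ?a"] t by simp
    qed (use e in simp)
    also have "\<dots> < e" using T e by simp
    finally show ?thesis by (simp add: dist_real_def abs_of_nonneg udist_nonneg)
  qed
  then show "\<forall>\<^sub>F r in sequentially. dist (udist x (grid_path r (\<lambda>k. x (real k / (real r)\<^sup>2)))) 0 < e"
    unfolding eventually_sequentially by blast
qed

text \<open>No rate of convergence is given, so Borel-Cantelli does not apply. The intersection of
  all events from \<open>n\<close> on is contained in each of them and therefore null, which
  excludes only that they occur eventually always.\<close>

lemma prod_tendsto_zero_AE_frequently:
  assumes M: "prob_space M" and E: "\<And>r. E r \<in> sets M" and lim: "(\<lambda>r. measure M (E r)) \<longlonglongrightarrow> 0"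
  shows "AE \<omega> in M. \<exists>\<^sub>F r in sequentially. \<omega> \<notin> E r"
proof -
  interpret prob_space M by fact
  have "AE \<omega> in M. \<exists>r\<ge>n. \<omega> \<notin> E r" for n
  proof -
    have m: "(\<Inter>r\<in>{n..}. E r) \<in> events" using E by (intro sets.countable_INT') auto
    have "prob (\<Inter>r\<in>{n..}. E r) \<le> prob (E r)" if "r \<ge> n" for r
      using that E by (intro finite_measure_mono) auto
    then have "\<forall>\<^sub>F r in sequentially. prob (\<Inter>r\<in>{n..}. E r) \<le> prob (E r)"
      unfolding eventually_sequentially by blast
    then have "prob (\<Inter>r\<in>{n..}. E r) \<le> 0"
      using tendsto_lowerbound[OF lim] by simp
    then have "prob (\<Inter>r\<in>{n..}. E r) = 0" by (simp add: measure_le_0_iff)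
    then have "AE \<omega> in M. \<omega> \<notin> (\<Inter>r\<in>{n..}. E r)" using m by (simp add: prob_eq_0)
    then show ?thesis by eventually_elim auto
  qed
  then have "AE \<omega> in M. \<forall>n. \<exists>r\<ge>n. \<omega> \<notin> E r" by (subst AE_all_countable) blast
  then show ?thesis by eventually_elim (simp add: frequently_sequentially)
qed

section \<open>The position process and powers of the step character\<close>

context scaled_walk
begin

definition position :: "real ^ 'n \<Rightarrow> real \<Rightarrow> 'w \<Rightarrow> real ^ 'n" where
  "position x t \<omega> = x + (LINT u:{0..t}|lborel. w (D (renewal_count (\<lambda>j. \<tau> j \<omega>) u) \<omega>))"

text \<open>The index of the current direction takes countably many values, so the integrand is
  jointly measurable in outcome and time, and integrating out the time preserves
  measurability.\<close>

lemma position_measurable: "position x t \<in> borel_measurable M"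
proof -
  have c: "(\<lambda>z. renewal_count (\<lambda>j. \<tau> j (fst z)) (snd z)) \<in> measurable (M \<Otimes>\<^sub>M lborel) (count_space UNIV)"
    by (rule measurable_renewal_count) measurable
  have "(\<lambda>z. (\<lambda>k z. w (D k (fst z))) (renewal_count (\<lambda>j. \<tau> j (fst z)) (snd z)) z) \<in> borel_measurable (M \<Otimes>\<^sub>M lborel)"
    by (rule measurable_compose_countable[OF _ c]) measurable
  then have [measurable]: "(\<lambda>z. w (D (renewal_count (\<lambda>j. \<tau> j (fst z)) (snd z)) (fst z)))
    \<in> borel_measurable (M \<Otimes>\<^sub>M lborel)"
    by simp
  have "(\<lambda>(\<omega>, u). indicator {0..t} u *\<^sub>R w (D (renewal_count (\<lambda>j. \<tau> j \<omega>) u) \<omega>)) \<in> borel_measurable (M \<Otimes>\<^sub>M lborel)"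
    by (simp add: case_prod_beta) measurable
  from lborel.borel_measurable_lebesgue_integral[OF this]
  show ?thesis unfolding position_def[abs_def] set_lebesgue_integral_def by simp
qed

lemma position_skorokhod:
  assumes "\<omega> \<in> space M" shows "(\<lambda>t. position x t \<omega>) \<in> skorokhod_space"
proof (rule continuous_imp_skorokhod)
  let ?C = "2 * b / \<epsilon>"
  have C: "?C \<ge> 0" using b eps by simp
  have bd: "norm (w (D j \<omega>)) \<le> ?C" for j by (rule w_bound[OF D_space[OF assms]])
  have lip: "norm (position x t \<omega> - position x s \<omega>) \<le> ?C * (t - s)" if "0 \<le> s" "s \<le> t" for s t
    using renewal_path_lipschitz[where v = "\<lambda>j. w (D j \<omega>)", OF bd that] by (simp add: position_def)
  show "continuous_on {0..} (\<lambda>t. position x t \<omega>)"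
    unfolding continuous_on_iff
  proof (intro ballI allI impI)
    fix t e :: real assume t: "t \<in> {0..}" and e: "e > 0"
    show "\<exists>d>0. \<forall>s\<in>{0..}. dist s t < d \<longrightarrow> dist (position x s \<omega>) (position x t \<omega>) < e"
    proof (intro exI[of _ "e / (?C + 1)"] conjI ballI impI)
      show "e / (?C + 1) > 0" using e C by (intro divide_pos_pos) auto
      fix s :: real assume s: "s \<in> {0..}" "dist s t < e / (?C + 1)"
      have "dist (position x s \<omega>) (position x t \<omega>) \<le> ?C * \<bar>s - t\<bar>"
        using lip[of s t] lip[of t s] s t by (cases "s \<le> t") (auto simp: dist_norm norm_minus_commute)
      also have "\<dots> \<le> (?C + 1) * \<bar>s - t\<bar>" by (intro mult_right_mono) auto
      also have "\<dots> < e" using s(2) C by (simp add: dist_real_def pos_less_divide_eq mult.commute)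
      finally show "dist (position x s \<omega>) (position x t \<omega>) < e" .
    qed
  qed
qed

text \<open>In the unit disc the \<open>p\<close>-th powers of two numbers differ by at most
  \<open>p\<close> times their distance. The exponential is in the disc because
  \<open>\<psi>\<close> has nonpositive real part, and the distance is of order
  \<open>\<epsilon>^3\<close>, while \<open>p * \<epsilon>^2\<close> stays bounded in the
  application.\<close>

lemma char_power_bound:
  fixes v :: "real ^ 'n"
  defines "\<psi> \<equiv> char_exponent m A v"
  shows "norm (char_Y v ^ p - exp (of_real (real p * \<epsilon>\<^sup>2) * \<psi>))
    \<le> real p * \<epsilon>\<^sup>2 * ((8 * (norm v * b) ^ 3 + 3 * (norm v * b)\<^sup>2 + exp (norm \<psi>) * (norm \<psi>)\<^sup>2) * \<epsilon>)"
proof -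
  let ?C = "8 * (norm v * b) ^ 3 + 3 * (norm v * b)\<^sup>2"
  let ?z = "of_real (\<epsilon>\<^sup>2) * \<psi>"
  have "Re \<psi> = - (\<integral>\<alpha>. (v \<bullet> f \<alpha>)\<^sup>2 \<partial>law)" by (simp add: \<psi>_def char_exponent_def second_moment_f)
  moreover have "0 \<le> (\<integral>\<alpha>. (v \<bullet> f \<alpha>)\<^sup>2 \<partial>law)" by (rule Bochner_Integration.integral_nonneg) simp
  ultimately have re: "Re \<psi> \<le> 0" by linarith
  have e1: "norm (exp ?z) \<le> 1" using re by (simp add: mult_nonneg_nonpos)
  have e2: "\<epsilon>\<^sup>2 \<le> 1" using eps by (simp add: power_le_one)
  have t: "norm (exp ?z - (1 + ?z)) \<le> exp (norm \<psi>) * (norm \<psi>)\<^sup>2 * \<epsilon> ^ 3"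
  proof -
    have "norm (exp ?z - (1 + ?z)) \<le> exp \<bar>Re ?z\<bar> * norm ?z ^ 2"
      using Taylor_exp[of ?z 1] by (simp add: numeral_2_eq_2)
    also have "\<dots> \<le> exp (norm \<psi>) * ((norm \<psi>)\<^sup>2 * \<epsilon> ^ 3)"
    proof (rule mult_mono)
      have "\<bar>Re ?z\<bar> \<le> norm ?z" by (rule abs_Re_le_cmod)
      also have "\<dots> = \<epsilon>\<^sup>2 * norm \<psi>" by (simp add: norm_mult norm_power)
      also have "\<dots> \<le> norm \<psi>" using e2 by (intro mult_left_le_one_le) auto
      finally show "exp \<bar>Re ?z\<bar> \<le> exp (norm \<psi>)" by simp
      have "norm ?z ^ 2 = (norm \<psi>)\<^sup>2 * \<epsilon> ^ 4"
        by (simp add: norm_mult norm_power power_mult_distrib mult.commute flip: power_mult)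
      also have "\<dots> \<le> (norm \<psi>)\<^sup>2 * \<epsilon> ^ 3" using eps by (intro mult_left_mono power_decreasing) auto
      finally show "norm ?z ^ 2 \<le> (norm \<psi>)\<^sup>2 * \<epsilon> ^ 3" .
    qed auto
    finally show ?thesis by simp
  qed
  have "norm (char_Y v - exp ?z) \<le> norm (char_Y v - (1 + ?z)) + norm (exp ?z - (1 + ?z))"
    using norm_triangle_ineq4[of "char_Y v - (1 + ?z)" "exp ?z - (1 + ?z)"] by simp
  also have "\<dots> \<le> ?C * \<epsilon> ^ 3 + exp (norm \<psi>) * (norm \<psi>)\<^sup>2 * \<epsilon> ^ 3"
    using char_expansion[of v 0] t by (intro add_mono) (simp_all add: char_Y_def \<psi>_def)
  also have "\<dots> = \<epsilon>\<^sup>2 * ((?C + exp (norm \<psi>) * (norm \<psi>)\<^sup>2) * \<epsilon>)"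
    by (simp add: power2_eq_square power3_eq_cube distrib_left distrib_right)
  finally have d: "norm (char_Y v - exp ?z) \<le> \<epsilon>\<^sup>2 * ((?C + exp (norm \<psi>) * (norm \<psi>)\<^sup>2) * \<epsilon>)" .
  have "exp (of_real (real p * \<epsilon>\<^sup>2) * \<psi>) = exp ?z ^ p"
    by (simp add: exp_of_nat_mult[symmetric] mult.assoc)
  then have "norm (char_Y v ^ p - exp (of_real (real p * \<epsilon>\<^sup>2) * \<psi>)) \<le> real p * norm (char_Y v - exp ?z)"
    using norm_power_diff[OF norm_char_Y e1, of v p] by simp
  also have "\<dots> \<le> real p * (\<epsilon>\<^sup>2 * ((?C + exp (norm \<psi>) * (norm \<psi>)\<^sup>2) * \<epsilon>))"
    by (rule mult_left_mono[OF d]) simp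
  finally show ?thesis by (simp only: mult.assoc)
qed

lemma knot_increment:
  assumes "a > 0"
  shows "\<bar>real (knot a (Suc k) - knot a k) * \<epsilon>\<^sup>2 - 1 / a\<bar> \<le> \<epsilon>\<^sup>2"
proof -
  have e2: "\<epsilon>\<^sup>2 > 0" using eps by simp
  have eq: "real (Suc k) / a / \<epsilon>\<^sup>2 = real k / a / \<epsilon>\<^sup>2 + 1 / a / \<epsilon>\<^sup>2" by (simp add: add_divide_distrib)
  have "real (knot a (Suc k) - knot a k) = real (knot a (Suc k)) - real (knot a k)"
    using monoD[OF mono_knot[OF assms], of k "Suc k"] by simp
  then have "\<bar>real (knot a (Suc k) - knot a k) - 1 / a / \<epsilon>\<^sup>2\<bar> \<le> 1"
    using knot_bounds[OF assms, of k] knot_bounds[OF assms, of "Suc k"] eq by linarith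
  then have "\<bar>real (knot a (Suc k) - knot a k) - 1 / a / \<epsilon>\<^sup>2\<bar> * \<epsilon>\<^sup>2 \<le> 1 * \<epsilon>\<^sup>2"
    using e2 by (intro mult_right_mono) auto
  moreover have "\<bar>real (knot a (Suc k) - knot a k) - 1 / a / \<epsilon>\<^sup>2\<bar> * \<epsilon>\<^sup>2 = \<bar>real (knot a (Suc k) - knot a k) * \<epsilon>\<^sup>2
    - 1 / a\<bar>"
  proof -
    have "\<bar>y\<bar> * \<epsilon>\<^sup>2 = \<bar>y * \<epsilon>\<^sup>2\<bar>" for y using e2 by (simp add: abs_mult)
    then show ?thesis using e2 by (simp add: left_diff_distrib)
  qed
  ultimately show ?thesis by simp
qed

end

lemma eventually_small_eps:
  "c > 0 \<Longrightarrow> \<forall>\<^sub>F \<epsilon> :: real in at_right 0. 0 < \<epsilon> \<and> \<epsilon> \<le> 1 \<and> \<epsilon>\<^sup>2 \<le> c"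
proof (rule eventually_at_rightI[of 0 "min 1 c"])
  fix \<epsilon> :: real assume "\<epsilon> \<in> {0<..<min 1 c}"
  then have \<epsilon>: "0 < \<epsilon>" "\<epsilon> < 1" "\<epsilon> < c" by auto
  then have "\<epsilon>\<^sup>2 \<le> \<epsilon> * 1" unfolding power2_eq_square by (intro mult_left_mono) auto
  then show "0 < \<epsilon> \<and> \<epsilon> \<le> 1 \<and> \<epsilon>\<^sup>2 \<le> c" using \<epsilon> by simp
qed simp

lemma eps_tendsto: "((\<lambda>\<epsilon> :: real. \<epsilon>) \<longlongrightarrow> 0) (at_right 0)" "((\<lambda>\<epsilon> :: real. \<epsilon>\<^sup>2) \<longlongrightarrow> 0) (at_right 0)"
proof -
  show 1: "((\<lambda>\<epsilon> :: real. \<epsilon>) \<longlongrightarrow> 0) (at_right 0)" by (rule tendsto_ident_at)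
  show "((\<lambda>\<epsilon> :: real. \<epsilon>\<^sup>2) \<longlongrightarrow> 0) (at_right 0)" using tendsto_power[OF 1, of 2] by simp
qed

section \<open>Convergence of the walks\<close>

locale walk_limit =
  fixes M :: "real \<Rightarrow> 'w measure" and N law :: "'b measure"
    and \<tau> :: "real \<Rightarrow> nat \<Rightarrow> 'w \<Rightarrow> real" and D :: "real \<Rightarrow> nat \<Rightarrow> 'w \<Rightarrow> 'b"
    and f g :: "'b \<Rightarrow> real ^ 'n::finite" and b :: real and m :: "real ^ 'n" and A :: "'n \<Rightarrow> 'n \<Rightarrow> real" and dim :: real
    and M0 :: "'v measure" and X0 :: "real \<Rightarrow> 'v \<Rightarrow> real ^ 'n" and x :: "real ^ 'n"
      and P :: "real \<Rightarrow> real ^ 'n \<Rightarrow> (real ^ 'n) measure"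
  assumes walk: "\<And>\<epsilon>. 0 < \<epsilon> \<Longrightarrow> \<epsilon> \<le> 1 \<Longrightarrow> scaled_walk (M \<epsilon>) N law \<epsilon> (\<tau> \<epsilon>) (D \<epsilon>) f g b m A dim"
    and X0_path: "\<And>\<omega>. \<omega> \<in> space M0 \<Longrightarrow> (\<lambda>t. X0 t \<omega>) \<in> skorokhod_space"
    and X0_start: "AE \<omega> in M0. X0 0 \<omega> = x"
    and markov: "markov_process M0 X0 P"
    and gen: "has_generator_on P (const_coeff_op m A) test_functions"
begin

definition incr :: "nat \<Rightarrow> real \<Rightarrow> nat \<Rightarrow> 'w \<Rightarrow> real ^ 'n" where
  "incr r \<epsilon> k \<omega>
    = (\<Sum>j=scaled_walk.knot \<epsilon> ((real r)\<^sup>2) k..<scaled_walk.knot \<epsilon> ((real r)\<^sup>2) (Suc k). scaled_walk.Y \<epsilon> (\<tau> \<epsilon>) (D \<epsilon>)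
    f g j \<omega>)"

definition incr0 :: "nat \<Rightarrow> nat \<Rightarrow> 'v \<Rightarrow> real ^ 'n" where
  "incr0 r k \<omega> = X0 (real (Suc k) / (real r)\<^sup>2) \<omega> - X0 (real k / (real r)\<^sup>2) \<omega>"

abbreviation tail_const :: real where "tail_const \<equiv> dim * (13856 * 256 * b ^ 4 * dim ^ 4)"

lemma b_dim: "0 \<le> b" "1 \<le> dim" "0 \<le> tail_const"
proof -
  interpret scaled_walk "M 1" N law 1 "\<tau> 1" "D 1" f g b m A dim by (rule walk) auto
  show "0 \<le> b" "1 \<le> dim" by (rule b dim_pos)+
  then show "0 \<le> tail_const" by simp
qed

lemma eventually_walk:
  "\<forall>\<^sub>F \<epsilon> in at_right 0. prob_space (M \<epsilon>) \<and> (\<forall>k. incr r \<epsilon> k \<in> borel_measurable (M \<epsilon>))"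
  using eventually_small_eps[of 1, OF zero_less_one]
proof eventually_elim
  case (elim \<epsilon>)
  interpret scaled_walk "M \<epsilon>" N law \<epsilon> "\<tau> \<epsilon>" "D \<epsilon>" f g b m A dim by (rule walk) (use elim in auto)
  show ?case using prob_space_axioms by (auto simp: incr_def[abs_def])
qed

lemma M0_prob: "prob_space M0"
  by (rule markov_prob_space[OF markov])

lemma X0_measurable: "t \<ge> 0 \<Longrightarrow> X0 t \<in> borel_measurable M0"
  by (rule markov_measurable[OF markov])

lemma incr0_measurable: "incr0 r k \<in> borel_measurable M0"
  unfolding incr0_def[abs_def] by (intro borel_measurable_diff X0_measurable) auto

text \<open>A block has \<open>p\<close> steps with \<open>p * \<epsilon>^2\<close> within
  \<open>\<epsilon>^2\<close> of the mesh \<open>1 / a\<close>, so its character, close to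
  \<open>exp (p * \<epsilon>^2 * \<psi>)\<close>, tends to \<open>exp (\<psi> / a)\<close>. This is
  the character of the diffusion increment.\<close>

lemma char_convergence:
  assumes r: "r > 0"
  shows "((\<lambda>\<epsilon>. \<integral>\<omega>. (\<Prod>k<K. cis (v k \<bullet> incr r \<epsilon> k \<omega>)) \<partial>M \<epsilon>) \<longlongrightarrow> (\<integral>\<omega>. (\<Prod>k<K. cis (v k \<bullet> incr0 r k \<omega>)) \<partial>M0)) (at_right 0)"
proof -
  define a where "a = (real r)\<^sup>2"
  have a: "a > 0" using r by (simp add: a_def)
  have R: "(\<integral>\<omega>. (\<Prod>k<K. cis (v k \<bullet> incr0 r k \<omega>)) \<partial>M0) = (\<Prod>k<K. exp (of_real (1 / a) * char_exponent m A (v k)))"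
    using diffusion_increments_char[OF markov gen, of "1 / a" v K] a by (simp add: incr0_def a_def)
  define p where "p \<epsilon> k = scaled_walk.knot \<epsilon> a (Suc k) - scaled_walk.knot \<epsilon> a k" for \<epsilon> k
  define ch where "ch \<epsilon> v = scaled_walk.char_Y (M \<epsilon>) \<epsilon> (\<tau> \<epsilon>) (D \<epsilon>) f g v" for \<epsilon> v
  have L: "\<forall>\<^sub>F \<epsilon> in at_right 0. (\<Prod>k<K. ch \<epsilon> (v k) ^ p \<epsilon> k) = (\<integral>\<omega>. (\<Prod>k<K. cis (v k \<bullet> incr r \<epsilon> k \<omega>)) \<partial>M \<epsilon>)"
    using eventually_small_eps[of 1, OF zero_less_one]
  proof eventually_elim
    case (elim \<epsilon>)
    interpret scaled_walk "M \<epsilon>" N law \<epsilon> "\<tau> \<epsilon>" "D \<epsilon>" f g b m A dim by (rule walk) (use elim in auto)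
    show ?case
      unfolding ch_def p_def incr_def a_def[symmetric]
      by (rule char_walk_increments[symmetric, OF knot_0 mono_knot[OF a]])
  qed
  have "((\<lambda>\<epsilon>. ch \<epsilon> u ^ p \<epsilon> k) \<longlongrightarrow> exp (of_real (1 / a) * char_exponent m A u)) (at_right 0)" for u k
  proof -
    let ?\<psi> = "char_exponent m A u"
    define C where "C = 8 * (norm u * b) ^ 3 + 3 * (norm u * b)\<^sup>2 + exp (norm ?\<psi>) * (norm ?\<psi>)\<^sup>2"
    have C: "C \<ge> 0" using b_dim by (simp add: C_def)
    have bounds: "\<forall>\<^sub>F \<epsilon> in at_right 0. \<bar>real (p \<epsilon> k) * \<epsilon>\<^sup>2 - 1 / a\<bar> \<le> \<epsilon>\<^sup>2 \<and>
        norm (ch \<epsilon> u ^ p \<epsilon> k - exp (of_real (real (p \<epsilon> k) * \<epsilon>\<^sup>2) * ?\<psi>)) \<le> (1 / a + 1) * (C * \<epsilon>)"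
      using eventually_small_eps[of 1, OF zero_less_one]
    proof eventually_elim
      case (elim \<epsilon>)
      interpret scaled_walk "M \<epsilon>" N law \<epsilon> "\<tau> \<epsilon>" "D \<epsilon>" f g b m A dim by (rule walk) (use elim in auto)
      have k: "\<bar>real (p \<epsilon> k) * \<epsilon>\<^sup>2 - 1 / a\<bar> \<le> \<epsilon>\<^sup>2" unfolding p_def by (rule knot_increment[OF a])
      have "norm (ch \<epsilon> u ^ p \<epsilon> k - exp (of_real (real (p \<epsilon> k) * \<epsilon>\<^sup>2) * ?\<psi>)) \<le> real (p \<epsilon> k) * \<epsilon>\<^sup>2 * (C * \<epsilon>)"
        unfolding ch_def C_def by (rule char_power_bound)
      also have "\<dots> \<le> (1 / a + 1) * (C * \<epsilon>)"
        using k elim C by (intro mult_right_mono) auto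
      finally show ?case using k by blast
    qed
    have "((\<lambda>\<epsilon>. real (p \<epsilon> k) * \<epsilon>\<^sup>2 - 1 / a) \<longlongrightarrow> 0) (at_right 0)"
      by (rule Lim_null_comparison[OF _ eps_tendsto(2)], rule eventually_mono[OF bounds]) simp
    then have "((\<lambda>\<epsilon>. real (p \<epsilon> k) * \<epsilon>\<^sup>2) \<longlongrightarrow> 1 / a) (at_right 0)" by (simp add: LIM_zero_iff)
    then have e: "((\<lambda>\<epsilon>. exp (of_real (real (p \<epsilon> k) * \<epsilon>\<^sup>2) * ?\<psi>)) \<longlongrightarrow> exp (of_real (1 / a) * ?\<psi>)) (at_right 0)"
      by (intro tendsto_intros)
    have "((\<lambda>\<epsilon>. (1 / a + 1) * (C * \<epsilon>)) \<longlongrightarrow> (1 / a + 1) * (C * 0)) (at_right 0)"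
      by (intro tendsto_intros eps_tendsto)
    then have lim: "((\<lambda>\<epsilon>. (1 / a + 1) * (C * \<epsilon>)) \<longlongrightarrow> 0) (at_right 0)" by simp
    have "((\<lambda>\<epsilon>. ch \<epsilon> u ^ p \<epsilon> k - exp (of_real (real (p \<epsilon> k) * \<epsilon>\<^sup>2) * ?\<psi>)) \<longlongrightarrow> 0) (at_right 0)"
      by (rule Lim_null_comparison[OF _ lim], rule eventually_mono[OF bounds]) blast
    from tendsto_add[OF this e] show ?thesis by simp
  qed
  then have "((\<lambda>\<epsilon>. \<Prod>k<K. ch \<epsilon> (v k) ^ p \<epsilon> k) \<longlongrightarrow> (\<Prod>k<K. exp (of_real (1 / a) * char_exponent m A (v k)))) (at_right 0)"
    by (intro tendsto_prod)
  then show ?thesis unfolding R by (rule Lim_transform_eventually[OF _ L])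
qed

lemma increments_tail:
  assumes r: "r > 0" and L: "L > 0" "4 * (1 / (real r)\<^sup>2) * b * dim \<le> L"
  shows "\<forall>\<^sub>F \<epsilon> in at_right 0. {\<omega> \<in> space (M \<epsilon>). \<exists>k<K. L < norm (incr r \<epsilon> k \<omega>)} \<in> sets (M \<epsilon>) \<and>
    measure (M \<epsilon>) {\<omega> \<in> space (M \<epsilon>). \<exists>k<K. L < norm (incr r \<epsilon> k \<omega>)} \<le> (real K + 1) *
      (tail_const * (1 / (real r)\<^sup>2)\<^sup>2 / L ^ 4)"
proof -
  define a where "a = (real r)\<^sup>2"
  have a: "a > 0" using r by (simp add: a_def)
  show ?thesis
    using eventually_small_eps[of "1 / a", OF divide_pos_pos[OF zero_less_one a]]
  proof eventually_elim
    case (elim \<epsilon>)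
    interpret scaled_walk "M \<epsilon>" N law \<epsilon> "\<tau> \<epsilon>" "D \<epsilon>" f g b m A dim by (rule walk) (use elim in auto)
    have im [measurable]: "incr r \<epsilon> k \<in> borel_measurable (M \<epsilon>)" for k unfolding incr_def[abs_def] by measurable
    have ms: "{\<omega> \<in> space (M \<epsilon>). \<exists>k<K. L < norm (incr r \<epsilon> k \<omega>)} \<in> sets (M \<epsilon>)" by measurable
    have "measure (M \<epsilon>) {\<omega> \<in> space (M \<epsilon>). \<exists>k<K. L < norm (incr r \<epsilon> k \<omega>)}
      \<le> measure (M \<epsilon>) {\<omega> \<in> space (M \<epsilon>). \<exists>k\<in>{..K}. \<exists>i\<in>{knot a k..knot a (Suc k)}. L < norm (\<Sum>j=knot a k..<i. Y j \<omega>)}"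
    proof (rule finite_measure_mono)
      show "{\<omega> \<in> space (M \<epsilon>). \<exists>k<K. L < norm (incr r \<epsilon> k \<omega>)} \<subseteq>
        {\<omega> \<in> space (M \<epsilon>). \<exists>k\<in>{..K}. \<exists>i\<in>{knot a k..knot a (Suc k)}. L < norm (\<Sum>j=knot a k..<i. Y j \<omega>)}"
      proof (intro subsetI)
        fix \<omega> assume "\<omega> \<in> {\<omega> \<in> space (M \<epsilon>). \<exists>k<K. L < norm (incr r \<epsilon> k \<omega>)}"
        then obtain k where k: "\<omega> \<in> space (M \<epsilon>)" "k < K" "L < norm (incr r \<epsilon> k \<omega>)" by blast
        then show "\<omega> \<in> {\<omega> \<in> space (M \<epsilon>). \<exists>k\<in>{..K}. \<exists>i\<in>{knot a k..knot a (Suc k)}. L < norm (\<Sum>j=knot a k..<i. Y j \<omega>)}"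
          using monoD[OF mono_knot[OF a], of k "Suc k"] unfolding incr_def a_def[symmetric]
          by (intro CollectI conjI bexI[of _ k] bexI[of _ "knot a (Suc k)"]) auto
      qed
    qed measurable
    also have "\<dots> \<le> (real K + 1) * (dim * (13856 * 256 * (1 / a)\<^sup>2 * b ^ 4 * dim ^ 4 / L ^ 4))"
      by (rule blocks_tail[OF a _ L(1) L(2)[folded a_def]]) (use elim in auto)
    finally show ?case using ms by (simp add: a_def mult_ac)
  qed
qed

lemma increments_weak_convergence:
  fixes G :: "(nat \<Rightarrow> real ^ 'n) \<Rightarrow> real"
  assumes r: "r > 0" and G: "continuous_on UNIV G" "\<And>z. \<bar>G z\<bar> \<le> B" "\<And>z z'. (\<And>k. k < K \<Longrightarrow> z k = z' k) \<Longrightarrow> G z = G z'"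
  shows "((\<lambda>\<epsilon>. \<integral>\<omega>. G (\<lambda>k. incr r \<epsilon> k \<omega>) \<partial>M \<epsilon>) \<longlongrightarrow> (\<integral>\<omega>. G (\<lambda>k. incr0 r k \<omega>) \<partial>M0)) (at_right 0)"
proof (rule weak_convergence_of_char[OF eventually_walk M0_prob incr0_measurable char_convergence[OF r] _ G])
  fix \<eta> :: real assume \<eta>: "\<eta> > 0"
  let ?C = "(real K + 1) * (tail_const * (1 / (real r)\<^sup>2)\<^sup>2)"
  have C: "?C \<ge> 0" using b_dim by (intro mult_nonneg_nonneg) auto
  show "\<exists>L0. \<forall>L\<ge>L0. \<forall>\<^sub>F \<epsilon> in at_right 0. measure (M \<epsilon>) {\<omega> \<in> space (M \<epsilon>). \<exists>k<K. \<exists>bb\<in>Basis. L < \<bar>incr r \<epsilon> k \<omega> \<bullet> bb\<bar>}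
    \<le> \<eta>"
  \<comment> \<open>The level is at least 1 so that its fourth power dominates it, then large enough
    for the drift condition of \<open>increments_tail\<close>, then for the tail to be at most
    \<open>\<eta>\<close>.\<close>
  proof (intro exI[of _ "max 1 (max (4 * (1 / (real r)\<^sup>2) * b * dim) (?C / \<eta>))"] allI impI)
    fix L assume "max 1 (max (4 * (1 / (real r)\<^sup>2) * b * dim) (?C / \<eta>)) \<le> L"
    then have L: "L \<ge> 1" "4 * (1 / (real r)\<^sup>2) * b * dim \<le> L" "?C / \<eta> \<le> L" by auto
    have "L ^ 4 \<ge> L" using power_increasing[of 1 4 L] L by simp
    then have "?C \<le> \<eta> * L ^ 4" using L(3) \<eta> by (simp add: pos_divide_le_eq) (smt (verit) mult.commute mult_left_mono)
    then have "?C / L ^ 4 \<le> \<eta>" using L(1) by (simp add: pos_divide_le_eq)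
    then have le: "(real K + 1) * (tail_const * (1 / (real r)\<^sup>2)\<^sup>2 / L ^ 4) \<le> \<eta>" by simp
    have L0: "L > 0" using L by simp
    show "\<forall>\<^sub>F \<epsilon> in at_right 0. measure (M \<epsilon>) {\<omega> \<in> space (M \<epsilon>). \<exists>k<K. \<exists>bb\<in>Basis. L < \<bar>incr r \<epsilon> k \<omega> \<bullet> bb\<bar>} \<le> \<eta>"
      using increments_tail[OF r L0 L(2), of K] eventually_walk[of r]
    proof eventually_elim
      case (elim \<epsilon>)
      interpret prob_space "M \<epsilon>" using elim by blast
      have "L < norm (incr r \<epsilon> k \<omega>)" if "bb \<in> Basis" "L < \<bar>incr r \<epsilon> k \<omega> \<bullet> bb\<bar>" for bb k \<omega>
        using Basis_le_norm[OF that(1), of "incr r \<epsilon> k \<omega>"] that(2) by linarith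
      then have "{\<omega> \<in> space (M \<epsilon>). \<exists>k<K. \<exists>bb\<in>Basis. L < \<bar>incr r \<epsilon> k \<omega> \<bullet> bb\<bar>} \<subseteq> {\<omega> \<in> space (M \<epsilon>). \<exists>k<K. L
        < norm (incr r \<epsilon> k \<omega>)}"
        by blast
      then have "measure (M \<epsilon>) {\<omega> \<in> space (M \<epsilon>). \<exists>k<K. \<exists>bb\<in>Basis. L < \<bar>incr r \<epsilon> k \<omega> \<bullet> bb\<bar>}
        \<le> measure (M \<epsilon>) {\<omega> \<in> space (M \<epsilon>). \<exists>k<K. L < norm (incr r \<epsilon> k \<omega>)}"
        by (rule finite_measure_mono) (use elim in blast)
      then show ?case using elim le by linarith
    qed
  qed
qed

text \<open>Convergence is known for increments; grid values are their partial sums started at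
  \<open>x\<close>, a continuous map. On the limit side the sums telescope because the process
  starts at \<open>x\<close> almost surely.\<close>

lemma grid_weak_convergence:
  assumes r: "r > 0" and \<phi>: "udist_continuous \<phi>" "\<And>y. y \<in> skorokhod_space \<Longrightarrow> \<bar>\<phi> y\<bar> \<le> B"
  shows "((\<lambda>\<epsilon>. \<integral>\<omega>. \<phi> (grid_path r (\<lambda>k. x + (\<Sum>j<k. incr r \<epsilon> j \<omega>))) \<partial>M \<epsilon>) \<longlongrightarrow>
     (\<integral>\<omega>. \<phi> (grid_path r (\<lambda>k. X0 (real k / (real r)\<^sup>2) \<omega>)) \<partial>M0)) (at_right 0)"
proof -
  define G where "G z = \<phi> (grid_path r (\<lambda>k. x + (\<Sum>j<k. z j)))" for z
  have "continuous_on UNIV (\<lambda>z :: nat \<Rightarrow> real ^ 'n. \<lambda>k. x + (\<Sum>j<k. z j))"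
    by (intro continuous_on_coordinatewise_then_product continuous_on_add continuous_on_const continuous_on_sum
      continuous_on_product_coordinates)
  then have G1: "continuous_on UNIV G"
    unfolding G_def using continuous_on_compose2[OF continuous_on_grid_path[OF \<phi>(1), of r]] by blast
  have G3: "G z = G z'" if "\<And>k. k < r ^ 3 \<Longrightarrow> z k = z' k" for z z'
  proof -
    have "(\<Sum>j<k. z j) = (\<Sum>j<k. z' j)" if "k \<le> r ^ 3" for k
      using that \<open>\<And>k. k < r ^ 3 \<Longrightarrow> z k = z' k\<close> by (intro sum.cong) auto
    then have "grid_path r (\<lambda>k. x + (\<Sum>j<k. z j)) = grid_path r (\<lambda>k. x + (\<Sum>j<k. z' j))"
      by (auto simp: grid_path_def)
    then show ?thesis by (simp add: G_def)
  qed
  have wc: "((\<lambda>\<epsilon>. \<integral>\<omega>. G (\<lambda>k. incr r \<epsilon> k \<omega>) \<partial>M \<epsilon>) \<longlongrightarrow> (\<integral>\<omega>. G (\<lambda>k. incr0 r k \<omega>) \<partial>M0)) (at_right 0)"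
    by (rule increments_weak_convergence[OF r G1 _ G3]) (auto simp: G_def intro: \<phi>(2) grid_path_skorokhod)
  have "(\<integral>\<omega>. G (\<lambda>k. incr0 r k \<omega>) \<partial>M0) = (\<integral>\<omega>. \<phi> (grid_path r (\<lambda>k. X0 (real k / (real r)\<^sup>2) \<omega>)) \<partial>M0)"
  proof (rule integral_cong_AE)
    show "(\<lambda>\<omega>. G (\<lambda>k. incr0 r k \<omega>)) \<in> borel_measurable M0"
      by (rule measurable_sequence_functional[OF G1 incr0_measurable])
    show "(\<lambda>\<omega>. \<phi> (grid_path r (\<lambda>k. X0 (real k / (real r)\<^sup>2) \<omega>))) \<in> borel_measurable M0"
      by (rule measurable_sequence_functional[OF continuous_on_grid_path[OF \<phi>(1)] X0_measurable]) simp
    show "AE \<omega> in M0. G (\<lambda>k. incr0 r k \<omega>) = \<phi> (grid_path r (\<lambda>k. X0 (real k / (real r)\<^sup>2) \<omega>))"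
      using X0_start
    proof eventually_elim
      case (elim \<omega>)
      have "x + (\<Sum>j<k. incr0 r j \<omega>) = X0 (real k / (real r)\<^sup>2) \<omega>" for k
        using sum_lessThan_telescope[of "\<lambda>k. X0 (real k / (real r)\<^sup>2) \<omega>" k] elim by (simp add: incr0_def)
      then show ?case by (simp add: G_def)
    qed
  qed
  then show ?thesis using wc by (simp add: G_def)
qed

text \<open>The tail bound of the walks is uniform in small \<open>\<epsilon>\<close> and so passes
  to the weak limit, through a continuous function in place of indicators. There are
  \<open>r^3\<close> increments with tails of order \<open>r^-4\<close>, hence the rate
  \<open>1 / r\<close>.\<close>

lemma grid_increments_small:
  assumes e: "e > 0"
  shows "(\<lambda>r. measure M0 {\<omega> \<in> space M0. \<exists>k<r ^ 3. 2 * e < norm (incr0 r k \<omega>)}) \<longlonglongrightarrow> 0"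
proof (rule tendsto_sandwich[of "\<lambda>_. 0"])
  obtain R0 :: nat where R0: "real R0 > max 1 (4 * b * dim / e)" using reals_Archimedean2 by blast
  have "measure M0 {\<omega> \<in> space M0. \<exists>k<r ^ 3. 2 * e < norm (incr0 r k \<omega>)} \<le> 2 * tail_const / e ^ 4 * (1 / real r)"
    if r: "r \<ge> R0" for r
  proof -
    have rr: "real r > 1" "4 * b * dim / e < real r" using R0 r by linarith+
    then have r0: "r > 0" by simp
    have "4 * b * dim < real r * e" using rr(2) e by (simp add: pos_divide_less_eq)
    also have "\<dots> \<le> (real r)\<^sup>2 * e" using rr e by (intro mult_right_mono) (auto simp: power2_eq_square)
    finally have L: "4 * (1 / (real r)\<^sup>2) * b * dim \<le> e" using r0 by (simp add: field_simps)
    \<comment> \<open>\<open>G\<close> vanishes if all increments are at most \<open>e\<close> and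
      equals 1 if one exceeds \<open>2 * e\<close>; it lies between the two indicators.\<close>
    define G where "G z = min 1 (\<Sum>k<r ^ 3. max 0 (norm (z k) / e - 1))" for z :: "nat \<Rightarrow> real ^ 'n"
    have G1: "continuous_on UNIV G" unfolding G_def
      by (intro continuous_on_min continuous_on_const continuous_on_sum continuous_on_max continuous_on_diff
          continuous_on_divide continuous_on_norm continuous_on_product_coordinates) (use e in auto)
    have G0: "0 \<le> G z" "G z \<le> 1" for z by (auto simp: G_def intro!: sum_nonneg)
    have G2: "\<bar>G z\<bar> \<le> 1" for z using G0[of z] by simp
    have G3: "G z = G z'" if "\<And>k. k < r ^ 3 \<Longrightarrow> z k = z' k" for z z'
      using that by (simp add: G_def)
    have wc: "((\<lambda>\<epsilon>. \<integral>\<omega>. G (\<lambda>k. incr r \<epsilon> k \<omega>) \<partial>M \<epsilon>) \<longlongrightarrow> (\<integral>\<omega>. G (\<lambda>k. incr0 r k \<omega>) \<partial>M0)) (at_right 0)"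
      by (rule increments_weak_convergence[OF r0 G1 G2 G3])
    let ?C = "(real (r ^ 3) + 1) * (tail_const * (1 / (real r)\<^sup>2)\<^sup>2 / e ^ 4)"
    have "\<forall>\<^sub>F \<epsilon> in at_right 0. (\<integral>\<omega>. G (\<lambda>k. incr r \<epsilon> k \<omega>) \<partial>M \<epsilon>) \<le> ?C"
      using increments_tail[OF r0 e L, of "r ^ 3"] eventually_walk[of r]
    proof eventually_elim
      case (elim \<epsilon>)
      let ?E = "{\<omega> \<in> space (M \<epsilon>). \<exists>k<r ^ 3. e < norm (incr r \<epsilon> k \<omega>)}"
      interpret prob_space "M \<epsilon>" using elim by blast
      have E: "?E \<in> sets (M \<epsilon>)" using elim by blast
      have Gm: "(\<lambda>\<omega>. G (\<lambda>k. incr r \<epsilon> k \<omega>)) \<in> borel_measurable (M \<epsilon>)"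
        by (rule measurable_sequence_functional[OF G1]) (use elim in blast)
      have "(\<integral>\<omega>. G (\<lambda>k. incr r \<epsilon> k \<omega>) \<partial>M \<epsilon>) \<le> (\<integral>\<omega>. indicator ?E \<omega> \<partial>M \<epsilon>)"
      proof (rule integral_mono)
        show "integrable (M \<epsilon>) (\<lambda>\<omega>. G (\<lambda>k. incr r \<epsilon> k \<omega>))"
          by (rule integrable_const_bound[of _ 1]) (use Gm G2 in auto)
        show "integrable (M \<epsilon>) (indicator ?E :: _ \<Rightarrow> real)" 
          by (rule integrable_const_bound[of _ 1]) (simp add: indicator_def, rule borel_measurable_indicator[OF E])
        fix \<omega> assume \<omega>: "\<omega> \<in> space (M \<epsilon>)"
        show "G (\<lambda>k. incr r \<epsilon> k \<omega>) \<le> indicator ?E \<omega>"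
        proof (cases "\<omega> \<in> ?E")
          case False
          then have "norm (incr r \<epsilon> k \<omega>) \<le> e" if "k < r ^ 3" for k
            using that \<omega> by force
          then have "norm (incr r \<epsilon> k \<omega>) / e - 1 \<le> 0" if "k < r ^ 3" for k
            using that e by simp
          then have "(\<Sum>k<r ^ 3. max 0 (norm (incr r \<epsilon> k \<omega>) / e - 1)) = 0"
            by (intro sum.neutral ballI max_absorb1) auto
          then show ?thesis using False by (simp add: G_def)
        qed (use G0 in simp)
      qed
      also have "\<dots> = measure (M \<epsilon>) ?E"
        unfolding Bochner_Integration.integral_indicator by (rule arg_cong[where f = "measure (M \<epsilon>)"]) blast
      also have "\<dots> \<le> ?C" using elim by blast
      finally show ?case .
    qed
    then have le: "(\<integral>\<omega>. G (\<lambda>k. incr0 r k \<omega>) \<partial>M0) \<le> ?C"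
      by (rule tendsto_upperbound[OF wc]) simp
    interpret prob_space M0 by (rule M0_prob)
    let ?E0 = "{\<omega> \<in> space M0. \<exists>k<r ^ 3. 2 * e < norm (incr0 r k \<omega>)}"
    have [measurable]: "incr0 r k \<in> borel_measurable M0" for k by (rule incr0_measurable)
    have E0: "?E0 \<in> sets M0" by measurable
    have "measure M0 ?E0 = (\<integral>\<omega>. indicator ?E0 \<omega> \<partial>M0)"
      unfolding Bochner_Integration.integral_indicator by (rule arg_cong[where f = "measure M0"]) blast
    also have "\<dots> \<le> (\<integral>\<omega>. G (\<lambda>k. incr0 r k \<omega>) \<partial>M0)"
    proof (rule integral_mono)
      show "integrable M0 (\<lambda>\<omega>. G (\<lambda>k. incr0 r k \<omega>))"
        by (rule integrable_const_bound[of _ 1]) (use measurable_sequence_functional[OF G1 incr0_measurable] G2 in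
          auto)
      show "integrable M0 (indicator ?E0 :: _ \<Rightarrow> real)" 
        by (rule integrable_const_bound[of _ 1]) (simp add: indicator_def, rule borel_measurable_indicator[OF E0])
      fix \<omega>
      show "indicator ?E0 \<omega> \<le> G (\<lambda>k. incr0 r k \<omega>)"
      proof (cases "\<omega> \<in> ?E0")
        case True
        then obtain k where k: "k < r ^ 3" "2 * e < norm (incr0 r k \<omega>)" by blast
        then have "1 \<le> max 0 (norm (incr0 r k \<omega>) / e - 1)" using e by (simp add: le_max_iff_disj pos_le_divide_eq)
        also have "\<dots> \<le> (\<Sum>k<r ^ 3. max 0 (norm (incr0 r k \<omega>) / e - 1))"
          using member_le_sum[of k "{..<r ^ 3}" "\<lambda>k. max 0 (norm (incr0 r k \<omega>) / e - 1)"] k by simp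
        finally show ?thesis by (simp add: G_def)
      qed (use G0 in simp)
    qed
    also have "\<dots> \<le> ?C" by (rule le)
    also have "?C \<le> 2 * real (r ^ 3) * (tail_const * (1 / (real r)\<^sup>2)\<^sup>2 / e ^ 4)"
      using r0 b_dim e by (intro mult_right_mono) auto
    also have "\<dots> = 2 * tail_const / e ^ 4 * (real (r ^ 3) * (1 / (real r)\<^sup>2)\<^sup>2)" by simp
    also have "real (r ^ 3) * (1 / (real r)\<^sup>2)\<^sup>2 = 1 / real r" using r0 by (simp add: power2_eq_square power3_eq_cube)
    finally show ?thesis .
  qed
  then show "\<forall>\<^sub>F r in sequentially. measure M0 {\<omega> \<in> space M0. \<exists>k<r ^ 3. 2 * e < norm (incr0 r k \<omega>)}
    \<le> 2 * tail_const / e ^ 4 * (1 / real r)"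
    unfolding eventually_sequentially by blast
  show "(\<lambda>r. 2 * tail_const / e ^ 4 * (1 / real r)) \<longlonglongrightarrow> 0"
    using tendsto_mult_right_zero[OF lim_1_over_n, of "2 * tail_const / e ^ 4"] by simp
qed simp_all

text \<open>For each of countably many thresholds, almost every outcome has infinitely many grids
  with all increments below it.\<close>

lemma X0_continuous: "AE \<omega> in M0. continuous_on {0..} (\<lambda>t. X0 t \<omega>)"
proof -
  have [measurable]: "incr0 r k \<in> borel_measurable M0" for r k by (rule incr0_measurable)
  have "AE \<omega> in M0. \<exists>\<^sub>F r in sequentially. \<omega> \<notin> {\<omega> \<in> space M0. \<exists>k<r ^ 3. 2 * (1 / real (Suc j))
    < norm (incr0 r k \<omega>)}" for j
    by (rule prod_tendsto_zero_AE_frequently[OF M0_prob _ grid_increments_small]) simp_all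
  then have "AE \<omega> in M0. \<forall>j. \<exists>\<^sub>F r in sequentially. \<omega> \<notin> {\<omega> \<in> space M0. \<exists>k<r ^ 3. 2 * (1 / real (Suc j))
    < norm (incr0 r k \<omega>)}"
    by (subst AE_all_countable) blast
  then show ?thesis
    using AE_space
  proof eventually_elim
    case (elim \<omega>)
    show ?case
    proof (rule cadlag_continuous_of_small_increments[OF X0_path[OF elim(2)]])
      fix e :: real assume e: "e > 0"
      obtain j :: nat where j: "1 / real (Suc j) < e / 2" using nat_approx_posE[of "e / 2"] e by auto
      have "\<exists>\<^sub>F r in sequentially. \<omega> \<notin> {\<omega> \<in> space M0. \<exists>k<r ^ 3. 2 * (1 / real (Suc j)) < norm (incr0 r k \<omega>)}"
        using elim(1) by blast
      then show "\<exists>\<^sub>F r in sequentially. \<forall>k<r ^ 3. norm (X0 (real (Suc k) / (real r)\<^sup>2) \<omega>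
        - X0 (real k / (real r)\<^sup>2) \<omega>) \<le> e"
      proof (rule frequently_elim1)
        fix r assume "\<omega> \<notin> {\<omega> \<in> space M0. \<exists>k<r ^ 3. 2 * (1 / real (Suc j)) < norm (incr0 r k \<omega>)}"
        then have "norm (incr0 r k \<omega>) \<le> 2 * (1 / real (Suc j))" if "k < r ^ 3" for k
          using elim(2) that by force
        then show "\<forall>k<r ^ 3. norm (X0 (real (Suc k) / (real r)\<^sup>2) \<omega> - X0 (real k / (real r)\<^sup>2) \<omega>) \<le> e"
          using j unfolding incr0_def by (smt (verit) field_sum_of_halves)
      qed
    qed
  qed
qed

end

context walk_limit
begin

abbreviation pos :: "real \<Rightarrow> real \<Rightarrow> 'w \<Rightarrow> real ^ 'n" where
  "pos \<epsilon> t \<omega> \<equiv> scaled_walk.position \<epsilon> (\<tau> \<epsilon>) (D \<epsilon>) f g x t \<omega>"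

lemma pos_measurable:
  assumes "0 < \<epsilon>" "\<epsilon> \<le> 1" and F: "continuous_map skorokhod_topology euclideanreal F"
  shows "(\<lambda>\<omega>. F (\<lambda>t. pos \<epsilon> t \<omega>)) \<in> borel_measurable (M \<epsilon>)"
proof -
  interpret scaled_walk "M \<epsilon>" N law \<epsilon> "\<tau> \<epsilon>" "D \<epsilon>" f g b m A dim by (rule walk) (use assms in auto)
  show ?thesis by (rule measurable_skorokhod_functional[OF F position_measurable position_skorokhod])
qed

lemma X0_functional_measurable:
  "continuous_map skorokhod_topology euclideanreal F \<Longrightarrow> (\<lambda>\<omega>. F (\<lambda>t. X0 t \<omega>)) \<in> borel_measurable M0"
  by (rule measurable_skorokhod_functional[OF _ X0_measurable X0_path])

text \<open>\<open>r\<close> is fixed before \<open>\<epsilon>\<close>: the part of the error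
  probability that depends on \<open>\<epsilon>\<close> falls below \<open>1 / r\<close> for small
  \<open>\<epsilon>\<close>, and the uniform part is of order \<open>1 / r\<close> at fixed
  \<open>\<eta>\<close>. The term \<open>exp (- real r)\<close> covers the times after
  \<open>r\<close>, where nothing is compared.\<close>

lemma position_near_grid_path:
  assumes \<eta>: "\<eta> > 0"
  obtains Q :: "nat \<Rightarrow> real" where "Q \<longlonglongrightarrow> 0"
    "\<And>r. 4 * (1 / (real r)\<^sup>2) * b * dim \<le> \<eta> \<Longrightarrow> r > 0 \<Longrightarrow> \<forall>\<^sub>F \<epsilon> in at_right 0. \<exists>B\<in>sets (M \<epsilon>). measure (M \<epsilon>) B \<le> Q r \<and>
       (\<forall>\<omega>\<in>space (M \<epsilon>) - B. udist (\<lambda>t. pos \<epsilon> t \<omega>) (grid_path r (\<lambda>k. x + (\<Sum>j<k. incr r \<epsilon> j \<omega>))) \<le> max (7 * \<eta>) (exp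
         (- real r)))"
proof -
  define Q where "Q r = 4 * tail_const / \<eta> ^ 4 * (1 / real r)" for r :: nat
  have "Q \<longlonglongrightarrow> 0" unfolding Q_def using tendsto_mult_right_zero[OF lim_1_over_n, of "4 * tail_const / \<eta> ^ 4"] by simp
  moreover have "\<forall>\<^sub>F \<epsilon> in at_right 0. \<exists>B\<in>sets (M \<epsilon>). measure (M \<epsilon>) B \<le> Q r + 1 / real r \<and>
       (\<forall>\<omega>\<in>space (M \<epsilon>) - B. udist (\<lambda>t. pos \<epsilon> t \<omega>) (grid_path r (\<lambda>k. x + (\<Sum>j<k. incr r \<epsilon> j \<omega>))) \<le> max (7 * \<eta>) (exp
         (- real r)))"
    if r: "4 * (1 / (real r)\<^sup>2) * b * dim \<le> \<eta>" "r > 0" for r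
  proof -
    define a where "a = (real r)\<^sup>2"
    have a: "a > 0" using r by (simp add: a_def)
    let ?K = "r ^ 3"
    \<comment> \<open>The contributions of the initial step and of the renewal times, which vanish
      with \<open>\<epsilon>\<close> at fixed mesh.\<close>
    define S
      where "S \<epsilon> = 2 * b * \<epsilon> / \<eta> + (real ?K + 3) * (212 * (real (?K + 2) / a + 1)\<^sup>2 * (\<epsilon>\<^sup>2)\<^sup>2 * (256 * a ^ 4))"
      for \<epsilon> :: real
    have "(S \<longlongrightarrow> 2 * b * 0 / \<eta> + (real ?K + 3) * (212 * (real (?K + 2) / a + 1)\<^sup>2 * 0\<^sup>2 * (256 * a ^ 4))) (at_right 0)"
      unfolding S_def using \<eta> by (intro tendsto_intros eps_tendsto) auto
    then have "(S \<longlongrightarrow> 0) (at_right 0)" by simp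
    then have Ssmall: "\<forall>\<^sub>F \<epsilon> in at_right 0. S \<epsilon> < 1 / real r" by (rule order_tendstoD) (use r in simp)
    have tail: "(real ?K + 2) * (dim * (13856 * 256 * (1 / a)\<^sup>2 * b ^ 4 * dim ^ 4 / \<eta> ^ 4)) \<le> Q r"
    proof -
      have "(real ?K + 2) * (dim * (13856 * 256 * (1 / a)\<^sup>2 * b ^ 4 * dim ^ 4 / \<eta> ^ 4))
        = (real ?K + 2) * (tail_const * (1 / a)\<^sup>2 / \<eta> ^ 4)"
        by (simp add: mult_ac)
      also have "\<dots> \<le> (4 * real ?K) * (tail_const * (1 / a)\<^sup>2 / \<eta> ^ 4)"
      proof (rule mult_right_mono)
        have "real ?K \<ge> 1" using r(2) by (simp add: Suc_le_eq)
        then show "real ?K + 2 \<le> 4 * real ?K" by linarith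
        show "0 \<le> tail_const * (1 / a)\<^sup>2 / \<eta> ^ 4" using b_dim \<eta> by simp
      qed
      also have "\<dots> = 4 * tail_const / \<eta> ^ 4 * (real ?K * (1 / a)\<^sup>2)" by simp
      also have "real ?K * (1 / a)\<^sup>2 = 1 / real r" using r by (simp add: a_def power2_eq_square power3_eq_cube)
      finally show ?thesis by (simp add: Q_def)
    qed
    have pos4a: "1 / (4 * a) > 0" using a by simp
    show ?thesis
      using eventually_small_eps[OF pos4a] Ssmall
    proof eventually_elim
      case (elim \<epsilon>)
      interpret scaled_walk "M \<epsilon>" N law \<epsilon> "\<tau> \<epsilon>" "D \<epsilon>" f g b m A dim by (rule walk) (use elim in auto)
      have e2: "\<epsilon>\<^sup>2 \<le> 1 / (4 * a)" using elim by blast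
      obtain B where B: "B \<in> events"
        "prob B \<le> 2 * b * \<epsilon> / \<eta> + (real ?K + 3) * (212 * (real (?K + 2) / a + 1)\<^sup>2 * \<epsilon> ^ 4 * (256 * a ^ 4))
           + (real ?K + 2) * (dim * (13856 * 256 * (1 / a)\<^sup>2 * b ^ 4 * dim ^ 4 / \<eta> ^ 4))"
        "\<And>\<omega> t x. \<omega> \<in> space (M \<epsilon>) - B \<Longrightarrow> 0 \<le> t \<Longrightarrow> nat \<lfloor>a * t\<rfloor> \<le> ?K \<Longrightarrow>
           norm ((x + (LINT u:{0..t}|lborel. w (D \<epsilon> (renewal_count (\<lambda>j. \<tau> \<epsilon> j \<omega>) u) \<omega>)))
             - (x + (\<Sum>j<knot a (nat \<lfloor>a * t\<rfloor>). Y j \<omega>))) \<le> 7 * \<eta>"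
        using walk_approximation[OF a e2 \<eta> r(1)[folded a_def], of ?K] by blast
      have "(\<epsilon>\<^sup>2)\<^sup>2 = \<epsilon> ^ 4" by (simp flip: power_mult)
      then have "prob B \<le> Q r + 1 / real r" using B(2) tail elim by (simp add: S_def)
      moreover have "udist (\<lambda>t. pos \<epsilon> t \<omega>) (grid_path r (\<lambda>k. x + (\<Sum>j<k. incr r \<epsilon> j \<omega>)))
        \<le> max (7 * \<eta>) (exp (- real r))"
        if \<omega>: "\<omega> \<in> space (M \<epsilon>) - B" for \<omega>
      proof (rule udist_le_horizon)
        fix t :: real assume t: "0 \<le> t" "t < real r"
        have "a * t \<le> a * real r" using t a by (intro mult_left_mono) auto
        also have "\<dots> = real ?K" by (simp add: a_def power2_eq_square power3_eq_cube)
        finally have k: "nat \<lfloor>a * t\<rfloor> \<le> ?K" by linarith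
        have blocks: "(\<Sum>j<k. incr r \<epsilon> j \<omega>) = (\<Sum>j<knot a k. Y j \<omega>)" for k
        proof (induction k)
          case (Suc k)
          then show ?case
            using sum.atLeastLessThan_concat[of 0 "knot a k" "knot a (Suc k)"
              "\<lambda>j. Y j \<omega>"] monoD[OF mono_knot[OF a], of k "Suc k"]
            by (simp add: incr_def a_def[symmetric] atLeast0LessThan)
        qed (simp add: knot_0)
        have "grid_path r (\<lambda>k. x + (\<Sum>j<k. incr r \<epsilon> j \<omega>)) t = x + (\<Sum>j<knot a (nat \<lfloor>a * t\<rfloor>). Y j \<omega>)"
          using k by (simp add: grid_path_def blocks a_def[symmetric] min_def)
        then show "dist (pos \<epsilon> t \<omega>) (grid_path r (\<lambda>k. x + (\<Sum>j<k. incr r \<epsilon> j \<omega>)) t) \<le> 7 * \<eta>"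
          using B(3)[OF \<omega> t(1) k, of x] by (simp add: dist_norm position_def)
      qed (use \<eta> in simp)
      ultimately show ?case using B(1) by blast
    qed
  qed
  moreover have "(\<lambda>r. Q r + 1 / real r) \<longlonglongrightarrow> 0" using tendsto_add[OF calculation(1) lim_1_over_n] by simp
  ultimately show ?thesis using that[of "\<lambda>r. Q r + 1 / real r"] by blast
qed

text \<open>The order of choices is: an envelope index \<open>k\<close>, then \<open>\<eta>\<close>,
  then the grid \<open>r\<close>, then small \<open>\<epsilon>\<close>. Five losses of at most
  \<open>\<delta> / 8\<close> each occur: from the functional to its envelope, from the limit path
  to its step path, weak convergence, the Lipschitz error and the exceptional event.\<close>

lemma expectation_lower_bound:
  assumes F: "continuous_map skorokhod_topology euclideanreal F" and B: "\<And>y. y \<in> skorokhod_space \<Longrightarrow> \<bar>F y\<bar> \<le> B"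
    and \<delta>: "\<delta> > 0"
  shows "\<forall>\<^sub>F \<epsilon> in at_right 0. (\<integral>\<omega>. F (\<lambda>t. X0 t \<omega>) \<partial>M0) - \<delta> \<le> (\<integral>\<omega>. F (\<lambda>t. pos \<epsilon> t \<omega>) \<partial>M \<epsilon>)"
proof -
  interpret M0: prob_space M0 by (rule M0_prob)
  have B0: "B \<ge> 0" using B[OF grid_path_skorokhod] by (meson abs_ge_zero order.trans)
  note uF = skorokhod_continuous_imp_udist_continuous[OF F]
  define env where "env k = lower_envelope F (real k)" for k :: nat
  have gc: "udist_continuous (env k)" for k unfolding env_def by (rule udist_continuous_lower_envelope[OF B]) simp_all
  have gb: "\<bar>env k y\<bar> \<le> B" if "y \<in> skorokhod_space"
    for k y unfolding env_def by (rule lower_envelope_abs_le[OF B _ that]) simp_all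
  let ?gr = "\<lambda>r \<omega>. grid_path r (\<lambda>k. X0 (real k / (real r)\<^sup>2) \<omega>)"
  have grm: "(\<lambda>\<omega>. env k (?gr r \<omega>)) \<in> borel_measurable M0" for k r
    by (rule measurable_sequence_functional[OF continuous_on_grid_path[OF gc] X0_measurable]) simp
  \<comment> \<open>A measurable version of the envelope along the limit process: it is a limit of
    measurable functions of grid values and agrees almost everywhere with the envelope because the
    paths are continuous.\<close>
  define H where "H k \<omega> = lim (\<lambda>r. env k (?gr r \<omega>))" for k \<omega>
  have Hm: "H k \<in> borel_measurable M0" for k unfolding H_def[abs_def] by (rule borel_measurable_lim_metric[OF grm])
  have lim_gr: "AE \<omega> in M0. (\<lambda>r. env k (?gr r \<omega>)) \<longlonglongrightarrow> env k (\<lambda>t. X0 t \<omega>)" for k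
    using X0_continuous AE_space
  proof eventually_elim
    case (elim \<omega>)
    note u = udist_grid_path_tendsto[OF elim(1)]
    show ?case
    proof (rule tendstoI)
      fix e :: real assume "e > 0"
      then obtain d where d: "d > 0" "\<And>y. y \<in> skorokhod_space \<Longrightarrow> udist y (\<lambda>t. X0 t \<omega>) < d \<Longrightarrow>
        \<bar>env k y - env k (\<lambda>t. X0 t \<omega>)\<bar> < e"
        using gc X0_path[OF elim(2)] unfolding udist_continuous_def by blast
      have "\<forall>\<^sub>F r in sequentially. udist (\<lambda>t. X0 t \<omega>) (?gr r \<omega>) < d" using order_tendstoD(2)[OF u d(1)] .
      then show "\<forall>\<^sub>F r in sequentially. dist (env k (?gr r \<omega>)) (env k (\<lambda>t. X0 t \<omega>)) < e"
        by eventually_elim (use d(2)[OF grid_path_skorokhod] in \<open>simp add: udist_commute dist_real_def\<close>)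
    qed
  qed
  have Heq: "AE \<omega> in M0. H k \<omega> = env k (\<lambda>t. X0 t \<omega>)" for k
    using lim_gr[of k] by eventually_elim (simp add: H_def limI)
  have lim1: "(\<lambda>r. \<integral>\<omega>. env k (?gr r \<omega>) \<partial>M0) \<longlonglongrightarrow> (\<integral>\<omega>. H k \<omega> \<partial>M0)" for k
  proof (rule integral_dominated_convergence[where w = "\<lambda>_. B"])
    show "AE \<omega> in M0. (\<lambda>r. env k (?gr r \<omega>)) \<longlonglongrightarrow> H k \<omega>"
      using lim_gr[of k] Heq[of k] by eventually_elim simp
    show "AE \<omega> in M0. norm (env k (?gr r \<omega>)) \<le> B" for r using gb[OF grid_path_skorokhod] by simp
  qed (simp_all add: Hm grm)
  have lim2: "(\<lambda>k. \<integral>\<omega>. H k \<omega> \<partial>M0) \<longlonglongrightarrow> (\<integral>\<omega>. F (\<lambda>t. X0 t \<omega>) \<partial>M0)"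
  proof (rule integral_dominated_convergence[where w = "\<lambda>_. B"])
    have "AE \<omega> in M0. \<forall>k. H k \<omega> = env k (\<lambda>t. X0 t \<omega>)" using Heq by (subst AE_all_countable) blast
    then show "AE \<omega> in M0. (\<lambda>k. H k \<omega>) \<longlonglongrightarrow> F (\<lambda>t. X0 t \<omega>)"
      using AE_space
    proof eventually_elim
      case (elim \<omega>)
      then show ?case using lower_envelope_tendsto[OF B uF X0_path[OF elim(2)]] by (simp add: env_def)
    qed
    show "AE \<omega> in M0. norm (H k \<omega>) \<le> B" for k
      using Heq[of k] AE_space by eventually_elim (simp add: gb X0_path)
  qed (simp_all add: Hm X0_functional_measurable[OF F])
  have "\<forall>\<^sub>F k in sequentially. (\<integral>\<omega>. F (\<lambda>t. X0 t \<omega>) \<partial>M0) - \<delta> / 8 < (\<integral>\<omega>. H k \<omega> \<partial>M0)"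
    by (rule order_tendstoD(1)[OF lim2]) (use \<delta> in simp)
  then obtain k where k: "(\<integral>\<omega>. F (\<lambda>t. X0 t \<omega>) \<partial>M0) - \<delta> / 8 < (\<integral>\<omega>. H k \<omega> \<partial>M0)"
    unfolding eventually_sequentially by blast
  \<comment> \<open>\<open>56 = 7 * 8\<close>: the path is within \<open>7 * \<eta>\<close> of the
    step path, and \<open>k\<close> times this has to be at most
    \<open>\<delta> / 8\<close>.\<close>
  define \<eta> where "\<eta> = \<delta> / (56 * (real k + 1))"
  have \<eta>: "\<eta> > 0" using \<delta> by (simp add: \<eta>_def)
  have k\<eta>: "real k * (7 * \<eta>) \<le> \<delta> / 8"
  proof -
    have "real k * (7 * \<eta>) \<le> (real k + 1) * (7 * \<eta>)" using \<eta> by (intro mult_right_mono) auto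
    also have "\<dots> = \<delta> / 8" by (simp add: \<eta>_def field_simps)
    finally show ?thesis .
  qed
  obtain Q where Q: "Q \<longlonglongrightarrow> 0"
    "\<And>r. 4 * (1 / (real r)\<^sup>2) * b * dim \<le> \<eta> \<Longrightarrow> r > 0 \<Longrightarrow> \<forall>\<^sub>F \<epsilon> in at_right 0. \<exists>B\<in>sets (M \<epsilon>). measure (M \<epsilon>) B \<le> Q r \<and>
       (\<forall>\<omega>\<in>space (M \<epsilon>) - B. udist (\<lambda>t. pos \<epsilon> t \<omega>) (grid_path r (\<lambda>k. x + (\<Sum>j<k. incr r \<epsilon> j \<omega>))) \<le> max (7 * \<eta>) (exp
         (- real r)))"
    by (rule position_near_grid_path[OF \<eta>]) (rule that)
  have l1: "(\<lambda>r. 4 * (1 / (real r)\<^sup>2) * b * dim) \<longlonglongrightarrow> 4 * (0\<^sup>2) * b * dim"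
    unfolding power_one_over[symmetric] by (intro tendsto_intros lim_1_over_n)
  have l2: "(\<lambda>r. real k * exp (- real r)) \<longlonglongrightarrow> real k * 0"
  proof (rule tendsto_mult_left)
    have "filterlim (\<lambda>r. - real r) at_bot sequentially"
      using filterlim_real_sequentially by (simp add: filterlim_uminus_at_bot)
    from filterlim_compose[OF exp_at_bot this] show "(\<lambda>r. exp (- real r)) \<longlonglongrightarrow> 0" .
  qed
  have l3: "(\<lambda>r. 2 * B * Q r) \<longlonglongrightarrow> 2 * B * 0" by (intro tendsto_intros Q)
  have "\<forall>\<^sub>F r in sequentially. 4 * (1 / (real r)\<^sup>2) * b * dim < \<eta> \<and> real k * exp (- real r) < \<delta> / 8 \<and> 2 * B * Q r
    < \<delta> / 8
     \<and> (\<integral>\<omega>. H k \<omega> \<partial>M0) - \<delta> / 8 < (\<integral>\<omega>. env k (?gr r \<omega>) \<partial>M0) \<and> r > 0"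
  proof (intro eventually_conj)
    show "\<forall>\<^sub>F r in sequentially. 4 * (1 / (real r)\<^sup>2) * b * dim < \<eta>"
      by (rule order_tendstoD(2)[OF l1]) (use \<eta> in simp)
    show "\<forall>\<^sub>F r in sequentially. real k * exp (- real r) < \<delta> / 8" by (rule order_tendstoD(2)[OF l2]) (use \<delta> in simp)
    show "\<forall>\<^sub>F r in sequentially. 2 * B * Q r < \<delta> / 8" by (rule order_tendstoD(2)[OF l3]) (use \<delta> in simp)
    show "\<forall>\<^sub>F r in sequentially. (\<integral>\<omega>. H k \<omega> \<partial>M0) - \<delta> / 8 < (\<integral>\<omega>. env k (?gr r \<omega>) \<partial>M0)"
      by (rule order_tendstoD(1)[OF lim1]) (use \<delta> in simp)
  qed (rule eventually_gt_at_top)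
  then obtain r where r: "4 * (1 / (real r)\<^sup>2) * b * dim < \<eta>" "real k * exp (- real r) < \<delta> / 8" "2 * B * Q r < \<delta> / 8"
     "(\<integral>\<omega>. H k \<omega> \<partial>M0) - \<delta> / 8 < (\<integral>\<omega>. env k (?gr r \<omega>) \<partial>M0)" "r > 0"
    unfolding eventually_sequentially by blast
  have near: "\<forall>\<^sub>F \<epsilon> in at_right 0. (\<integral>\<omega>. env k (?gr r \<omega>) \<partial>M0) - \<delta> / 8
    < (\<integral>\<omega>. env k (grid_path r (\<lambda>k. x + (\<Sum>j<k. incr r \<epsilon> j \<omega>))) \<partial>M \<epsilon>)"
    by (rule order_tendstoD(1)[OF grid_weak_convergence[OF r(5) gc gb]]) (use \<delta> in auto)
  show ?thesis
    using near Q(2)[OF less_imp_le[OF r(1)] r(5)] eventually_small_eps[of 1, OF zero_less_one] eventually_walk[of r]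
  proof eventually_elim
    case (elim \<epsilon>)
    interpret scaled_walk "M \<epsilon>" N law \<epsilon> "\<tau> \<epsilon>" "D \<epsilon>" f g b m A dim by (rule walk) (use elim in auto)
    obtain E where E: "E \<in> events" "prob E \<le> Q r"
      "\<And>\<omega>. \<omega> \<in> space (M \<epsilon>) - E \<Longrightarrow> udist (\<lambda>t. pos \<epsilon> t \<omega>) (grid_path r (\<lambda>k. x + (\<Sum>j<k. incr r \<epsilon> j \<omega>)))
        \<le> max (7 * \<eta>) (exp (- real r))"
      using elim(2) by blast
    let ?G = "\<lambda>\<omega>. grid_path r (\<lambda>k. x + (\<Sum>j<k. incr r \<epsilon> j \<omega>))"
    let ?c = "real k * max (7 * \<eta>) (exp (- real r))"
    have im: "incr r \<epsilon> j \<in> borel_measurable (M \<epsilon>)" for j using elim(4) by blast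
    have Gm: "(\<lambda>\<omega>. env k (?G \<omega>)) \<in> borel_measurable (M \<epsilon>)"
      by (rule measurable_sequence_functional[OF continuous_on_grid_path[OF gc]])
        (intro borel_measurable_add borel_measurable_const borel_measurable_sum im)
    have iG: "integrable (M \<epsilon>) (\<lambda>\<omega>. env k (?G \<omega>))"
      by (rule integrable_const_bound[of _ B]) (use gb[OF grid_path_skorokhod] Gm in auto)
    have iE: "integrable (M \<epsilon>) (indicator E :: _ \<Rightarrow> real)"
      by (rule integrable_const_bound[of _ 1]) (simp add: indicator_def, rule borel_measurable_indicator[OF E(1)])
    have path: "(\<lambda>t. pos \<epsilon> t \<omega>) \<in> skorokhod_space" if "\<omega> \<in> space (M \<epsilon>)" for \<omega> by (rule position_skorokhod[OF that])
    have iF: "integrable (M \<epsilon>) (\<lambda>\<omega>. F (\<lambda>t. pos \<epsilon> t \<omega>))"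
      by (rule integrable_const_bound[of _ B]) (use B[OF path] pos_measurable[OF _ _ F] elim(3) in auto)
    \<comment> \<open>A measurable minorant of the functional that involves the envelope on step
      paths only. Off \<open>E\<close> it uses the Lipschitz property and that the envelope lies
      below \<open>F\<close>; on \<open>E\<close> subtracting \<open>2 * B\<close> brings it to at
      most \<open>- B\<close>.\<close>
    have "(\<integral>\<omega>. env k (?G \<omega>) - ?c - 2 * B * indicator E \<omega> \<partial>M \<epsilon>) \<le> (\<integral>\<omega>. F (\<lambda>t. pos \<epsilon> t \<omega>) \<partial>M \<epsilon>)"
    proof (rule integral_mono)
      show "integrable (M \<epsilon>) (\<lambda>\<omega>. env k (?G \<omega>) - ?c - 2 * B * indicator E \<omega>)" using iG iE by simp
      show "integrable (M \<epsilon>) (\<lambda>\<omega>. F (\<lambda>t. pos \<epsilon> t \<omega>))" by (rule iF)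
      fix \<omega> assume \<omega>: "\<omega> \<in> space (M \<epsilon>)"
      have c0: "?c \<ge> 0" using \<eta> by simp
      show "env k (?G \<omega>) - ?c - 2 * B * indicator E \<omega> \<le> F (\<lambda>t. pos \<epsilon> t \<omega>)"
      proof (cases "\<omega> \<in> E")
        case True
        then show ?thesis
          using gb[OF grid_path_skorokhod, of k r "\<lambda>k. x + (\<Sum>j<k. incr r \<epsilon> j \<omega>)"] B[OF path[OF \<omega>]] c0 by simp
      next
        case False
        have "env k (?G \<omega>) \<le> env k (\<lambda>t. pos \<epsilon> t \<omega>) + real k * udist (?G \<omega>) (\<lambda>t. pos \<epsilon> t \<omega>)"
          unfolding env_def by (rule lower_envelope_lipschitz[OF B]) simp_all
        also have "\<dots> \<le> F (\<lambda>t. pos \<epsilon> t \<omega>) + ?c"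
          unfolding env_def using E(3)[of \<omega>] False \<omega>
          by (intro add_mono mult_left_mono lower_envelope_le[OF B] path) (auto simp: udist_commute)
        finally show ?thesis using False by simp
      qed
    qed
    moreover have "(\<integral>\<omega>. env k (?G \<omega>) - ?c - 2 * B * indicator E \<omega> \<partial>M \<epsilon>)
      = (\<integral>\<omega>. env k (?G \<omega>) \<partial>M \<epsilon>) - ?c - 2 * B * prob E"
      using iG iE E(1) by (simp add: prob_space)
    moreover have "2 * B * prob E \<le> 2 * B * Q r" using E(2) B0 by (intro mult_left_mono) auto
    moreover have "?c \<le> \<delta> / 8" using k\<eta> r(2) by (simp add: max_def)
    ultimately show ?case using elim(1) r(3,4) k \<delta> by linarith
  qed
qed

lemma weak_convergence: "weak_conv_skorokhod M pos M0 X0 (at_right 0)"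
  unfolding weak_conv_skorokhod_def
proof (intro conjI allI impI)
  show "\<forall>\<^sub>F \<epsilon> in at_right 0. \<forall>\<omega>\<in>space (M \<epsilon>). (\<lambda>t. pos \<epsilon> t \<omega>) \<in> skorokhod_space"
    using eventually_small_eps[of 1, OF zero_less_one]
  proof eventually_elim
    case (elim \<epsilon>)
    interpret scaled_walk "M \<epsilon>" N law \<epsilon> "\<tau> \<epsilon>" "D \<epsilon>" f g b m A dim by (rule walk) (use elim in auto)
    show ?case using position_skorokhod by blast
  qed
  show "\<forall>\<omega>\<in>space M0. (\<lambda>t. X0 t \<omega>) \<in> skorokhod_space" using X0_path by blast
  fix F :: "(real \<Rightarrow> real ^ 'n) \<Rightarrow> real"
  assume "continuous_map skorokhod_topology euclideanreal F \<and> bounded (F ` skorokhod_space)"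
  then obtain B where F: "continuous_map skorokhod_topology euclideanreal F"
    and B: "\<And>y. y \<in> skorokhod_space \<Longrightarrow> \<bar>F y\<bar> \<le> B"
    unfolding bounded_iff by auto
  show "\<forall>\<^sub>F \<epsilon> in at_right 0. integrable (M \<epsilon>) (\<lambda>\<omega>. F (\<lambda>t. pos \<epsilon> t \<omega>))"
    using eventually_small_eps[of 1, OF zero_less_one]
  proof eventually_elim
    case (elim \<epsilon>)
    interpret scaled_walk "M \<epsilon>" N law \<epsilon> "\<tau> \<epsilon>" "D \<epsilon>" f g b m A dim by (rule walk) (use elim in auto)
    show ?case
      by (rule integrable_const_bound[of _ B]) (use B[OF position_skorokhod] pos_measurable[OF _ _ F] elim in auto)
  qed
  interpret M0: prob_space M0 by (rule M0_prob)
  show "integrable M0 (\<lambda>\<omega>. F (\<lambda>t. X0 t \<omega>))"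
    by (rule M0.integrable_const_bound[of _ B]) (use B[OF X0_path] X0_functional_measurable[OF F] in auto)
  show "((\<lambda>\<epsilon>. \<integral>\<omega>. F (\<lambda>t. pos \<epsilon> t \<omega>) \<partial>M \<epsilon>) \<longlongrightarrow> (\<integral>\<omega>. F (\<lambda>t. X0 t \<omega>) \<partial>M0)) (at_right 0)"
  proof (rule tendstoI)
    fix e :: real assume e: "e > 0"
    have F': "continuous_map skorokhod_topology euclideanreal (\<lambda>y. - F y)" by (intro continuous_map_minus F)
    have l: "\<forall>\<^sub>F \<epsilon> in at_right 0. (\<integral>\<omega>. F (\<lambda>t. X0 t \<omega>) \<partial>M0) - e / 2 \<le> (\<integral>\<omega>. F (\<lambda>t. pos \<epsilon> t \<omega>) \<partial>M \<epsilon>)"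
      by (rule expectation_lower_bound[OF F B]) (use e in auto)
    have u: "\<forall>\<^sub>F \<epsilon> in at_right 0. (\<integral>\<omega>. - F (\<lambda>t. X0 t \<omega>) \<partial>M0) - e / 2 \<le> (\<integral>\<omega>. - F (\<lambda>t. pos \<epsilon> t \<omega>) \<partial>M \<epsilon>)"
      by (rule expectation_lower_bound[OF F', of B]) (use e B in auto)
    from l u show "\<forall>\<^sub>F \<epsilon> in at_right 0. dist (\<integral>\<omega>. F (\<lambda>t. pos \<epsilon> t \<omega>) \<partial>M \<epsilon>) (\<integral>\<omega>. F (\<lambda>t. X0 t \<omega>) \<partial>M0) < e"
    proof eventually_elim
      case (elim \<epsilon>)
      then show ?case using e by (simp add: dist_real_def)
    qed
  qed
qed

end

section \<open>Random evolutions on the sphere of directions\<close>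

lemma weak_conv_skorokhod_cong:
  fixes X Y :: "'i \<Rightarrow> real \<Rightarrow> 'w \<Rightarrow> 'a::metric_space"
  assumes conv: "weak_conv_skorokhod M X M0 X0 F"
    and eq: "\<forall>\<^sub>F i in F. \<forall>\<omega>\<in>space (M i). \<forall>t. X i t \<omega> = Y i t \<omega>"
  shows "weak_conv_skorokhod M Y M0 X0 F"
  unfolding weak_conv_skorokhod_def
proof (intro conjI allI impI)
  have eq': "\<forall>\<^sub>F i in F. \<forall>\<omega>\<in>space (M i). (\<lambda>t. Y i t \<omega>) = (\<lambda>t. X i t \<omega>)"
    using eq by eventually_elim auto
  show "\<forall>\<^sub>F i in F. \<forall>\<omega>\<in>space (M i). (\<lambda>t. Y i t \<omega>) \<in> skorokhod_space"
    using conjunct1[OF conv[unfolded weak_conv_skorokhod_def]] eq' by eventually_elim simp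
  show "\<forall>\<omega>\<in>space M0. (\<lambda>t. X0 t \<omega>) \<in> skorokhod_space"
    using conv unfolding weak_conv_skorokhod_def by blast
  fix f :: "(real \<Rightarrow> 'a) \<Rightarrow> real"
  assume f: "continuous_map skorokhod_topology euclideanreal f \<and> bounded (f ` skorokhod_space)"
  have c: "\<forall>\<^sub>F i in F. integrable (M i) (\<lambda>\<omega>. f (\<lambda>t. X i t \<omega>))" "integrable M0 (\<lambda>\<omega>. f (\<lambda>t. X0 t \<omega>))"
    "((\<lambda>i. \<integral>\<omega>. f (\<lambda>t. X i t \<omega>) \<partial>M i) \<longlongrightarrow> (\<integral>\<omega>. f (\<lambda>t. X0 t \<omega>) \<partial>M0)) F"
    using conv f unfolding weak_conv_skorokhod_def by blast+
  show "\<forall>\<^sub>F i in F. integrable (M i) (\<lambda>\<omega>. f (\<lambda>t. Y i t \<omega>))"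
    using c(1) eq'
  proof eventually_elim
    case (elim i)
    then show ?case
      using Bochner_Integration.integrable_cong[of "M i" "M i" "\<lambda>\<omega>. f (\<lambda>t. Y i t \<omega>)" "\<lambda>\<omega>. f (\<lambda>t. X i t \<omega>)"] by simp
  qed
  show "integrable M0 (\<lambda>\<omega>. f (\<lambda>t. X0 t \<omega>))" by (rule c)
  have "\<forall>\<^sub>F i in F. (\<integral>\<omega>. f (\<lambda>t. X i t \<omega>) \<partial>M i) = (\<integral>\<omega>. f (\<lambda>t. Y i t \<omega>) \<partial>M i)"
    using eq'
  proof eventually_elim
    case (elim i)
    then show ?case by (intro Bochner_Integration.integral_cong) auto
  qed
  from Lim_transform_eventually[OF c(3) this]
  show "((\<lambda>i. \<integral>\<omega>. f (\<lambda>t. Y i t \<omega>) \<partial>M i) \<longlongrightarrow> (\<integral>\<omega>. f (\<lambda>t. X0 t \<omega>) \<partial>M0)) F" .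
qed

section \<open>Averages of the direction vector\<close>

lemma direction_coordinate:
  "direction \<theta> $ (i :: 'n::{finite,linorder}) = (\<Prod>j=1..card {j. j < i}. sin (\<theta> j)) *
     (if Suc (card {j. j < i}) < CARD('n) then cos (\<theta> (Suc (card {j. j < i}))) else 1)"
  by (simp add: direction_def Let_def)

lemma abs_direction_le_1: "\<bar>direction \<theta> $ (i :: 'n::{finite,linorder})\<bar> \<le> 1"
proof -
  have "\<bar>\<Prod>j=1..k. sin (\<theta> j)\<bar> \<le> 1" for k
    unfolding abs_prod by (intro prod_le_1) auto
  moreover have "\<bar>if Suc (card {j. j < i}) < CARD('n) then cos (\<theta> (Suc (card {j. j < i}))) else 1\<bar> \<le> 1" by simp
  ultimately show ?thesis unfolding direction_coordinate abs_mult by (intro mult_le_one) auto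
qed

text \<open>A crude sum over the coordinates; a finite bound on the size of the direction is all
  that the walk requires.\<close>

lemma norm_direction_le: "norm (direction \<theta> :: real ^ 'n::{finite,linorder}) \<le> real CARD('n)"
proof -
  have "norm (direction \<theta> :: (real, 'n) vec) \<le> (\<Sum>i\<in>UNIV. \<bar>direction \<theta> $ (i :: 'n)\<bar>)" by (rule norm_le_l1_cart)
  also have "\<dots> \<le> (\<Sum>i\<in>(UNIV :: 'n set). 1)" by (intro sum_mono abs_direction_le_1)
  finally show ?thesis by simp
qed

lemma card_less_CARD: "card {j. j < (i :: 'n::{finite,linorder})} < CARD('n)"
  by (rule psubset_card_mono) auto

lemma space_sphere_measure: "space (sphere_measure n) = angle_set n"
  by (auto simp: sphere_measure_def space_restrict_space space_PiM angle_set_def PiE_def)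

text \<open>A coordinate with fewer than \<open>CARD('n)\<close> predecessors reads only angles
  numbered up to \<open>CARD('n) - 1\<close>, which are components of the product space; the last
  coordinate stops before its cosine.\<close>

lemma direction_measurable:
  "(direction :: _ \<Rightarrow> real ^ 'n::{finite,linorder}) \<in> borel_measurable (sphere_measure CARD('n))"
proof -
  have comp: "(\<lambda>\<theta>. \<theta> j) \<in> borel_measurable (sphere_measure CARD('n))" if "j \<in> {1..CARD('n) - 1}" for j
  proof -
    have "(\<lambda>\<theta>. \<theta> j) \<in> measurable (\<Pi>\<^sub>M i\<in>{1..CARD('n) - 1}. lborel) lborel"
      by (rule measurable_component_singleton[OF that])
    then have "(\<lambda>\<theta>. \<theta> j) \<in> borel_measurable (\<Pi>\<^sub>M i\<in>{1..CARD('n) - 1}. lborel)" by simp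
    then have "(\<lambda>\<theta>. \<theta> j) \<in> borel_measurable (restrict_space (\<Pi>\<^sub>M i\<in>{1..CARD('n) - 1}. lborel) (angle_set CARD('n)))"
      by (rule measurable_restrict_space1)
    then show ?thesis by (simp add: sphere_measure_def)
  qed
  have "(\<lambda>\<theta>. direction \<theta> $ i) \<in> borel_measurable (sphere_measure CARD('n))" for i :: 'n
  proof -
    have s: "(\<lambda>\<theta>. sin (\<theta> j)) \<in> borel_measurable (sphere_measure CARD('n))" if "j \<in> {1..card {j. j < i}}" for j
      using that card_less_CARD[of i] by (intro measurable_compose[OF comp borel_measurable_sin]) auto
    have c: "(\<lambda>\<theta>. if Suc (card {j. j < i}) < CARD('n) then cos (\<theta> (Suc (card {j. j < i}))) else 1)
      \<in> borel_measurable (sphere_measure CARD('n))"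
    proof (cases "Suc (card {j. j < i}) < CARD('n)")
      case True
      then have "(\<lambda>\<theta>. cos (\<theta> (Suc (card {j. j < i})))) \<in> borel_measurable (sphere_measure CARD('n))"
        by (intro measurable_compose[OF comp borel_measurable_cos]) auto
      then show ?thesis using True by simp
    qed simp
    show ?thesis unfolding direction_coordinate by (intro borel_measurable_times borel_measurable_prod s c)
  qed
  then show ?thesis
    by (subst borel_measurable_euclidean_space) (auto simp: Basis_vec_def inner_axis)
qed

lemma direction_law_density: "direction_law n = density (sphere_measure n) (\<lambda>_. ennreal (1 / sphere_mass n))"
  by (rule measure_eqI) (simp_all add: direction_law_def emeasure_density_const)

lemma integral_direction_law:
  "F \<in> borel_measurable (sphere_measure n) \<Longrightarrow> (\<integral>\<alpha>. F \<alpha> \<partial>direction_law n) = average n F"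
  unfolding direction_law_density
  by (subst integral_density) (auto simp: average_def sphere_mass_def)

lemma average_uminus: "average n (\<lambda>\<alpha>. - F \<alpha>) = - average n F"
  by (simp add: average_def)

text \<open>A cutoff with value 1 at the origin times a coordinate. It turns identities between
  operators on test functions into identities between vectors.\<close>

lemma linear_test_function:
  obtains \<phi> :: "real ^ ('n::finite) \<Rightarrow> real" where "\<phi> \<in> test_functions" "\<And>v. grad_along v \<phi> 0 = v $ i"
proof -
  obtain \<kappa> :: "real ^ 'n \<Rightarrow> real" where \<kappa>: "smooth \<kappa>" "\<kappa> 0 = 1" "bounded {y. \<kappa> y \<noteq> 0}"
    using bump_exists by blast
  define G where "G k = (\<lambda>t :: real. if k = (0::nat) then t else if k = 1 then 1 else 0)" for k
  have G: "(G k has_field_derivative G (Suc k) t) (at t)" for k t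
    by (auto simp: G_def)
  define \<phi> where "\<phi> y = \<kappa> y * (axis i 1 \<bullet> y + 0)" for y
  have lin: "smooth (\<lambda>y :: real ^ 'n. axis i 1 \<bullet> y + 0)"
    using smooth_affine_compose[where G = G and m = 0 and v = "axis i 1" and a = 0, OF G] by (simp add: G_def)
  have "smooth \<phi>" unfolding \<phi>_def by (rule smooth_mult[OF \<kappa>(1) lin])
  moreover have "bounded {y. \<phi> y \<noteq> 0}" by (rule bounded_subset[OF \<kappa>(3)]) (auto simp: \<phi>_def)
  ultimately have t: "\<phi> \<in> test_functions" by (simp add: test_functions_iff)
  have d: "partial_deriv j \<phi> 0 = axis i 1 $ j" for j
  proof -
    have "partial_deriv j \<phi> 0 = partial_deriv j \<kappa> 0 * (axis i 1 \<bullet> (0 :: real ^ 'n) + 0) + \<kappa> 0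
      * partial_deriv j (\<lambda>y. axis i 1 \<bullet> y + 0) 0"
      unfolding \<phi>_def by (rule partial_deriv_mult[OF smooth_differentiable[OF \<kappa>(1)] smooth_differentiable[OF lin]])
    also have "partial_deriv j (\<lambda>y. axis i 1 \<bullet> y + 0) 0 = axis i 1 $ j * 1"
      by (rule partial_deriv_affine_compose[where g = "\<lambda>t. t"]) simp
    finally show ?thesis by (simp add: \<kappa>)
  qed
  have "grad_along v \<phi> 0 = v $ i" for v
    by (simp add: grad_along_def d axis_def if_distrib cong: if_cong)
  then show ?thesis using that t by blast
qed

text \<open>Evaluated at the origin on a test function with gradient the \<open>i\<close>-th unit
  vector; the sign is that of the transport operator.\<close>

lemma average_transport:
  assumes "\<forall>\<phi>\<in>(test_functions :: ((real, 'n::{finite,linorder}) vec \<Rightarrow> real) set). \<forall>y.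
        average CARD('n) (\<lambda>\<alpha>. c \<alpha> * transport_op \<alpha> \<phi> y) = grad_along d \<phi> y"
  shows "average CARD('n) (\<lambda>\<alpha>. c \<alpha> * direction \<alpha> $ (i :: 'n)) = - d $ i"
proof -
  obtain \<phi> :: "(real, 'n) vec \<Rightarrow> real" where \<phi>: "\<phi> \<in> test_functions" "\<And>v. grad_along v \<phi> 0 = v $ i"
    using linear_test_function by blast
  have "average CARD('n) (\<lambda>\<alpha>. c \<alpha> * transport_op \<alpha> \<phi> 0) = d $ i" using assms \<phi> by simp
  then have "average CARD('n) (\<lambda>\<alpha>. - (c \<alpha> * direction \<alpha> $ i)) = d $ i" by (simp add: transport_op_def \<phi>)
  then show ?thesis by (simp add: average_uminus)
qed

text \<open>The hypotheses are put in terms of averaged coordinates and of the velocity itself, free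
  of the sign convention of the transport operator, so that both signs of the velocity become
  instances.\<close>

lemma random_evolution_weak_convergence:
  fixes c c1 :: "(nat \<Rightarrow> real) \<Rightarrow> real"
    and m x :: "real ^ ('n::{finite,linorder})"
    and M :: "real \<Rightarrow> 'w measure"
    and \<theta> :: "real \<Rightarrow> real \<Rightarrow> 'w \<Rightarrow> nat \<Rightarrow> real"
    and M0 :: "'v measure"
  assumes c_meas: "c \<in> borel_measurable (sphere_measure CARD('n))"
    and c1_meas: "c1 \<in> borel_measurable (sphere_measure CARD('n))"
    and c_bdd: "bounded (c ` angle_set CARD('n))"
    and c1_bdd: "bounded (c1 ` angle_set CARD('n))"
    and balance: "\<And>i :: 'n. average CARD('n) (\<lambda>\<alpha>. c \<alpha> * direction \<alpha> $ i) = 0"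
    and drift: "\<And>i :: 'n. average CARD('n) (\<lambda>\<alpha>. c1 \<alpha> * direction \<alpha> $ i) = m $ i"
    and switching: "\<forall>\<epsilon>>0. switching_process CARD('n) (1 / \<epsilon>\<^sup>2) (M \<epsilon>) (\<theta> \<epsilon>)"
    and limit: "is_diffusion_from x (\<lambda>\<phi> y. grad_along m \<phi> y + diffusion_op c \<phi> y) M0 X0"
  shows "weak_conv_skorokhod M (\<lambda>\<epsilon>. random_evolution (\<lambda>\<alpha>. (c \<alpha> / \<epsilon> + c1 \<alpha>) *\<^sub>R direction \<alpha>) x (\<theta> \<epsilon>)) M0 X0
    (at_right 0)"
proof -
  let ?n = "CARD('n)"
  let ?N = "sphere_measure ?n"
  let ?law = "direction_law ?n"
  define R where "R \<epsilon> \<tau> D \<longleftrightarrow> prob_space (M \<epsilon>) \<and> (\<forall>k. distributed (M \<epsilon>) lborel (\<tau> k) (exponential_density (1 / \<epsilon>\<^sup>2))) \<and>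
        (\<forall>k. D k \<in> measurable (M \<epsilon>) ?N) \<and>
        (\<forall>k\<ge>1. distr (M \<epsilon>) ?N (D k) = ?law) \<and>
        prob_space.indep_vars (M \<epsilon>) (\<lambda>_. borel) \<tau> (UNIV :: nat set) \<and>
        prob_space.indep_vars (M \<epsilon>) (\<lambda>_. ?N) D (UNIV :: nat set) \<and>
        prob_space.indep_set (M \<epsilon>)
          (sets (vimage_algebra (space (M \<epsilon>)) (\<lambda>\<omega> k. \<tau> k \<omega>) (\<Pi>\<^sub>M k\<in>UNIV. borel)))
          (sets (vimage_algebra (space (M \<epsilon>)) (\<lambda>\<omega> k. D k \<omega>) (\<Pi>\<^sub>M k\<in>UNIV. ?N))) \<and>
        (\<forall>t\<ge>0. \<forall>\<omega>\<in>space (M \<epsilon>). \<theta> \<epsilon> t \<omega> = D (card {k. (\<Sum>j\<le>k. \<tau> j \<omega>) \<le> t}) \<omega>)" for \<epsilon> \<tau> D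
  have ex: "\<exists>\<tau> D. R \<epsilon> \<tau> D" if "\<epsilon> > 0" for \<epsilon>
    using switching that unfolding switching_process_def R_def by blast
  \<comment> \<open>A switching process only asserts that waiting times and directions exist; one
    realisation is chosen for each \<open>\<epsilon>\<close>.\<close>
  define \<tau> where "\<tau> \<epsilon> = (SOME \<tau>. \<exists>D. R \<epsilon> \<tau> D)" for \<epsilon>
  define D where "D \<epsilon> = (SOME D. R \<epsilon> (\<tau> \<epsilon>) D)" for \<epsilon>
  have R: "R \<epsilon> (\<tau> \<epsilon>) (D \<epsilon>)" if "\<epsilon> > 0" for \<epsilon>
    unfolding D_def \<tau>_def by (intro someI_ex[of "R \<epsilon> _"] someI_ex[of "\<lambda>\<tau>. \<exists>D. R \<epsilon> \<tau> D"] ex that)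
  note R' = R[unfolded R_def]
  have sw: "prob_space (M \<epsilon>)"
    and sw1: "distributed (M \<epsilon>) lborel (\<tau> \<epsilon> k) (exponential_density (1 / \<epsilon>\<^sup>2))"
    and sw2: "D \<epsilon> k \<in> measurable (M \<epsilon>) ?N"
    and sw3: "k \<ge> 1 \<Longrightarrow> distr (M \<epsilon>) ?N (D \<epsilon> k) = ?law"
    and sw4: "prob_space.indep_vars (M \<epsilon>) (\<lambda>_. borel) (\<tau> \<epsilon>) (UNIV :: nat set)"
    and sw5: "prob_space.indep_vars (M \<epsilon>) (\<lambda>_. ?N) (D \<epsilon>) (UNIV :: nat set)"
    and sw6: "prob_space.indep_set (M \<epsilon>)
          (sets (vimage_algebra (space (M \<epsilon>)) (\<lambda>\<omega> k. \<tau> \<epsilon> k \<omega>) (\<Pi>\<^sub>M k\<in>UNIV. borel)))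
          (sets (vimage_algebra (space (M \<epsilon>)) (\<lambda>\<omega> k. D \<epsilon> k \<omega>) (\<Pi>\<^sub>M k\<in>UNIV. ?N)))"
    and sw7: "t \<ge> 0 \<Longrightarrow> \<omega> \<in> space (M \<epsilon>) \<Longrightarrow> \<theta> \<epsilon> t \<omega> = D \<epsilon> (card {k. (\<Sum>j\<le>k. \<tau> \<epsilon> j \<omega>) \<le> t}) \<omega>"
    if "\<epsilon> > 0" for \<epsilon> k t \<omega>
    using R'[OF that] by blast+
  obtain Bc where Bc: "\<And>\<alpha>. \<alpha> \<in> angle_set ?n \<Longrightarrow> \<bar>c \<alpha>\<bar> \<le> Bc" using c_bdd unfolding bounded_iff by auto
  obtain Bc1 where Bc1: "\<And>\<alpha>. \<alpha> \<in> angle_set ?n \<Longrightarrow> \<bar>c1 \<alpha>\<bar> \<le> Bc1" using c1_bdd unfolding bounded_iff by auto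
  define b where "b = max 0 (max Bc Bc1) * real ?n"
  define f where "f \<alpha> = c \<alpha> *\<^sub>R (direction \<alpha> :: (real, 'n) vec)" for \<alpha>
  define g where "g \<alpha> = c1 \<alpha> *\<^sub>R (direction \<alpha> :: (real, 'n) vec)" for \<alpha>
  define A where "A i j = (\<integral>\<alpha>. f \<alpha> $ i * f \<alpha> $ j \<partial>?law)" for i j
  have fgm: "f \<in> borel_measurable ?N" "g \<in> borel_measurable ?N"
    unfolding f_def g_def by (intro borel_measurable_scaleR c_meas c1_meas direction_measurable)+
  have comp: "(\<lambda>\<alpha>. f \<alpha> $ i) \<in> borel_measurable ?N" "(\<lambda>\<alpha>. g \<alpha> $ i) \<in> borel_measurable ?N" for i
    by (rule measurable_compose[OF fgm(1) borel_measurable_nth] measurable_compose[OF fgm(2) borel_measurable_nth])+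
  have walk: "scaled_walk (M \<epsilon>) ?N ?law \<epsilon> (\<tau> \<epsilon>) (D \<epsilon>) f g b m A (real ?n)" if \<epsilon>: "0 < \<epsilon>" "\<epsilon> \<le> 1" for \<epsilon>
  proof -
    interpret prob_space "M \<epsilon>" by (rule sw[OF \<epsilon>(1)])
    note pairs = indep_vars_pair_sequences[OF sw4[OF \<epsilon>(1)] sw5[OF \<epsilon>(1)] sw6[OF \<epsilon>(1)]]
    show ?thesis
    proof unfold_locales
      show "norm (f \<alpha>) \<le> b" if "\<alpha> \<in> space ?N" for \<alpha>
        using Bc[of \<alpha>] that norm_direction_le[of \<alpha>, where 'n = 'n]
          unfolding f_def b_def space_sphere_measure norm_scaleR
        by (intro mult_mono) auto
      show "norm (g \<alpha>) \<le> b" if "\<alpha> \<in> space ?N" for \<alpha>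
        using Bc1[of \<alpha>] that norm_direction_le[of \<alpha>, where 'n = 'n]
          unfolding g_def b_def space_sphere_measure norm_scaleR
        by (intro mult_mono) auto
      show "(\<integral>\<alpha>. f \<alpha> $ i \<partial>?law) = 0" for i
        unfolding integral_direction_law[OF comp(1)] using balance[of i] by (simp add: f_def)
      show "(\<integral>\<alpha>. g \<alpha> $ i \<partial>?law) = m $ i" for i
        unfolding integral_direction_law[OF comp(2)] using drift[of i] by (simp add: g_def)
      show "prob ((\<tau> \<epsilon> k -` S \<inter> space (M \<epsilon>)) \<inter> (D \<epsilon> k -` T \<inter> space (M \<epsilon>)))
        = prob (\<tau> \<epsilon> k -` S \<inter> space (M \<epsilon>)) * prob (D \<epsilon> k -` T \<inter> space (M \<epsilon>))"
        if "S \<in> sets borel" "T \<in> sets ?N" for k S T by (rule pairs(2)[OF that])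
    qed (use \<epsilon> sw1 sw2 sw3 pairs(1) fgm in \<open>auto simp: A_def b_def\<close>)
  qed
  interpret w1: scaled_walk "M 1" ?N ?law 1 "\<tau> 1" "D 1" f g b m A "real ?n" by (rule walk) auto
  \<comment> \<open>The operator under the average has constant coefficients, the second moments of
    \<open>f\<close>, because differentiation in space does not touch the angles.\<close>
  have op: "grad_along m \<phi> y + diffusion_op c \<phi> y = const_coeff_op m A \<phi> y" for \<phi> y
  proof -
    have "(c \<alpha>)\<^sup>2 * grad_along_sq (direction \<alpha>) \<phi> y
      = (\<Sum>i\<in>UNIV. \<Sum>j\<in>UNIV. f \<alpha> $ i * f \<alpha> $ j * partial_deriv i (partial_deriv j \<phi>) y)" for \<alpha>
      by (simp add: grad_along_sq_def f_def sum_distrib_left power2_eq_square mult_ac)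
    then have "diffusion_op c \<phi> y
      = average ?n (\<lambda>\<alpha>. \<Sum>i\<in>UNIV. \<Sum>j\<in>UNIV. f \<alpha> $ i * f \<alpha> $ j * partial_deriv i (partial_deriv j \<phi>) y)"
      by (simp add: diffusion_op_def)
    also have "\<dots> = (\<integral>\<alpha>. (\<Sum>i\<in>UNIV. \<Sum>j\<in>UNIV. f \<alpha> $ i * f \<alpha> $ j * partial_deriv i (partial_deriv j \<phi>) y) \<partial>?law)"
      by (rule integral_direction_law[symmetric])
        (intro borel_measurable_sum borel_measurable_times comp borel_measurable_const)
    also have "\<dots> = (\<Sum>i\<in>UNIV. \<Sum>j\<in>UNIV. A i j * partial_deriv i (partial_deriv j \<phi>) y)"
      using w1.integrable_law by (simp add: Bochner_Integration.integral_sum A_def)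
    finally show ?thesis by (simp add: const_coeff_op_def grad_along_def)
  qed
  obtain P where P: "markov_process M0 X0 P" "has_generator_on P (const_coeff_op m A) test_functions"
    using limit unfolding is_diffusion_from_def op by blast
  interpret walk_limit M ?N ?law \<tau> D f g b m A "real ?n" M0 X0 x P
  proof (rule walk_limit.intro)
    show "\<And>\<omega>. \<omega> \<in> space M0 \<Longrightarrow> (\<lambda>t. X0 t \<omega>) \<in> skorokhod_space" "AE \<omega> in M0. X0 0 \<omega> = x"
      using limit unfolding is_diffusion_from_def by blast+
  qed (fact walk P)+
  show ?thesis
  proof (rule weak_conv_skorokhod_cong[OF weak_convergence])
    show "\<forall>\<^sub>F \<epsilon> in at_right 0. \<forall>\<omega>\<in>space (M \<epsilon>). \<forall>t. pos \<epsilon> t \<omega> =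
        random_evolution (\<lambda>\<alpha>. (c \<alpha> / \<epsilon> + c1 \<alpha>) *\<^sub>R direction \<alpha>) x (\<theta> \<epsilon>) t \<omega>"
      using eventually_small_eps[of 1, OF zero_less_one]
    proof eventually_elim
      case (elim \<epsilon>)
      then interpret scaled_walk "M \<epsilon>" ?N ?law \<epsilon> "\<tau> \<epsilon>" "D \<epsilon>" f g b m A "real ?n" by (intro walk) auto
      show ?case
      proof (intro ballI allI)
        fix \<omega> t assume \<omega>: "\<omega> \<in> space (M \<epsilon>)"
        have "w (D \<epsilon> (renewal_count (\<lambda>j. \<tau> \<epsilon> j \<omega>) u) \<omega>) = (c (\<theta> \<epsilon> u \<omega>) / \<epsilon> + c1 (\<theta> \<epsilon> u \<omega>)) *\<^sub>R direction (\<theta> \<epsilon> u \<omega>)"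
          if "u \<in> {0..t}" for u
          using sw7[of \<epsilon> u \<omega>] elim \<omega> that by (simp add: w_def f_def g_def renewal_count_def scaleR_add_left)
        then have "(LINT u:{0..t}|lborel. w (D \<epsilon> (renewal_count (\<lambda>j. \<tau> \<epsilon> j \<omega>) u) \<omega>)) =
          (LINT u:{0..t}|lborel. (c (\<theta> \<epsilon> u \<omega>) / \<epsilon> + c1 (\<theta> \<epsilon> u \<omega>)) *\<^sub>R direction (\<theta> \<epsilon> u \<omega>))"
          by (intro set_lebesgue_integral_cong) auto
        then show "pos \<epsilon> t \<omega> = random_evolution (\<lambda>\<alpha>. (c \<alpha> / \<epsilon> + c1 \<alpha>) *\<^sub>R direction \<alpha>) x (\<theta> \<epsilon>) t \<omega>"
          by (simp add: position_def random_evolution_def)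
      qed
    qed
  qed
qed

text \<open>A generator term \<open>v * transport_op\<close> belongs to the velocity opposite to
  \<open>v\<close> times the direction. The two halves take the two signs in turn: the velocity that
  matches the generator has limit drift \<open>d\<close>, the velocity written with a plus sign has
  drift \<open>- d\<close>.\<close>

theorem theorem3:
  fixes c c1 :: "(nat \<Rightarrow> real) \<Rightarrow> real"
    and d x :: "real ^ ('n::{finite,linorder})"
    and M :: "real \<Rightarrow> 'w measure"
    and \<theta> :: "real \<Rightarrow> real \<Rightarrow> 'w \<Rightarrow> nat \<Rightarrow> real"
  assumes dim: "CARD('n) \<ge> 2"
    and c_meas: "c \<in> borel_measurable (sphere_measure CARD('n))"
    and c1_meas: "c1 \<in> borel_measurable (sphere_measure CARD('n))"
    and c_bdd: "bounded (c ` angle_set CARD('n))"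
    and c1_bdd: "bounded (c1 ` angle_set CARD('n))"
    and balance: "\<forall>\<phi>\<in>(test_functions :: ((real, 'n) vec \<Rightarrow> real) set). \<forall>y.
        average CARD('n) (\<lambda>\<alpha>. c \<alpha> * transport_op \<alpha> \<phi> y) = 0"
    and nonsymmetry: "\<forall>\<phi>\<in>(test_functions :: ((real, 'n) vec \<Rightarrow> real) set). \<forall>y.
        average CARD('n) (\<lambda>\<alpha>. c1 \<alpha> * transport_op \<alpha> \<phi> y) = grad_along d \<phi> y"
    and d_nonzero: "d \<noteq> 0"
    and switching: "\<forall>\<epsilon>>0. switching_process CARD('n) (1 / \<epsilon>\<^sup>2) (M \<epsilon>) (\<theta> \<epsilon>)"
  shows
    "(\<forall>(M0 :: 'v measure) X0.
        is_diffusion_from x (\<lambda>\<phi> y. grad_along d \<phi> y + diffusion_op c \<phi> y) M0 X0 \<longrightarrow>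
        weak_conv_skorokhod M
          (\<lambda>\<epsilon>. random_evolution (\<lambda>\<alpha>. - ((c \<alpha> / \<epsilon> + c1 \<alpha>) *\<^sub>R direction \<alpha>)) x (\<theta> \<epsilon>))
          M0 X0 (at_right 0))
     \<and> (\<forall>(M0 :: 'v measure) X0.
        is_diffusion_from x (\<lambda>\<phi> y. grad_along (- d) \<phi> y + diffusion_op c \<phi> y) M0 X0 \<longrightarrow>
        weak_conv_skorokhod M
          (\<lambda>\<epsilon>. random_evolution (\<lambda>\<alpha>. (c \<alpha> / \<epsilon> + c1 \<alpha>) *\<^sub>R direction \<alpha>) x (\<theta> \<epsilon>))
          M0 X0 (at_right 0))"
proof (intro conjI allI impI)
  \<comment> \<open>The balance condition is the non-symmetry identity with drift 0.\<close>
  have mean_c: "average CARD('n) (\<lambda>\<alpha>. c \<alpha> * direction \<alpha> $ i) = 0" for i :: 'n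
    using average_transport[of c 0 i] balance by (simp add: grad_along_def)
  have mean_c1: "average CARD('n) (\<lambda>\<alpha>. c1 \<alpha> * direction \<alpha> $ i) = - d $ i" for i :: 'n
    by (rule average_transport[OF nonsymmetry])
  fix M0 :: "'v measure" and X0
  {
    assume lim: "is_diffusion_from x (\<lambda>\<phi> y. grad_along d \<phi> y + diffusion_op c \<phi> y) M0 X0"
    \<comment> \<open>\<open>c\<close> enters the second-order part squared, so reversing the
      velocity changes the drift only.\<close>
    have "diffusion_op (\<lambda>\<alpha>. - c \<alpha>) = (diffusion_op c :: ((real, 'n) vec \<Rightarrow> real) \<Rightarrow> (real, 'n) vec \<Rightarrow> real)"
      by (simp add: diffusion_op_def fun_eq_iff)
    then have lim': "is_diffusion_from x (\<lambda>\<phi> y. grad_along d \<phi> y + diffusion_op (\<lambda>\<alpha>. - c \<alpha>) \<phi> y) M0 X0"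
      using lim by simp
    have bdd: "bounded ((\<lambda>\<alpha>. - h \<alpha>) ` S)" if "bounded (h ` S)" for h :: "(nat \<Rightarrow> real) \<Rightarrow> real" and S
      using that unfolding bounded_iff by auto
    have "weak_conv_skorokhod M
          (\<lambda>\<epsilon>. random_evolution (\<lambda>\<alpha>. (- c \<alpha> / \<epsilon> + - c1 \<alpha>) *\<^sub>R direction \<alpha>) x (\<theta> \<epsilon>)) M0 X0 (at_right 0)"
      by (rule random_evolution_weak_convergence[OF _ _ bdd[OF c_bdd] bdd[OF c1_bdd] _ _ switching lim'])
        (use c_meas c1_meas mean_c mean_c1 in \<open>simp_all add: average_uminus\<close>)
    moreover have "(- c \<alpha> / \<epsilon> + - c1 \<alpha>) *\<^sub>R direction \<alpha>
      = - ((c \<alpha> / \<epsilon> + c1 \<alpha>) *\<^sub>R (direction \<alpha> :: (real, 'n) vec))" for \<alpha> \<epsilon>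
      by (simp flip: scaleR_minus_left)
    ultimately show "weak_conv_skorokhod M
          (\<lambda>\<epsilon>. random_evolution (\<lambda>\<alpha>. - ((c \<alpha> / \<epsilon> + c1 \<alpha>) *\<^sub>R direction \<alpha>)) x (\<theta> \<epsilon>)) M0 X0 (at_right 0)"
      by simp
  next
    assume lim: "is_diffusion_from x (\<lambda>\<phi> y. grad_along (- d) \<phi> y + diffusion_op c \<phi> y) M0 X0"
    show "weak_conv_skorokhod M
          (\<lambda>\<epsilon>. random_evolution (\<lambda>\<alpha>. (c \<alpha> / \<epsilon> + c1 \<alpha>) *\<^sub>R direction \<alpha>) x (\<theta> \<epsilon>)) M0 X0 (at_right 0)"
      by (rule random_evolution_weak_convergence[OF c_meas c1_meas c_bdd c1_bdd mean_c _ switching lim])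
        (simp add: mean_c1)
  }
qed

end
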